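(* Let $(A,d_A,[\cdot,\cdot]_A)$ and $(B,d_B,[\cdot,\cdot]_B)$ be differential graded Lie algebras over a field of characteristic $0$, and let $i\colon A\to B$ and $p\colon B\to A$ be quasi-isomorphisms of cochain complexes and $h\colon B\to B$ a linear map of degree $-1$ such that $h d_B+d_B h=\mathrm{id}_B-i\circ p$, $p\circ i=\mathrm{id}_A$, $h^2=0$, $h\circ i=0$ and $p\circ h=0$. Assume in addition that $i$ is a morphism of differential graded Lie algebras. Define recursively $P^1_1=p$ and, for $k\ge 1$, $$P^1_{k+1}=L_{\infty,k+1}\circ H_{k+1},\qquad L_{\infty,k+1}=Q^1_{A,2}\circ P^2_{k+1}-P^1_k\circ Q^k_{B,k+1}.$$ Then the coalgebra morphism $P\colon \mathrm{Sym}(B[1])\to\mathrm{Sym}(A[1])$ with structure maps $P^1_k$ is an $L_\infty$-quasi-isomorphism which is quasi-inverse to $i$.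
   Context: For a DGLA $(L,d,[\cdot,\cdot])$ let $Q$ be the degree $+1$ codifferential on the cocommutative coalgebra $\mathrm{Sym}(L[1])$ with structure maps $Q_1^1=-d$, $Q_2^1(x\vee y)=-(-1)^{|x|}[x,y]$ ($|x|$ the degree in $L[1]$) and $Q^1_n=0$ otherwise. $Q_n^j$ is the component of $Q$ from $\mathrm{Sym}^n(L[1])$ to $\mathrm{Sym}^j(L[1])$: $Q_n^j(x_1\vee\dots\vee x_n)=\sum_{\sigma\in \mathrm{Sh}(n+1-j,j-1)}\epsilon(\sigma)Q^1_{n+1-j}(x_{\sigma(1)}\vee\dots\vee x_{\sigma(n+1-j)})\vee x_{\sigma(n+2-j)}\vee\dots\vee x_{\sigma(n)}$, with $\epsilon(\sigma)$ the Koszul sign in $L[1]$. Indices $A,B$ refer to the two DGLAs. A coalgebra morphism $F\colon\mathrm{Sym}(L[1])\to\mathrm{Sym}(L'[1])$ of degree $0$ with $F(1)=1$ is uniquely determined by its structure maps $F^1_n\colon\mathrm{Sym}^n(L[1])\to L'[1]$, $n\ge1$; $F^j_n\colon\mathrm{Sym}^n(L[1])\to\mathrm{Sym}^j(L'[1])$ denotes its component, and $F^j_n$ depends only on $F^1_k$ with $k\le n-j+1$. $F$ is an $L_\infty$-morphism if $FQ=Q'F$, and an $L_\infty$-quasi-isomorphism if moreover $F^1_1$ is a quasi-isomorphism of complexes. Two $L_\infty$-quasi-isomorphisms in opposite directions are quasi-inverse if their first structure maps induce mutually inverse maps in cohomology. A DGLA morphism is viewed as an $L_\infty$-morphism with only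 the first structure map non-zero. The maps $H_n\colon\mathrm{Sym}^n(B[1])\to\mathrm{Sym}^n(B[1])$ of degree $-1$ are $H_n=K_n\circ\tilde H_n$ with $\tilde H_n(x_1\vee\dots\vee x_n)=-\sum_{\sigma\in\mathrm{Sh}(1,n-1)}\epsilon(\sigma)\,h x_{\sigma(1)}\vee x_{\sigma(2)}\vee\dots\vee x_{\sigma(n)}$ and $K_n(x_1\vee\dots\vee x_n)=\frac1{n!}\sum_{j=0}^{n-1}\sum_{\sigma\in S_n}\frac{\epsilon(\sigma)}{n-j}\,ip\,x_{\sigma(1)}\vee\dots\vee ip\,x_{\sigma(j)}\vee x_{\sigma(j+1)}\vee\dots\vee x_{\sigma(n)}$. They satisfy $Q_{B,n}^nH_n+H_nQ_{B,n}^n=\mathrm{id}-(ip)^{\vee n}$. *)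

theory Defs
  imports Complex_Main "HOL-Library.Poly_Mapping" "HOL-Combinatorics.Permutations"
begin

section \<open>Graded vector spaces and differential graded Lie algebras\<close>

text \<open>
  A graded vector space over \<open>'k\<close> is a vector space structure on the whole type \<open>'a\<close> together
  with a decomposition of \<open>'a\<close> as the direct sum of subspaces \<open>grd V n\<close>, \<open>n\<close> an integer.
\<close>

record ('k, 'a) gvs =
  scl :: "'k \<Rightarrow> 'a \<Rightarrow> 'a"
  grd :: "int \<Rightarrow> 'a set"

definition is_decomp :: "('k, 'a::ab_group_add, 'z) gvs_scheme \<Rightarrow> 'a \<Rightarrow> (int \<Rightarrow> 'a) \<Rightarrow> bool" where
  "is_decomp V x c \<longleftrightarrow> finite {n. c n \<noteq> 0} \<and> (\<forall>n. c n \<in> grd V n) \<and> x = (\<Sum>n | c n \<noteq> 0. c n)"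

definition graded_vector_space :: "('k::field, 'a::ab_group_add, 'z) gvs_scheme \<Rightarrow> bool" where
  "graded_vector_space V \<longleftrightarrow>
     vector_space (scl V) \<and> (\<forall>n. module.subspace (scl V) (grd V n)) \<and> (\<forall>x. \<exists>!c. is_decomp V x c)"

definition hcomp :: "('k, 'a::ab_group_add, 'z) gvs_scheme \<Rightarrow> 'a \<Rightarrow> int \<Rightarrow> 'a" where
  "hcomp V x = (THE c. is_decomp V x c)"

definition homogeneous :: "('k, 'a, 'z) gvs_scheme \<Rightarrow> 'a set" where
  "homogeneous V = (\<Union>n. grd V n)"

text \<open>
  The degree of a nonzero homogeneous element. The value at \<open>0\<close> is arbitrary, which is harmless:
  below, degrees only enter as signs in front of words having the element as an entry (or in front of
  values of multilinear maps at it), and these vanish if the entry is \<open>0\<close>.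
\<close>

definition deg :: "('k, 'a, 'z) gvs_scheme \<Rightarrow> 'a \<Rightarrow> int" where
  "deg V x = (SOME n. x \<in> grd V n)"

record ('k, 'a) dgla = "('k, 'a) gvs" +
  dif :: "'a \<Rightarrow> 'a"
  brk :: "'a \<Rightarrow> 'a \<Rightarrow> 'a"

definition is_dgla :: "('k::field, 'a::ab_group_add) dgla \<Rightarrow> bool" where
  "is_dgla L \<longleftrightarrow>
     graded_vector_space L \<and>
     Vector_Spaces.linear (scl L) (scl L) (dif L) \<and>
     (\<forall>n. \<forall>x\<in>grd L n. dif L x \<in> grd L (n + 1)) \<and>
     (\<forall>x. dif L (dif L x) = 0) \<and>
     (\<forall>x. Vector_Spaces.linear (scl L) (scl L) (brk L x)) \<and>
     (\<forall>y. Vector_Spaces.linear (scl L) (scl L) (\<lambda>x. brk L x y)) \<and>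
     (\<forall>m n. \<forall>x\<in>grd L m. \<forall>y\<in>grd L n. brk L x y \<in> grd L (m + n)) \<and>
     (\<forall>m n. \<forall>x\<in>grd L m. \<forall>y\<in>grd L n.
        brk L x y = - scl L ((-1) powi (m * n)) (brk L y x)) \<and>
     (\<forall>m n. \<forall>x\<in>grd L m. \<forall>y\<in>grd L n. \<forall>z.
        brk L x (brk L y z) = brk L (brk L x y) z + scl L ((-1) powi (m * n)) (brk L y (brk L x z))) \<and>
     (\<forall>m. \<forall>x\<in>grd L m. \<forall>y.
        dif L (brk L x y) = brk L (dif L x) y + scl L ((-1) powi m) (brk L x (dif L y)))"

definition cochain_map ::
  "('k::field, 'a::ab_group_add) dgla \<Rightarrow> ('k, 'b::ab_group_add) dgla \<Rightarrow> ('a \<Rightarrow> 'b) \<Rightarrow> bool" where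
  "cochain_map L L' f \<longleftrightarrow>
     Vector_Spaces.linear (scl L) (scl L') f \<and>
     (\<forall>n. \<forall>x\<in>grd L n. f x \<in> grd L' n) \<and> (\<forall>x. f (dif L x) = dif L' (f x))"

definition dgla_morphism ::
  "('k::field, 'a::ab_group_add) dgla \<Rightarrow> ('k, 'b::ab_group_add) dgla \<Rightarrow> ('a \<Rightarrow> 'b) \<Rightarrow> bool" where
  "dgla_morphism L L' f \<longleftrightarrow> cochain_map L L' f \<and> (\<forall>x y. f (brk L x y) = brk L' (f x) (f y))"

subsection \<open>Cohomology\<close>

definition cocycles :: "('k, 'a::ab_group_add) dgla \<Rightarrow> int \<Rightarrow> 'a set" where
  "cocycles L n = {x \<in> grd L n. dif L x = 0}"

definition cohomologous :: "('k, 'a::ab_group_add) dgla \<Rightarrow> int \<Rightarrow> ('a \<times> 'a) set" where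
  "cohomologous L n =
     {(x, y). x \<in> cocycles L n \<and> y \<in> cocycles L n \<and> x - y \<in> dif L ` grd L (n - 1)}"

definition cohomology :: "('k, 'a::ab_group_add) dgla \<Rightarrow> int \<Rightarrow> 'a set set" where
  "cohomology L n = cocycles L n // cohomologous L n"

text \<open>The map induced in degree \<open>n\<close> by a cochain map; the class of \<open>x\<close> is sent to the class of
  \<open>f x\<close>.\<close>

definition cohomology_map :: "('k, 'b::ab_group_add) dgla \<Rightarrow> ('a \<Rightarrow> 'b) \<Rightarrow> int \<Rightarrow> 'a set \<Rightarrow> 'b set" where
  "cohomology_map L' f n X = cohomologous L' n `` (f ` X)"

definition quasi_isomorphism ::
  "('k::field, 'a::ab_group_add) dgla \<Rightarrow> ('k, 'b::ab_group_add) dgla \<Rightarrow> ('a \<Rightarrow> 'b) \<Rightarrow> bool" where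
  "quasi_isomorphism L L' f \<longleftrightarrow>
     cochain_map L L' f \<and>
     (\<forall>n. bij_betw (cohomology_map L' f n) (cohomology L n) (cohomology L' n))"

section \<open>Free vector spaces\<close>

definition fscale :: "'k::field \<Rightarrow> ('w \<Rightarrow>\<^sub>0 'k) \<Rightarrow> ('w \<Rightarrow>\<^sub>0 'k)" where
  "fscale c t = Poly_Mapping.map ((*) c) t"

lemma lookup_fscale [simp]:
  "Poly_Mapping.lookup (fscale c t) w = c * Poly_Mapping.lookup t w"
  unfolding fscale_def by (transfer) (simp add: when_def)

global_interpretation free: vector_space "fscale :: 'k::field \<Rightarrow> ('w \<Rightarrow>\<^sub>0 'k) \<Rightarrow> _"
  by unfold_locales (rule poly_mapping_eqI; simp add: lookup_add algebra_simps)+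

abbreviation gen :: "'w \<Rightarrow> ('w \<Rightarrow>\<^sub>0 'k::field)" where
  "gen w \<equiv> Poly_Mapping.single w 1"

text \<open>Linear extension of a map defined on generators; \<open>s\<close> is the scalar multiplication of the
  target.\<close>

definition lin_ext :: "('k::field \<Rightarrow> 'v \<Rightarrow> 'v) \<Rightarrow> ('w \<Rightarrow> 'v::ab_group_add) \<Rightarrow> ('w \<Rightarrow>\<^sub>0 'k) \<Rightarrow> 'v" where
  "lin_ext s g t = (\<Sum>w\<in>Poly_Mapping.keys t. s (Poly_Mapping.lookup t w) (g w))"

definition tensor :: "('u \<Rightarrow>\<^sub>0 'k::field) \<Rightarrow> ('w \<Rightarrow>\<^sub>0 'k) \<Rightarrow> ('u \<times> 'w \<Rightarrow>\<^sub>0 'k)" where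
  "tensor s t = (\<Sum>u\<in>Poly_Mapping.keys s. \<Sum>w\<in>Poly_Mapping.keys t.
     fscale (Poly_Mapping.lookup s u * Poly_Mapping.lookup t w) (gen (u, w)))"

section \<open>The symmetric coalgebra of a graded vector space\<close>

text \<open>
  \<open>Sym(V)\<close> is presented by generators and relations, as the quotient \<open>sym_carrier V / sym_rel V\<close>:
  the generators are the words \<open>gen [x1, ..., xn]\<close> in homogeneous elements, standing for the products
  of \<open>x1, ..., xn\<close>, and the relations are multilinearity and graded commutativity. Equality in
  \<open>Sym(V)\<close> is \<open>sym_eq V\<close>, and a linear map between symmetric coalgebras is given by a linear map
  of the free vector spaces which preserves the carriers and the relations.
\<close>

definition sym_carrier :: "('k::field, 'a::ab_group_add, 'z) gvs_scheme \<Rightarrow> ('a list \<Rightarrow>\<^sub>0 'k) set" where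
  "sym_carrier V = free.span {gen xs | xs. set xs \<subseteq> homogeneous V}"

definition sym_rel :: "('k::field, 'a::ab_group_add, 'z) gvs_scheme \<Rightarrow> ('a list \<Rightarrow>\<^sub>0 'k) set" where
  "sym_rel V = free.span (
     {gen (us @ (scl V a x + scl V b y) # vs)
        - fscale a (gen (us @ x # vs)) - fscale b (gen (us @ y # vs)) | us vs a b x y n.
        set us \<subseteq> homogeneous V \<and> set vs \<subseteq> homogeneous V \<and> x \<in> grd V n \<and> y \<in> grd V n} \<union>
     {gen (us @ x # y # vs) - fscale ((-1) powi (m * n)) (gen (us @ y # x # vs)) | us vs x y m n.
        set us \<subseteq> homogeneous V \<and> set vs \<subseteq> homogeneous V \<and> x \<in> grd V m \<and> y \<in> grd V n})"

definition sym_eq ::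
  "('k::field, 'a::ab_group_add, 'z) gvs_scheme \<Rightarrow> ('a list \<Rightarrow>\<^sub>0 'k) \<Rightarrow> ('a list \<Rightarrow>\<^sub>0 'k) \<Rightarrow> bool" where
  "sym_eq V s t \<longleftrightarrow> s - t \<in> sym_rel V"

text \<open>Preimage in the free vector space of the degree \<open>d\<close> part of \<open>Sym(V)\<close>.\<close>

definition sym_grd :: "('k::field, 'a::ab_group_add, 'z) gvs_scheme \<Rightarrow> int \<Rightarrow> ('a list \<Rightarrow>\<^sub>0 'k) set" where
  "sym_grd V d = free.span (sym_rel V \<union>
     {gen xs | xs ds. list_all2 (\<lambda>x n. x \<in> grd V n) xs ds \<and> sum_list ds = d})"

text \<open>Projection onto \<open>Sym\<^sup>n(V)\<close>.\<close>

definition proj :: "nat \<Rightarrow> ('a list \<Rightarrow>\<^sub>0 'k::field) \<Rightarrow> ('a list \<Rightarrow>\<^sub>0 'k)" where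
  "proj n = lin_ext fscale (\<lambda>xs. if length xs = n then gen xs else 0)"

text \<open>Projection onto \<open>Sym\<^sup>1(V) = V\<close>, and the inverse of this identification.\<close>

definition corestr :: "('k::field, 'a::ab_group_add, 'z) gvs_scheme \<Rightarrow> ('a list \<Rightarrow>\<^sub>0 'k) \<Rightarrow> 'a" where
  "corestr V = lin_ext (scl V) (\<lambda>xs. case xs of [x] \<Rightarrow> x | _ \<Rightarrow> 0)"

definition incl :: "('k::field, 'a::ab_group_add, 'z) gvs_scheme \<Rightarrow> 'a \<Rightarrow> ('a list \<Rightarrow>\<^sub>0 'k)" where
  "incl V x = (\<Sum>n | hcomp V x n \<noteq> 0. gen [hcomp V x n])"

subsection \<open>Shuffles and Koszul signs\<close>

text \<open>Permutations act on the indices \<open>0, ..., n - 1\<close>, so that \<open>permute_list \<sigma> xs\<close> is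
  \<open>x\<^bsub>\<sigma>(1)\<^esub>, ..., x\<^bsub>\<sigma>(n)\<^esub>\<close>.\<close>

definition Sh :: "nat \<Rightarrow> nat \<Rightarrow> (nat \<Rightarrow> nat) set" where
  "Sh p q = {\<sigma>. \<sigma> permutes {..<p + q} \<and> strict_mono_on {..<p} \<sigma> \<and> strict_mono_on {p..<p + q} \<sigma>}"

definition koszul :: "('k::field, 'a, 'z) gvs_scheme \<Rightarrow> (nat \<Rightarrow> nat) \<Rightarrow> 'a list \<Rightarrow> 'k" where
  "koszul V \<sigma> xs = (\<Prod>(a, b) \<in> {(a, b). a < b \<and> b < length xs \<and> \<sigma> b < \<sigma> a}.
     (-1) powi (deg V (xs ! \<sigma> a) * deg V (xs ! \<sigma> b)))"

subsection \<open>Coalgebra structure and coalgebra morphisms\<close>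

definition sym_counit :: "('a list \<Rightarrow>\<^sub>0 'k::field) \<Rightarrow> 'k" where
  "sym_counit t = Poly_Mapping.lookup t []"

definition sym_comult ::
  "('k::field, 'a::ab_group_add, 'z) gvs_scheme \<Rightarrow> ('a list \<Rightarrow>\<^sub>0 'k) \<Rightarrow> ('a list \<times> 'a list \<Rightarrow>\<^sub>0 'k)" where
  "sym_comult V = lin_ext fscale (\<lambda>xs.
     \<Sum>p\<in>{0..length xs}. \<Sum>\<sigma>\<in>Sh p (length xs - p). fscale (koszul V \<sigma> xs)
       (gen (take p (permute_list \<sigma> xs), drop p (permute_list \<sigma> xs))))"

text \<open>Equality in the tensor square of \<open>Sym(V)\<close>.\<close>

definition tensor_eq ::
  "('k::field, 'a::ab_group_add, 'z) gvs_scheme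
     \<Rightarrow> ('a list \<times> 'a list \<Rightarrow>\<^sub>0 'k) \<Rightarrow> ('a list \<times> 'a list \<Rightarrow>\<^sub>0 'k) \<Rightarrow> bool" where
  "tensor_eq V s t \<longleftrightarrow> s - t \<in> free.span
     ({tensor r u | r u. r \<in> sym_rel V \<and> u \<in> sym_carrier V} \<union>
      {tensor u r | r u. r \<in> sym_rel V \<and> u \<in> sym_carrier V})"

text \<open>There is no Koszul sign in \<open>F \<otimes> F\<close>, as it is only used for \<open>F\<close> of degree \<open>0\<close>.\<close>

definition tensor_map ::
  "(('a list \<Rightarrow>\<^sub>0 'k::field) \<Rightarrow> ('b list \<Rightarrow>\<^sub>0 'k))
     \<Rightarrow> ('a list \<times> 'a list \<Rightarrow>\<^sub>0 'k) \<Rightarrow> ('b list \<times> 'b list \<Rightarrow>\<^sub>0 'k)" where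
  "tensor_map F = lin_ext fscale (\<lambda>(xs, ys). tensor (F (gen xs)) (F (gen ys)))"

definition sym_linear ::
  "('k::field, 'a::ab_group_add, 'y) gvs_scheme \<Rightarrow> ('k, 'b::ab_group_add, 'z) gvs_scheme
     \<Rightarrow> (('a list \<Rightarrow>\<^sub>0 'k) \<Rightarrow> ('b list \<Rightarrow>\<^sub>0 'k)) \<Rightarrow> bool" where
  "sym_linear V W F \<longleftrightarrow>
     Vector_Spaces.linear fscale fscale F \<and>
     F ` sym_carrier V \<subseteq> sym_carrier W \<and> F ` sym_rel V \<subseteq> sym_rel W"

text \<open>Coalgebra morphisms of degree \<open>0\<close> with \<open>F(1) = 1\<close>.\<close>

definition coalg_morphism ::
  "('k::field, 'a::ab_group_add, 'y) gvs_scheme \<Rightarrow> ('k, 'b::ab_group_add, 'z) gvs_scheme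
     \<Rightarrow> (('a list \<Rightarrow>\<^sub>0 'k) \<Rightarrow> ('b list \<Rightarrow>\<^sub>0 'k)) \<Rightarrow> bool" where
  "coalg_morphism V W F \<longleftrightarrow>
     sym_linear V W F \<and>
     (\<forall>t\<in>sym_carrier V. tensor_eq W (sym_comult W (F t)) (tensor_map F (sym_comult V t))) \<and>
     (\<forall>t\<in>sym_carrier V. sym_counit (F t) = sym_counit t) \<and>
     (\<forall>d. F ` sym_grd V d \<subseteq> sym_grd W d) \<and>
     sym_eq W (F (gen [])) (gen [])"

text \<open>The component \<open>Sym\<^sup>n(V) \<rightarrow> Sym\<^sup>j(W)\<close>, and the structure map \<open>Sym\<^sup>n(V) \<rightarrow> W\<close>. The latter is
  also applied to the codifferential below.\<close>

definition component ::
  "(('a list \<Rightarrow>\<^sub>0 'k::field) \<Rightarrow> ('b list \<Rightarrow>\<^sub>0 'k)) \<Rightarrow> nat \<Rightarrow> nat \<Rightarrow> ('a list \<Rightarrow>\<^sub>0 'k) \<Rightarrow> ('b list \<Rightarrow>\<^sub>0 'k)" where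
  "component F n j t = proj j (F (proj n t))"

definition structure_map ::
  "('k::field, 'b::ab_group_add, 'z) gvs_scheme \<Rightarrow> (('a list \<Rightarrow>\<^sub>0 'k) \<Rightarrow> ('b list \<Rightarrow>\<^sub>0 'k))
     \<Rightarrow> nat \<Rightarrow> ('a list \<Rightarrow>\<^sub>0 'k) \<Rightarrow> 'b" where
  "structure_map W F n t = corestr W (F (proj n t))"

section \<open>\<open>L\<^sub>\<infinity>\<close>-morphisms of differential graded Lie algebras\<close>

definition shift :: "('k, 'a) dgla \<Rightarrow> ('k, 'a) gvs" (\<open>_\<lbrakk>1\<rbrakk>\<close> [1000] 1000) where
  "L\<lbrakk>1\<rbrakk> = \<lparr>scl = scl L, grd = (\<lambda>n. grd L (n + 1))\<rparr>"

definition codiff1 :: "('k::field, 'a::ab_group_add) dgla \<Rightarrow> 'a list \<Rightarrow> 'a" where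
  "codiff1 L xs = (case xs of
       [x] \<Rightarrow> - dif L x
     | [x, y] \<Rightarrow> - scl L ((-1) powi deg (L\<lbrakk>1\<rbrakk>) x) (brk L x y)
     | _ \<Rightarrow> 0)"

text \<open>The component of the codifferential in \<open>Sym\<^sup>j\<close>, for \<open>1 \<le> j \<le> length xs\<close>.\<close>

definition codiff_word :: "('k::field, 'a::ab_group_add) dgla \<Rightarrow> nat \<Rightarrow> 'a list \<Rightarrow> ('a list \<Rightarrow>\<^sub>0 'k)" where
  "codiff_word L j xs = (let m = length xs + 1 - j in
     \<Sum>\<sigma>\<in>Sh m (j - 1). fscale (koszul (L\<lbrakk>1\<rbrakk>) \<sigma> xs)
       (gen (codiff1 L (take m (permute_list \<sigma> xs)) # drop m (permute_list \<sigma> xs))))"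

definition codiff :: "('k::field, 'a::ab_group_add) dgla \<Rightarrow> ('a list \<Rightarrow>\<^sub>0 'k) \<Rightarrow> ('a list \<Rightarrow>\<^sub>0 'k)" where
  "codiff L = lin_ext fscale (\<lambda>xs. \<Sum>j\<in>{1..length xs}. codiff_word L j xs)"

definition Linf_morphism ::
  "('k::field, 'a::ab_group_add) dgla \<Rightarrow> ('k, 'b::ab_group_add) dgla
     \<Rightarrow> (('a list \<Rightarrow>\<^sub>0 'k) \<Rightarrow> ('b list \<Rightarrow>\<^sub>0 'k)) \<Rightarrow> bool" where
  "Linf_morphism L L' F \<longleftrightarrow>
     coalg_morphism (L\<lbrakk>1\<rbrakk>) (L'\<lbrakk>1\<rbrakk>) F \<and>
     (\<forall>t\<in>sym_carrier (L\<lbrakk>1\<rbrakk>). sym_eq (L'\<lbrakk>1\<rbrakk>) (F (codiff L t)) (codiff L' (F t)))"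

definition first_map ::
  "('k::field, 'a::ab_group_add) dgla \<Rightarrow> ('k, 'b::ab_group_add) dgla
     \<Rightarrow> (('a list \<Rightarrow>\<^sub>0 'k) \<Rightarrow> ('b list \<Rightarrow>\<^sub>0 'k)) \<Rightarrow> 'a \<Rightarrow> 'b" where
  "first_map L L' F x = structure_map (L'\<lbrakk>1\<rbrakk>) F 1 (incl (L\<lbrakk>1\<rbrakk>) x)"

text \<open>The complexes \<open>L[1]\<close> with differential \<open>- d\<close> and \<open>L\<close> with differential \<open>d\<close> have the same
  cocycles and coboundaries (up to the shift), so quasi-isomorphisms may be tested on the latter.\<close>

definition Linf_quasi_isomorphism ::
  "('k::field, 'a::ab_group_add) dgla \<Rightarrow> ('k, 'b::ab_group_add) dgla
     \<Rightarrow> (('a list \<Rightarrow>\<^sub>0 'k) \<Rightarrow> ('b list \<Rightarrow>\<^sub>0 'k)) \<Rightarrow> bool" where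
  "Linf_quasi_isomorphism L L' F \<longleftrightarrow>
     Linf_morphism L L' F \<and> quasi_isomorphism L L' (first_map L L' F)"

definition quasi_inverse ::
  "('k::field, 'a::ab_group_add) dgla \<Rightarrow> ('k, 'b::ab_group_add) dgla
     \<Rightarrow> (('a list \<Rightarrow>\<^sub>0 'k) \<Rightarrow> ('b list \<Rightarrow>\<^sub>0 'k)) \<Rightarrow> (('b list \<Rightarrow>\<^sub>0 'k) \<Rightarrow> ('a list \<Rightarrow>\<^sub>0 'k)) \<Rightarrow> bool" where
  "quasi_inverse L L' F G \<longleftrightarrow>
     Linf_quasi_isomorphism L L' F \<and> Linf_quasi_isomorphism L' L G \<and>
     (\<forall>n. \<forall>X\<in>cohomology L n.
        cohomology_map L (first_map L' L G) n (cohomology_map L' (first_map L L' F) n X) = X) \<and>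
     (\<forall>n. \<forall>Y\<in>cohomology L' n.
        cohomology_map L' (first_map L L' F) n (cohomology_map L (first_map L' L G) n Y) = Y)"

text \<open>The coalgebra morphism whose only nonzero structure map is the first one, equal to \<open>f\<close>.\<close>

definition Linf_of :: "('a \<Rightarrow> 'b) \<Rightarrow> ('a list \<Rightarrow>\<^sub>0 'k::field) \<Rightarrow> ('b list \<Rightarrow>\<^sub>0 'k)" where
  "Linf_of f = lin_ext fscale (\<lambda>xs. gen (map f xs))"

lemma lin_ext_gen: "vector_space s \<Longrightarrow> lin_ext s g (gen w) = g w"
  by (simp add: lin_ext_def vector_space.vector_space_assms)

lemma corestr_Linf_of:
  assumes "vector_space (scl W)"
  shows "corestr W (Linf_of f (gen xs)) = (case xs of [x] \<Rightarrow> f x | _ \<Rightarrow> 0)"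
  by (simp add: Linf_of_def corestr_def lin_ext_gen assms free.vector_space_axioms split: list.split)

section \<open>The recursively defined morphism\<close>

definition H_tilde ::
  "('k::field_char_0, 'b::ab_group_add) dgla \<Rightarrow> ('b \<Rightarrow> 'b) \<Rightarrow> ('b list \<Rightarrow>\<^sub>0 'k) \<Rightarrow> ('b list \<Rightarrow>\<^sub>0 'k)" where
  "H_tilde B h = lin_ext fscale (\<lambda>xs.
     - (\<Sum>\<sigma>\<in>Sh 1 (length xs - 1). fscale (koszul (B\<lbrakk>1\<rbrakk>) \<sigma> xs)
         (gen (map h (take 1 (permute_list \<sigma> xs)) @ drop 1 (permute_list \<sigma> xs)))))"

definition K_map ::
  "('k::field_char_0, 'b::ab_group_add) dgla \<Rightarrow> ('b \<Rightarrow> 'b) \<Rightarrow> ('b list \<Rightarrow>\<^sub>0 'k) \<Rightarrow> ('b list \<Rightarrow>\<^sub>0 'k)" where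
  "K_map B e = lin_ext fscale (\<lambda>xs. let n = length xs in
     fscale (1 / fact n) (\<Sum>j\<in>{0..<n}. \<Sum>\<sigma> | \<sigma> permutes {..<n}.
       fscale (koszul (B\<lbrakk>1\<rbrakk>) \<sigma> xs / of_nat (n - j))
         (gen (map e (take j (permute_list \<sigma> xs)) @ drop j (permute_list \<sigma> xs)))))"

definition H_map ::
  "('k::field_char_0, 'b::ab_group_add) dgla \<Rightarrow> ('a \<Rightarrow> 'b) \<Rightarrow> ('b \<Rightarrow> 'a) \<Rightarrow> ('b \<Rightarrow> 'b)
     \<Rightarrow> nat \<Rightarrow> ('b list \<Rightarrow>\<^sub>0 'k) \<Rightarrow> ('b list \<Rightarrow>\<^sub>0 'k)" where
  "H_map B i p h n t = K_map B (i \<circ> p) (H_tilde B h (proj n t))"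

definition L_infty ::
  "('k::field_char_0, 'a::ab_group_add) dgla \<Rightarrow> ('k, 'b::ab_group_add) dgla
     \<Rightarrow> (('b list \<Rightarrow>\<^sub>0 'k) \<Rightarrow> ('a list \<Rightarrow>\<^sub>0 'k)) \<Rightarrow> nat \<Rightarrow> ('b list \<Rightarrow>\<^sub>0 'k) \<Rightarrow> 'a" where
  "L_infty A B P k t =
     structure_map (A\<lbrakk>1\<rbrakk>) (codiff A) 2 (component P (k + 1) 2 t)
       - structure_map (A\<lbrakk>1\<rbrakk>) P k (component (codiff B) (k + 1) k t)"

text \<open>The components of \<open>P\<close> occurring in \<open>L_infty A B P k\<close> depend only on the structure maps of
  \<open>P\<close> of order at most \<open>k\<close>, so the following is a recursion for the structure maps of \<open>P\<close>.\<close>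

definition recursive_structure_maps ::
  "('k::field_char_0, 'a::ab_group_add) dgla \<Rightarrow> ('k, 'b::ab_group_add) dgla
     \<Rightarrow> ('a \<Rightarrow> 'b) \<Rightarrow> ('b \<Rightarrow> 'a) \<Rightarrow> ('b \<Rightarrow> 'b) \<Rightarrow> (('b list \<Rightarrow>\<^sub>0 'k) \<Rightarrow> ('a list \<Rightarrow>\<^sub>0 'k)) \<Rightarrow> bool" where
  "recursive_structure_maps A B i p h P \<longleftrightarrow>
     first_map B A P = p \<and>
     (\<forall>k\<ge>1. \<forall>t\<in>sym_carrier (B\<lbrakk>1\<rbrakk>).
        structure_map (A\<lbrakk>1\<rbrakk>) P (k + 1) t = L_infty A B P k (H_map B i p h (k + 1) t))"

end

theory Submission
  imports Defs
begin

text \<open>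
  A linear map out of \<open>Sym(V)\<close> is a graded symmetric multilinear function of words, so operators on
  symmetric coalgebras are studied through their transposes, which act on such functions.  The defect
  \<open>D = Q P - P Q\<close> is a coderivation along \<open>P\<close>; primitive elements have length one, so by induction on the
  word length it suffices that the \<open>Sym\<^sup>1\<close>-component of \<open>D\<close> vanishes.  If \<open>D\<close> vanishes on words shorter
  than \<open>k + 1\<close>, then \<open>L = L\<^bsub>\<infinity>,k+1\<^esub>\<close> is compatible with the differentials, and \<open>QH + HQ = 1 - (ip)\<^sup>k\<^sup>+\<^sup>1\<close>
  shows that this component is \<open>L \<circ> (ip)\<^sup>k\<^sup>+\<^sup>1\<close>.  As \<open>H\<close> vanishes on words in the image of \<open>i\<close>, the
  composite \<open>P \<circ> i\<close> is the identity, and as \<open>i\<close> respects brackets, \<open>L\<close> vanishes on such words as well.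
\<close>

subsection \<open>Signs and unshuffles\<close>

text \<open>The compatibility of L with the differentials comes from Q^2 = 0 on both sides. It gives
  Q D + D Q = 0. In length k + 1 the element D x is primitive, so only the linear part of Q sees it,
  and D vanishes in length k, so only the linear part of Q contributes to D Q. Writing D as L minus
  the boundary of the structure map of P then transfers the resulting identity from D to L. The
  weights 1/(n - j) in K are the solution of a recursion. Let c_j be the weight of the terms with ip
  applied to j letters. Composition with the derivation extending 1 - ip turns c_j into (n - j) c_j
  - j c_(j-1), and this has to be 1 for j = 0, -1 for j = n and 0 in between. Two obstacles shape
  the text. The degree of the letter 0 is arbitrary, so every identity with signs treats words with
  a zero letter apart. And the existence of P is part of the claim, so a coalgebra morphism has to
  be built from its structure maps before the recursion can be solved.\<close>

definition sg :: "int \<Rightarrow> 'v::ab_group_add \<Rightarrow> 'v" where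
  "sg n v = (if even n then v else - v)"

lemma sg_0 [simp]: "sg 0 v = v"
  and sg_zero [simp]: "sg n 0 = 0"
  and sg_add: "sg n (v + w) = sg n v + sg n w"
  and sg_minus: "sg n (- v) = - sg n v"
  and sg_diff: "sg n (v - w) = sg n v - sg n w"
  and sg_sg [simp]: "sg m (sg n v) = sg (m + n) v"
  and sg_eq_0 [simp]: "sg n v = 0 \<longleftrightarrow> v = 0"
  by (auto simp: sg_def)

lemma sg_cong: "even m = even n \<Longrightarrow> sg m v = sg n v"
  by (simp add: sg_def)

lemma sg_hom:
  assumes "\<And>x y. f (x + y) = f x + f y"
  shows "f (sg n v) = sg n (f v)"
proof -
  interpret additive f by standard (fact assms)
  show ?thesis by (simp add: sg_def minus)
qed

text \<open>\<open>sg\<close> needs no scalars, so the sign calculus is independent of the target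
  space. This is the bridge to the powers of -1 in the definitions of the coalgebra.\<close>

lemma scale_powi_minus1:
  fixes s :: "'k::field \<Rightarrow> 'v::ab_group_add \<Rightarrow> 'v"
  assumes "vector_space s"
  shows "s ((-1) powi n) v = sg n v"
proof -
  interpret vector_space s by fact
  show ?thesis by (simp add: sg_def)
qed

text \<open>A zero letter contributes an arbitrary integer. The ambiguity is harmless wherever a
  multilinear function stands behind the sign, since it vanishes on such words.\<close>

definition wdeg :: "('k, 'a, 'z) gvs_scheme \<Rightarrow> 'a list \<Rightarrow> int" where
  "wdeg V xs = sum_list (map (deg V) xs)"

lemma wdeg_simps [simp]:
  "wdeg V [] = 0" "wdeg V (x # xs) = deg V x + wdeg V xs" "wdeg V (xs @ ys) = wdeg V xs + wdeg V ys"
  by (simp_all add: wdeg_def)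

lemma wdeg_mset: "mset xs = mset ys \<Longrightarrow> wdeg V xs = wdeg V ys"
  unfolding wdeg_def by (metis mset_map sum_mset_sum_list)

text \<open>\<open>unsh V xs g\<close> is the sum of \<open>g u w\<close>, with Koszul signs, over all unshuffles of \<open>xs\<close> into a
  pair \<open>u, w\<close> of complementary subwords; that is, \<open>g\<close> evaluated at the coproduct of \<open>xs\<close>.\<close>

primrec unsh :: "('k, 'a, 'z) gvs_scheme \<Rightarrow> 'a list \<Rightarrow> ('a list \<Rightarrow> 'a list \<Rightarrow> 'v::ab_group_add) \<Rightarrow> 'v" where
  "unsh V [] g = g [] []"
| "unsh V (x # xs) g =
     unsh V xs (\<lambda>u w. g (x # u) w) + unsh V xs (\<lambda>u w. sg (deg V x * wdeg V u) (g u (x # w)))"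

lemma unsh_cong_mset:
  "(\<And>u w. mset u + mset w = mset xs \<Longrightarrow> g u w = g' u w) \<Longrightarrow> unsh V xs g = unsh V xs g'"
proof (induction xs arbitrary: g g')
  case (Cons x xs)
  have "unsh V xs (\<lambda>u w. g (x # u) w) = unsh V xs (\<lambda>u w. g' (x # u) w)"
    by (intro Cons.IH Cons.prems) auto
  moreover have "unsh V xs (\<lambda>u w. sg (deg V x * wdeg V u) (g u (x # w)))
      = unsh V xs (\<lambda>u w. sg (deg V x * wdeg V u) (g' u (x # w)))"
    by (intro Cons.IH arg_cong[where f = "sg _"] Cons.prems) auto
  ultimately show ?case by simp
qed simp

lemma unsh_cong:
  assumes "\<And>u w. set u \<subseteq> set xs \<Longrightarrow> set w \<subseteq> set xs \<Longrightarrow> length u + length w = length xs \<Longrightarrow>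
    wdeg V u + wdeg V w = wdeg V xs \<Longrightarrow> g u w = g' u w"
  shows "unsh V xs g = unsh V xs g'"
proof (rule unsh_cong_mset)
  fix u w assume *: "mset u + mset w = mset xs"
  then have "mset (u @ w) = mset xs" by simp
  note ** = mset_eq_setD[OF this] mset_eq_length[OF this] wdeg_mset[OF this, of V]
  show "g u w = g' u w"
    by (rule assms) (use ** in auto)
qed

lemma unsh_hom:
  assumes "\<And>x y. f (x + y) = f x + f y"
  shows "f (unsh V xs g) = unsh V xs (\<lambda>u w. f (g u w))"
  by (induction xs arbitrary: g) (simp_all add: assms sg_hom[of f, OF assms])

lemma unsh_add: "unsh V xs (\<lambda>u w. g u w + g' u w) = unsh V xs g + unsh V xs g'"
  by (induction xs arbitrary: g g') (simp_all add: sg_add)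

lemma unsh_zero [simp]: "unsh V xs (\<lambda>u w. 0) = 0"
  by (induction xs) simp_all

lemma unsh_minus: "unsh V xs (\<lambda>u w. - g u w) = - unsh V xs g"
  by (rule unsh_hom[symmetric]) simp

lemma unsh_diff: "unsh V xs (\<lambda>u w. g u w - g' u w) = unsh V xs g - unsh V xs g'"
  using unsh_add[of V xs g "\<lambda>u w. - g' u w"] by (simp add: unsh_minus)

lemma unsh_sg: "unsh V xs (\<lambda>u w. sg n (g u w)) = sg n (unsh V xs g)"
  by (rule unsh_hom[symmetric]) (simp add: sg_add)

lemma unsh_eq_0:
  assumes "\<And>u w. set u \<subseteq> set xs \<Longrightarrow> set w \<subseteq> set xs \<Longrightarrow> length u + length w = length xs \<Longrightarrow>
    wdeg V u + wdeg V w = wdeg V xs \<Longrightarrow> g u w = 0"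
  shows "unsh V xs g = 0"
proof -
  have "unsh V xs g = unsh V xs (\<lambda>u w. 0)"
    by (rule unsh_cong) (fact assms)
  then show ?thesis by simp
qed

lemma unsh_closed:
  assumes U: "\<And>v w. v \<in> U \<Longrightarrow> w \<in> U \<Longrightarrow> v + w \<in> U" "\<And>v. v \<in> U \<Longrightarrow> - v \<in> U"
    and g: "\<And>u w. mset u + mset w = mset xs \<Longrightarrow> g u w \<in> U"
  shows "unsh V xs g \<in> U"
  using g
proof (induction xs arbitrary: g)
  case (Cons x xs)
  have sg: "sg n v \<in> U" if "v \<in> U" for n v
    using that U by (simp add: sg_def)
  show ?case unfolding unsh.simps
    by (intro U(1) Cons.IH sg Cons.prems) auto
qed simp

text \<open>Coassociativity. The first letter goes to one of three blocks, and the sign for passing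
  two blocks is the product of the signs for each of them, because degrees add.\<close>

lemma unsh_assoc:
  "unsh V xs (\<lambda>u w. unsh V u (\<lambda>a b. g a b w)) = unsh V xs (\<lambda>a v. unsh V v (\<lambda>b w. g a b w))"
proof (induction xs arbitrary: g)
  case (Cons x xs)
  have "unsh V xs (\<lambda>u w. sg (deg V x * wdeg V u) (unsh V u (\<lambda>a b. g a b (x # w)))) =
      unsh V xs (\<lambda>u w. unsh V u (\<lambda>a b. sg (deg V x * wdeg V a + deg V x * wdeg V b) (g a b (x # w))))"
    by (rule unsh_cong, subst unsh_sg[symmetric], rule unsh_cong) (metis distrib_left)
  then show ?case
    by (simp add: unsh_add Cons.IH unsh_sg[symmetric] sg_add ac_simps)
qed simp

text \<open>Graded cocommutativity. Moving the first letter from one factor to the other changes the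
  sign by exactly that part of \<open>wdeg V u * wdeg V w\<close> which involves this
  letter.\<close>

lemma unsh_comm: "unsh V xs g = unsh V xs (\<lambda>u w. sg (wdeg V u * wdeg V w) (g w u))"
proof (induction xs arbitrary: g)
  case (Cons x xs)
  have "unsh V xs (\<lambda>u w. g (x # u) w) = unsh V xs (\<lambda>u w. sg (wdeg V u * wdeg V w) (g (x # w) u))"
    by (rule Cons.IH)
  also have "\<dots> = unsh V xs (\<lambda>u w. sg (deg V x * wdeg V u) (sg (wdeg V u * (deg V x + wdeg V w)) (g (x # w) u)))"
    by (intro unsh_cong) (auto simp: sg_def)
  finally have 1: "unsh V xs (\<lambda>u w. g (x # u) w) = \<dots>" .
  have "unsh V xs (\<lambda>u w. sg (deg V x * wdeg V u) (g u (x # w))) =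
     unsh V xs (\<lambda>u w. sg (wdeg V u * wdeg V w) (sg (deg V x * wdeg V w) (g w (x # u))))"
    by (rule Cons.IH)
  also have "\<dots> = unsh V xs (\<lambda>u w. sg ((deg V x + wdeg V u) * wdeg V w) (g w (x # u)))"
    by (intro unsh_cong) (auto simp: sg_def)
  finally have 2: "unsh V xs (\<lambda>u w. sg (deg V x * wdeg V u) (g u (x # w))) = \<dots>" .
  show ?case by (simp only: unsh.simps 1 2 wdeg_simps add.commute)
qed simp

text \<open>Cocommutativity in the first two of three factors: regroup by coassociativity, exchange,
  regroup back.\<close>

lemma unsh_swap:
  "unsh V xs (\<lambda>u v. unsh V v (\<lambda>a b. g u a b))
    = unsh V xs (\<lambda>a v. unsh V v (\<lambda>u b. sg (wdeg V a * wdeg V u) (g u a b)))"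
proof -
  have "unsh V xs (\<lambda>u v. unsh V v (\<lambda>a b. g u a b)) = unsh V xs (\<lambda>v b. unsh V v (\<lambda>u a. g u a b))"
    by (rule unsh_assoc[symmetric])
  also have "\<dots> = unsh V xs (\<lambda>v b. unsh V v (\<lambda>a u. sg (wdeg V a * wdeg V u) (g u a b)))"
    by (intro unsh_cong unsh_comm)
  also have "\<dots> = unsh V xs (\<lambda>a v. unsh V v (\<lambda>u b. sg (wdeg V a * wdeg V u) (g u a b)))"
    by (rule unsh_assoc)
  finally show ?thesis .
qed

text \<open>In an induction on the word length the terms with a proper left factor vanish by
  hypothesis; the single remaining term puts the whole word on the left.\<close>

lemma unsh_right_Nil:
  assumes "\<And>u w. length u < length xs \<Longrightarrow> set u \<subseteq> set xs \<Longrightarrow> set w \<subseteq> set xs \<Longrightarrow>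
    length u + length w = length xs \<Longrightarrow> g u w = 0"
  shows "unsh V xs g = g xs []"
  using assms
proof (induction xs arbitrary: g)
  case (Cons x xs)
  have "unsh V xs (\<lambda>u w. g (x # u) w) = g (x # xs) []"
    by (rule Cons.IH) (auto intro!: Cons.prems)
  moreover have "unsh V xs (\<lambda>u w. sg (deg V x * wdeg V u) (g u (x # w))) = 0"
    by (rule unsh_eq_0) (auto intro!: Cons.prems)
  ultimately show ?case by simp
qed simp

lemma unsh_left_Nil:
  assumes "\<And>u w. length w < length xs \<Longrightarrow> set u \<subseteq> set xs \<Longrightarrow> set w \<subseteq> set xs \<Longrightarrow>
    length u + length w = length xs \<Longrightarrow> g u w = 0"
  shows "unsh V xs g = g [] xs"
proof -
  have "unsh V xs (\<lambda>u w. sg (wdeg V u * wdeg V w) (g w u)) = g [] xs"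
    by (subst unsh_right_Nil) (auto intro: assms)
  then show ?thesis by (simp only: unsh_comm[of V xs g])
qed

subsection \<open>Permutations by insertion\<close>

text \<open>Insertion of a new first letter: the index 0 is put at position \<open>p\<close> of the
  rearrangement given by \<open>\<sigma>\<close>, and the old indices go up by one. This matches the
  recursion of \<open>unsh\<close> on the first letter.\<close>

definition cins :: "nat \<Rightarrow> (nat \<Rightarrow> nat) \<Rightarrow> nat \<Rightarrow> nat" where
  "cins p \<sigma> a = (if a < p then Suc (\<sigma> a) else if a = p then 0 else Suc (\<sigma> (a - 1)))"

lemma cins_simps [simp]: "a < p \<Longrightarrow> cins p \<sigma> a = Suc (\<sigma> a)" "cins p \<sigma> p = 0"
  "p \<le> a \<Longrightarrow> cins p \<sigma> (Suc a) = Suc (\<sigma> a)"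
  by (auto simp: cins_def)

lemma cins_permutes:
  assumes "\<sigma> permutes {..<n}" "p \<le> n"
  shows "cins p \<sigma> permutes {..<Suc n}"
proof (rule bij_imp_permutes)
  have inj: "\<sigma> a = \<sigma> b \<longleftrightarrow> a = b" for a b
    using permutes_inj[OF assms(1)] by (auto dest: injD)
  have lt: "\<sigma> a < n \<longleftrightarrow> a < n" for a
    using permutes_in_image[OF assms(1), of a] by simp
  have "inj_on (cins p \<sigma>) {..<Suc n}"
    by (rule inj_onI) (auto simp: cins_def inj split: if_splits)
  moreover have "cins p \<sigma> ` {..<Suc n} \<subseteq> {..<Suc n}"
    using assms(2) by (auto simp: cins_def lt)
  ultimately show "bij_betw (cins p \<sigma>) {..<Suc n} {..<Suc n}"
    by (simp add: bij_betw_def endo_inj_surj)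
next
  fix a assume "a \<notin> {..<Suc n}"
  moreover from this have "\<sigma> (a - 1) = a - 1"
    using assms(1) by (auto intro!: permutes_not_in)
  ultimately show "cins p \<sigma> a = a" using assms(2) by (auto simp: cins_def)
qed

text \<open>Injective because \<open>p\<close> is recovered as the place where the value 0 is taken.
  Surjective by counting: there are n + 1 places and n! permutations of the rest.\<close>

lemma bij_betw_cins:
  "bij_betw (\<lambda>(p, \<sigma>). cins p \<sigma>) ({..n} \<times> {\<sigma>. \<sigma> permutes {..<n}}) {\<sigma>. \<sigma> permutes {..<Suc n}}"
proof -
  let ?f = "\<lambda>(p, \<sigma>). cins p \<sigma>" and ?A = "{..n} \<times> {\<sigma>. \<sigma> permutes {..<n}}"
  have inj: "inj_on ?f ?A"
  proof (rule inj_onI, clarsimp)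
    fix p q \<sigma> \<tau>
    assume eq: "cins p \<sigma> = cins q \<tau>"
    have "cins q \<tau> p = 0" using eq by (metis cins_simps(2))
    then have pq: "p = q" by (simp add: cins_def split: if_splits)
    have "\<sigma> a = \<tau> a" for a
      using fun_cong[OF eq, of "if a < p then a else Suc a"] pq by (auto split: if_splits)
    then show "p = q \<and> \<sigma> = \<tau>" using pq by auto
  qed
  have "?f ` ?A \<subseteq> {\<sigma>. \<sigma> permutes {..<Suc n}}"
    by (auto intro: cins_permutes)
  moreover have "card (?f ` ?A) = card {\<sigma>. \<sigma> permutes {..<Suc n}}"
    by (simp add: card_image[OF inj] card_cartesian_product card_permutations[OF refl])
  ultimately have "?f ` ?A = {\<sigma>. \<sigma> permutes {..<Suc n}}"
    by (intro card_subset_eq finite_permutations) auto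
  with inj show ?thesis by (simp add: bij_betw_def)
qed

lemma sum_permutes_Suc:
  "(\<Sum>\<sigma> | \<sigma> permutes {..<Suc n}. f \<sigma>) = (\<Sum>p\<le>n. \<Sum>\<sigma> | \<sigma> permutes {..<n}. f (cins p \<sigma>))"
  unfolding sum.cartesian_product
  using sum.reindex_bij_betw[OF bij_betw_cins, of f n, symmetric] by (simp add: case_prod_beta')

lemma permute_list_cins:
  assumes "\<sigma> permutes {..<length xs}" "p \<le> length xs"
  shows "permute_list (cins p \<sigma>) (x # xs) = take p (permute_list \<sigma> xs) @ x # drop p (permute_list \<sigma> xs)"
proof (rule nth_equalityI)
  fix a assume "a < length (permute_list (cins p \<sigma>) (x # xs))"
  then have a: "a < Suc (length xs)" by simp
  have "permute_list (cins p \<sigma>) (x # xs) ! a = (x # xs) ! cins p \<sigma> a"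
    by (rule permute_list_nth[OF _ ]) (use cins_permutes[OF assms] a in auto)
  also have "\<dots> = (take p (permute_list \<sigma> xs) @ x # drop p (permute_list \<sigma> xs)) ! a"
    using a assms(2) by (cases a) (auto simp: cins_def nth_append permute_list_nth[OF assms(1)] nth_Cons' min_def not_less less_diff_conv)
  finally show "permute_list (cins p \<sigma>) (x # xs) ! a = \<dots>" .
qed (use assms in simp)

text \<open>The inserted letter has the smallest index, so its inversions are with the
  \<open>p\<close> letters placed before it and with no others. All remaining inversions come from
  \<open>\<sigma>\<close>.\<close>

lemma koszul_cins:
  fixes V :: "('k::field, 'a, 'z) gvs_scheme"
  assumes "\<sigma> permutes {..<length xs}" "p \<le> length xs"
  shows "koszul V (cins p \<sigma>) (x # xs)
    = (-1) powi (deg V x * wdeg V (take p (permute_list \<sigma> xs))) * koszul V \<sigma> xs"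
proof -
  \<comment> \<open>The increasing enumeration of the positions other than \<open>p\<close>; it
    carries the inversions of \<open>\<sigma>\<close> to those of
    \<open>cins p \<sigma>\<close>.\<close>
  define s where "s a = (if a < p then a else Suc a)" for a
  define I where "I = {(a, b). a < b \<and> b < length xs \<and> \<sigma> b < \<sigma> a}"
  let ?J = "{(a, b). a < b \<and> b < length (x # xs) \<and> cins p \<sigma> b < cins p \<sigma> a}"
  let ?f = "\<lambda>(a, b). (-1::'k) powi (deg V ((x # xs) ! cins p \<sigma> a) * deg V ((x # xs) ! cins p \<sigma> b))"
  have fin: "finite I"
    by (rule finite_subset[of _ "{..<length xs} \<times> {..<length xs}"]) (auto simp: I_def)
  have s_less: "s a < s b \<longleftrightarrow> a < b" for a b by (auto simp: s_def)
  have s_eq: "s a = s b \<longleftrightarrow> a = b" for a b by (auto simp: s_def)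
  have c_s: "cins p \<sigma> (s a) = Suc (\<sigma> a)" for a by (auto simp: s_def)
  have s_len: "s a < Suc (length xs) \<longleftrightarrow> a < length xs" for a
    using assms(2) by (auto simp: s_def)
  have s_ex: "\<exists>a'. a = s a'" if "a \<noteq> p" for a
    using that by (intro exI[of _ "if a < p then a else a - 1"]) (auto simp: s_def)
  have s_inj: "inj_on (map_prod s s) I"
    by (rule inj_on_subset[OF prod.inj_map]) (auto intro!: injI simp: s_def split: if_splits)
  have J: "?J = (\<lambda>a. (a, p)) ` {..<p} \<union> map_prod s s ` I"
  proof (rule set_eqI, clarify)
    fix a b
    show "(a, b) \<in> ?J \<longleftrightarrow> (a, b) \<in> (\<lambda>a. (a, p)) ` {..<p} \<union> map_prod s s ` I"
    proof (cases "a = p \<or> b = p")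
      case True
      have "s a' \<noteq> p" for a' by (simp add: s_def)
      then have "p \<noteq> s a'" for a' by metis
      with True show ?thesis using assms(2) \<open>\<And>a'. s a' \<noteq> p\<close>
        by (auto simp: image_iff simp del: not_gr_zero dest: sym)
    next
      case False
      then obtain a' b' where "a = s a'" "b = s b'" using s_ex by metis
      moreover have "(s a', s b') \<in> map_prod s s ` I \<longleftrightarrow> (a', b') \<in> I"
      proof
        assume "(s a', s b') \<in> map_prod s s ` I"
        then obtain a'' b'' where "(a'', b'') \<in> I" "s a' = s a''" "s b' = s b''" by auto
        then show "(a', b') \<in> I" by (simp add: s_eq)
      qed (metis map_prod_imageI)
      ultimately show ?thesis using False
        by (auto simp: I_def s_less s_len[simplified] c_s less_Suc_eq_le[symmetric])
    qed
  qed
  have "koszul V (cins p \<sigma>) (x # xs) = prod ?f ?J"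
    by (simp add: koszul_def)
  also have "\<dots> = prod ?f ((\<lambda>a. (a, p)) ` {..<p}) * prod ?f (map_prod s s ` I)"
  proof -
    have "s b \<noteq> p" for b by (simp add: s_def)
    then have "p \<noteq> s b" for b by metis
    then show ?thesis unfolding J by (intro prod.union_disjoint finite_imageI fin) auto
  qed
  also have "prod ?f ((\<lambda>a. (a, p)) ` {..<p}) = (\<Prod>a<p. (-1) powi (deg V (xs ! \<sigma> a) * deg V x))"
    by (subst prod.reindex) (auto simp: inj_on_def)
  also have "\<dots> = (-1) powi (deg V x * wdeg V (take p (permute_list \<sigma> xs)))"
  proof -
    have "(\<Prod>a<q. (-1) powi (deg V (xs ! \<sigma> a) * deg V x))
        = ((-1)::'k) powi (deg V x * wdeg V (take q (permute_list \<sigma> xs)))" if "q \<le> length xs" for q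
      using that
    proof (induction q)
      case (Suc q)
      then show ?case
        by (simp add: take_Suc_conv_app_nth permute_list_nth[OF assms(1)] distrib_left power_int_add ac_simps)
    qed simp
    with assms(2) show ?thesis by simp
  qed
  also have "prod ?f (map_prod s s ` I) = koszul V \<sigma> xs"
    by (subst prod.reindex[OF s_inj]) (auto simp: koszul_def I_def c_s intro!: prod.cong)
  finally show ?thesis .
qed

text \<open>Both blocks of a shuffle increase, so the index 0 can only stand at the beginning of a
  block, that is at position 0 or \<open>m\<close>.\<close>

lemma Sh_cins_iff:
  assumes "\<sigma> permutes {..<n}" "p \<le> n" "m + q = Suc n"
  shows "cins p \<sigma> \<in> Sh m q \<longleftrightarrow>
    (p = 0 \<and> 0 < m \<and> \<sigma> \<in> Sh (m - 1) q) \<or> (p = m \<and> 0 < q \<and> \<sigma> \<in> Sh m (q - 1))"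
proof -
  have perm: "cins p \<sigma> permutes {..<m + q}" using cins_permutes[OF assms(1,2)] assms(3) by simp
  have mono: "strict_mono_on S f \<longleftrightarrow> (\<forall>a\<in>S. \<forall>b\<in>S. a < b \<longrightarrow> f a < f b)" for S and f :: "nat \<Rightarrow> nat"
    by (auto simp: strict_mono_on_def)
  consider "p = 0" "0 < m" | "p = m" "0 < q" | "0 < p" "p < m" | "m < p" using assms by linarith
  then show ?thesis
  proof cases
    case 1
    have "strict_mono_on {..<m} (cins 0 \<sigma>) \<longleftrightarrow> strict_mono_on {..<m - 1} \<sigma>"
    proof
      assume *: "strict_mono_on {..<m} (cins 0 \<sigma>)"
      show "strict_mono_on {..<m - 1} \<sigma>" unfolding mono
      proof (intro ballI impI)
        fix a b assume "a \<in> {..<m-1}" "b \<in> {..<m-1}" "a < b"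
        then show "\<sigma> a < \<sigma> b" using *[unfolded mono, rule_format, of "Suc a" "Suc b"] by simp
      qed
    qed (use 1 in \<open>auto simp: mono cins_def\<close>)
    moreover have "strict_mono_on {m..<m + q} (cins 0 \<sigma>) \<longleftrightarrow> strict_mono_on {m - 1..<m - 1 + q} \<sigma>"
    proof
      assume *: "strict_mono_on {m..<m + q} (cins 0 \<sigma>)"
      show "strict_mono_on {m - 1..<m - 1 + q} \<sigma>" unfolding mono
      proof (intro ballI impI)
        fix a b assume "a \<in> {m - 1..<m - 1 + q}" "b \<in> {m - 1..<m - 1 + q}" "a < b"
        then show "\<sigma> a < \<sigma> b" using *[unfolded mono, rule_format, of "Suc a" "Suc b"] 1 by auto
      qed
    next
      assume *: "strict_mono_on {m - 1..<m - 1 + q} \<sigma>"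
      show "strict_mono_on {m..<m + q} (cins 0 \<sigma>)" unfolding mono
      proof (intro ballI impI)
        fix a b assume "a \<in> {m..<m + q}" "b \<in> {m..<m + q}" "a < b"
        then show "cins 0 \<sigma> a < cins 0 \<sigma> b"
          using *[unfolded mono, rule_format, of "a - 1" "b - 1"] 1 by (simp add: cins_def)
      qed
    qed
    moreover have "{..<m - 1 + q} = {..<n}" using 1 assms(3) by auto
    ultimately show ?thesis using 1 assms perm by (auto simp: Sh_def)
  next
    case 2
    have "strict_mono_on {..<m} (cins m \<sigma>) \<longleftrightarrow> strict_mono_on {..<m} \<sigma>"
      by (auto simp: mono)
    moreover have "strict_mono_on {m..<m + q} (cins m \<sigma>) \<longleftrightarrow> strict_mono_on {m..<m + (q - 1)} \<sigma>"
    proof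
      assume *: "strict_mono_on {m..<m + q} (cins m \<sigma>)"
      show "strict_mono_on {m..<m + (q - 1)} \<sigma>" unfolding mono
      proof (intro ballI impI)
        fix a b assume "a \<in> {m..<m + (q - 1)}" "b \<in> {m..<m + (q - 1)}" "a < b"
        then show "\<sigma> a < \<sigma> b" using *[unfolded mono, rule_format, of "Suc a" "Suc b"] by simp
      qed
    next
      assume *: "strict_mono_on {m..<m + (q - 1)} \<sigma>"
      show "strict_mono_on {m..<m + q} (cins m \<sigma>)" unfolding mono
      proof (intro ballI impI)
        fix a b assume "a \<in> {m..<m + q}" "b \<in> {m..<m + q}" "a < b"
        then show "cins m \<sigma> a < cins m \<sigma> b"
          using *[unfolded mono, rule_format, of "a - 1" "b - 1"] by (simp add: cins_def)
      qed
    qed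
    moreover have "{..<m + (q - 1)} = {..<n}" using 2 assms(3) by auto
    ultimately show ?thesis using 2 assms perm by (cases "m = 0") (auto simp: Sh_def)
  next
    case 3
    then have "\<not> strict_mono_on {..<m} (cins p \<sigma>)"
      unfolding mono by (intro notI) (drule bspec[of _ _ "p - 1"], simp, drule bspec[of _ _ p], auto)
    with 3 show ?thesis by (auto simp: Sh_def)
  next
    case 4
    then have "\<not> strict_mono_on {m..<m + q} (cins p \<sigma>)"
      unfolding mono using assms
      by (intro notI) (drule bspec[of _ _ "p - 1"], simp, linarith, drule bspec[of _ _ p], auto)
    with 4 show ?thesis by (auto simp: Sh_def)
  qed
qed

lemma finite_Sh [simp]: "finite (Sh m q)"
  by (rule finite_subset[OF _ finite_permutations[of "{..<m + q}"]]) (auto simp: Sh_def)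

lemma sum_Sh:
  assumes "m + q = Suc n"
  shows "(\<Sum>\<sigma>\<in>Sh m q. f \<sigma>) = (if 0 < m then \<Sum>\<sigma>\<in>Sh (m - 1) q. f (cins 0 \<sigma>) else 0)
     + (if 0 < q then \<Sum>\<sigma>\<in>Sh m (q - 1). f (cins m \<sigma>) else 0)"
proof -
  let ?X = "if 0 < m then (\<lambda>\<sigma>. (0::nat, \<sigma>)) ` Sh (m - 1) q else {}"
  let ?Y = "if 0 < q then (\<lambda>\<sigma>. (m, \<sigma>)) ` Sh m (q - 1) else {}"
  let ?A = "{..n} \<times> {\<sigma>. \<sigma> permutes {..<n}}"
  have perm1: "\<sigma> permutes {..<n}" if "0 < m" "\<sigma> \<in> Sh (m - 1) q" for \<sigma>
  proof -
    have "m - 1 + q = n" using that assms by linarith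
    then show ?thesis using that by (simp add: Sh_def)
  qed
  have perm2: "\<sigma> permutes {..<n}" if "0 < q" "\<sigma> \<in> Sh m (q - 1)" for \<sigma>
  proof -
    have "m + (q - 1) = n" using that assms by linarith
    then show ?thesis using that by (simp add: Sh_def)
  qed
  have bij: "bij_betw (\<lambda>(p, \<sigma>). cins p \<sigma>) (?X \<union> ?Y) (Sh m q)"
  proof (rule bij_betw_imageI)
    show "inj_on (\<lambda>(p, \<sigma>). cins p \<sigma>) (?X \<union> ?Y)"
      by (rule inj_on_subset[OF bij_betw_imp_inj_on[OF bij_betw_cins[of n]]])
        (use assms perm1 perm2 in \<open>auto split: if_splits\<close>)
    show "(\<lambda>(p, \<sigma>). cins p \<sigma>) ` (?X \<union> ?Y) = Sh m q"
    proof (intro equalityI subsetI)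
      fix \<tau> assume "\<tau> \<in> (\<lambda>(p, \<sigma>). cins p \<sigma>) ` (?X \<union> ?Y)"
      then show "\<tau> \<in> Sh m q"
        using Sh_cins_iff[of _ n 0 m q] Sh_cins_iff[of _ n m m q] perm1 perm2 assms
        by (fastforce split: if_splits)
    next
      fix \<tau> assume \<tau>: "\<tau> \<in> Sh m q"
      then have "\<tau> permutes {..<Suc n}" using assms by (simp add: Sh_def)
      then obtain p \<sigma> where *: "\<tau> = cins p \<sigma>" "p \<le> n" "\<sigma> permutes {..<n}"
        using bij_betw_imp_surj_on[OF bij_betw_cins[of n]] by (force simp: image_iff set_eq_iff)
      then show "\<tau> \<in> (\<lambda>(p, \<sigma>). cins p \<sigma>) ` (?X \<union> ?Y)"
        using Sh_cins_iff[of \<sigma> n p m q] \<tau> assms by (force simp: image_iff)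
    qed
  qed
  have "sum f (Sh m q) = (\<Sum>x\<in>?X \<union> ?Y. f (case x of (p, \<sigma>) \<Rightarrow> cins p \<sigma>))"
    by (rule sum.reindex_bij_betw[OF bij, symmetric])
  also have "\<dots> = (\<Sum>x\<in>?X. f (case x of (p, \<sigma>) \<Rightarrow> cins p \<sigma>)) + (\<Sum>x\<in>?Y. f (case x of (p, \<sigma>) \<Rightarrow> cins p \<sigma>))"
    by (rule sum.union_disjoint) auto
  also have "\<dots> = (if 0 < m then \<Sum>\<sigma>\<in>Sh (m - 1) q. f (cins 0 \<sigma>) else 0)
     + (if 0 < q then \<Sum>\<sigma>\<in>Sh m (q - 1). f (cins m \<sigma>) else 0)"
    by (auto simp: sum.reindex inj_on_def)
  finally show ?thesis .
qed

text \<open>The two summands of \<open>sum_Sh\<close> are the two summands in the recursion of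
  \<open>unsh\<close>. Through this lemma the shuffle sums in the coproduct, the codifferential and
  \<open>H_tilde\<close> become recursive sums.\<close>

lemma sum_Sh_eq_unsh:
  fixes V :: "('k::field, 'a, 'z) gvs_scheme" and s :: "'k \<Rightarrow> 'v::ab_group_add \<Rightarrow> 'v"
  assumes s: "vector_space s"
  shows "m + q = length xs \<Longrightarrow> (\<Sum>\<sigma>\<in>Sh m q. s (koszul V \<sigma> xs)
      (g (take m (permute_list \<sigma> xs)) (drop m (permute_list \<sigma> xs))))
    = unsh V xs (\<lambda>u w. if length u = m then g u w else 0)"
proof (induction xs arbitrary: m q g)
  case Nil
  interpret vector_space s by fact
  have "Sh 0 0 = {id}" by (simp add: Sh_def strict_mono_on_def)
  moreover have "koszul V (\<lambda>a. a) [] = 1" by (simp add: koszul_def)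
  ultimately show ?case using Nil by simp
next
  case (Cons x xs)
  interpret vector_space s by fact
  define v where "v \<sigma> = permute_list \<sigma> xs" for \<sigma>
  have pl: "permute_list (cins p \<sigma>) (x # xs) = take p (v \<sigma>) @ x # drop p (v \<sigma>)"
    and ko: "koszul V (cins p \<sigma>) (x # xs) = (-1) powi (deg V x * wdeg V (take p (v \<sigma>))) * koszul V \<sigma> xs"
    if "\<sigma> \<in> Sh m' q'" "m' + q' = length xs" "p \<le> length xs" for \<sigma> p m' q'
    using that permute_list_cins koszul_cins by (auto simp: Sh_def v_def)
  let ?f = "\<lambda>\<sigma>. s (koszul V \<sigma> (x # xs))
      (g (take m (permute_list \<sigma> (x # xs))) (drop m (permute_list \<sigma> (x # xs))))"
  have 1: "(\<Sum>\<sigma>\<in>Sh (m - 1) q. ?f (cins 0 \<sigma>))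
      = unsh V xs (\<lambda>u w. if length (x # u) = m then g (x # u) w else 0)" if m: "0 < m"
  proof -
    have mq: "m - 1 + q = length xs" using Cons.prems m by simp
    have "(\<Sum>\<sigma>\<in>Sh (m - 1) q. ?f (cins 0 \<sigma>))
      = (\<Sum>\<sigma>\<in>Sh (m - 1) q. s (koszul V \<sigma> xs) (g (x # take (m - 1) (permute_list \<sigma> xs)) (drop (m - 1) (permute_list \<sigma> xs))))"
      using m by (intro sum.cong) (simp_all add: pl[OF _ mq] ko[OF _ mq] take_Cons' drop_Cons' v_def)
    also have "\<dots> = unsh V xs (\<lambda>u w. if length u = m - 1 then g (x # u) w else 0)"
      by (rule Cons.IH[OF mq])
    also have "\<dots> = unsh V xs (\<lambda>u w. if length (x # u) = m then g (x # u) w else 0)"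
      by (rule unsh_cong) (use m in auto)
    finally show ?thesis .
  qed
  have 2: "(\<Sum>\<sigma>\<in>Sh m (q - 1). ?f (cins m \<sigma>))
      = unsh V xs (\<lambda>u w. sg (deg V x * wdeg V u) (if length u = m then g u (x # w) else 0))" if q: "0 < q"
  proof -
    have mq: "m + (q - 1) = length xs" using Cons.prems q by simp
    then have "(\<Sum>\<sigma>\<in>Sh m (q - 1). ?f (cins m \<sigma>))
      = (\<Sum>\<sigma>\<in>Sh m (q - 1). s (koszul V \<sigma> xs) (sg (deg V x * wdeg V (take m (permute_list \<sigma> xs)))
          (g (take m (permute_list \<sigma> xs)) (x # drop m (permute_list \<sigma> xs)))))"
      by (intro sum.cong refl, subst scale_powi_minus1[OF s, symmetric])
        (simp_all add: pl[OF _ mq] ko[OF _ mq] v_def ac_simps)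
    also have "\<dots> = unsh V xs (\<lambda>u w. if length u = m then sg (deg V x * wdeg V u) (g u (x # w)) else 0)"
      by (rule Cons.IH[OF mq])
    also have "\<dots> = unsh V xs (\<lambda>u w. sg (deg V x * wdeg V u) (if length u = m then g u (x # w) else 0))"
      by (rule unsh_cong) auto
    finally show ?thesis .
  qed
  have 3: "unsh V xs (\<lambda>u w. if length (x # u) = m then g (x # u) w else 0) = 0" if "m = 0"
    using that by simp
  have 4: "unsh V xs (\<lambda>u w. sg (deg V x * wdeg V u) (if length u = m then g u (x # w) else 0)) = 0" if "q = 0"
    using that Cons.prems by (intro unsh_eq_0) auto
  show ?case
    unfolding unsh.simps using 1 2 3 4 Cons.prems by (subst sum_Sh[of m q "length xs"]) auto
qed

subsection \<open>Linear maps out of free vector spaces\<close>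

lemma
  assumes "Vector_Spaces.linear s t f"
  shows vs_linear_add: "f (x + y) = f x + f y"
    and vs_linear_scale: "f (s c x) = t c (f x)"
    and vs_linear_0: "f 0 = 0"
    and vs_linear_minus: "f (- x) = - f x"
    and vs_linear_diff: "f (x - y) = f x - f y"
    and vs_linear_sum: "f (sum g A) = (\<Sum>a\<in>A. f (g a))"
    and vs_linear_sg: "f (sg n x) = sg n (f x)"
    and vs_linear_unsh: "f (unsh V xs G) = unsh V xs (\<lambda>u w. f (G u w))"
    and vs_linear_cod: "vector_space t"
proof -
  interpret Vector_Spaces.linear s t f by fact
  show *: "f (x + y) = f x + f y" for x y by (rule add)
  show "f (s c x) = t c (f x)" "f 0 = 0" "f (- x) = - f x" "f (x - y) = f x - f y"
    "f (sum g A) = (\<Sum>a\<in>A. f (g a))"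
    by (simp_all add: scale neg diff sum)
  show "f (sg n x) = sg n (f x)" "f (unsh V xs G) = unsh V xs (\<lambda>u w. f (G u w))"
    by (rule sg_hom unsh_hom, rule *)+
  show "vector_space t" by unfold_locales
qed

lemma vs_linearI:
  assumes "vector_space s" "vector_space t" "\<And>x y. f (x + y) = f x + f y" "\<And>c x. f (s c x) = t c (f x)"
  shows "Vector_Spaces.linear s t f"
  using assms by (auto simp: Vector_Spaces.linear_iff)

lemma lin_ext_superset:
  assumes "vector_space s" "finite S" "Poly_Mapping.keys t \<subseteq> S"
  shows "lin_ext s g t = (\<Sum>w\<in>S. s (Poly_Mapping.lookup t w) (g w))"
proof -
  interpret vector_space s by fact
  show ?thesis unfolding lin_ext_def
    by (rule sum.mono_neutral_left) (use assms in \<open>auto simp: in_keys_iff\<close>)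
qed

lemma linear_lin_ext:
  fixes s :: "'k::field \<Rightarrow> 'v::ab_group_add \<Rightarrow> 'v" and g :: "'w \<Rightarrow> 'v"
  assumes "vector_space s"
  shows "Vector_Spaces.linear fscale s (lin_ext s g)"
proof (rule vs_linearI[OF free.vector_space_axioms assms])
  interpret vector_space s by fact
  fix t u :: "'w \<Rightarrow>\<^sub>0 'k" and c
  let ?S = "Poly_Mapping.keys t \<union> Poly_Mapping.keys u"
  show "lin_ext s g (t + u) = lin_ext s g t + lin_ext s g u"
    using keys_add[of t u]
    by (simp add: lin_ext_superset[OF assms, of ?S] lookup_add scale_left_distrib sum.distrib)
  have "Poly_Mapping.keys (fscale c t) \<subseteq> Poly_Mapping.keys t"
    by (auto simp: in_keys_iff)
  then show "lin_ext s g (fscale c t) = s c (lin_ext s g t)"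
    by (simp add: lin_ext_superset[OF assms, of "Poly_Mapping.keys t"] scale_sum_right)
qed

lemmas lin_ext_add = linear_lin_ext[THEN vs_linear_add]
  and lin_ext_scale = linear_lin_ext[THEN vs_linear_scale]
  and lin_ext_0 = linear_lin_ext[THEN vs_linear_0]
  and lin_ext_minus = linear_lin_ext[THEN vs_linear_minus]
  and lin_ext_diff = linear_lin_ext[THEN vs_linear_diff]
  and lin_ext_sum = linear_lin_ext[THEN vs_linear_sum]
  and lin_ext_sg = linear_lin_ext[THEN vs_linear_sg]
  and lin_ext_unsh = linear_lin_ext[THEN vs_linear_unsh]

lemma lin_ext_cong: "(\<And>w. w \<in> Poly_Mapping.keys t \<Longrightarrow> g w = g' w) \<Longrightarrow> lin_ext s g t = lin_ext s g' t"
  by (simp add: lin_ext_def)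

lemma lin_ext_hom:
  assumes "Vector_Spaces.linear s s' f"
  shows "f (lin_ext s g t) = lin_ext s' (\<lambda>w. f (g w)) t"
  by (simp add: lin_ext_def vs_linear_sum[OF assms] vs_linear_scale[OF assms])

lemma
  assumes "vector_space s"
  shows lin_ext_fun_add: "lin_ext s (\<lambda>w. g w + g' w) t = lin_ext s g t + lin_ext s g' t"
    and lin_ext_fun_diff: "lin_ext s (\<lambda>w. g w - g' w) t = lin_ext s g t - lin_ext s g' t"
    and lin_ext_fun_0: "lin_ext s (\<lambda>w. 0) t = 0"
    and lin_ext_fun_minus: "lin_ext s (\<lambda>w. - g w) t = - lin_ext s g t"
    and lin_ext_fun_scale: "lin_ext s (\<lambda>w. s c (g w)) t = s c (lin_ext s g t)"
    and lin_ext_fun_sg: "lin_ext s (\<lambda>w. sg n (g w)) t = sg n (lin_ext s g t)"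
    and lin_ext_fun_unsh: "lin_ext s (\<lambda>w. unsh V xs (\<lambda>u v. G u v w)) t = unsh V xs (\<lambda>u v. lin_ext s (G u v) t)"
proof -
  interpret vector_space s by fact
  show add: "lin_ext s (\<lambda>w. g w + g' w) t = lin_ext s g t + lin_ext s g' t" for g g'
    by (simp add: lin_ext_def scale_right_distrib sum.distrib)
  show "lin_ext s (\<lambda>w. g w - g' w) t = lin_ext s g t - lin_ext s g' t"
    by (simp add: lin_ext_def scale_right_diff_distrib sum_subtractf)
  show "lin_ext s (\<lambda>w. 0) t = 0" by (simp add: lin_ext_def)
  show minus: "lin_ext s (\<lambda>w. - g w) t = - lin_ext s g t" for g by (simp add: lin_ext_def sum_negf)
  show sg: "lin_ext s (\<lambda>w. sg n (g w)) t = sg n (lin_ext s g t)" for g n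
    by (simp add: sg_def minus)
  show "lin_ext s (\<lambda>w. s c (g w)) t = s c (lin_ext s g t)"
    by (simp add: lin_ext_def scale_sum_right mult.commute)
  show "lin_ext s (\<lambda>w. unsh V xs (\<lambda>u v. G u v w)) t = unsh V xs (\<lambda>u v. lin_ext s (G u v) t)"
    by (induction xs arbitrary: G) (simp_all add: add sg)
qed

lemma lin_ext_gen_self: "lin_ext fscale gen t = t"
proof (rule poly_mapping_eqI)
  fix w
  show "Poly_Mapping.lookup (lin_ext fscale gen t) w = Poly_Mapping.lookup t w"
    by (simp add: lin_ext_def lookup_sum lookup_single when_def in_keys_iff
        if_distrib[of "\<lambda>x. _ * x"] sum.delta cong: if_cong)
qed

lemma linear_eq_lin_ext:
  assumes "Vector_Spaces.linear fscale s F"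
  shows "F t = lin_ext s (\<lambda>w. F (gen w)) t"
  using lin_ext_hom[OF assms, of gen t] by (simp add: lin_ext_gen_self)

lemma lin_ext_linear:
  assumes "Vector_Spaces.linear fscale fscale F" "vector_space s"
  shows "lin_ext s g (F t) = lin_ext s (\<lambda>w. lin_ext s g (F (gen w))) t"
  by (subst linear_eq_lin_ext[OF assms(1)], rule lin_ext_hom, rule linear_lin_ext, fact)

lemma lin_ext_lin_ext:
  assumes "vector_space s"
  shows "lin_ext s g (lin_ext fscale f t) = lin_ext s (\<lambda>w. lin_ext s g (f w)) t"
  by (rule lin_ext_hom, rule linear_lin_ext, fact)

text \<open>Quotients of a free vector space are realised as images of linear endomorphisms.\<close>

definition quot :: "('w \<Rightarrow>\<^sub>0 'k::field) set \<Rightarrow> ('w \<Rightarrow>\<^sub>0 'k) \<Rightarrow> ('w \<Rightarrow>\<^sub>0 'k)" where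
  "quot S = (SOME q. Vector_Spaces.linear fscale fscale q \<and> (\<forall>t. q t = 0 \<longleftrightarrow> t \<in> S))"

text \<open>Over a field a subspace has a linear projection \<open>g\<close> onto it, and
  \<open>t - g t\<close> has kernel exactly \<open>S\<close>.\<close>

lemma
  fixes S :: "('w \<Rightarrow>\<^sub>0 'k::field) set"
  assumes S: "free.subspace S"
  shows linear_quot: "Vector_Spaces.linear fscale fscale (quot S)"
    and quot_eq_0_iff: "quot S t = 0 \<longleftrightarrow> t \<in> S"
proof -
  interpret vector_space_pair "fscale :: 'k \<Rightarrow> ('w \<Rightarrow>\<^sub>0 'k) \<Rightarrow> _" "fscale :: 'k \<Rightarrow> ('w \<Rightarrow>\<^sub>0 'k) \<Rightarrow> _"
    by unfold_locales
  have "Vector_Spaces.linear fscale fscale (\<lambda>t::'w \<Rightarrow>\<^sub>0 'k. t)"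
    by (rule vs_linearI) (simp_all add: free.vector_space_axioms)
  from linear_exists_left_inverse_on[OF this S] obtain g :: "('w \<Rightarrow>\<^sub>0 'k) \<Rightarrow> ('w \<Rightarrow>\<^sub>0 'k)"
    where g: "g ` UNIV \<subseteq> S" "Vector_Spaces.linear fscale fscale g" "\<forall>v\<in>S. g v = v"
    by auto
  have "Vector_Spaces.linear fscale fscale (\<lambda>t. t - g t)"
    by (rule vs_linearI)
      (simp_all add: free.vector_space_axioms vs_linear_add[OF g(2)] vs_linear_scale[OF g(2)] free.scale_right_diff_distrib)
  moreover have "t - g t = 0 \<longleftrightarrow> t \<in> S" for t
    using g(1,3) by (metis eq_iff_diff_eq_0 rangeI subsetD)
  ultimately have "\<exists>q :: ('w \<Rightarrow>\<^sub>0 'k) \<Rightarrow> ('w \<Rightarrow>\<^sub>0 'k). Vector_Spaces.linear fscale fscale q \<and> (\<forall>t. q t = 0 \<longleftrightarrow> t \<in> S)"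
    by blast
  from someI_ex[OF this] show "Vector_Spaces.linear fscale fscale (quot S)" "quot S t = 0 \<longleftrightarrow> t \<in> S"
    unfolding quot_def by auto
qed

section \<open>Words, carriers and classes modulo the relations\<close>

lemma subspace_sym_rel: "free.subspace (sym_rel V)"
  by (simp add: sym_rel_def)

abbreviation sym_class :: "('k::field, 'a::ab_group_add, 'z) gvs_scheme \<Rightarrow> 'a list \<Rightarrow> ('a list \<Rightarrow>\<^sub>0 'k)" where
  "sym_class V xs \<equiv> quot (sym_rel V) (gen xs)"

lemma lin_ext_sym_class: "lin_ext fscale (sym_class V) t = quot (sym_rel V) t"
  by (rule linear_eq_lin_ext[symmetric]) (rule linear_quot[OF subspace_sym_rel])

lemma sym_eq_iff: "sym_eq V t t' \<longleftrightarrow> quot (sym_rel V) t = quot (sym_rel V) t'"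
  unfolding sym_eq_def quot_eq_0_iff[OF subspace_sym_rel, symmetric]
  by (simp add: vs_linear_diff[OF linear_quot[OF subspace_sym_rel]])

abbreviation hom_word :: "('k, 'a, 'z) gvs_scheme \<Rightarrow> 'a list \<Rightarrow> bool" where
  "hom_word V xs \<equiv> set xs \<subseteq> homogeneous V"

text \<open>The words form a basis of the free space, so membership in the carrier can be read off
  from the support.\<close>

lemma sym_carrier_iff:
  fixes V :: "('k::field, 'a::ab_group_add, 'z) gvs_scheme"
  shows "t \<in> sym_carrier V \<longleftrightarrow> (\<forall>xs\<in>Poly_Mapping.keys t. hom_word V xs)"
proof
  let ?K = "{t :: 'a list \<Rightarrow>\<^sub>0 'k. \<forall>xs\<in>Poly_Mapping.keys t. hom_word V xs}"
  have "free.subspace ?K"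
  proof (rule free.subspaceI)
    fix t u :: "'a list \<Rightarrow>\<^sub>0 'k" and c assume t: "t \<in> ?K" "u \<in> ?K"
    show "t + u \<in> ?K" using t keys_add[of t u] by auto
  next
    fix t :: "'a list \<Rightarrow>\<^sub>0 'k" and c assume t: "t \<in> ?K"
    then show "fscale c t \<in> ?K" by (auto simp: in_keys_iff)
  qed simp
  then have "sym_carrier V \<subseteq> ?K"
    unfolding sym_carrier_def by (rule free.span_minimal[rotated]) auto
  then show "\<forall>xs\<in>Poly_Mapping.keys t. hom_word V xs" if "t \<in> sym_carrier V"
    using that by blast
next
  assume *: "\<forall>xs\<in>Poly_Mapping.keys t. hom_word V xs"
  have "lin_ext fscale gen t \<in> sym_carrier V"
    unfolding lin_ext_def sym_carrier_def
    by (intro free.span_sum free.span_scale free.span_base) (use * in auto)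
  then show "t \<in> sym_carrier V" by (simp add: lin_ext_gen_self)
qed

lemma subspace_sym_carrier: "free.subspace (sym_carrier V)"
  by (simp add: sym_carrier_def)

lemma gen_in_sym_carrier [simp]: "gen xs \<in> sym_carrier V \<longleftrightarrow> hom_word V xs"
  by (simp add: sym_carrier_iff)

lemma lin_ext_in_subspace:
  assumes "vector_space s" "module.subspace s U" "\<And>w. w \<in> Poly_Mapping.keys t \<Longrightarrow> g w \<in> U"
  shows "lin_ext s g t \<in> U"
proof -
  interpret vector_space s by fact
  show ?thesis unfolding lin_ext_def by (intro subspace_sum subspace_scale assms)
qed

subsection \<open>Graded vector spaces\<close>

locale graded_space =
  fixes V :: "('k::field, 'a::ab_group_add, 'z) gvs_scheme"
  assumes graded: "graded_vector_space V"
begin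

sublocale vs: vector_space "scl V"
  using graded by (simp add: graded_vector_space_def)

lemma subspace_grd: "vs.subspace (grd V n)"
  using graded by (simp add: graded_vector_space_def)

lemmas grd_0 [simp] = vs.subspace_0[OF subspace_grd]
  and grd_add = vs.subspace_add[OF subspace_grd]
  and grd_scale = vs.subspace_scale[OF subspace_grd]
  and grd_minus = vs.subspace_neg[OF subspace_grd]
  and grd_diff = vs.subspace_diff[OF subspace_grd]
  and grd_sum = vs.subspace_sum[OF subspace_grd]

lemma grd_sg: "x \<in> grd V n \<Longrightarrow> sg k x \<in> grd V n"
  by (simp add: sg_def grd_minus)

lemma homogeneousI: "x \<in> grd V n \<Longrightarrow> x \<in> homogeneous V"
  by (auto simp: homogeneous_def)

lemma zero_homogeneous [simp]: "0 \<in> homogeneous V"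
  by (rule homogeneousI[OF grd_0[of 0]])

lemma in_grd_deg: "x \<in> homogeneous V \<Longrightarrow> x \<in> grd V (deg V x)"
  unfolding homogeneous_def deg_def by (auto intro: someI)

lemma is_decomp_unique: "is_decomp V x c \<Longrightarrow> is_decomp V x c' \<Longrightarrow> c = c'"
  using graded by (auto simp: graded_vector_space_def)

lemma is_decomp_homogeneous:
  assumes "x \<in> grd V n"
  shows "is_decomp V x (\<lambda>k. if k = n then x else 0)"
proof -
  have "{k. (if k = n then x else 0) \<noteq> 0} = (if x = 0 then {} else {n})" by auto
  then show ?thesis using assms by (simp add: is_decomp_def)
qed

lemma grd_unique: "x \<in> grd V m \<Longrightarrow> x \<in> grd V n \<Longrightarrow> x \<noteq> 0 \<Longrightarrow> m = n"
  using is_decomp_unique[OF is_decomp_homogeneous is_decomp_homogeneous, of x m n]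
  by (auto dest: fun_cong[of _ _ m] split: if_splits)

lemma deg_eq: "x \<in> grd V n \<Longrightarrow> x \<noteq> 0 \<Longrightarrow> deg V x = n"
  by (rule grd_unique[OF in_grd_deg]) (auto intro: homogeneousI)

lemma hcomp_decomp: "is_decomp V x (hcomp V x)"
  unfolding hcomp_def by (rule theI'[of "is_decomp V x"]) (use graded in \<open>simp add: graded_vector_space_def\<close>)

lemma hcomp_eq: "is_decomp V x c \<Longrightarrow> hcomp V x = c"
  by (rule is_decomp_unique[OF hcomp_decomp])

lemma hcomp_homogeneous: "x \<in> grd V n \<Longrightarrow> hcomp V x = (\<lambda>k. if k = n then x else 0)"
  by (rule hcomp_eq[OF is_decomp_homogeneous])

lemma hcomp_in_grd: "hcomp V x n \<in> grd V n"
  using hcomp_decomp by (simp add: is_decomp_def)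

lemma finite_hcomp: "finite {n. hcomp V x n \<noteq> 0}"
  using hcomp_decomp by (simp add: is_decomp_def)

lemma sum_hcomp: "finite S \<Longrightarrow> {n. hcomp V x n \<noteq> 0} \<subseteq> S \<Longrightarrow> (\<Sum>n\<in>S. hcomp V x n) = x"
proof -
  assume "finite S" "{n. hcomp V x n \<noteq> 0} \<subseteq> S"
  then have "(\<Sum>n\<in>S. hcomp V x n) = (\<Sum>n | hcomp V x n \<noteq> 0. hcomp V x n)"
    by (intro sum.mono_neutral_right) auto
  then show ?thesis using hcomp_decomp[of x] by (simp add: is_decomp_def)
qed

lemma hcomp_lincomb:
  "hcomp V (scl V a x + scl V b y) = (\<lambda>n. scl V a (hcomp V x n) + scl V b (hcomp V y n))"
proof (rule hcomp_eq)
  let ?c = "\<lambda>n. scl V a (hcomp V x n) + scl V b (hcomp V y n)"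
  let ?S = "{n. hcomp V x n \<noteq> 0} \<union> {n. hcomp V y n \<noteq> 0}"
  have fin: "finite ?S" by (simp add: finite_hcomp)
  have sub: "{n. ?c n \<noteq> 0} \<subseteq> ?S" by auto
  have "(\<Sum>n | ?c n \<noteq> 0. ?c n) = (\<Sum>n\<in>?S. ?c n)"
    by (rule sum.mono_neutral_left[OF fin sub]) auto
  also have "\<dots> = scl V a (\<Sum>n\<in>?S. hcomp V x n) + scl V b (\<Sum>n\<in>?S. hcomp V y n)"
    by (simp only: sum.distrib vs.scale_sum_right)
  also have "\<dots> = scl V a x + scl V b y"
    by (subst (1 2) sum_hcomp[OF fin]) auto
  finally show "is_decomp V (scl V a x + scl V b y) ?c"
    by (simp add: is_decomp_def finite_subset[OF sub fin] grd_add grd_scale hcomp_in_grd)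
qed

text \<open>The letters of words are homogeneous, but \<open>corestr\<close> takes values in all of
  the space. This turns a map that is linear on each homogeneous part into a linear map, as needed
  to express the class of a one-letter word through \<open>corestr\<close>.\<close>

definition extend :: "('a \<Rightarrow> 'v::ab_group_add) \<Rightarrow> 'a \<Rightarrow> 'v" where
  "extend f x = (\<Sum>n | hcomp V x n \<noteq> 0. f (hcomp V x n))"

lemma
  assumes s: "vector_space s"
    and f: "\<And>n x y a b. x \<in> grd V n \<Longrightarrow> y \<in> grd V n \<Longrightarrow> f (scl V a x + scl V b y) = s a (f x) + s b (f y)"
  shows linear_extend: "Vector_Spaces.linear (scl V) s (extend f)"
    and extend_homogeneous: "x \<in> homogeneous V \<Longrightarrow> extend f x = f x"
proof -
  interpret s: vector_space s by fact
  have f0: "f 0 = 0" using f[of 0 0 0 0 0] by simp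
  have eq: "extend f x = (\<Sum>n\<in>S. f (hcomp V x n))" if "finite S" "{n. hcomp V x n \<noteq> 0} \<subseteq> S" for x S
    unfolding extend_def by (rule sum.mono_neutral_left) (use that f0 in auto)
  have lc: "extend f (scl V a x + scl V b y) = s a (extend f x) + s b (extend f y)" for a b x y
  proof -
    let ?S = "{n. hcomp V x n \<noteq> 0} \<union> {n. hcomp V y n \<noteq> 0}"
    have fin: "finite ?S" by (simp add: finite_hcomp)
    have "extend f (scl V a x + scl V b y) = (\<Sum>n\<in>?S. s a (f (hcomp V x n)) + s b (f (hcomp V y n)))"
      by (subst eq[OF fin]) (auto simp: hcomp_lincomb f[OF hcomp_in_grd hcomp_in_grd])
    also have "\<dots> = s a (\<Sum>n\<in>?S. f (hcomp V x n)) + s b (\<Sum>n\<in>?S. f (hcomp V y n))"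
      by (simp only: sum.distrib s.scale_sum_right)
    also have "\<dots> = s a (extend f x) + s b (extend f y)"
      by (subst (1 2) eq[OF fin]) auto
    finally show ?thesis .
  qed
  show "Vector_Spaces.linear (scl V) s (extend f)"
    using lc[of 1 _ 1] lc[of _ _ 0] by (intro vs_linearI) (simp_all add: s.vector_space_axioms vs.vector_space_axioms)
  show "extend f x = f x" if "x \<in> homogeneous V"
  proof -
    obtain n where "x \<in> grd V n" using \<open>x \<in> homogeneous V\<close> by (auto simp: homogeneous_def)
    then show ?thesis by (subst eq[of "{n}"]) (auto simp: hcomp_homogeneous split: if_splits)
  qed
qed

abbreviation graded_word :: "'a list \<Rightarrow> int list \<Rightarrow> bool" where
  "graded_word xs ns \<equiv> list_all2 (\<lambda>x n. x \<in> grd V n) xs ns"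

lemma graded_word_hom_word: "graded_word xs ns \<Longrightarrow> hom_word V xs"
  by (induction xs ns rule: list_all2_induct) (auto intro: homogeneousI)

lemma hom_word_graded_word: "hom_word V xs \<Longrightarrow> graded_word xs (map (deg V) xs)"
  by (induction xs) (auto intro: in_grd_deg)

lemma wdeg_eq: "graded_word xs ns \<Longrightarrow> 0 \<notin> set xs \<Longrightarrow> wdeg V xs = sum_list ns"
  by (induction xs ns rule: list_all2_induct) (auto simp: deg_eq)

end

subsection \<open>Graded symmetric multilinear functions\<close>

text \<open>These are the functions on words whose linear extension kills \<open>sym_rel\<close>,
  see \<open>lin_ext_sym_rel\<close> and the converse \<open>gsmI_sym_rel\<close>. The scalar
  multiplication is an argument because the targets vary: \<open>V\<close> itself, free spaces, and
  quotients realised inside free spaces.\<close>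

definition gsm :: "('k::field, 'a::ab_group_add, 'z) gvs_scheme \<Rightarrow> ('k \<Rightarrow> 'v \<Rightarrow> 'v::ab_group_add)
    \<Rightarrow> ('a list \<Rightarrow> 'v) \<Rightarrow> bool" where
  "gsm V s \<Psi> \<longleftrightarrow> vector_space s \<and>
     (\<forall>us vs x y a b n. hom_word V us \<longrightarrow> hom_word V vs \<longrightarrow> x \<in> grd V n \<longrightarrow> y \<in> grd V n \<longrightarrow>
        \<Psi> (us @ (scl V a x + scl V b y) # vs) = s a (\<Psi> (us @ x # vs)) + s b (\<Psi> (us @ y # vs))) \<and>
     (\<forall>us vs x y m n. hom_word V us \<longrightarrow> hom_word V vs \<longrightarrow> x \<in> grd V m \<longrightarrow> y \<in> grd V n \<longrightarrow>
        \<Psi> (us @ x # y # vs) = sg (m * n) (\<Psi> (us @ y # x # vs)))"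

text \<open>By \<open>lin_ext_tensor_rel\<close> such functions descend to the tensor square of the
  symmetric coalgebra, hence they may be evaluated on coproducts.\<close>

definition bigsm :: "('k::field, 'a::ab_group_add, 'z) gvs_scheme \<Rightarrow> ('k \<Rightarrow> 'v \<Rightarrow> 'v::ab_group_add)
    \<Rightarrow> ('a list \<Rightarrow> 'a list \<Rightarrow> 'v) \<Rightarrow> bool" where
  "bigsm V s G \<longleftrightarrow> (\<forall>u. hom_word V u \<longrightarrow> gsm V s (G u)) \<and> (\<forall>w. hom_word V w \<longrightarrow> gsm V s (\<lambda>u. G u w))"

definition gsm_deg :: "('k::field, 'a::ab_group_add, 'y) gvs_scheme \<Rightarrow> ('k, 'b::ab_group_add, 'z) gvs_scheme
    \<Rightarrow> int \<Rightarrow> ('a list \<Rightarrow> 'b) \<Rightarrow> bool" where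
  "gsm_deg V W k \<phi> \<longleftrightarrow> gsm V (scl W) \<phi> \<and> (\<forall>xs. hom_word V xs \<longrightarrow> \<phi> xs \<in> grd W (wdeg V xs + k))"

lemma gsm_vs: "gsm V s \<Psi> \<Longrightarrow> vector_space s"
  by (simp add: gsm_def)

lemma gsm_lincomb:
  "gsm V s \<Psi> \<Longrightarrow> hom_word V us \<Longrightarrow> hom_word V vs \<Longrightarrow> x \<in> grd V n \<Longrightarrow> y \<in> grd V n \<Longrightarrow>
    \<Psi> (us @ (scl V a x + scl V b y) # vs) = s a (\<Psi> (us @ x # vs)) + s b (\<Psi> (us @ y # vs))"
  unfolding gsm_def by blast

lemma gsm_swap:
  "gsm V s \<Psi> \<Longrightarrow> hom_word V us \<Longrightarrow> hom_word V vs \<Longrightarrow> x \<in> grd V m \<Longrightarrow> y \<in> grd V n \<Longrightarrow>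
    \<Psi> (us @ x # y # vs) = sg (m * n) (\<Psi> (us @ y # x # vs))"
  unfolding gsm_def by blast

lemma bigsm_left: "bigsm V s G \<Longrightarrow> hom_word V w \<Longrightarrow> gsm V s (\<lambda>u. G u w)"
  and bigsm_right: "bigsm V s G \<Longrightarrow> hom_word V u \<Longrightarrow> gsm V s (G u)"
  by (simp_all add: bigsm_def)

lemma bigsmI:
  "(\<And>u. hom_word V u \<Longrightarrow> gsm V s (G u)) \<Longrightarrow> (\<And>w. hom_word V w \<Longrightarrow> gsm V s (\<lambda>u. G u w)) \<Longrightarrow> bigsm V s G"
  by (simp add: bigsm_def)

lemma gsm_deg_gsm: "gsm_deg V W k \<phi> \<Longrightarrow> gsm V (scl W) \<phi>"
  and gsm_deg_in_grd: "gsm_deg V W k \<phi> \<Longrightarrow> hom_word V xs \<Longrightarrow> \<phi> xs \<in> grd W (wdeg V xs + k)"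
  by (simp_all add: gsm_deg_def)

lemma gsm_rawI:
  assumes "vector_space s"
    and "\<And>us vs x y a b n. hom_word V us \<Longrightarrow> hom_word V vs \<Longrightarrow> x \<in> grd V n \<Longrightarrow> y \<in> grd V n \<Longrightarrow>
      \<Psi> (us @ (scl V a x + scl V b y) # vs) = s a (\<Psi> (us @ x # vs)) + s b (\<Psi> (us @ y # vs))"
    and "\<And>us vs x y m n. hom_word V us \<Longrightarrow> hom_word V vs \<Longrightarrow> x \<in> grd V m \<Longrightarrow> y \<in> grd V n \<Longrightarrow>
      \<Psi> (us @ x # y # vs) = sg (m * n) (\<Psi> (us @ y # x # vs))"
  shows "gsm V s \<Psi>"
  using assms unfolding gsm_def by blast

context graded_space
begin

lemma gsm_add:
  assumes "gsm V s \<Psi>" "hom_word V us" "hom_word V vs" "x \<in> grd V n" "y \<in> grd V n"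
  shows "\<Psi> (us @ (x + y) # vs) = \<Psi> (us @ x # vs) + \<Psi> (us @ y # vs)"
proof -
  interpret s: vector_space s using gsm_vs[OF assms(1)] .
  show ?thesis using gsm_lincomb[OF assms, of 1 1] by simp
qed

lemma gsm_scale:
  assumes "gsm V s \<Psi>" "hom_word V us" "hom_word V vs" "x \<in> homogeneous V"
  shows "\<Psi> (us @ scl V a x # vs) = s a (\<Psi> (us @ x # vs))"
proof -
  interpret s: vector_space s using gsm_vs[OF assms(1)] .
  show ?thesis using gsm_lincomb[OF assms(1-3) in_grd_deg[OF assms(4)] in_grd_deg[OF assms(4)], of a 0] by simp
qed

lemma gsm_0:
  assumes "gsm V s \<Psi>" "hom_word V us" "hom_word V vs"
  shows "\<Psi> (us @ 0 # vs) = 0"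
proof -
  interpret s: vector_space s using gsm_vs[OF assms(1)] .
  show ?thesis using gsm_scale[OF assms, of 0 0] by simp
qed

lemma gsm_Cons_0: "gsm V s \<Psi> \<Longrightarrow> hom_word V vs \<Longrightarrow> \<Psi> (0 # vs) = 0"
  using gsm_0[of s \<Psi> "[]" vs] by simp

lemma gsm_mem_0:
  assumes "gsm V s \<Psi>" "hom_word V xs" "0 \<in> set xs"
  shows "\<Psi> xs = 0"
proof -
  obtain us vs where "xs = us @ 0 # vs" using assms(3) by (auto simp: in_set_conv_decomp)
  then show ?thesis using gsm_0[of s \<Psi> us vs] assms by auto
qed

lemma gsm_sg:
  assumes "gsm V s \<Psi>" "hom_word V us" "hom_word V vs" "x \<in> homogeneous V"
  shows "\<Psi> (us @ sg n x # vs) = sg n (\<Psi> (us @ x # vs))"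
proof -
  interpret s: vector_space s using gsm_vs[OF assms(1)] .
  show ?thesis using gsm_scale[OF assms, of "-1"] by (simp add: sg_def)
qed

lemma gsm_Cons_swap:
  "gsm V s \<Psi> \<Longrightarrow> hom_word V vs \<Longrightarrow> x \<in> grd V m \<Longrightarrow> y \<in> grd V n \<Longrightarrow>
    \<Psi> (x # y # vs) = sg (m * n) (\<Psi> (y # x # vs))"
  using gsm_swap[of V s \<Psi> "[]" vs x m y n] by simp

text \<open>The introduction rule for functions whose values involve signs in \<open>deg\<close>.
  Zero letters, zero scalars and cancelling sums are handled once and for all, so that in the
  remaining premises every letter is nonzero and has the expected degree.\<close>

lemma gsmI:
  assumes s: "vector_space s"
    and zero: "\<And>us vs. hom_word V us \<Longrightarrow> hom_word V vs \<Longrightarrow> \<Psi> (us @ 0 # vs) = 0"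
    and scale: "\<And>us vs x a. hom_word V us \<Longrightarrow> hom_word V vs \<Longrightarrow> x \<in> homogeneous V \<Longrightarrow> x \<noteq> 0 \<Longrightarrow> a \<noteq> 0 \<Longrightarrow>
      scl V a x \<noteq> 0 \<Longrightarrow> scl V a x \<in> homogeneous V \<Longrightarrow> deg V (scl V a x) = deg V x \<Longrightarrow>
      \<Psi> (us @ scl V a x # vs) = s a (\<Psi> (us @ x # vs))"
    and add: "\<And>us vs x y. hom_word V us \<Longrightarrow> hom_word V vs \<Longrightarrow> x \<in> homogeneous V \<Longrightarrow> y \<in> homogeneous V \<Longrightarrow>
      x + y \<in> homogeneous V \<Longrightarrow> x \<noteq> 0 \<Longrightarrow> y \<noteq> 0 \<Longrightarrow> x + y \<noteq> 0 \<Longrightarrow> deg V y = deg V x \<Longrightarrow> deg V (x + y) = deg V x \<Longrightarrow>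
      \<Psi> (us @ (x + y) # vs) = \<Psi> (us @ x # vs) + \<Psi> (us @ y # vs)"
    and swap: "\<And>us vs x y. hom_word V us \<Longrightarrow> hom_word V vs \<Longrightarrow> x \<in> homogeneous V \<Longrightarrow> y \<in> homogeneous V \<Longrightarrow>
      x \<noteq> 0 \<Longrightarrow> y \<noteq> 0 \<Longrightarrow> \<Psi> (us @ x # y # vs) = sg (deg V x * deg V y) (\<Psi> (us @ y # x # vs))"
  shows "gsm V s \<Psi>"
  unfolding gsm_def
proof (intro conjI allI impI s)
  interpret s: vector_space s by fact
  fix us vs x y and a b :: 'k and n
  assume us: "hom_word V us" "hom_word V vs" and xy: "x \<in> grd V n" "y \<in> grd V n"
  have scale': "\<Psi> (us @ scl V a x # vs) = s a (\<Psi> (us @ x # vs))" if "x \<in> grd V n" for a x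
  proof (cases "x = 0 \<or> a = 0")
    case True
    then show ?thesis using zero us by auto
  next
    case False
    then show ?thesis
      using scale[OF us, of x a] that grd_scale[OF that, of a] deg_eq[of x n] deg_eq[of "scl V a x" n]
      by (auto intro: homogeneousI)
  qed
  have add': "\<Psi> (us @ (x + y) # vs) = \<Psi> (us @ x # vs) + \<Psi> (us @ y # vs)"
    if "x \<in> grd V n" "y \<in> grd V n" for x y
  proof -
    consider "x = 0" | "y = 0" | "x + y = 0" | "x \<noteq> 0" "y \<noteq> 0" "x + y \<noteq> 0" by blast
    then show ?thesis
    proof cases
      case 3
      \<comment> \<open>Two cancelling letters: the sum 0 has no degree of its own, so the premise
        \<open>add\<close> does not apply, and scaling by -1 replaces it.\<close>
      then have "y = scl V (-1) x" by (simp add: eq_neg_iff_add_eq_0 add.commute)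
      then show ?thesis using scale'[OF that(1), of "-1"] zero us 3 by simp
    next
      case 4
      then show ?thesis
        using add[OF us, of x y] that grd_add[OF that] deg_eq[of x n] deg_eq[of y n] deg_eq[of "x + y" n]
        by (auto intro: homogeneousI)
    qed (use zero us in auto)
  qed
  show "\<Psi> (us @ (scl V a x + scl V b y) # vs) = s a (\<Psi> (us @ x # vs)) + s b (\<Psi> (us @ y # vs))"
    by (simp add: add' scale' grd_scale xy)
next
  fix us vs x y m n
  assume us: "hom_word V us" "hom_word V vs" and xy: "x \<in> grd V m" "y \<in> grd V n"
  show "\<Psi> (us @ x # y # vs) = sg (m * n) (\<Psi> (us @ y # x # vs))"
  proof (cases "x = 0 \<or> y = 0")
    case True
    have hom: "x \<in> homogeneous V" "y \<in> homogeneous V" using xy by (auto intro: homogeneousI)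
    show ?thesis
      using True zero[of us "y # vs"] zero[of "us @ [x]" vs] zero[of us "x # vs"] zero[of "us @ [y]" vs] us hom
      by auto
  next
    case False
    then show ?thesis using swap[OF us, of x y] xy deg_eq[of x m] deg_eq[of y n] by (auto intro: homogeneousI)
  qed
qed

lemma gsm_cong:
  assumes "gsm V s \<Psi>" "\<And>xs. hom_word V xs \<Longrightarrow> \<Psi>' xs = \<Psi> xs"
  shows "gsm V s \<Psi>'"
proof (rule gsmI[OF gsm_vs[OF assms(1)]], goal_cases)
  case (1 us vs)
  then show ?case using gsm_0[OF assms(1)] by (simp add: assms(2))
next
  case (2 us vs x a)
  then show ?case using gsm_scale[OF assms(1)] by (simp add: assms(2))
next
  case (3 us vs x y)
  then show ?case using gsm_add[OF assms(1), of us vs x "deg V x" y] in_grd_deg[of x] in_grd_deg[of y]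
    by (simp add: assms(2))
next
  case (4 us vs x y)
  then show ?case using gsm_swap[OF assms(1), of us vs x _ y, OF _ _ in_grd_deg in_grd_deg] by (simp add: assms(2))
qed

lemma gsm_linear:
  assumes "Vector_Spaces.linear s s' f" "gsm V s \<Psi>"
  shows "gsm V s' (\<lambda>xs. f (\<Psi> xs))"
proof (rule gsm_rawI[OF vs_linear_cod[OF assms(1)]], goal_cases)
  case (1 us vs x y a b n)
  then show ?case
    using gsm_lincomb[OF assms(2) 1] by (simp add: vs_linear_add[OF assms(1)] vs_linear_scale[OF assms(1)])
next
  case (2 us vs x y m n)
  then show ?case using gsm_swap[OF assms(2) 2] by (simp add: vs_linear_sg[OF assms(1)])
qed

lemma gsm_zero_fun: "vector_space s \<Longrightarrow> gsm V s (\<lambda>xs. 0)"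
proof -
  assume s: "vector_space s"
  then interpret s: vector_space s .
  show ?thesis by (simp add: gsm_def s)
qed

lemma gsm_plus: "gsm V s \<Psi> \<Longrightarrow> gsm V s \<Psi>' \<Longrightarrow> gsm V s (\<lambda>xs. \<Psi> xs + \<Psi>' xs)"
proof -
  assume *: "gsm V s \<Psi>" "gsm V s \<Psi>'"
  interpret s: vector_space s using gsm_vs[OF *(1)] .
  show ?thesis
  proof (rule gsm_rawI[OF s.vector_space_axioms], goal_cases)
    case (1 us vs x y a b n)
    then show ?case using gsm_lincomb[OF *(1) 1] gsm_lincomb[OF *(2) 1] by (simp add: s.scale_right_distrib sg_add)
  next
    case (2 us vs x y m n)
    then show ?case using gsm_swap[OF *(1) 2] gsm_swap[OF *(2) 2] by (simp add: s.scale_right_distrib sg_add)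
  qed
qed

lemma gsm_minus: "gsm V s \<Psi> \<Longrightarrow> gsm V s \<Psi>' \<Longrightarrow> gsm V s (\<lambda>xs. \<Psi> xs - \<Psi>' xs)"
proof -
  assume *: "gsm V s \<Psi>" "gsm V s \<Psi>'"
  interpret s: vector_space s using gsm_vs[OF *(1)] .
  show ?thesis
  proof (rule gsm_rawI[OF s.vector_space_axioms], goal_cases)
    case (1 us vs x y a b n)
    then show ?case using gsm_lincomb[OF *(1) 1] gsm_lincomb[OF *(2) 1] by (simp add: s.scale_right_diff_distrib sg_diff)
  next
    case (2 us vs x y m n)
    then show ?case using gsm_swap[OF *(1) 2] gsm_swap[OF *(2) 2] by (simp add: s.scale_right_diff_distrib sg_diff)
  qed
qed

lemma gsm_uminus: "gsm V s \<Psi> \<Longrightarrow> gsm V s (\<lambda>xs. - \<Psi> xs)"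
  using gsm_minus[OF gsm_zero_fun[OF gsm_vs], of V s \<Psi> \<Psi>] by simp

text \<open>Both kinds of relations preserve the length of words, so factors depending on the length
  are compatible with them.\<close>

lemma gsm_length_scale:
  assumes "gsm V s \<Psi>"
  shows "gsm V s (\<lambda>xs. s (c (length xs)) (\<Psi> xs))"
proof -
  interpret s: vector_space s using gsm_vs[OF assms] .
  show ?thesis
  proof (rule gsm_rawI[OF s.vector_space_axioms], goal_cases)
    case (1 us vs x y a b n)
    then show ?case using gsm_lincomb[OF assms 1] by (simp add: s.scale_right_distrib mult.commute)
  next
    case (2 us vs x y m n)
    then show ?case using gsm_swap[OF assms 2] by (simp add: vs_linear_sg[OF s.linear_scale_self])
  qed
qed

lemma gsm_length_if:
  assumes "gsm V s \<Psi>"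
  shows "gsm V s (\<lambda>xs. if P (length xs) then \<Psi> xs else 0)"
proof -
  interpret s: vector_space s using gsm_vs[OF assms] .
  show ?thesis using gsm_length_scale[OF assms, of "\<lambda>n. if P n then 1 else 0"]
    by (rule gsm_cong) simp
qed

lemma gsm_wdeg_sg:
  assumes "gsm V s \<Psi>"
  shows "gsm V s (\<lambda>xs. sg (k * wdeg V xs) (\<Psi> xs))"
proof (rule gsmI[OF gsm_vs[OF assms]], goal_cases)
  case (1 us vs)
  then show ?case using gsm_0[OF assms] by simp
next
  case (2 us vs x a)
  interpret s: vector_space s using gsm_vs[OF assms] .
  show ?case using 2 by (simp add: gsm_scale[OF assms] vs_linear_sg[OF s.linear_scale_self])
next
  case (3 us vs x y)
  then show ?case using gsm_add[OF assms, of us vs x "deg V x" y] in_grd_deg[of x] in_grd_deg[of y]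
    by (simp add: sg_add)
next
  case (4 us vs x y)
  then show ?case using gsm_swap[OF assms, of us vs x _ y, OF _ _ in_grd_deg in_grd_deg] by (simp add: ac_simps)
qed

lemma gsm_prepend: "gsm V s \<Psi> \<Longrightarrow> hom_word V ws \<Longrightarrow> gsm V s (\<lambda>xs. \<Psi> (ws @ xs))"
proof -
  assume *: "gsm V s \<Psi>" "hom_word V ws"
  show ?thesis unfolding gsm_def
  proof (intro conjI allI impI gsm_vs[OF *(1)], goal_cases)
    case (1 us vs x y a b n)
    then show ?case using gsm_lincomb[OF *(1), of "ws @ us" vs x n y] *(2) by simp
  next
    case (2 us vs x y m n)
    then show ?case using gsm_swap[OF *(1), of "ws @ us" vs x m y n] *(2) by simp
  qed
qed

lemma gsm_Cons: "gsm V s \<Psi> \<Longrightarrow> x \<in> homogeneous V \<Longrightarrow> gsm V s (\<lambda>xs. \<Psi> (x # xs))"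
  using gsm_prepend[of s \<Psi> "[x]"] by simp

lemma gsm_append: "gsm V s \<Psi> \<Longrightarrow> hom_word V ws \<Longrightarrow> gsm V s (\<lambda>xs. \<Psi> (xs @ ws))"
proof -
  assume *: "gsm V s \<Psi>" "hom_word V ws"
  show ?thesis unfolding gsm_def
  proof (intro conjI allI impI gsm_vs[OF *(1)], goal_cases)
    case (1 us vs x y a b n)
    then show ?case using gsm_lincomb[OF *(1), of us "vs @ ws" x n y] *(2) by simp
  next
    case (2 us vs x y m n)
    then show ?case using gsm_swap[OF *(1), of us "vs @ ws" x m y n] *(2) by simp
  qed
qed

text \<open>The degrees are given as a list \<open>ns\<close> instead of being taken from
  \<open>deg\<close>, because the letters passed over may be images such as \<open>e x\<close>,
  which can be 0 and then have an arbitrary \<open>deg\<close>.\<close>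

lemma gsm_move:
  assumes "gsm V s \<Psi>" "graded_word us ns" "x \<in> grd V m" "hom_word V vs"
  shows "\<Psi> (us @ x # vs) = sg (m * sum_list ns) (\<Psi> (x # us @ vs))"
  using assms(2,1)
proof (induction us ns arbitrary: \<Psi> rule: list_all2_induct)
  case (Cons u us n ns)
  have hom: "u \<in> homogeneous V" "hom_word V us"
    using Cons.hyps homogeneousI graded_word_hom_word by blast+
  have "\<Psi> (u # us @ x # vs) = sg (m * sum_list ns) (\<Psi> (u # x # us @ vs))"
    using Cons.IH[OF gsm_Cons[OF Cons.prems hom(1)]] .
  also have "\<Psi> (u # x # us @ vs) = sg (n * m) (\<Psi> (x # u # us @ vs))"
    by (rule gsm_Cons_swap[OF Cons.prems]) (use hom assms Cons.hyps in auto)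
  finally show ?case by (simp add: algebra_simps)
qed simp

lemma gsm_move_wdeg:
  assumes "gsm V s \<Psi>" "hom_word V us" "x \<in> grd V m" "hom_word V vs"
  shows "\<Psi> (us @ x # vs) = sg (m * wdeg V us) (\<Psi> (x # us @ vs))"
  using gsm_move[OF assms(1) hom_word_graded_word[OF assms(2)] assms(3,4)] by (simp add: wdeg_def)

lemma bigsm_Cons_left:
  assumes "bigsm V s G" "x \<in> homogeneous V"
  shows "bigsm V s (\<lambda>u w. G (x # u) w)"
proof (rule bigsmI)
  fix u assume "hom_word V u"
  then show "gsm V s (\<lambda>w. G (x # u) w)" using bigsm_right[OF assms(1), of "x # u"] assms(2) by simp
next
  fix w assume "hom_word V w"
  from gsm_Cons[OF bigsm_left[OF assms(1) this] assms(2)] show "gsm V s (\<lambda>u. G (x # u) w)" .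
qed

lemma bigsm_Cons_right: "bigsm V s G \<Longrightarrow> x \<in> homogeneous V \<Longrightarrow> bigsm V s (\<lambda>u w. sg (k * wdeg V u) (G u (x # w)))"
proof (rule bigsmI)
  fix u assume G: "bigsm V s G" "x \<in> homogeneous V" and u: "hom_word V u"
  have "gsm V s (\<lambda>w. G u (x # w))" by (rule gsm_Cons[OF bigsm_right[OF G(1) u] G(2)])
  then show "gsm V s (\<lambda>w. sg (k * wdeg V u) (G u (x # w)))"
    using gsm_uminus[of s "\<lambda>w. G u (x # w)"] by (cases "even (k * wdeg V u)") (simp_all add: sg_def)
next
  fix w assume G: "bigsm V s G" "x \<in> homogeneous V" and w: "hom_word V w"
  then have "gsm V s (\<lambda>u. G u (x # w))" by (intro bigsm_left) auto
  then show "gsm V s (\<lambda>u. sg (k * wdeg V u) (G u (x # w)))" by (rule gsm_wdeg_sg)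
qed

text \<open>The coproduct respects multilinearity and graded commutativity.\<close>

lemma gsm_unsh:
  assumes s: "vector_space s" and "bigsm V s G"
  shows "gsm V s (\<lambda>xs. unsh V xs G)"
proof (rule gsmI[OF s], goal_cases)
  case (1 us vs)
  then show ?case using assms(2)
  proof (induction us arbitrary: G)
    case Nil
    have "G (0 # u) w = 0" "G u (0 # w) = 0" if "hom_word V u" "hom_word V w" for u w
      using gsm_Cons_0[OF bigsm_left[OF Nil.prems(3) that(2)] that(1)]
        gsm_Cons_0[OF bigsm_right[OF Nil.prems(3) that(1)] that(2)] by auto
    then have "unsh V vs (\<lambda>u w. G (0 # u) w) = 0" "unsh V vs (\<lambda>u w. sg (deg V 0 * wdeg V u) (G u (0 # w))) = 0"
      using Nil.prems(2) by (auto intro!: unsh_eq_0)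
    then show ?case by simp
  next
    case (Cons z us)
    then show ?case using bigsm_Cons_left[OF Cons.prems(3), of z] bigsm_Cons_right[OF Cons.prems(3), of z] by simp
  qed
next
  case (2 us vs x a)
  then show ?case using assms(2)
  proof (induction us arbitrary: G)
    case Nil
    interpret s: vector_space s by fact
    have lin: "Vector_Spaces.linear s s (s a)" by (rule s.linear_scale_self)
    have 1: "G (scl V a x # u) w = s a (G (x # u) w)" if "hom_word V u" "hom_word V w" for u w
      using gsm_scale[OF bigsm_left[OF Nil.prems(9) that(2)], of "[]" u x a] Nil.prems that by simp
    have 2: "G u (scl V a x # w) = s a (G u (x # w))" if "hom_word V u" "hom_word V w" for u w
      using gsm_scale[OF bigsm_right[OF Nil.prems(9) that(1)], of "[]" w x a] Nil.prems that by simp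
    have "unsh V vs (\<lambda>u w. G (scl V a x # u) w) = s a (unsh V vs (\<lambda>u w. G (x # u) w))"
      unfolding vs_linear_unsh[OF lin] by (rule unsh_cong, rule 1) (use Nil.prems in auto)
    moreover have "unsh V vs (\<lambda>u w. sg (deg V x * wdeg V u) (G u (scl V a x # w)))
        = s a (unsh V vs (\<lambda>u w. sg (deg V x * wdeg V u) (G u (x # w))))"
      unfolding vs_linear_unsh[OF lin] vs_linear_sg[OF lin]
      by (rule unsh_cong, subst 2) (use Nil.prems in auto)
    ultimately show ?case using Nil.prems by (simp add: s.scale_right_distrib)
  next
    case (Cons z us)
    interpret s: vector_space s by fact
    show ?case using Cons.IH[OF _ _ _ _ _ _ _ _ bigsm_Cons_left[OF Cons.prems(9), of z]]
      Cons.IH[OF _ _ _ _ _ _ _ _ bigsm_Cons_right[OF Cons.prems(9), of z]] Cons.prems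
      by (simp add: s.scale_right_distrib)
  qed
next
  case (3 us vs x y)
  then show ?case using assms(2)
  proof (induction us arbitrary: G)
    case Nil
    have x: "x \<in> grd V (deg V x)" "y \<in> grd V (deg V x)"
      using in_grd_deg[of x] in_grd_deg[of y] Nil.prems by auto
    have 1: "G ((x + y) # u) w = G (x # u) w + G (y # u) w" if "hom_word V u" "hom_word V w" for u w
      using gsm_add[OF bigsm_left[OF Nil.prems(11) that(2)], of "[]" u x _ y, OF _ _ x] that by simp
    have 2: "G u ((x + y) # w) = G u (x # w) + G u (y # w)" if "hom_word V u" "hom_word V w" for u w
      using gsm_add[OF bigsm_right[OF Nil.prems(11) that(1)], of "[]" w x _ y, OF _ _ x] that by simp
    have "unsh V vs (\<lambda>u w. G ((x + y) # u) w) = unsh V vs (\<lambda>u w. G (x # u) w) + unsh V vs (\<lambda>u w. G (y # u) w)"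
      unfolding unsh_add[symmetric] by (rule unsh_cong, rule 1) (use Nil.prems in auto)
    moreover have "unsh V vs (\<lambda>u w. sg (deg V x * wdeg V u) (G u ((x + y) # w)))
        = unsh V vs (\<lambda>u w. sg (deg V x * wdeg V u) (G u (x # w))) + unsh V vs (\<lambda>u w. sg (deg V x * wdeg V u) (G u (y # w)))"
      unfolding unsh_add[symmetric] sg_add[symmetric]
      by (rule unsh_cong, subst 2) (use Nil.prems in auto)
    ultimately show ?case using Nil.prems by simp
  next
    case (Cons z us)
    show ?case using Cons.IH[OF _ _ _ _ _ _ _ _ _ _ bigsm_Cons_left[OF Cons.prems(11), of z]]
      Cons.IH[OF _ _ _ _ _ _ _ _ _ _ bigsm_Cons_right[OF Cons.prems(11), of z]] Cons.prems
      by simp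
  qed
next
  case (4 us vs x y)
  then show ?case using assms(2)
  proof (induction us arbitrary: G)
    case Nil
    have xy: "x \<in> grd V (deg V x)" "y \<in> grd V (deg V y)"
      using in_grd_deg Nil.prems by auto
    have 1: "unsh V vs (\<lambda>u w. G (x # y # u) w) = sg (deg V x * deg V y) (unsh V vs (\<lambda>u w. G (y # x # u) w))"
      unfolding unsh_sg[symmetric]
      by (rule unsh_cong, rule gsm_Cons_swap[OF bigsm_left[OF Nil.prems(7)]]) (use Nil.prems xy in auto)
    have 2: "unsh V vs (\<lambda>u w. sg (deg V y * wdeg V u) (sg (deg V x * wdeg V u) (G u (x # y # w))))
        = sg (deg V x * deg V y) (unsh V vs (\<lambda>u w. sg (deg V x * wdeg V u) (sg (deg V y * wdeg V u) (G u (y # x # w)))))"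
      unfolding unsh_sg[symmetric]
      by (rule unsh_cong, subst gsm_Cons_swap[OF bigsm_right[OF Nil.prems(7)] _ xy])
        (use Nil.prems xy in \<open>auto simp: ac_simps\<close>)
    \<comment> \<open>When \<open>x\<close> and \<open>y\<close> are sent to different factors, the
      two mixed terms trade places; the sign of the exchange is the extra sign picked up by the
      letter that passes the other one.\<close>
    have 3: "unsh V vs (\<lambda>u w. sg (deg V x * wdeg V (y # u)) (G (y # u) (x # w)))
        = sg (deg V x * deg V y) (unsh V vs (\<lambda>u w. sg (deg V x * wdeg V u) (G (y # u) (x # w))))"
      unfolding unsh_sg[symmetric] by (simp add: distrib_left)
    have 4: "unsh V vs (\<lambda>u w. sg (deg V y * wdeg V u) (G (x # u) (y # w)))
        = sg (deg V x * deg V y) (unsh V vs (\<lambda>u w. sg (deg V y * wdeg V (x # u)) (G (x # u) (y # w))))"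
      unfolding unsh_sg[symmetric] by (rule unsh_cong) (auto simp: sg_def)
    show ?case by (simp only: append_Nil unsh.simps 1 2 3 4 sg_add) (simp only: add.assoc add.commute add.left_commute)
  next
    case (Cons z us)
    show ?case using Cons.IH[OF _ _ _ _ _ _ bigsm_Cons_left[OF Cons.prems(7), of z]]
      Cons.IH[OF _ _ _ _ _ _ bigsm_Cons_right[OF Cons.prems(7), of z]] Cons.prems
      by (simp add: sg_add)
  qed
qed

text \<open>Moving the selected letter back to its old place cancels the Koszul sign of the
  unshuffle, so each of the choices contributes the same value.\<close>

lemma unsh_length_1:
  assumes "gsm V s \<Psi>" "hom_word V xs"
  shows "unsh V xs (\<lambda>u w. if length u = 1 then \<Psi> (u @ w) else 0) = s (of_nat (length xs)) (\<Psi> xs)"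
  using assms
proof (induction xs arbitrary: \<Psi>)
  case Nil
  interpret s: vector_space s using gsm_vs[OF Nil(1)] .
  show ?case by simp
next
  case (Cons x xs)
  interpret s: vector_space s using gsm_vs[OF Cons.prems(1)] .
  have "unsh V xs (\<lambda>u w. if length (x # u) = 1 then \<Psi> ((x # u) @ w) else 0) = \<Psi> (x # xs)"
    by (subst unsh_left_Nil) auto
  moreover have "unsh V xs (\<lambda>u w. sg (deg V x * wdeg V u) (if length u = 1 then \<Psi> (u @ x # w) else 0))
      = unsh V xs (\<lambda>u w. if length u = 1 then \<Psi> (x # u @ w) else 0)"
  proof (rule unsh_cong)
    fix u w assume "set u \<subseteq> set xs" "set w \<subseteq> set xs"
    then have "\<Psi> (u @ x # w) = sg (deg V x * wdeg V u) (\<Psi> (x # u @ w))"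
      using Cons.prems(2) by (intro gsm_move_wdeg[OF Cons.prems(1)] in_grd_deg) auto
    then show "sg (deg V x * wdeg V u) (if length u = 1 then \<Psi> (u @ x # w) else 0)
        = (if length u = 1 then \<Psi> (x # u @ w) else 0)"
      by (simp add: sg_def)
  qed
  moreover have "\<dots> = s (of_nat (length xs)) (\<Psi> (x # xs))"
    by (rule Cons.IH[OF gsm_Cons[OF Cons.prems(1)]]) (use Cons.prems in auto)
  ultimately show ?case by (simp add: s.scale_left_distrib)
qed

subsection \<open>Symmetric coalgebras through multilinear functions\<close>

lemma sym_rel_subsetI:
  assumes "free.subspace U"
    and "\<And>us vs a b x y n. hom_word V us \<Longrightarrow> hom_word V vs \<Longrightarrow> x \<in> grd V n \<Longrightarrow> y \<in> grd V n \<Longrightarrow>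
      gen (us @ (scl V a x + scl V b y) # vs) - fscale a (gen (us @ x # vs)) - fscale b (gen (us @ y # vs)) \<in> U"
    and "\<And>us vs x y m n. hom_word V us \<Longrightarrow> hom_word V vs \<Longrightarrow> x \<in> grd V m \<Longrightarrow> y \<in> grd V n \<Longrightarrow>
      gen (us @ x # y # vs) - fscale ((-1) powi (m * n)) (gen (us @ y # x # vs)) \<in> U"
  shows "sym_rel V \<subseteq> U"
  unfolding sym_rel_def
  by (rule free.span_minimal[OF _ assms(1)]) (use assms(2,3) in blast)

lemma lin_ext_sym_rel:
  assumes \<Psi>: "gsm V s \<Psi>" and t: "t \<in> sym_rel V"
  shows "lin_ext s \<Psi> t = 0"
proof -
  note s = gsm_vs[OF \<Psi>]
  interpret s: vector_space s by fact
  have "module.subspace fscale {t. lin_ext s \<Psi> t = 0}"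
    by (rule free.subspaceI) (simp_all add: lin_ext_0[OF s] lin_ext_add[OF s] lin_ext_scale[OF s])
  note subspace = this
  have "sym_rel V \<subseteq> {t. lin_ext s \<Psi> t = 0}"
  proof (rule sym_rel_subsetI[OF subspace], goal_cases)
    case (1 us vs a b x y n)
    show ?case unfolding mem_Collect_eq using gsm_lincomb[OF \<Psi> 1, of a b]
      by (simp add: lin_ext_diff[OF s] lin_ext_scale[OF s] lin_ext_gen[OF s])
  next
    case (2 us vs x y m n)
    show ?case unfolding mem_Collect_eq using gsm_swap[OF \<Psi> 2]
      by (simp add: lin_ext_diff[OF s] lin_ext_scale[OF s] lin_ext_gen[OF s] scale_powi_minus1[OF s])
  qed
  then show ?thesis using t by blast
qed

lemma lin_ext_sym_eq:
  assumes "gsm V s \<Psi>" "t - t' \<in> sym_rel V"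
  shows "lin_ext s \<Psi> t = lin_ext s \<Psi> t'"
  using lin_ext_sym_rel[OF assms] by (simp add: lin_ext_diff[OF gsm_vs[OF assms(1)]])

text \<open>The universal function of this kind. By \<open>sym_relI\<close> an element on which it
  vanishes is a relation, so identities in the symmetric coalgebra may be tested on multilinear
  functions.\<close>

lemma gsm_sym_class: "gsm V fscale (sym_class V)"
proof -
  note lin = linear_quot[OF subspace_sym_rel[of V]] and ker = quot_eq_0_iff[OF subspace_sym_rel[of V]]
  show ?thesis unfolding gsm_def
  proof (intro conjI allI impI, goal_cases)
    case (2 us vs x y a b n)
    then have "gen (us @ (scl V a x + scl V b y) # vs) - fscale a (gen (us @ x # vs))
        - fscale b (gen (us @ y # vs)) \<in> sym_rel V"
      unfolding sym_rel_def by (intro free.span_base) blast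
    then show ?case
      by (simp add: ker[symmetric] vs_linear_diff[OF lin] vs_linear_scale[OF lin] diff_eq_eq add.commute)
  next
    case (3 us vs x y m n)
    then have "gen (us @ x # y # vs) - fscale ((-1) powi (m * n)) (gen (us @ y # x # vs)) \<in> sym_rel V"
      unfolding sym_rel_def by (intro free.span_base) blast
    then show ?case
      by (simp add: ker[symmetric] vs_linear_diff[OF lin] vs_linear_sg[OF lin] scale_powi_minus1[OF free.vector_space_axioms])
  qed (rule free.vector_space_axioms)
qed

lemma sym_relI: "lin_ext fscale (sym_class V) t = 0 \<Longrightarrow> t \<in> sym_rel V"
  by (simp add: lin_ext_sym_class quot_eq_0_iff[OF subspace_sym_rel])

end

subsection \<open>Coderivations\<close>

text \<open>The value of the structure map stands at the front of the word, so the sign and scalars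
  produced by its arguments leave through the first letter of \<open>\<Psi>\<close> without passing
  anything.\<close>

lemma gsm_head:
  assumes V: "graded_space V" and W: "graded_space W"
    and \<phi>: "gsm_deg V W k \<phi>" and \<Psi>: "gsm W s \<Psi>" and w: "hom_word W w"
  shows "gsm V s (\<lambda>u. \<Psi> (\<phi> u # w))"
proof -
  interpret V: graded_space V by fact
  interpret W: graded_space W by fact
  note g = gsm_deg_gsm[OF \<phi>]
  have hom: "\<phi> xs \<in> homogeneous W" if "hom_word V xs" for xs
    using W.homogeneousI[OF gsm_deg_in_grd[OF \<phi> that]] .
  show ?thesis
  proof (rule V.gsmI[OF gsm_vs[OF \<Psi>]], goal_cases)
    case (1 us vs)
    then show ?case by (simp add: V.gsm_0[OF g] W.gsm_Cons_0[OF \<Psi> w])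
  next
    case (2 us vs x a)
    then have h: "hom_word V (us @ x # vs)" by auto
    show ?case using W.gsm_scale[OF \<Psi> _ w hom[OF h], of "[]" a] 2 by (simp add: V.gsm_scale[OF g])
  next
    case (3 us vs x y)
    then have h: "hom_word V (us @ x # vs)" "hom_word V (us @ y # vs)" by auto
    have "\<phi> (us @ y # vs) \<in> grd W (wdeg V (us @ x # vs) + k)"
      using gsm_deg_in_grd[OF \<phi> h(2)] 3(9) by simp
    then show ?case
      using W.gsm_add[OF \<Psi> _ w gsm_deg_in_grd[OF \<phi> h(1)], of "[]" "\<phi> (us @ y # vs)"]
        V.gsm_add[OF g 3(1,2) V.in_grd_deg[OF 3(3)], of y] V.in_grd_deg[OF 3(4)] 3(9)
      by simp
  next
    case (4 us vs x y)
    then have h: "hom_word V (us @ y # x # vs)" by auto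
    show ?case
      using W.gsm_sg[OF \<Psi> _ w hom[OF h], of "[]" "deg V x * deg V y"]
        gsm_swap[OF g 4(1,2) V.in_grd_deg[OF 4(3)] V.in_grd_deg[OF 4(4)]]
      by simp
  qed
qed

text \<open>The transpose of the coderivation with structure map \<open>\<phi>\<close>: the value of
  \<open>\<Psi>\<close> at the image of \<open>xs\<close>. As for all transposes, in a nested
  application the outer \<open>cod\<close> belongs to the operator that acts first.\<close>

definition cod :: "('k, 'a, 'z) gvs_scheme \<Rightarrow> ('a list \<Rightarrow> 'a) \<Rightarrow> 'a list \<Rightarrow> ('a list \<Rightarrow> 'v::ab_group_add) \<Rightarrow> 'v" where
  "cod V \<phi> xs \<Psi> = unsh V xs (\<lambda>u w. \<Psi> (\<phi> u # w))"

lemma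
  shows cod_add: "cod V \<phi> xs (\<lambda>ys. \<Psi> ys + \<Psi>' ys) = cod V \<phi> xs \<Psi> + cod V \<phi> xs \<Psi>'"
    and cod_diff: "cod V \<phi> xs (\<lambda>ys. \<Psi> ys - \<Psi>' ys) = cod V \<phi> xs \<Psi> - cod V \<phi> xs \<Psi>'"
    and cod_sg: "cod V \<phi> xs (\<lambda>ys. sg n (\<Psi> ys)) = sg n (cod V \<phi> xs \<Psi>)"
    and cod_zero: "cod V \<phi> xs (\<lambda>ys. 0) = 0"
  by (simp_all add: cod_def unsh_add unsh_diff unsh_minus unsh_sg)

lemma cod_linear: "Vector_Spaces.linear s t f \<Longrightarrow> cod V \<phi> xs (\<lambda>ys. f (\<Psi> ys)) = f (cod V \<phi> xs \<Psi>)"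
  by (simp add: cod_def vs_linear_unsh)

lemma cod_lin_ext:
  "vector_space s \<Longrightarrow> cod V \<phi> xs (\<lambda>ys. lin_ext s (G ys) t) = lin_ext s (\<lambda>b. cod V \<phi> xs (\<lambda>ys. G ys b)) t"
  by (simp add: cod_def lin_ext_fun_unsh)

context graded_space
begin

lemma gsm_deg_homogeneous: "gsm_deg V V k \<phi> \<Longrightarrow> hom_word V u \<Longrightarrow> \<phi> u \<in> homogeneous V"
  by (rule homogeneousI[OF gsm_deg_in_grd])

lemma cod_cong:
  assumes "gsm_deg V V k \<phi>" "hom_word V xs"
    and "\<And>u w. hom_word V u \<Longrightarrow> hom_word V w \<Longrightarrow> length u + length w = length xs \<Longrightarrow> \<Psi> (\<phi> u # w) = \<Psi>' (\<phi> u # w)"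
  shows "cod V \<phi> xs \<Psi> = cod V \<phi> xs \<Psi>'"
  unfolding cod_def by (rule unsh_cong) (use assms(2,3) in auto)

lemma cod_cong_hom:
  assumes "gsm_deg V V k \<phi>" "hom_word V xs" "\<And>ys. hom_word V ys \<Longrightarrow> \<Psi> ys = \<Psi>' ys"
  shows "cod V \<phi> xs \<Psi> = cod V \<phi> xs \<Psi>'"
  by (rule cod_cong[OF assms(1,2)]) (use assms(3) gsm_deg_homogeneous[OF assms(1)] in auto)

lemma bigsm_head:
  assumes "gsm_deg V V k \<phi>" "gsm V s \<Psi>"
  shows "bigsm V s (\<lambda>u w. \<Psi> (\<phi> u # w))"
proof (rule bigsmI)
  fix u assume "hom_word V u"
  then show "gsm V s (\<lambda>w. \<Psi> (\<phi> u # w))"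
    by (intro gsm_Cons[OF assms(2)] gsm_deg_homogeneous[OF assms(1)])
next
  fix w assume "hom_word V w"
  then show "gsm V s (\<lambda>u. \<Psi> (\<phi> u # w))"
    by (rule gsm_head[OF graded_space_axioms graded_space_axioms assms])
qed

lemma gsm_cod:
  assumes "gsm_deg V V k \<phi>" "gsm V s \<Psi>"
  shows "gsm V s (\<lambda>xs. cod V \<phi> xs \<Psi>)"
  unfolding cod_def by (rule gsm_unsh[OF gsm_vs[OF assms(2)] bigsm_head[OF assms]])

text \<open>If \<open>\<phi> u\<close> is 0 then its \<open>deg\<close> is arbitrary, but
  \<open>\<Psi>\<close> vanishes on the word; otherwise the two exponents agree.\<close>

lemma gsm_head_wdeg:
  assumes "gsm_deg V V k \<phi>" "gsm V s \<Psi>" "hom_word V u" "hom_word V w"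
  shows "sg (c * deg V (\<phi> u)) (\<Psi> (\<phi> u # w)) = sg (c * (wdeg V u + k)) (\<Psi> (\<phi> u # w))"
proof (cases "\<phi> u = 0")
  case True
  then show ?thesis using gsm_Cons_0[OF assms(2,4)] by simp
next
  case False
  then show ?thesis using deg_eq[OF gsm_deg_in_grd[OF assms(1,3)]] by simp
qed

lemma cod_wdeg:
  assumes "gsm_deg V V k \<phi>" "gsm V s \<Psi>" "hom_word V xs"
  shows "cod V \<phi> xs (\<lambda>ys. sg (c * wdeg V ys) (\<Psi> ys)) = sg (c * (wdeg V xs + k)) (cod V \<phi> xs \<Psi>)"
  unfolding cod_def unsh_sg[symmetric]
proof (rule unsh_cong)
  fix u w assume *: "set u \<subseteq> set xs" "set w \<subseteq> set xs" "wdeg V u + wdeg V w = wdeg V xs"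
  then have hom: "hom_word V u" "hom_word V w" using assms(3) by auto
  have "sg (c * wdeg V (\<phi> u # w)) (\<Psi> (\<phi> u # w)) = sg (c * wdeg V w) (sg (c * deg V (\<phi> u)) (\<Psi> (\<phi> u # w)))"
    by (simp add: algebra_simps)
  also have "\<dots> = sg (c * (wdeg V xs + k)) (\<Psi> (\<phi> u # w))"
    unfolding gsm_head_wdeg[OF assms(1,2) hom] by (simp add: algebra_simps flip: *(3))
  finally show "sg (c * wdeg V (\<phi> u # w)) (\<Psi> (\<phi> u # w)) = \<dots>" .
qed

text \<open>The coderivation property: the coproduct carries the operator to its action on the left
  factor plus, with a sign, its action on the right factor. The letter \<open>\<phi> u\<close> falls
  into one of the two factors; in the second case it has to be moved past the left factor, which is
  \<open>unsh_swap\<close>.\<close>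

lemma cod_unsh:
  assumes \<phi>: "gsm_deg V V k \<phi>" and G: "bigsm V s G" and xs: "hom_word V xs"
  shows "cod V \<phi> xs (\<lambda>ys. unsh V ys G) =
    unsh V xs (\<lambda>u w. cod V \<phi> u (\<lambda>a. G a w) + sg (k * wdeg V u) (cod V \<phi> w (G u)))"
proof -
  have "cod V \<phi> xs (\<lambda>ys. unsh V ys G) = unsh V xs (\<lambda>u w. unsh V w (\<lambda>a b. G (\<phi> u # a) b))
      + unsh V xs (\<lambda>u w. unsh V w (\<lambda>a b. sg (deg V (\<phi> u) * wdeg V a) (G a (\<phi> u # b))))"
    by (simp add: cod_def unsh_add)
  also have "unsh V xs (\<lambda>u w. unsh V w (\<lambda>a b. G (\<phi> u # a) b)) = unsh V xs (\<lambda>u w. cod V \<phi> u (\<lambda>a. G a w))"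
    by (simp add: cod_def unsh_assoc)
  also have "unsh V xs (\<lambda>u w. unsh V w (\<lambda>a b. sg (deg V (\<phi> u) * wdeg V a) (G a (\<phi> u # b))))
      = unsh V xs (\<lambda>u w. unsh V w (\<lambda>a b. sg ((wdeg V u + k) * wdeg V a) (G a (\<phi> u # b))))"
  proof (intro unsh_cong)
    fix u w a b assume "set u \<subseteq> set xs" "set w \<subseteq> set xs" "set a \<subseteq> set w" "set b \<subseteq> set w"
    then have "hom_word V u" "hom_word V a" "hom_word V b" using xs by auto
    then show "sg (deg V (\<phi> u) * wdeg V a) (G a (\<phi> u # b)) = sg ((wdeg V u + k) * wdeg V a) (G a (\<phi> u # b))"
      using gsm_head_wdeg[OF \<phi> bigsm_right[OF G], of a u b "wdeg V a"] by (simp add: mult.commute)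
  qed
  also have "\<dots> = unsh V xs (\<lambda>a w. unsh V w (\<lambda>u b. sg (wdeg V a * wdeg V u) (sg ((wdeg V u + k) * wdeg V a) (G a (\<phi> u # b)))))"
    by (rule unsh_swap)
  also have "\<dots> = unsh V xs (\<lambda>u w. sg (k * wdeg V u) (cod V \<phi> w (G u)))"
    unfolding cod_def unsh_sg[symmetric] by (intro unsh_cong) (auto simp: sg_def)
  finally show ?thesis by (simp add: unsh_add)
qed

lemma cod_Nil: "gsm_deg V V k \<phi> \<Longrightarrow> \<phi> [] = 0 \<Longrightarrow> gsm V s \<Psi> \<Longrightarrow> cod V \<phi> [] \<Psi> = 0"
  by (simp add: cod_def gsm_Cons_0)

end

lemma gsm_deg_cod:
  assumes V: "graded_space V" and W: "graded_space W" and \<phi>: "gsm_deg V V k \<phi>" and \<Psi>: "gsm_deg V W l \<Psi>"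
  shows "gsm_deg V W (k + l) (\<lambda>xs. cod V \<phi> xs \<Psi>)"
proof -
  interpret V: graded_space V by fact
  interpret W: graded_space W by fact
  show ?thesis unfolding gsm_deg_def
  proof (intro conjI allI impI V.gsm_cod[OF \<phi> gsm_deg_gsm[OF \<Psi>]])
    fix xs assume xs: "hom_word V xs"
    show "cod V \<phi> xs \<Psi> \<in> grd W (wdeg V xs + (k + l))"
      unfolding cod_def
    proof (rule unsh_closed)
      fix u w assume "mset u + mset w = mset xs"
      then have *: "mset (u @ w) = mset xs" by simp
      note ** = mset_eq_setD[OF *] wdeg_mset[OF *, of V]
      then have hom: "hom_word V u" "hom_word V w" using xs by auto
      show "\<Psi> (\<phi> u # w) \<in> grd W (wdeg V xs + (k + l))"
      proof (cases "\<phi> u = 0")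
        case True
        then show ?thesis using V.gsm_Cons_0[OF gsm_deg_gsm[OF \<Psi>] hom(2)] by simp
      next
        case False
        have "hom_word V (\<phi> u # w)" using hom V.gsm_deg_homogeneous[OF \<phi>] by simp
        from gsm_deg_in_grd[OF \<Psi> this] V.deg_eq[OF gsm_deg_in_grd[OF \<phi> hom(1)] False] **(2)
        show ?thesis by (simp add: algebra_simps)
      qed
    qed (auto intro: W.grd_add W.grd_minus)
  qed
qed

subsection \<open>Primitive elements\<close>

definition the_letter :: "'a::zero list \<Rightarrow> 'a" where
  "the_letter xs = (case xs of [x] \<Rightarrow> x | _ \<Rightarrow> 0)"

lemma the_letter_simps [simp]:
  "the_letter [] = 0" "the_letter [x] = x" "the_letter (x # y # zs) = 0"
  by (simp_all add: the_letter_def)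

lemma the_letter_length: "length xs \<noteq> 1 \<Longrightarrow> the_letter xs = 0"
  by (auto simp: the_letter_def split: list.splits)

lemma corestr_eq: "corestr V = lin_ext (scl V) the_letter"
  by (simp add: corestr_def the_letter_def[abs_def])

lemma lin_ext_proj:
  "vector_space s \<Longrightarrow> lin_ext s \<Psi> (proj n t) = lin_ext s (\<lambda>xs. if length xs = n then \<Psi> xs else 0) t"
  unfolding proj_def
  by (subst lin_ext_lin_ext) (auto intro!: lin_ext_cong simp: lin_ext_gen lin_ext_0)

lemma linear_proj: "Vector_Spaces.linear fscale fscale (proj n)"
  unfolding proj_def by (rule linear_lin_ext[OF free.vector_space_axioms])

context graded_space
begin

lemma the_letter_cases_Cons: "the_letter (us @ x # vs) = (if us = [] \<and> vs = [] then x else 0)"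
  by (cases us; cases vs) (auto simp: the_letter_length)

lemma gsm_deg_the_letter: "gsm_deg V V 0 the_letter"
  unfolding gsm_deg_def
proof (intro conjI allI impI gsm_rawI[OF vs.vector_space_axioms])
  fix us vs :: "'a list" and x y a b n
  show "the_letter (us @ (scl V a x + scl V b y) # vs)
      = scl V a (the_letter (us @ x # vs)) + scl V b (the_letter (us @ y # vs))"
    by (simp add: the_letter_cases_Cons)
next
  fix us vs :: "'a list" and x y m n
  show "the_letter (us @ x # y # vs) = sg (m * n) (the_letter (us @ y # x # vs))"
    by (simp add: the_letter_cases_Cons)
next
  fix xs assume "hom_word V xs"
  then show "the_letter xs \<in> grd V (wdeg V xs + 0)"
    by (cases xs; cases "tl xs") (auto simp: the_letter_length intro: in_grd_deg)
qed

lemma gsm_Nil: "vector_space s \<Longrightarrow> gsm V s (\<lambda>xs. if xs = [] then c else 0)"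
proof -
  assume "vector_space s"
  then interpret s: vector_space s .
  show ?thesis by (rule gsm_rawI) (simp_all add: s.vector_space_axioms)
qed

end

lemma (in graded_space) bigsm_Nil:
  assumes "vector_space s"
  shows "bigsm V s (\<lambda>a b. if a = [] \<and> b = [] then c else 0)"
proof (rule bigsmI)
  note gsm_zero_fun[OF assms]
  moreover fix u :: "'a list"
  have "gsm V s (\<lambda>w. if w = [] then (if u = [] then c else 0) else 0)"
    "gsm V s (\<lambda>w. if w = [] then (if u = [] then c else 0) else 0)"
    by (rule gsm_Nil[OF assms])+
  then show "gsm V s (\<lambda>w. if u = [] \<and> w = [] then c else 0)" "gsm V s (\<lambda>w. if w = [] \<and> u = [] then c else 0)"
    by (auto elim!: gsm_cong)
qed

lemma unsh_Nil_if: "unsh V ys (\<lambda>a b. if a = [] \<and> b = [] then c else 0) = (if ys = [] then c else 0)"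
  by (cases ys) (auto intro!: unsh_eq_0)

text \<open>Primitive elements of a symmetric coalgebra have length one, as multiplication after the
  \<open>(1, n - 1)\<close> component of the coproduct is multiplication by \<open>n\<close>.\<close>

lemma primitive_lin_ext:
  fixes W :: "('k::field_char_0, 'a::ab_group_add, 'z) gvs_scheme"
  assumes W: "graded_space W" and t: "t \<in> sym_carrier W"
    and prim: "\<And>G :: 'a list \<Rightarrow> 'a list \<Rightarrow> ('a list \<Rightarrow>\<^sub>0 'k). bigsm W fscale G \<Longrightarrow> lin_ext fscale (\<lambda>ys. unsh W ys G) t
      = lin_ext fscale (\<lambda>ys. G ys []) t + lin_ext fscale (\<lambda>ys. G [] ys) t"
    and \<Psi>: "gsm W s \<Psi>"
  shows "lin_ext s \<Psi> t = lin_ext s (\<lambda>ys. if length ys = 1 then \<Psi> ys else 0) t"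
proof -
  interpret graded_space W by fact
  note fs = free.vector_space_axioms
  define c where "c = sym_class W"
  have c: "gsm W fscale c" unfolding c_def by (rule gsm_sym_class)
  \<comment> \<open>Testing primitivity on the indicator of the pair of empty words gives v = v + v
    for the constant part v.\<close>
  have 0: "lin_ext fscale (\<lambda>ys. if ys = [] then c [] else 0) t = 0"
  proof -
    let ?G = "\<lambda>a b. if a = [] \<and> b = [] then c [] else 0"
    from prim[OF bigsm_Nil[OF fs, of "c []"]]
    have "lin_ext fscale (\<lambda>ys. if ys = [] then c [] else 0) t
      = lin_ext fscale (\<lambda>ys. if ys = [] then c [] else 0) t + lin_ext fscale (\<lambda>ys. if ys = [] then c [] else 0) t"
      by (simp add: unsh_Nil_if)
    then show ?thesis by simp
  qed
  \<comment> \<open>The weight is one over the total length, so that by \<open>unsh_length_1\<close>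
    the coproduct paired with \<open>G\<close> returns the class of each nonempty word exactly once.
    Characteristic 0 enters through this division.\<close>
  define G where "G a b = (if length a = 1 then fscale (1 / of_nat (1 + length b)) (c (a @ b)) else 0)" for a b
  have G: "bigsm W fscale G"
  proof (rule bigsmI)
    fix u assume u: "hom_word W u"
    show "gsm W fscale (G u)"
      unfolding G_def[abs_def] using gsm_length_scale[OF gsm_prepend[OF c u], of "\<lambda>n. 1 / of_nat (1 + n)"]
      by (cases "length u = 1") (simp_all add: gsm_zero_fun[OF fs])
  next
    fix w assume w: "hom_word W w"
    show "gsm W fscale (\<lambda>u. G u w)"
      unfolding G_def
      by (rule gsm_length_if[of fscale "\<lambda>u. fscale (1 / of_nat (1 + length w)) (c (u @ w))"],
          rule gsm_length_scale[OF gsm_append[OF c w], of "\<lambda>_. 1 / of_nat (1 + length w)"])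
  qed
  have unshG: "unsh W ys G = (if ys = [] then 0 else c ys)" if ys: "hom_word W ys" for ys
  proof (cases "ys = []")
    case False
    have "unsh W ys G = unsh W ys (\<lambda>u w. fscale (1 / of_nat (length ys)) (if length u = 1 then c (u @ w) else 0))"
      by (rule unsh_cong) (auto simp: G_def simp flip: of_nat_Suc)
    also have "\<dots> = fscale (1 / of_nat (length ys)) (fscale (of_nat (length ys)) (c ys))"
      by (simp only: unsh_length_1[OF c ys, symmetric] vs_linear_unsh[OF free.linear_scale_self])
    finally show ?thesis using False by simp
  qed (simp add: G_def)
  have "lin_ext fscale (\<lambda>ys. unsh W ys G) t = lin_ext fscale (\<lambda>ys. c ys - (if ys = [] then c [] else 0)) t"
    by (rule lin_ext_cong) (use t in \<open>auto simp: unshG sym_carrier_iff\<close>)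
  then have "lin_ext fscale c t = lin_ext fscale (\<lambda>ys. unsh W ys G) t"
    by (simp add: lin_ext_fun_diff[OF fs] 0)
  \<comment> \<open>On the primitive side \<open>G [] ys\<close> is 0 and \<open>G ys []\<close> is
    nonzero only for words of length one.\<close>
  also have "\<dots> = lin_ext fscale (\<lambda>ys. if length ys = 1 then c ys else 0) t"
    unfolding prim[OF G] by (simp add: G_def[abs_def] lin_ext_fun_0[OF fs] cong: if_cong)
  also have "\<dots> = lin_ext fscale c (proj 1 t)"
    by (simp add: lin_ext_proj[OF fs])
  finally have "t - proj 1 t \<in> sym_rel W"
    by (intro sym_relI) (simp add: lin_ext_diff[OF fs] c_def)
  from lin_ext_sym_eq[OF \<Psi> this] show ?thesis
    by (simp add: lin_ext_proj[OF gsm_vs[OF \<Psi>]])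
qed

text \<open>By \<open>primitive_lin_ext\<close> only one-letter words contribute to the class. The
  class of such a word depends linearly on the letter, so the class of \<open>t\<close> is a
  function of \<open>corestr W t\<close>.\<close>

lemma primitive_in_sym_rel:
  fixes W :: "('k::field_char_0, 'a::ab_group_add, 'z) gvs_scheme"
  assumes W: "graded_space W" and t: "t \<in> sym_carrier W"
    and prim: "\<And>G :: 'a list \<Rightarrow> 'a list \<Rightarrow> ('a list \<Rightarrow>\<^sub>0 'k). bigsm W fscale G \<Longrightarrow> lin_ext fscale (\<lambda>ys. unsh W ys G) t
      = lin_ext fscale (\<lambda>ys. G ys []) t + lin_ext fscale (\<lambda>ys. G [] ys) t"
    and 0: "corestr W t = 0"
  shows "t \<in> sym_rel W"
proof (rule graded_space.sym_relI[OF W])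
  interpret graded_space W by fact
  note fs = free.vector_space_axioms
  let ?f = "\<lambda>x. sym_class W [x]"
  have f: "?f (scl W a x + scl W b y) = fscale a (?f x) + fscale b (?f y)"
    if "x \<in> grd W n" "y \<in> grd W n" for n x y a b
    using gsm_lincomb[OF gsm_sym_class, of "[]" "[]" x n y a b] that by simp
  note lin = linear_extend[of fscale ?f, OF fs f]
  have "lin_ext fscale (sym_class W) t = lin_ext fscale (\<lambda>ys. if length ys = 1 then sym_class W ys else 0) t"
    by (rule primitive_lin_ext[OF W t prim gsm_sym_class])
  also have "\<dots> = lin_ext fscale (\<lambda>ys. extend ?f (the_letter ys)) t"
  proof (rule lin_ext_cong)
    fix ys assume "ys \<in> Poly_Mapping.keys t"
    then have ys: "hom_word W ys" using t by (simp add: sym_carrier_iff)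
    show "(if length ys = 1 then sym_class W ys else 0) = extend ?f (the_letter ys)"
    proof (cases "length ys = 1")
      case True
      then obtain y where "ys = [y]" by (auto simp: length_Suc_conv)
      then show ?thesis using ys by (simp add: extend_homogeneous[of fscale ?f, OF fs f])
    qed (simp add: the_letter_length vs_linear_0[OF lin])
  qed
  also have "\<dots> = extend ?f (corestr W t)"
    unfolding corestr_eq by (rule lin_ext_hom[OF lin, symmetric])
  finally show "lin_ext fscale (sym_class W) t = 0" by (simp add: 0 vs_linear_0[OF lin])
qed

subsection \<open>Coalgebra morphisms\<close>

lemma lin_ext_tensor:
  assumes "vector_space s"
  shows "lin_ext s g (tensor t u) = lin_ext s (\<lambda>a. lin_ext s (\<lambda>b. g (a, b)) u) t"
proof -
  interpret vector_space s by fact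
  show ?thesis
    by (simp add: tensor_def lin_ext_sum[OF assms] lin_ext_scale[OF assms] lin_ext_gen[OF assms])
      (simp add: lin_ext_def scale_sum_right)
qed

lemma unsh_sum: "finite A \<Longrightarrow> unsh V xs (\<lambda>u w. \<Sum>a\<in>A. g a u w) = (\<Sum>a\<in>A. unsh V xs (g a))"
  by (induction A rule: finite_induct) (simp_all add: unsh_add)

lemma sym_comult_gen: "sym_comult V (gen xs) = unsh V xs (\<lambda>u w. gen (u, w))"
proof -
  note fs = free.vector_space_axioms
  have "sym_comult V (gen xs) = (\<Sum>p\<in>{0..length xs}. unsh V xs (\<lambda>u w. if length u = p then gen (u, w) else 0))"
    unfolding sym_comult_def lin_ext_gen[OF fs]
    by (intro sum.cong refl sum_Sh_eq_unsh[OF fs, where g = "\<lambda>u w. gen (u, w)"]) auto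
  also have "\<dots> = unsh V xs (\<lambda>u w. \<Sum>p\<in>{0..length xs}. if length u = p then gen (u, w) else 0)"
    by (simp only: unsh_sum[OF finite_atLeastAtMost])
  also have "\<dots> = unsh V xs (\<lambda>u w. gen (u, w))"
    by (rule unsh_cong) auto
  finally show ?thesis .
qed

lemma lin_ext_sym_comult:
  assumes "vector_space s"
  shows "lin_ext s g (sym_comult V t) = lin_ext s (\<lambda>xs. unsh V xs (\<lambda>u w. g (u, w))) t"
proof -
  have "Vector_Spaces.linear fscale fscale (sym_comult V)"
    unfolding sym_comult_def by (rule linear_lin_ext[OF free.vector_space_axioms])
  from lin_ext_linear[OF this assms] show ?thesis
    by (simp add: sym_comult_gen lin_ext_unsh[OF assms] lin_ext_gen[OF assms])
qed

lemma lin_ext_tensor_map: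
  assumes "vector_space s"
  shows "lin_ext s g (tensor_map F t)
    = lin_ext s (\<lambda>(u, w). lin_ext s (\<lambda>a. lin_ext s (\<lambda>b. g (a, b)) (F (gen w))) (F (gen u))) t"
  unfolding tensor_map_def lin_ext_lin_ext[OF assms]
  by (rule lin_ext_cong) (simp add: lin_ext_tensor[OF assms] case_prod_beta')

definition tensor_rel :: "('k::field, 'a::ab_group_add, 'z) gvs_scheme \<Rightarrow> ('a list \<times> 'a list \<Rightarrow>\<^sub>0 'k) set" where
  "tensor_rel V = free.span
     ({tensor r u | r u. r \<in> sym_rel V \<and> u \<in> sym_carrier V} \<union>
      {tensor u r | r u. r \<in> sym_rel V \<and> u \<in> sym_carrier V})"

lemma subspace_tensor_rel: "free.subspace (tensor_rel V)"
  by (simp add: tensor_rel_def)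

lemma tensor_rel_left: "r \<in> sym_rel V \<Longrightarrow> u \<in> sym_carrier V \<Longrightarrow> tensor r u \<in> tensor_rel V"
  and tensor_rel_right: "r \<in> sym_rel V \<Longrightarrow> u \<in> sym_carrier V \<Longrightarrow> tensor u r \<in> tensor_rel V"
  unfolding tensor_rel_def by (rule free.span_base, blast)+

lemma tensor_eq_iff: "tensor_eq V t u \<longleftrightarrow> t - u \<in> tensor_rel V"
  by (simp add: tensor_eq_def tensor_rel_def)

context graded_space
begin

lemma gsmI_sym_rel:
  assumes "vector_space s" "\<And>r. r \<in> sym_rel V \<Longrightarrow> lin_ext s \<Psi> r = 0"
  shows "gsm V s \<Psi>"
proof (rule gsm_rawI[OF assms(1)])
  note s = assms(1)
  fix us vs x y and a b :: 'k and n
  assume *: "hom_word V us" "hom_word V vs" "x \<in> grd V n" "y \<in> grd V n"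
  then have "gen (us @ (scl V a x + scl V b y) # vs) - fscale a (gen (us @ x # vs))
      - fscale b (gen (us @ y # vs)) \<in> sym_rel V"
    unfolding sym_rel_def by (intro free.span_base) blast
  from assms(2)[OF this]
  show "\<Psi> (us @ (scl V a x + scl V b y) # vs) = s a (\<Psi> (us @ x # vs)) + s b (\<Psi> (us @ y # vs))"
    by (simp add: lin_ext_diff[OF s] lin_ext_scale[OF s] lin_ext_gen[OF s] diff_eq_eq add.commute)
next
  note s = assms(1)
  fix us vs x y m n
  assume *: "hom_word V us" "hom_word V vs" "x \<in> grd V m" "y \<in> grd V n"
  then have "gen (us @ x # y # vs) - fscale ((-1) powi (m * n)) (gen (us @ y # x # vs)) \<in> sym_rel V"
    unfolding sym_rel_def by (intro free.span_base) blast
  from assms(2)[OF this] show "\<Psi> (us @ x # y # vs) = sg (m * n) (\<Psi> (us @ y # x # vs))"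
    by (simp add: lin_ext_diff[OF s] lin_ext_scale[OF s] lin_ext_gen[OF s] scale_powi_minus1[OF s])
qed

text \<open>Sum over the words of the unrelated factor first: for each fixed word there, the
  function of the other factor kills the relations.\<close>

lemma lin_ext_tensor_rel:
  assumes G: "bigsm V s G" and s: "vector_space s" and t: "t \<in> tensor_rel V"
  shows "lin_ext s (\<lambda>(a, b). G a b) t = 0"
proof -
  interpret s: vector_space s by fact
  let ?g = "\<lambda>(a, b). G a b"
  have "module.subspace fscale {t. lin_ext s ?g t = 0}"
    by (rule free.subspaceI) (simp_all add: lin_ext_0[OF s] lin_ext_add[OF s] lin_ext_scale[OF s])
  moreover have "lin_ext s ?g (tensor r u) = 0" if "r \<in> sym_rel V" "u \<in> sym_carrier V" for r u
  proof -
    have "gsm V s (\<lambda>a. lin_ext s (G a) u)"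
    proof (rule gsmI_sym_rel[OF s])
      fix r assume r: "r \<in> sym_rel V"
      have "lin_ext s (\<lambda>a. lin_ext s (G a) u) r = (\<Sum>b\<in>Poly_Mapping.keys u. s (Poly_Mapping.lookup u b) (lin_ext s (\<lambda>a. G a b) r))"
        by (simp add: lin_ext_def s.scale_sum_right mult.commute) (rule sum.swap)
      also have "\<dots> = 0"
        by (rule sum.neutral)
          (use that(2) r in \<open>auto simp: sym_carrier_iff lin_ext_sym_rel[OF bigsm_left[OF G]]\<close>)
      finally show "lin_ext s (\<lambda>a. lin_ext s (G a) u) r = 0" .
    qed
    from lin_ext_sym_rel[OF this that(1)] show ?thesis by (simp add: lin_ext_tensor[OF s])
  qed
  moreover have "lin_ext s ?g (tensor u r) = 0" if "r \<in> sym_rel V" "u \<in> sym_carrier V" for r u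
  proof -
    have "lin_ext s ?g (tensor u r) = lin_ext s (\<lambda>a. 0) u"
      unfolding lin_ext_tensor[OF s]
      by (rule lin_ext_cong) (use that in \<open>auto simp: sym_carrier_iff lin_ext_sym_rel[OF bigsm_right[OF G]]\<close>)
    then show ?thesis by (simp add: lin_ext_fun_0[OF s])
  qed
  ultimately have "tensor_rel V \<subseteq> {t. lin_ext s ?g t = 0}"
    unfolding tensor_rel_def by (intro free.span_minimal) auto
  with t show ?thesis by blast
qed

text \<open>The universal function on the tensor square. An equation of coproducts holds modulo
  \<open>tensor_eq\<close> as soon as it holds after applying this function.\<close>

lemma bigsm_tensor_class: "bigsm V fscale (\<lambda>a b. quot (tensor_rel V) (gen (a, b)))"
proof (rule bigsmI)
  note fs = free.vector_space_axioms
  note lin = linear_quot[OF subspace_tensor_rel[of V]]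
  have tensor: "tensor t u = lin_ext fscale (\<lambda>a. lin_ext fscale (\<lambda>b. gen (a, b)) u) t" for t u :: "'a list \<Rightarrow>\<^sub>0 'k"
    using lin_ext_tensor[OF fs, of gen t u] by (simp add: lin_ext_gen_self)
  fix u assume u: "hom_word V u"
  show "gsm V fscale (\<lambda>w. quot (tensor_rel V) (gen (u, w)))"
  proof (rule gsmI_sym_rel[OF fs])
    fix r assume "r \<in> sym_rel V"
    then have "tensor (gen u) r \<in> tensor_rel V"
      using u by (intro tensor_rel_right) auto
    then have "quot (tensor_rel V) (lin_ext fscale (\<lambda>b. gen (u, b)) r) = 0"
      by (simp add: quot_eq_0_iff[OF subspace_tensor_rel] tensor lin_ext_gen[OF fs])
    then show "lin_ext fscale (\<lambda>w. quot (tensor_rel V) (gen (u, w))) r = 0"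
      by (simp add: lin_ext_hom[OF lin])
  qed
  show "gsm V fscale (\<lambda>w. quot (tensor_rel V) (gen (w, u)))"
  proof (rule gsmI_sym_rel[OF fs])
    fix r assume "r \<in> sym_rel V"
    then have "tensor r (gen u) \<in> tensor_rel V"
      using u by (intro tensor_rel_left) auto
    then have "quot (tensor_rel V) (lin_ext fscale (\<lambda>b. gen (b, u)) r) = 0"
      by (simp add: quot_eq_0_iff[OF subspace_tensor_rel] tensor lin_ext_gen[OF fs])
    then show "lin_ext fscale (\<lambda>w. quot (tensor_rel V) (gen (w, u))) r = 0"
      by (simp add: lin_ext_hom[OF lin])
  qed
qed

lemma sym_rel_mem_0: "hom_word V xs \<Longrightarrow> 0 \<in> set xs \<Longrightarrow> gen xs \<in> sym_rel V"
  using gsm_mem_0[OF gsm_sym_class] quot_eq_0_iff[OF subspace_sym_rel] by metis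

text \<open>Words with a zero letter are relations, and on the remaining generators the prescribed
  degree \<open>d\<close> is the intrinsic \<open>wdeg\<close>.\<close>

lemma sym_grd_induct:
  assumes U: "free.subspace U" and "sym_rel V \<subseteq> U"
    and "\<And>xs. hom_word V xs \<Longrightarrow> 0 \<notin> set xs \<Longrightarrow> wdeg V xs = d \<Longrightarrow> gen xs \<in> U"
  shows "sym_grd V d \<subseteq> U"
  unfolding sym_grd_def
proof (rule free.span_minimal[OF _ U], intro Un_least assms(2) subsetI)
  fix t :: "'a list \<Rightarrow>\<^sub>0 'k" assume "t \<in> {gen xs | xs ds. graded_word xs ds \<and> sum_list ds = d}"
  then obtain xs ds where t: "t = gen xs" "graded_word xs ds" "sum_list ds = d" by blast
  then show "t \<in> U"
    using assms(2,3) graded_word_hom_word[OF t(2)] sym_rel_mem_0[of xs] wdeg_eq[OF t(2)] by (cases "0 \<in> set xs") auto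
qed

lemma gen_in_sym_grd: "hom_word V xs \<Longrightarrow> gen xs \<in> sym_grd V (wdeg V xs)"
  unfolding sym_grd_def wdeg_def by (intro free.span_base) (use hom_word_graded_word in blast)

lemma subspace_sym_grd: "free.subspace (sym_grd V d)"
  by (simp add: sym_grd_def)

lemma sym_rel_subset_grd: "sym_rel V \<subseteq> sym_grd V d"
  unfolding sym_grd_def by (meson Un_upper1 free.span_superset order_trans)

end

text \<open>Reduces the defining conditions to statements about the images of words. It serves both
  for the morphism built from structure maps and for the extension of \<open>i\<close>.\<close>

lemma coalg_morphismI:
  fixes V :: "('k::field, 'a::ab_group_add, 'y) gvs_scheme" and W :: "('k, 'b::ab_group_add, 'z) gvs_scheme"
  assumes V: "graded_space V" and W: "graded_space W"
    and carrier: "\<And>xs. hom_word V xs \<Longrightarrow> f xs \<in> sym_carrier W"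
    and gsm: "gsm V fscale (\<lambda>xs. quot (sym_rel W) (f xs))"
    and comult: "\<And>xs (G :: 'b list \<Rightarrow> 'b list \<Rightarrow> ('b list \<times> 'b list \<Rightarrow>\<^sub>0 'k)). bigsm W fscale G \<Longrightarrow> hom_word V xs \<Longrightarrow>
      lin_ext fscale (\<lambda>ys. unsh W ys G) (f xs)
        = unsh V xs (\<lambda>u w. lin_ext fscale (\<lambda>a. lin_ext fscale (G a) (f w)) (f u))"
    and counit: "\<And>xs. hom_word V xs \<Longrightarrow> Poly_Mapping.lookup (f xs) [] = (if xs = [] then 1 else 0)"
    and deg: "\<And>xs. hom_word V xs \<Longrightarrow> f xs \<in> sym_grd W (wdeg V xs)"
    and Nil: "sym_eq W (f []) (gen [])"
  shows "coalg_morphism V W (lin_ext fscale f)"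
proof -
  interpret V: graded_space V by fact
  interpret W: graded_space W by fact
  note fs = free.vector_space_axioms
  let ?F = "lin_ext fscale f"
  have lin: "Vector_Spaces.linear fscale fscale ?F" by (rule linear_lin_ext[OF fs])
  have rel: "?F r \<in> sym_rel W" if "r \<in> sym_rel V" for r
  proof -
    have "quot (sym_rel W) (?F r) = 0"
      unfolding lin_ext_hom[OF linear_quot[OF subspace_sym_rel]] by (rule V.lin_ext_sym_rel[OF gsm that])
    then show ?thesis by (simp add: quot_eq_0_iff[OF subspace_sym_rel])
  qed
  have "sym_linear V W ?F"
    unfolding sym_linear_def
    using lin rel carrier
    by (auto intro!: lin_ext_in_subspace[OF fs subspace_sym_carrier] simp: sym_carrier_iff[of _ V])
  moreover have "tensor_eq W (sym_comult W (?F t)) (tensor_map ?F (sym_comult V t))" if t: "t \<in> sym_carrier V" for t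
  proof -
    let ?G = "\<lambda>a b. quot (tensor_rel W) (gen (a, b))"
    note lq = linear_quot[OF subspace_tensor_rel[of W]]
    have q: "quot (tensor_rel W) X = lin_ext fscale (\<lambda>(a, b). ?G a b) X" for X
      by (subst linear_eq_lin_ext[OF lq]) (simp add: case_prod_unfold)
    have "quot (tensor_rel W) (sym_comult W (?F t)) = lin_ext fscale (\<lambda>xs. lin_ext fscale (\<lambda>ys. unsh W ys ?G) (f xs)) t"
      by (subst q, subst lin_ext_sym_comult[OF fs]) (simp add: lin_ext_lin_ext[OF fs])
    also have "\<dots> = lin_ext fscale (\<lambda>xs. unsh V xs (\<lambda>u w. lin_ext fscale (\<lambda>a. lin_ext fscale (?G a) (f w)) (f u))) t"
      by (rule lin_ext_cong, rule comult[OF W.bigsm_tensor_class]) (use t in \<open>simp add: sym_carrier_iff\<close>)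
    also have "\<dots> = quot (tensor_rel W) (tensor_map ?F (sym_comult V t))"
      by (subst q[of "tensor_map _ _"], subst lin_ext_tensor_map[OF fs], subst lin_ext_sym_comult[OF fs]) (simp add: lin_ext_gen[OF fs])
    finally show ?thesis
      by (simp add: tensor_eq_iff quot_eq_0_iff[OF subspace_tensor_rel, symmetric] vs_linear_diff[OF lq])
  qed
  moreover have "sym_counit (?F t) = sym_counit t" if "t \<in> sym_carrier V" for t
  proof -
    have "sym_counit (?F t) = (\<Sum>xs\<in>Poly_Mapping.keys t. Poly_Mapping.lookup t xs * (if xs = [] then 1 else 0))"
      unfolding sym_counit_def lin_ext_def lookup_sum
      by (rule sum.cong) (use that in \<open>auto simp: sym_carrier_iff counit\<close>)
    also have "\<dots> = sym_counit t"
      by (simp add: sym_counit_def in_keys_iff if_distrib[of "\<lambda>x. _ * x"] cong: if_cong)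
    finally show ?thesis .
  qed
  moreover have "?F ` sym_grd V d \<subseteq> sym_grd W d" for d
  proof -
    have "sym_grd V d \<subseteq> {t. ?F t \<in> sym_grd W d}"
    proof (rule V.sym_grd_induct)
      show "free.subspace {t. ?F t \<in> sym_grd W d}"
        using module_hom.subspace_linear_preimage[OF lin[folded module_hom_iff_linear] W.subspace_sym_grd] .
    qed (use rel W.sym_rel_subset_grd deg in \<open>auto simp: lin_ext_gen[OF fs]\<close>)
    then show ?thesis by blast
  qed
  ultimately show ?thesis
    using Nil by (simp add: coalg_morphism_def lin_ext_gen[OF fs])
qed

section \<open>Transposes of coalgebra morphisms\<close>

definition pull :: "('k::field \<Rightarrow> 'v \<Rightarrow> 'v::ab_group_add) \<Rightarrow> (('a list \<Rightarrow>\<^sub>0 'k) \<Rightarrow> ('b list \<Rightarrow>\<^sub>0 'k))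
    \<Rightarrow> ('b list \<Rightarrow> 'v) \<Rightarrow> 'a list \<Rightarrow> 'v" where
  "pull s P \<Psi> xs = lin_ext s \<Psi> (P (gen xs))"

locale sym_morphism = V: graded_space V + W: graded_space W
  for V :: "('k::field, 'a::ab_group_add, 'y) gvs_scheme" and W :: "('k, 'b::ab_group_add, 'z) gvs_scheme" +
  fixes P :: "('a list \<Rightarrow>\<^sub>0 'k) \<Rightarrow> ('b list \<Rightarrow>\<^sub>0 'k)"
  assumes coalg: "coalg_morphism V W P"
begin

lemma linear: "Vector_Spaces.linear fscale fscale P"
  and P_carrier: "t \<in> sym_carrier V \<Longrightarrow> P t \<in> sym_carrier W"
  and P_rel: "t \<in> sym_rel V \<Longrightarrow> P t \<in> sym_rel W"
  and P_grd: "t \<in> sym_grd V d \<Longrightarrow> P t \<in> sym_grd W d"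
  and P_comult: "t \<in> sym_carrier V \<Longrightarrow> tensor_eq W (sym_comult W (P t)) (tensor_map P (sym_comult V t))"
  and P_Nil: "P (gen []) - gen [] \<in> sym_rel W"
  using coalg unfolding coalg_morphism_def sym_linear_def sym_eq_def by blast+

lemma lin_ext_pull: "vector_space s \<Longrightarrow> lin_ext s (pull s P \<Psi>) t = lin_ext s \<Psi> (P t)"
  unfolding pull_def by (rule lin_ext_linear[OF linear, symmetric])

lemma gsm_pull: "gsm W s \<Psi> \<Longrightarrow> gsm V s (pull s P \<Psi>)"
  by (rule V.gsmI_sym_rel) (auto simp: lin_ext_pull gsm_vs P_rel W.lin_ext_sym_rel)

lemma pull_cong:
  assumes "hom_word V xs" "\<And>ys. hom_word W ys \<Longrightarrow> \<Psi> ys = \<Psi>' ys"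
  shows "pull s P \<Psi> xs = pull s P \<Psi>' xs"
  unfolding pull_def
  by (rule lin_ext_cong) (use assms P_carrier[of "gen xs"] in \<open>auto simp: sym_carrier_iff\<close>)

lemma pull_Nil:
  assumes "gsm W s \<Psi>"
  shows "pull s P \<Psi> [] = \<Psi> []"
  unfolding pull_def W.lin_ext_sym_eq[OF assms P_Nil] by (rule lin_ext_gen[OF gsm_vs[OF assms]])

text \<open>The transposed form of compatibility with coproducts: the inner \<open>pull\<close> acts
  on the right factor, the outer one on the left factor.\<close>

lemma pull_unsh:
  assumes s: "vector_space s" and G: "bigsm W s G" and xs: "hom_word V xs"
  shows "pull s P (\<lambda>ys. unsh W ys G) xs = unsh V xs (\<lambda>u w. pull s P (\<lambda>a. pull s P (G a) w) u)"
proof -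
  let ?g = "\<lambda>(a, b). G a b"
  have "pull s P (\<lambda>ys. unsh W ys G) xs = lin_ext s ?g (sym_comult W (P (gen xs)))"
    by (simp add: pull_def lin_ext_sym_comult[OF s])
  also have "\<dots> = lin_ext s ?g (tensor_map P (sym_comult V (gen xs)))"
    using W.lin_ext_tensor_rel[OF G s, OF P_comult[of "gen xs", unfolded tensor_eq_iff]] xs
    by (simp add: lin_ext_diff[OF s])
  also have "\<dots> = unsh V xs (\<lambda>u w. pull s P (\<lambda>a. pull s P (G a) w) u)"
    by (simp add: lin_ext_tensor_map[OF s] lin_ext_sym_comult[OF s] lin_ext_gen[OF s] pull_def)
  finally show ?thesis .
qed

text \<open>The representative \<open>P (gen xs)\<close> may contain words of wrong degree, but only
  as part of a relation. A property of the image therefore needs to be checked on relations and on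
  words of the right degree.\<close>

lemma pull_induct:
  assumes U: "free.subspace U" and "sym_rel W \<subseteq> U"
    and "\<And>ys. hom_word W ys \<Longrightarrow> 0 \<notin> set ys \<Longrightarrow> wdeg W ys = wdeg V xs \<Longrightarrow> gen ys \<in> U"
    and xs: "hom_word V xs"
  shows "P (gen xs) \<in> U"
  using W.sym_grd_induct[OF assms(1-3)] P_grd[OF V.gen_in_sym_grd[OF xs]] by blast

lemma pull_wdeg:
  assumes \<Psi>: "gsm W s \<Psi>" and xs: "hom_word V xs"
  shows "pull s P (\<lambda>ys. sg (c * wdeg W ys) (\<Psi> ys)) xs = sg (c * wdeg V xs) (pull s P \<Psi> xs)"
proof -
  note s = gsm_vs[OF \<Psi>]
  interpret s: vector_space s by fact
  let ?\<Phi> = "\<lambda>ys. sg (c * wdeg W ys) (\<Psi> ys)"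
  have \<Phi>: "gsm W s ?\<Phi>" by (rule W.gsm_wdeg_sg[OF \<Psi>])
  have "P (gen xs) \<in> {t. lin_ext s ?\<Phi> t = sg (c * wdeg V xs) (lin_ext s \<Psi> t)}"
  proof (rule pull_induct[OF _ _ _ xs])
    show "free.subspace {t. lin_ext s ?\<Phi> t = sg (c * wdeg V xs) (lin_ext s \<Psi> t)}"
      by (rule free.subspaceI)
        (simp_all add: lin_ext_0[OF s] lin_ext_add[OF s] lin_ext_scale[OF s] sg_add vs_linear_sg[OF s.linear_scale_self])
  qed (auto simp: W.lin_ext_sym_rel[OF \<Psi>] W.lin_ext_sym_rel[OF \<Phi>] lin_ext_gen[OF s])
  then show ?thesis by (simp add: pull_def)
qed

lemma gsm_deg_pull:
  assumes U: "graded_space U" and \<Psi>: "gsm_deg W U l \<Psi>"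
  shows "gsm_deg V U l (pull (scl U) P \<Psi>)"
  unfolding gsm_deg_def
proof (intro conjI allI impI gsm_pull[OF gsm_deg_gsm[OF \<Psi>]])
  interpret U: graded_space U by fact
  note s = U.vs.vector_space_axioms
  fix xs assume xs: "hom_word V xs"
  have "P (gen xs) \<in> {t. lin_ext (scl U) \<Psi> t \<in> grd U (wdeg V xs + l)}"
  proof (rule pull_induct[OF _ _ _ xs])
    show "free.subspace {t. lin_ext (scl U) \<Psi> t \<in> grd U (wdeg V xs + l)}"
      by (rule free.subspaceI)
        (simp_all add: lin_ext_0[OF s] lin_ext_add[OF s] lin_ext_scale[OF s] U.grd_add U.grd_scale)
    fix ys assume "hom_word W ys" "wdeg W ys = wdeg V xs"
    then show "gen ys \<in> {t. lin_ext (scl U) \<Psi> t \<in> grd U (wdeg V xs + l)}"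
      using gsm_deg_in_grd[OF \<Psi>, of ys] by (simp add: lin_ext_gen[OF s])
  qed (auto simp: W.lin_ext_sym_rel[OF gsm_deg_gsm[OF \<Psi>]])
  then show "pull (scl U) P \<Psi> xs \<in> grd U (wdeg V xs + l)" by (simp add: pull_def)
qed

end

lemma unsh_unsh_commute: "unsh V u (\<lambda>a b. unsh W w (\<lambda>c d. g a b c d)) = unsh W w (\<lambda>c d. unsh V u (\<lambda>a b. g a b c d))"
  by (induction u arbitrary: g) (simp_all add: unsh_add flip: unsh_sg)

text \<open>No sign appears here, since the two sums run over independent words. The sign in the
  exchange of two odd operators on a tensor product comes from \<open>cod_wdeg\<close>.\<close>

lemma cod_cod_commute: "cod V \<phi> u (\<lambda>a. cod W \<psi> w (\<lambda>b. G a b)) = cod W \<psi> w (\<lambda>b. cod V \<phi> u (\<lambda>a. G a b))"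
  unfolding cod_def by (rule unsh_unsh_commute)

context graded_space
begin

lemma gsm_unsh_param:
  assumes s: "vector_space s" and "\<And>a b. mset a + mset b = mset w \<Longrightarrow> gsm V s (\<lambda>u. K u a b)"
  shows "gsm V s (\<lambda>u. unsh W w (K u))"
  using assms(2)
proof (induction w arbitrary: K)
  case (Cons x w)
  have "gsm V s (\<lambda>u. unsh W w (\<lambda>a b. K u (x # a) b))" by (rule Cons.IH, rule Cons.prems) simp
  moreover have "gsm V s (\<lambda>u. unsh W w (\<lambda>a b. sg (deg W x * wdeg W a) (K u a (x # b))))"
  proof (rule Cons.IH)
    fix a b assume "mset a + mset b = mset w"
    then have "gsm V s (\<lambda>u. K u a (x # b))" by (intro Cons.prems) simp
    then show "gsm V s (\<lambda>u. sg (deg W x * wdeg W a) (K u a (x # b)))"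
      using gsm_uminus by (cases "even (deg W x * wdeg W a)") (simp_all add: sg_def)
  qed
  ultimately show ?case by (simp add: gsm_plus)
qed simp

lemma gsm_sg_const: "gsm V s \<Psi> \<Longrightarrow> gsm V s (\<lambda>u. sg n (\<Psi> u))"
  using gsm_uminus by (cases "even n") (simp_all add: sg_def)

lemma hom_word_mset:
  "mset a + mset b = mset w \<Longrightarrow> hom_word V w \<Longrightarrow> hom_word V a \<and> hom_word V b"
  using mset_eq_setD[of "a @ b" w] by auto

lemma bigsm_cod:
  assumes \<phi>: "gsm_deg V V k \<phi>" and s: "vector_space s" and G: "bigsm V s G"
  shows "bigsm V s (\<lambda>u w. cod V \<phi> u (\<lambda>a. G a w))" (is ?L) and "bigsm V s (\<lambda>u w. cod V \<phi> w (G u))" (is ?R)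
proof -
  have 1: "gsm V s (\<lambda>w. cod V \<phi> u (\<lambda>a. G a w))" if u: "hom_word V u" for u
    unfolding cod_def
    by (rule gsm_unsh_param[OF s], rule bigsm_right[OF G])
      (use u in \<open>auto dest!: hom_word_mset intro: gsm_deg_homogeneous[OF \<phi>]\<close>)
  have 2: "gsm V s (\<lambda>u. cod V \<phi> w (\<lambda>b. G u b))" if w: "hom_word V w" for w
    unfolding cod_def
    by (rule gsm_unsh_param[OF s], rule bigsm_left[OF G])
      (use w in \<open>auto dest!: hom_word_mset intro: gsm_deg_homogeneous[OF \<phi>]\<close>)
  show ?L by (rule bigsmI, rule 1, assumption, rule gsm_cod[OF \<phi> bigsm_left[OF G]])
  show ?R by (rule bigsmI, rule gsm_cod[OF \<phi> bigsm_right[OF G]], assumption, rule 2)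
qed

lemma bigsm_plus: "bigsm V s G \<Longrightarrow> bigsm V s H \<Longrightarrow> bigsm V s (\<lambda>u w. G u w + H u w)"
  by (simp add: bigsm_def gsm_plus)

lemma bigsm_sg: "bigsm V s G \<Longrightarrow> bigsm V s (\<lambda>u w. sg (c * wdeg V u) (G u w))"
  by (simp add: bigsm_def gsm_sg_const gsm_wdeg_sg)

end

subsection \<open>The codifferential of a differential graded Lie algebra\<close>

lemma shift_simps [simp]: "scl (L\<lbrakk>1\<rbrakk>) = scl L" "grd (L\<lbrakk>1\<rbrakk>) n = grd L (n + 1)"
  by (simp_all add: shift_def)

lemma homogeneous_shift [simp]: "homogeneous (L\<lbrakk>1\<rbrakk>) = homogeneous L"
proof -
  have "(\<Union>n. grd L (n + 1)) = (\<Union>n. grd L n)"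
    by auto (metis diff_add_cancel)
  then show ?thesis by (simp add: homogeneous_def)
qed

lemma graded_space_shift:
  assumes "graded_vector_space L"
  shows "graded_space (L\<lbrakk>1\<rbrakk>)"
proof
  have iff: "is_decomp (L\<lbrakk>1\<rbrakk>) x c \<longleftrightarrow> is_decomp L x (\<lambda>n. c (n - 1))" for x c
  proof -
    have eq: "{n. c (n - 1) \<noteq> 0} = (\<lambda>n. n + 1) ` {n. c n \<noteq> 0}"
      by (auto simp: image_iff) (metis diff_add_cancel)
    have "finite {n. c (n - 1) \<noteq> 0} \<longleftrightarrow> finite {n. c n \<noteq> 0}"
      unfolding eq by (rule finite_image_iff) (simp add: inj_on_def)
    moreover have "(\<Sum>n | c (n - 1) \<noteq> 0. c (n - 1)) = (\<Sum>n | c n \<noteq> 0. c n)"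
      unfolding eq by (subst sum.reindex) (auto simp: inj_on_def)
    moreover have "(\<forall>n. c (n - 1) \<in> grd L n) \<longleftrightarrow> (\<forall>n. c n \<in> grd L (n + 1))"
      by (metis add_diff_cancel_right' diff_add_cancel)
    ultimately show ?thesis by (simp add: is_decomp_def)
  qed
  have "\<exists>!c. is_decomp (L\<lbrakk>1\<rbrakk>) x c" for x
  proof -
    have "\<exists>!c. is_decomp L x c" using assms by (simp add: graded_vector_space_def)
    then obtain c where c: "is_decomp L x c" and u: "\<And>c'. is_decomp L x c' \<Longrightarrow> c' = c" by blast
    show ?thesis
    proof (rule ex1I[of _ "\<lambda>n. c (n + 1)"])
      show "is_decomp (L\<lbrakk>1\<rbrakk>) x (\<lambda>n. c (n + 1))" using c by (simp add: iff)
      fix c' assume "is_decomp (L\<lbrakk>1\<rbrakk>) x c'"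
      then have "(\<lambda>n. c' (n - 1)) = c" by (auto simp: iff intro: u)
      then show "c' = (\<lambda>n. c (n + 1))" by auto
    qed
  qed
  then show "graded_vector_space (L\<lbrakk>1\<rbrakk>)"
    using assms by (simp add: graded_vector_space_def)
qed

text \<open>A structure map concentrated in word length one. Used in \<open>cod\<close> it yields
  the operator that applies \<open>f\<close> to one letter at a time.\<close>

definition on_letter :: "('a \<Rightarrow> 'b::zero) \<Rightarrow> 'a list \<Rightarrow> 'b" where
  "on_letter f xs = (case xs of [x] \<Rightarrow> f x | _ \<Rightarrow> 0)"

lemma on_letter_simps [simp]:
  "on_letter f [] = 0" "on_letter f [x] = f x" "on_letter f (x # y # zs) = 0"
  by (simp_all add: on_letter_def)

lemma on_letter_length: "length xs \<noteq> 1 \<Longrightarrow> on_letter f xs = 0"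
  by (auto simp: on_letter_def split: list.splits)

lemma on_letter_append_Cons: "on_letter f (us @ x # vs) = (if us = [] \<and> vs = [] then f x else 0)"
  by (cases us; cases vs) (auto simp: on_letter_length)

definition graded_linear :: "('k::field, 'a::ab_group_add, 'y) gvs_scheme \<Rightarrow> ('k, 'b::ab_group_add, 'z) gvs_scheme
    \<Rightarrow> int \<Rightarrow> ('a \<Rightarrow> 'b) \<Rightarrow> bool" where
  "graded_linear V W k f \<longleftrightarrow> Vector_Spaces.linear (scl V) (scl W) f \<and> (\<forall>n. \<forall>x\<in>grd V n. f x \<in> grd W (n + k))"

lemma graded_linear_linear: "graded_linear V W k f \<Longrightarrow> Vector_Spaces.linear (scl V) (scl W) f"
  and graded_linear_grd: "graded_linear V W k f \<Longrightarrow> x \<in> grd V n \<Longrightarrow> f x \<in> grd W (n + k)"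
  by (simp_all add: graded_linear_def)

lemma gsm_deg_on_letter:
  assumes V: "graded_space V" and W: "graded_space W" and gl: "graded_linear V W k f"
  shows "gsm_deg V W k (on_letter f)"
proof -
  note f = graded_linear_linear[OF gl] graded_linear_grd[OF gl]
  interpret V: graded_space V by fact
  interpret W: graded_space W by fact
  show ?thesis unfolding gsm_deg_def
  proof (intro conjI allI impI gsm_rawI[OF W.vs.vector_space_axioms])
    fix us vs :: "'b list" and x y a b n
    show "on_letter f (us @ (scl V a x + scl V b y) # vs)
      = scl W a (on_letter f (us @ x # vs)) + scl W b (on_letter f (us @ y # vs))"
      by (simp add: on_letter_append_Cons vs_linear_add[OF f(1)] vs_linear_scale[OF f(1)])
  next
    fix us vs :: "'b list" and x y m n
    show "on_letter f (us @ x # y # vs) = sg (m * n) (on_letter f (us @ y # x # vs))"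
      by (simp add: on_letter_append_Cons)
  next
    fix xs assume "hom_word V xs"
    then show "on_letter f xs \<in> grd W (wdeg V xs + k)"
      by (cases xs; cases "tl xs") (auto simp: on_letter_length intro!: f(2) V.in_grd_deg)
  qed
qed

lemma
  fixes L :: "('k::field, 'a::ab_group_add) dgla"
  assumes "is_dgla L"
  shows dgla_graded: "graded_vector_space L"
    and dif_linear: "Vector_Spaces.linear (scl L) (scl L) (dif L)"
    and dif_grd: "x \<in> grd L n \<Longrightarrow> dif L x \<in> grd L (n + 1)"
    and dif_dif: "dif L (dif L x) = 0"
    and brk_linear_right: "Vector_Spaces.linear (scl L) (scl L) (brk L x)"
    and brk_linear_left: "Vector_Spaces.linear (scl L) (scl L) (\<lambda>x. brk L x y)"
    and brk_grd: "x \<in> grd L m \<Longrightarrow> y \<in> grd L n \<Longrightarrow> brk L x y \<in> grd L (m + n)"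
    and brk_antisym: "x \<in> grd L m \<Longrightarrow> y \<in> grd L n \<Longrightarrow> brk L x y = - sg (m * n) (brk L y x)"
    and brk_jacobi: "x \<in> grd L m \<Longrightarrow> y \<in> grd L n \<Longrightarrow>
      brk L x (brk L y z) = brk L (brk L x y) z + sg (m * n) (brk L y (brk L x z))"
    and dif_brk: "x \<in> grd L m \<Longrightarrow> dif L (brk L x y) = brk L (dif L x) y + sg m (brk L x (dif L y))"
proof -
  have vs: "vector_space (scl L)" using assms by (simp add: is_dgla_def graded_vector_space_def)
  show "graded_vector_space L" "Vector_Spaces.linear (scl L) (scl L) (dif L)"
    "x \<in> grd L n \<Longrightarrow> dif L x \<in> grd L (n + 1)" "dif L (dif L x) = 0"
    "Vector_Spaces.linear (scl L) (scl L) (brk L x)" "Vector_Spaces.linear (scl L) (scl L) (\<lambda>x. brk L x y)"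
    "x \<in> grd L m \<Longrightarrow> y \<in> grd L n \<Longrightarrow> brk L x y \<in> grd L (m + n)"
    by (use assms[unfolded is_dgla_def] in metis)+
  show "x \<in> grd L m \<Longrightarrow> y \<in> grd L n \<Longrightarrow> brk L x y = - sg (m * n) (brk L y x)"
    "x \<in> grd L m \<Longrightarrow> y \<in> grd L n \<Longrightarrow>
      brk L x (brk L y z) = brk L (brk L x y) z + sg (m * n) (brk L y (brk L x z))"
    "x \<in> grd L m \<Longrightarrow> dif L (brk L x y) = brk L (dif L x) y + sg m (brk L x (dif L y))"
    using assms unfolding is_dgla_def scale_powi_minus1[OF vs] by blast+
qed

locale dgla =
  fixes L :: "('k::field, 'a::ab_group_add) dgla"
  assumes dgla: "is_dgla L"
begin

sublocale graded_space "L\<lbrakk>1\<rbrakk>"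
  by (rule graded_space_shift[OF dgla_graded[OF dgla]])

sublocale Ls: vector_space "scl L"
  using vs.vector_space_axioms by simp

abbreviation "d \<equiv> dif L"
abbreviation "br \<equiv> brk L"
abbreviation "q \<equiv> codiff1 L"

lemma d_add: "d (x + y) = d x + d y" and d_minus: "d (- x) = - d x" and d_0 [simp]: "d 0 = 0"
  and d_scale: "d (scl L a x) = scl L a (d x)" and d_sg: "d (sg n x) = sg n (d x)"
  using dif_linear[OF dgla] by (rule vs_linear_add vs_linear_minus vs_linear_0 vs_linear_scale vs_linear_sg)+

lemma br_add_left: "br (x + y) z = br x z + br y z" and br_minus_left: "br (- x) z = - br x z"
  and br_0_left [simp]: "br 0 z = 0"
  and br_scale_left: "br (scl L a x) z = scl L a (br x z)" and br_sg_left: "br (sg n x) z = sg n (br x z)"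
  using brk_linear_left[OF dgla] by (rule vs_linear_add vs_linear_minus vs_linear_0 vs_linear_scale vs_linear_sg)+

lemma br_add_right: "br z (x + y) = br z x + br z y"
  and br_0_right [simp]: "br z 0 = 0"
  and br_scale_right: "br z (scl L a x) = scl L a (br z x)" and br_sg_right: "br z (sg n x) = sg n (br z x)"
  using brk_linear_right[OF dgla] by (rule vs_linear_add vs_linear_minus vs_linear_0 vs_linear_scale vs_linear_sg)+

lemma q_Nil [simp]: "q [] = 0"
  and q_one [simp]: "q [x] = - d x"
  and q_long [simp]: "q (x # y # z # zs) = 0"
  by (simp_all add: codiff1_def)

lemma q_two: "x \<in> grd L (m + 1) \<Longrightarrow> q [x, y] = - sg m (br x y)"
  using deg_eq[of x m] scale_powi_minus1[OF vs.vector_space_axioms]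
  by (cases "x = 0") (simp_all add: codiff1_def)

lemma q_length: "length xs \<noteq> 1 \<Longrightarrow> length xs \<noteq> 2 \<Longrightarrow> q xs = 0"
  by (auto simp: codiff1_def split: list.splits)

text \<open>In the shifted degrees the factor (-1)^|x| turns the graded antisymmetry of the bracket
  into graded symmetry, and the bracket gets degree 1 like the differential.\<close>

lemma gsm_deg_q: "gsm_deg (L\<lbrakk>1\<rbrakk>) (L\<lbrakk>1\<rbrakk>) 1 q"
  unfolding gsm_deg_def
proof (intro conjI allI impI gsm_rawI[OF vs.vector_space_axioms])
  fix us vs :: "'a list" and x y and a b :: 'k and n
  assume *: "hom_word (L\<lbrakk>1\<rbrakk>) us" "hom_word (L\<lbrakk>1\<rbrakk>) vs" "x \<in> grd (L\<lbrakk>1\<rbrakk>) n" "y \<in> grd (L\<lbrakk>1\<rbrakk>) n"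
  then have xy: "x \<in> grd L (n + 1)" "y \<in> grd L (n + 1)" "scl L a x + scl L b y \<in> grd L (n + 1)"
    using grd_add[OF grd_scale grd_scale, of x n y a b] by auto
  consider "us = []" "vs = []" | v where "us = []" "vs = [v]" | u where "us = [u]" "vs = []"
    | "2 \<le> length us + length vs"
    by (cases us; cases "tl us"; cases vs; cases "tl vs") auto
  then show "q (us @ (scl (L\<lbrakk>1\<rbrakk>) a x + scl (L\<lbrakk>1\<rbrakk>) b y) # vs)
    = scl (L\<lbrakk>1\<rbrakk>) a (q (us @ x # vs)) + scl (L\<lbrakk>1\<rbrakk>) b (q (us @ y # vs))"
  proof cases
    case 1
    then show ?thesis by (simp add: d_add d_scale)
  next
    case 2
    then show ?thesis
      using q_two[OF xy(1)] q_two[OF xy(2)] q_two[OF xy(3)] vs_linear_sg[OF vs.linear_scale_self]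
      by (simp add: br_add_left br_scale_left sg_add)
  next
    case (3 u)
    then obtain m where "u \<in> grd L (m + 1)" using *(1) in_grd_deg[of u] by auto
    then show ?thesis
      using 3 q_two[of u m] vs_linear_sg[OF vs.linear_scale_self]
      by (simp add: br_add_right br_scale_right sg_add)
  next
    case 4
    then have "q (us @ z # vs) = 0" for z by (intro q_length) auto
    then show ?thesis by simp
  qed
next
  fix us vs :: "'a list" and x y m n
  assume *: "hom_word (L\<lbrakk>1\<rbrakk>) us" "hom_word (L\<lbrakk>1\<rbrakk>) vs" "x \<in> grd (L\<lbrakk>1\<rbrakk>) m" "y \<in> grd (L\<lbrakk>1\<rbrakk>) n"
  consider "us = []" "vs = []" | "1 \<le> length us + length vs"
    by (cases us; cases vs) auto
  then show "q (us @ x # y # vs) = sg (m * n) (q (us @ y # x # vs))"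
  proof cases
    case 1
    then show ?thesis
      using q_two[of x m y] q_two[of y n x] *(3,4) brk_antisym[OF dgla, of x "m + 1" y "n + 1"]
      by (simp add: sg_def)
  next
    case 2
    then have "q (us @ z # z' # vs) = 0" for z z' by (intro q_length) auto
    then show ?thesis by simp
  qed
next
  fix xs assume xs: "hom_word (L\<lbrakk>1\<rbrakk>) xs"
  consider "xs = []" | x where "xs = [x]" | x y where "xs = [x, y]" | "3 \<le> length xs"
    by (cases xs; cases "tl xs"; cases "tl (tl xs)") auto
  then show "q xs \<in> grd (L\<lbrakk>1\<rbrakk>) (wdeg (L\<lbrakk>1\<rbrakk>) xs + 1)"
  proof cases
    case 1
    then show ?thesis using grd_0[of 1] by simp
  next
    case (2 x)
    have "x \<in> grd L (deg (L\<lbrakk>1\<rbrakk>) x + 1)" using in_grd_deg[of x] xs 2 by simp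
    from dif_grd[OF dgla this] have "- d x \<in> grd (L\<lbrakk>1\<rbrakk>) (deg (L\<lbrakk>1\<rbrakk>) x + 1)" by (intro grd_minus) simp
    then show ?thesis using 2 by simp
  next
    case (3 x y)
    have x: "x \<in> grd L (deg (L\<lbrakk>1\<rbrakk>) x + 1)" and y: "y \<in> grd L (deg (L\<lbrakk>1\<rbrakk>) y + 1)"
      using in_grd_deg[of x] in_grd_deg[of y] xs 3 by auto
    have "br x y \<in> grd (L\<lbrakk>1\<rbrakk>) (wdeg (L\<lbrakk>1\<rbrakk>) xs + 1)"
      using brk_grd[OF dgla x y] 3 by (simp add: algebra_simps)
    then show ?thesis using q_two[OF x, of y] 3(1) by (simp only: grd_minus grd_sg)
  next
    case 4
    then show ?thesis using grd_0 by (simp only: q_length)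
  qed
qed

lemma codiff_gen: "codiff L (gen xs) = (\<Sum>j\<in>{1..length xs}. codiff_word L j xs)"
  by (simp add: codiff_def lin_ext_gen free.vector_space_axioms)

lemma codiff_word_eq:
  assumes "1 \<le> j" "j \<le> length xs"
  shows "codiff_word L j xs = unsh (L\<lbrakk>1\<rbrakk>) xs (\<lambda>u w. if length u = length xs + 1 - j then gen (q u # w) else 0)"
  unfolding codiff_word_def Let_def
  by (rule sum_Sh_eq_unsh[OF free.vector_space_axioms, where g = "\<lambda>u w. gen (q u # w)"]) (use assms in auto)

lemma codiff_linear: "Vector_Spaces.linear fscale fscale (codiff L)"
  unfolding codiff_def by (rule linear_lin_ext[OF free.vector_space_axioms])

text \<open>The component in Sym^j collects the unshuffles with \<open>j = length w + 1\<close>. The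
  sum over j from 1 to the length of the word misses only the term with \<open>u\<close> empty,
  which is 0 because \<open>q []\<close> is 0.\<close>

lemma lin_ext_codiff_gen:
  assumes \<Psi>: "gsm (L\<lbrakk>1\<rbrakk>) s \<Psi>" and xs: "hom_word (L\<lbrakk>1\<rbrakk>) xs"
  shows "lin_ext s \<Psi> (codiff L (gen xs)) = cod (L\<lbrakk>1\<rbrakk>) q xs \<Psi>"
proof -
  note s = gsm_vs[OF \<Psi>]
  let ?V = "L\<lbrakk>1\<rbrakk>"
  have "lin_ext s \<Psi> (codiff L (gen xs))
      = (\<Sum>j\<in>{1..length xs}. unsh ?V xs (\<lambda>u w. if length u = length xs + 1 - j then \<Psi> (q u # w) else 0))"
    unfolding codiff_gen lin_ext_sum[OF s]
    by (intro sum.cong refl)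
      (auto simp: codiff_word_eq lin_ext_unsh[OF s] lin_ext_gen[OF s] lin_ext_0[OF s] if_distrib[of "lin_ext s \<Psi>"] cong: if_cong)
  also have "\<dots> = unsh ?V xs (\<lambda>u w. \<Sum>j\<in>{1..length xs}. if length u = length xs + 1 - j then \<Psi> (q u # w) else 0)"
    by (simp only: unsh_sum[OF finite_atLeastAtMost])
  also have "\<dots> = unsh ?V xs (\<lambda>u w. \<Psi> (q u # w))"
  proof (rule unsh_cong)
    fix u w assume *: "set u \<subseteq> set xs" "set w \<subseteq> set xs" "length u + length w = length xs"
    show "(\<Sum>j\<in>{1..length xs}. if length u = length xs + 1 - j then \<Psi> (q u # w) else 0) = \<Psi> (q u # w)"
    proof (cases "u = []")
      case True
      then show ?thesis using gsm_Cons_0[OF \<Psi>, of w] *(2) xs by (auto intro!: sum.neutral)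
    next
      case False
      have "(\<Sum>j\<in>{1..length xs}. if length u = length xs + 1 - j then \<Psi> (q u # w) else 0)
          = (\<Sum>j\<in>{1..length xs}. if j = length w + 1 then \<Psi> (q u # w) else 0)"
        by (rule sum.cong) (use * in auto)
      also have "\<dots> = \<Psi> (q u # w)" using * False by (simp add: Suc_le_eq) (metis Suc_leI add_less_same_cancel2 add.commute less_add_same_cancel1 length_greater_0_conv)
      finally show ?thesis .
    qed
  qed
  finally show ?thesis by (simp add: cod_def)
qed

lemma codiff_carrier:
  assumes "t \<in> sym_carrier (L\<lbrakk>1\<rbrakk>)"
  shows "codiff L t \<in> sym_carrier (L\<lbrakk>1\<rbrakk>)"
  unfolding codiff_def
proof (rule lin_ext_in_subspace[OF free.vector_space_axioms subspace_sym_carrier])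
  fix xs assume "xs \<in> Poly_Mapping.keys t"
  then have xs: "hom_word (L\<lbrakk>1\<rbrakk>) xs" using assms unfolding sym_carrier_iff by blast
  show "(\<Sum>j\<in>{1..length xs}. codiff_word L j xs) \<in> sym_carrier (L\<lbrakk>1\<rbrakk>)"
  proof (rule free.subspace_sum[OF subspace_sym_carrier])
    fix j assume "j \<in> {1..length xs}"
    then have j: "1 \<le> j" "j \<le> length xs" by auto
    show "codiff_word L j xs \<in> sym_carrier (L\<lbrakk>1\<rbrakk>)"
      unfolding codiff_word_eq[OF j]
    proof (rule unsh_closed)
      fix u w assume "mset u + mset w = mset xs"
      then have "hom_word (L\<lbrakk>1\<rbrakk>) u" "hom_word (L\<lbrakk>1\<rbrakk>) w" using hom_word_mset xs by blast+
      then have "hom_word (L\<lbrakk>1\<rbrakk>) (q u # w)" using gsm_deg_homogeneous[OF gsm_deg_q] by simp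
      then show "(if length u = length xs + 1 - j then gen (q u # w) else 0) \<in> sym_carrier (L\<lbrakk>1\<rbrakk>)"
        using free.subspace_0[OF subspace_sym_carrier[of "L\<lbrakk>1\<rbrakk>"]] by (simp del: homogeneous_shift)
    qed (auto intro: free.subspace_add[OF subspace_sym_carrier] free.subspace_neg[OF subspace_sym_carrier])
  qed
qed

lemma lin_ext_codiff:
  assumes \<Psi>: "gsm (L\<lbrakk>1\<rbrakk>) s \<Psi>" and t: "t \<in> sym_carrier (L\<lbrakk>1\<rbrakk>)"
  shows "lin_ext s \<Psi> (codiff L t) = lin_ext s (\<lambda>ys. cod (L\<lbrakk>1\<rbrakk>) q ys \<Psi>) t"
  unfolding lin_ext_linear[OF codiff_linear gsm_vs[OF \<Psi>], of \<Psi> t]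
  by (rule lin_ext_cong, rule lin_ext_codiff_gen[OF \<Psi>]) (use t in \<open>simp add: sym_carrier_iff\<close>)

lemma cod_the_letter: "cod (L\<lbrakk>1\<rbrakk>) q ys the_letter = q ys"
  unfolding cod_def by (subst unsh_right_Nil) (auto intro: the_letter_length)

text \<open>On one letter this is d^2 = 0, on two letters the Leibniz rule, on three letters the
  Jacobi identity. From four letters on, in each term one of the two applications of
  \<open>q\<close> has more than two arguments.\<close>

lemma cod_q_q:
  assumes "hom_word (L\<lbrakk>1\<rbrakk>) xs"
  shows "cod (L\<lbrakk>1\<rbrakk>) q xs q = 0"
proof -
  consider "xs = []" | x where "xs = [x]" | x y where "xs = [x, y]" | x y z where "xs = [x, y, z]" | "4 \<le> length xs"
    by (cases xs; cases "tl xs"; cases "tl (tl xs)"; cases "tl (tl (tl xs))") auto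
  then show ?thesis
  proof cases
    case (2 x)
    have "q [0, x] = 0" using q_two[of 0 0 x] grd_0[of 0] by simp
    with 2 show ?thesis by (simp add: cod_def d_minus dif_dif[OF dgla])
  next
    case (3 x y)
    define m n where "m = deg (L\<lbrakk>1\<rbrakk>) x" and "n = deg (L\<lbrakk>1\<rbrakk>) y"
    have x: "x \<in> grd L (m + 1)" and y: "y \<in> grd L (n + 1)"
      using in_grd_deg[of x] in_grd_deg[of y] assms 3 by (auto simp: m_def n_def)
    have dx: "- d x \<in> grd L ((m + 1) + 1)" and dy: "- d y \<in> grd L ((n + 1) + 1)"
      using grd_minus[of "d x" "m + 1"] grd_minus[of "d y" "n + 1"] dif_grd[OF dgla x] dif_grd[OF dgla y] by auto
    have "cod (L\<lbrakk>1\<rbrakk>) q xs q = q [q [x, y]] + q [q [x], y] + sg (m * n) (q [q [y], x])"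
      using 3 by (simp add: cod_def m_def n_def)
    also have "\<dots> = sg m (d (br x y)) + sg (m + 1) (br (d x) y) + sg (m * n) (sg (n + 1) (br (d y) x))"
      using q_two[OF dx, of y] q_two[OF dy, of x] by (simp add: q_two[OF x] br_minus_left d_minus d_sg sg_minus)
    also have "\<dots> = 0"
      unfolding dif_brk[OF dgla x, of y] brk_antisym[OF dgla dif_grd[OF dgla y] x]
      by (simp add: sg_def)
    finally show ?thesis .
  next
    case (4 x y z)
    define m n p where "m = deg (L\<lbrakk>1\<rbrakk>) x" and "n = deg (L\<lbrakk>1\<rbrakk>) y" and "p = deg (L\<lbrakk>1\<rbrakk>) z"
    have x: "x \<in> grd L (m + 1)" and y: "y \<in> grd L (n + 1)" and z: "z \<in> grd L (p + 1)"
      using in_grd_deg[of x] in_grd_deg[of y] in_grd_deg[of z] assms 4 by (auto simp: m_def n_def p_def)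
    have qq: "q [q [a, b], c] = sg (l + 1) (br (br a b) c)"
      if "a \<in> grd L (k + 1)" "b \<in> grd L (l + 1)" for a b c k l
    proof -
      have "q [a, b] = - sg k (br a b)" by (rule q_two[OF that(1)])
      moreover have "q [a, b] \<in> grd (L\<lbrakk>1\<rbrakk>) (k + l + 1)"
        unfolding q_two[OF that(1)] using brk_grd[OF dgla that] by (intro grd_minus grd_sg) (simp add: algebra_simps)
      ultimately show ?thesis using q_two[of "q [a, b]" "k + l + 1" c]
        by (simp add: br_minus_left br_sg_left sg_minus) (simp add: sg_def)
    qed
    have "cod (L\<lbrakk>1\<rbrakk>) q xs q = q [q [x, y], z] + sg (n * p) (q [q [x, z], y]) + sg (m * (n + p)) (q [q [y, z], x])"
      using 4 by (simp add: cod_def m_def n_def p_def algebra_simps)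
    also have "\<dots> = sg (n + 1) (br (br x y) z) + sg (n * p) (sg (p + 1) (br (br x z) y))
        + sg (m * (n + p)) (sg (p + 1) (br (br y z) x))"
      by (simp only: qq[OF x y] qq[OF x z] qq[OF y z])
    also have "\<dots> = 0"
      unfolding brk_antisym[OF dgla brk_grd[OF dgla x z] y] brk_antisym[OF dgla brk_grd[OF dgla y z] x]
        brk_jacobi[OF dgla x y]
      by (simp add: sg_def)
    finally show ?thesis .
  next
    case 5
    show ?thesis unfolding cod_def
    proof (rule unsh_eq_0)
      fix u w :: "'a list" assume *: "length u + length w = length xs" "set w \<subseteq> set xs"
      show "q (q u # w) = 0"
      proof (cases "length w \<le> 1")
        case True
        then have "q u = 0" using * 5 by (intro q_length) auto
        then show ?thesis using gsm_Cons_0[OF gsm_deg_gsm[OF gsm_deg_q]] * assms by auto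
      next
        case False
        then show ?thesis by (intro q_length) auto
      qed
    qed
  qed (use q_one[of 0] in \<open>simp add: cod_def\<close>)
qed

end

text \<open>The square of an odd coderivation is again a coderivation, the mixed terms cancelling.
  So with the induction hypothesis the image of \<open>xs\<close> is primitive, and its letter part
  is \<open>cod_q_q\<close>.\<close>

lemma codiff_codiff:
  fixes L :: "('k::field_char_0, 'a::ab_group_add) dgla"
  assumes L: "is_dgla L" and xs: "hom_word (L\<lbrakk>1\<rbrakk>) xs"
  shows "codiff L (codiff L (gen xs)) \<in> sym_rel (L\<lbrakk>1\<rbrakk>)"
  using xs
proof (induction "length xs" arbitrary: xs rule: less_induct)
  case less
  interpret dgla L by standard fact
  let ?V = "L\<lbrakk>1\<rbrakk>"
  let ?QQ = "\<lambda>\<Psi> u. cod ?V q u (\<lambda>a. cod ?V q a \<Psi>)"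
  note fs = free.vector_space_axioms
  have eq: "lin_ext s \<Psi> (codiff L (codiff L (gen u))) = ?QQ \<Psi> u"
    if "gsm ?V s \<Psi>" "hom_word ?V u" for s \<Psi> u
    using that lin_ext_codiff[OF that(1) codiff_carrier, of "gen u"]
      lin_ext_codiff_gen[OF gsm_cod[OF gsm_deg_q that(1)] that(2)] by simp
  have IH: "?QQ \<Psi> u = 0" if "gsm ?V s \<Psi>" "hom_word ?V u" "length u < length xs" for s \<Psi> u
    using eq[OF that(1,2)] lin_ext_sym_rel[OF that(1) less.hyps[OF that(3,2)]] by simp
  have carrier: "codiff L (codiff L (gen xs)) \<in> sym_carrier ?V"
    by (intro codiff_carrier) (use less.prems in simp)
  show ?case
  proof (rule primitive_in_sym_rel[OF graded_space_axioms carrier])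
    fix G :: "'a list \<Rightarrow> 'a list \<Rightarrow> ('a list \<Rightarrow>\<^sub>0 'k)" assume G: "bigsm ?V fscale G"
    define H where "H u w = cod ?V q u (\<lambda>a. G a w) + sg (1 * wdeg ?V u) (cod ?V q w (G u))" for u w
    note bi = bigsm_cod[OF gsm_deg_q fs G]
    have H: "bigsm ?V fscale H"
      unfolding H_def[abs_def] by (intro bigsm_plus bigsm_sg bi)
    have "?QQ (\<lambda>ys. unsh ?V ys G) xs = cod ?V q xs (\<lambda>ys. unsh ?V ys H)"
      unfolding H_def[abs_def] by (rule cod_cong_hom[OF gsm_deg_q less.prems]) (rule cod_unsh[OF gsm_deg_q G])
    also have "\<dots> = unsh ?V xs (\<lambda>u w. cod ?V q u (\<lambda>a. H a w) + sg (1 * wdeg ?V u) (cod ?V q w (H u)))"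
      by (rule cod_unsh[OF gsm_deg_q H less.prems])
    also have "\<dots> = unsh ?V xs (\<lambda>u w. ?QQ (\<lambda>a. G a w) u + ?QQ (G u) w)"
    proof (rule unsh_cong)
      fix u w assume "set u \<subseteq> set xs" "set w \<subseteq> set xs"
      then have u: "hom_word ?V u" and w: "hom_word ?V w" using less.prems by auto
      have "cod ?V q u (\<lambda>a. H a w) = ?QQ (\<lambda>a. G a w) u + sg (1 * (wdeg ?V u + 1)) (cod ?V q u (\<lambda>a. cod ?V q w (G a)))"
        unfolding H_def cod_add by (simp only: cod_wdeg[OF gsm_deg_q bigsm_left[OF bi(2) w] u])
      moreover have "cod ?V q w (H u) = cod ?V q w (\<lambda>b. cod ?V q u (\<lambda>a. G a b)) + sg (wdeg ?V u) (?QQ (G u) w)"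
        unfolding H_def cod_add by (simp add: cod_sg)
      \<comment> \<open>The mixed terms carry the signs of \<open>wdeg u + 1\<close> and
        \<open>wdeg u\<close>, hence cancel; on the right factor the sign of \<open>wdeg u\<close>
        occurs twice and disappears.\<close>
      ultimately show "cod ?V q u (\<lambda>a. H a w) + sg (1 * wdeg ?V u) (cod ?V q w (H u)) = ?QQ (\<lambda>a. G a w) u + ?QQ (G u) w"
        by (simp only: cod_cod_commute[of ?V q u]) (simp add: sg_def)
    qed
    also have "\<dots> = ?QQ (\<lambda>a. G a []) xs + ?QQ (G []) xs"
      unfolding unsh_add
      by (intro arg_cong2[where f = "(+)"] unsh_right_Nil unsh_left_Nil
          IH[OF bigsm_left[OF G]] IH[OF bigsm_right[OF G]]) (use less.prems in auto)
    finally show "lin_ext fscale (\<lambda>ys. unsh ?V ys G) (codiff L (codiff L (gen xs)))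
      = lin_ext fscale (\<lambda>ys. G ys []) (codiff L (codiff L (gen xs)))
        + lin_ext fscale (\<lambda>ys. G [] ys) (codiff L (codiff L (gen xs)))"
      using eq[OF gsm_unsh[OF fs G] less.prems] eq[OF bigsm_left[OF G, of "[]"] less.prems]
        eq[OF bigsm_right[OF G, of "[]"] less.prems] by simp
  next
    have "corestr ?V (codiff L (codiff L (gen xs))) = ?QQ the_letter xs"
      using eq[OF gsm_deg_gsm[OF gsm_deg_the_letter] less.prems] by (simp add: corestr_eq)
    then show "corestr ?V (codiff L (codiff L (gen xs))) = 0"
      by (simp add: cod_the_letter cod_q_q[OF less.prems])
  qed
qed

lemma cod_cod_codiff1:
  fixes L :: "('k::field_char_0, 'a::ab_group_add) dgla"
  assumes L: "is_dgla L" and \<Psi>: "gsm (L\<lbrakk>1\<rbrakk>) s \<Psi>" and xs: "hom_word (L\<lbrakk>1\<rbrakk>) xs"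
  shows "cod (L\<lbrakk>1\<rbrakk>) (codiff1 L) xs (\<lambda>ys. cod (L\<lbrakk>1\<rbrakk>) (codiff1 L) ys \<Psi>) = 0"
proof -
  interpret dgla L by standard fact
  show ?thesis
    using lin_ext_sym_rel[OF \<Psi> codiff_codiff[OF L xs]] lin_ext_codiff[OF \<Psi> codiff_carrier, of "gen xs"]
      lin_ext_codiff_gen[OF gsm_cod[OF gsm_deg_q \<Psi>] xs] xs by simp
qed

subsection \<open>Derivations extending linear maps\<close>

context graded_space
begin

lemma gsm_deg_on_letter_self: "graded_linear V V k f \<Longrightarrow> gsm_deg V V k (on_letter f)"
  by (rule gsm_deg_on_letter[OF graded_space_axioms graded_space_axioms])

lemma graded_linear_homogeneous: "graded_linear V V k f \<Longrightarrow> x \<in> homogeneous V \<Longrightarrow> f x \<in> homogeneous V"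
  using homogeneousI[OF graded_linear_grd[OF _ in_grd_deg]] .

lemma cod_on_letter_Nil: "gsm V s \<Psi> \<Longrightarrow> cod V (on_letter f) [] \<Psi> = 0"
  by (simp add: cod_def gsm_Cons_0)

text \<open>The Leibniz rule: \<open>f\<close> hits the first letter, or it hits a later one and its
  value, of degree higher by \<open>k\<close>, is exchanged with \<open>x\<close>. Of the resulting
  sign only \<open>k * m\<close> survives, the rest cancels against the unshuffle sign.\<close>

lemma cod_on_letter_Cons:
  assumes f: "graded_linear V V k f" and \<Psi>: "gsm V s \<Psi>" and x: "x \<in> grd V m" and xs: "hom_word V xs"
  shows "cod V (on_letter f) (x # xs) \<Psi> = \<Psi> (f x # xs) + sg (k * m) (cod V (on_letter f) xs (\<lambda>ys. \<Psi> (x # ys)))"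
proof -
  note of = gsm_deg_on_letter_self[OF f]
  have hx: "x \<in> homogeneous V" by (rule homogeneousI[OF x])
  have "unsh V xs (\<lambda>u w. \<Psi> (on_letter f (x # u) # w)) = \<Psi> (on_letter f [x] # xs)"
  proof (rule unsh_left_Nil)
    fix u w :: "'a list" assume *: "length w < length xs" "set w \<subseteq> set xs" "length u + length w = length xs"
    then have "on_letter f (x # u) = 0" by (intro on_letter_length) auto
    then show "\<Psi> (on_letter f (x # u) # w) = 0" using gsm_Cons_0[OF \<Psi>, of w] * xs by auto
  qed
  moreover have "unsh V xs (\<lambda>u w. sg (deg V x * wdeg V u) (\<Psi> (on_letter f u # x # w)))
      = sg (k * m) (cod V (on_letter f) xs (\<lambda>ys. \<Psi> (x # ys)))"
    unfolding cod_def unsh_sg[symmetric]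
  proof (rule unsh_cong)
    fix u w assume "set u \<subseteq> set xs" "set w \<subseteq> set xs"
    then have u: "hom_word V u" and w: "hom_word V w" using xs by auto
    have hu: "on_letter f u \<in> homogeneous V" by (rule gsm_deg_homogeneous[OF of u])
    show "sg (deg V x * wdeg V u) (\<Psi> (on_letter f u # x # w)) = sg (k * m) (\<Psi> (x # on_letter f u # w))"
    proof (cases "x = 0")
      case True
      then show ?thesis
        using gsm_Cons_0[OF \<Psi>, of "on_letter f u # w"] gsm_mem_0[OF \<Psi>, of "on_letter f u # x # w"] hu w hx by simp
    next
      case False
      have "\<Psi> (on_letter f u # x # w) = sg ((wdeg V u + k) * m) (\<Psi> (x # on_letter f u # w))"
        by (rule gsm_Cons_swap[OF \<Psi> w gsm_deg_in_grd[OF of u] x])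
      then have "sg (deg V x * wdeg V u) (\<Psi> (on_letter f u # x # w))
          = sg (m * wdeg V u) (sg ((wdeg V u + k) * m) (\<Psi> (x # on_letter f u # w)))"
        by (simp only: deg_eq[OF x False])
      also have "\<dots> = sg (k * m) (\<Psi> (x # on_letter f u # w))" by (simp add: sg_def)
      finally show ?thesis .
    qed
  qed
  ultimately show ?thesis by (simp add: cod_def)
qed

text \<open>Maps acting on single letters preserve the length, so agreement on words of the given
  length is enough. This allows length dependent weights and recursion formulas that are known in
  one length only.\<close>

lemma cod_on_letter_cong:
  assumes f: "graded_linear V V k f" and \<Psi>: "gsm V s \<Psi>" "gsm V s \<Psi>'" and xs: "hom_word V xs"
    and eq: "\<And>ys. hom_word V ys \<Longrightarrow> length ys = length xs \<Longrightarrow> \<Psi> ys = \<Psi>' ys"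
  shows "cod V (on_letter f) xs \<Psi> = cod V (on_letter f) xs \<Psi>'"
proof (rule cod_cong[OF gsm_deg_on_letter_self[OF f] xs])
  fix u w :: "'a list" assume *: "hom_word V u" "hom_word V w" "length u + length w = length xs"
  show "\<Psi> (on_letter f u # w) = \<Psi>' (on_letter f u # w)"
  proof (cases "length u = 1")
    case True
    then show ?thesis using * gsm_deg_homogeneous[OF gsm_deg_on_letter_self[OF f] *(1)] by (intro eq) auto
  next
    case False
    then show ?thesis using gsm_Cons_0[OF \<Psi>(1) *(2)] gsm_Cons_0[OF \<Psi>(2) *(2)] by (simp add: on_letter_length)
  qed
qed

text \<open>The terms in which \<open>f\<close> and \<open>g\<close> hit different letters cancel in
  the graded commutator, so only letters hit by both remain. The order in \<open>c\<close> is
  \<open>g\<close> after \<open>f\<close> because the outer \<open>cod\<close> acts first.\<close>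

lemma cod_on_letter_commutator:
  assumes f: "graded_linear V V k f" and g: "graded_linear V V l g"
    and c: "graded_linear V V (k + l) c" and c_eq: "\<And>x. x \<in> homogeneous V \<Longrightarrow> c x = g (f x) - sg (k * l) (f (g x))"
    and "gsm V s \<Psi>" "hom_word V xs"
  shows "cod V (on_letter f) xs (\<lambda>ys. cod V (on_letter g) ys \<Psi>)
      - sg (k * l) (cod V (on_letter g) xs (\<lambda>ys. cod V (on_letter f) ys \<Psi>)) = cod V (on_letter c) xs \<Psi>"
  using assms(5,6)
proof (induction xs arbitrary: \<Psi>)
  case Nil
  show ?case
    by (simp add: cod_on_letter_Nil[OF Nil(1)] cod_on_letter_Nil[OF gsm_cod[OF gsm_deg_on_letter_self[OF f] Nil(1)]]
      cod_on_letter_Nil[OF gsm_cod[OF gsm_deg_on_letter_self[OF g] Nil(1)]])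
next
  case (Cons x xs)
  note \<Psi> = \<open>gsm V s \<Psi>\<close>
  define m where "m = deg V x"
  have x: "x \<in> grd V m" and hx: "x \<in> homogeneous V" and xs: "hom_word V xs"
    using Cons.prems in_grd_deg[of x] by (auto simp: m_def)
  have gen: "cod V (on_letter f) (x # xs) (\<lambda>ys. cod V (on_letter g) ys \<Psi>)
    = \<Psi> (g (f x) # xs) + sg (l * (m + k)) (cod V (on_letter g) xs (\<lambda>ys. \<Psi> (f x # ys)))
      + sg (k * m) (cod V (on_letter f) xs (\<lambda>ys. \<Psi> (g x # ys)))
      + sg (k * m + l * m) (cod V (on_letter f) xs (\<lambda>ys. cod V (on_letter g) ys (\<lambda>ys. \<Psi> (x # ys))))"
    if f: "graded_linear V V k f" and g: "graded_linear V V l g" for f g k l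
  proof -
    note gg = gsm_cod[OF gsm_deg_on_letter_self[OF g] \<Psi>]
    have "cod V (on_letter f) xs (\<lambda>ys. cod V (on_letter g) (x # ys) \<Psi>)
      = cod V (on_letter f) xs (\<lambda>ys. \<Psi> (g x # ys) + sg (l * m) (cod V (on_letter g) ys (\<lambda>ys. \<Psi> (x # ys))))"
      by (rule cod_cong_hom[OF gsm_deg_on_letter_self[OF f] xs]) (rule cod_on_letter_Cons[OF g \<Psi> x])
    then show ?thesis
      by (simp add: cod_on_letter_Cons[OF f gg x xs] cod_on_letter_Cons[OF g \<Psi> graded_linear_grd[OF f x] xs]
          cod_add cod_sg sg_add)
  qed
  have cx: "c x = g (f x) + sg (1 + k * l) (f (g x))" using c_eq[OF hx] by (simp add: sg_def)
  have "f (g x) \<in> homogeneous V"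
    using graded_linear_homogeneous[OF f graded_linear_homogeneous[OF g hx]] .
  then have \<Psi>c: "\<Psi> (c x # xs) = \<Psi> (g (f x) # xs) - sg (k * l) (\<Psi> (f (g x) # xs))"
  proof -
    have 1: "g (f x) \<in> grd V (m + k + l)" and 2: "f (g x) \<in> grd V (m + k + l)"
      using graded_linear_grd[OF g graded_linear_grd[OF f x]] graded_linear_grd[OF f graded_linear_grd[OF g x]]
      by (simp_all add: algebra_simps)
    have "\<Psi> (c x # xs) = \<Psi> (g (f x) # xs) + \<Psi> (sg (1 + k * l) (f (g x)) # xs)"
      unfolding cx using gsm_add[OF \<Psi> _ xs 1 grd_sg[OF 2], of "[]"] by simp
    also have "\<Psi> (sg (1 + k * l) (f (g x)) # xs) = - sg (k * l) (\<Psi> (f (g x) # xs))"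
      using gsm_sg[OF \<Psi> _ xs homogeneousI[OF 2], of "[]" "1 + k * l"] by (simp add: sg_def)
    finally show ?thesis by simp
  qed
  have IH: "cod V (on_letter c) xs (\<lambda>ys. \<Psi> (x # ys)) = cod V (on_letter f) xs (\<lambda>ys. cod V (on_letter g) ys (\<lambda>ys. \<Psi> (x # ys)))
      - sg (k * l) (cod V (on_letter g) xs (\<lambda>ys. cod V (on_letter f) ys (\<lambda>ys. \<Psi> (x # ys))))"
    by (rule Cons.IH[OF gsm_Cons[OF \<Psi> hx] xs, symmetric])
  show ?case
    unfolding cod_on_letter_Cons[OF c \<Psi> x xs] \<Psi>c IH gen[OF f g] gen[OF g f] by (simp add: sg_def)
qed

lemma gsm_length_dep:
  assumes "\<And>n. gsm V s (F n)"
  shows "gsm V s (\<lambda>xs. F (length xs) xs)"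
proof (rule gsm_rawI[OF gsm_vs[OF assms]], goal_cases)
  case (1 us vs x y a b n)
  then show ?case using gsm_lincomb[OF assms 1] by simp
next
  case (2 us vs x y m n)
  show ?case using gsm_swap[OF assms 2, of "length (us @ x # y # vs)"] by simp
qed

end

text \<open>\<open>wsum s e c xs \<Psi>\<close> is the sum of \<open>\<Psi>\<close> over the words obtained from \<open>xs\<close> by applying \<open>e\<close> to
  some of the letters, with weight \<open>c j\<close> if \<open>j\<close> letters are affected.\<close>

primrec wsum :: "('k \<Rightarrow> 'v \<Rightarrow> 'v::ab_group_add) \<Rightarrow> ('a \<Rightarrow> 'a) \<Rightarrow> (nat \<Rightarrow> 'k) \<Rightarrow> 'a list \<Rightarrow> ('a list \<Rightarrow> 'v) \<Rightarrow> 'v" where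
  "wsum s e c [] \<Psi> = s (c 0) (\<Psi> [])"
| "wsum s e c (x # xs) \<Psi> = wsum s e c xs (\<lambda>ys. \<Psi> (x # ys)) + wsum s e (\<lambda>j. c (Suc j)) xs (\<lambda>ys. \<Psi> (e x # ys))"

lemma wsum_cong_weight: "(\<And>j. j \<le> length xs \<Longrightarrow> c j = c' j) \<Longrightarrow> wsum s e c xs \<Psi> = wsum s e c' xs \<Psi>"
proof (induction xs arbitrary: c c' \<Psi>)
  case (Cons x xs)
  show ?case
    using Cons.IH[of c c'] Cons.IH[of "\<lambda>j. c (Suc j)" "\<lambda>j. c' (Suc j)"] Cons.prems by simp
qed simp

lemma
  assumes "vector_space s"
  shows wsum_add: "wsum s e c xs (\<lambda>ys. \<Psi> ys + \<Psi>' ys) = wsum s e c xs \<Psi> + wsum s e c xs \<Psi>'"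
    and wsum_zero: "wsum s e c xs (\<lambda>ys. 0) = 0"
    and wsum_uminus: "wsum s e c xs (\<lambda>ys. - \<Psi> ys) = - wsum s e c xs \<Psi>"
    and wsum_sg: "wsum s e c xs (\<lambda>ys. sg n (\<Psi> ys)) = sg n (wsum s e c xs \<Psi>)"
    and wsum_scale: "wsum s e c xs (\<lambda>ys. s a (\<Psi> ys)) = s a (wsum s e c xs \<Psi>)"
    and wsum_weight_add: "wsum s e (\<lambda>j. c j + c' j) xs \<Psi> = wsum s e c xs \<Psi> + wsum s e c' xs \<Psi>"
    and wsum_weight_scale: "wsum s e (\<lambda>j. a * c j) xs \<Psi> = s a (wsum s e c xs \<Psi>)"
    and wsum_weight_zero: "wsum s e (\<lambda>j. 0) xs \<Psi> = 0"
    and wsum_weight_minus: "wsum s e (\<lambda>j. - c j) xs \<Psi> = - wsum s e c xs \<Psi>"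
proof -
  interpret vector_space s by fact
  show "wsum s e c xs (\<lambda>ys. \<Psi> ys + \<Psi>' ys) = wsum s e c xs \<Psi> + wsum s e c xs \<Psi>'"
    by (induction xs arbitrary: c \<Psi> \<Psi>') (simp_all add: scale_right_distrib)
  show "wsum s e c xs (\<lambda>ys. 0) = 0" by (induction xs arbitrary: c) simp_all
  show minus: "wsum s e c xs (\<lambda>ys. - \<Psi> ys) = - wsum s e c xs \<Psi>"
    by (induction xs arbitrary: c \<Psi>) simp_all
  show "wsum s e c xs (\<lambda>ys. sg n (\<Psi> ys)) = sg n (wsum s e c xs \<Psi>)"
    by (simp add: sg_def minus)
  show "wsum s e c xs (\<lambda>ys. s a (\<Psi> ys)) = s a (wsum s e c xs \<Psi>)"
    by (induction xs arbitrary: c \<Psi>) (simp_all add: scale_right_distrib mult.commute)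
  show "wsum s e (\<lambda>j. c j + c' j) xs \<Psi> = wsum s e c xs \<Psi> + wsum s e c' xs \<Psi>"
    by (induction xs arbitrary: c c' \<Psi>) (simp_all add: scale_left_distrib)
  show "wsum s e (\<lambda>j. a * c j) xs \<Psi> = s a (wsum s e c xs \<Psi>)"
    by (induction xs arbitrary: c \<Psi>) (simp_all add: scale_right_distrib)
  show "wsum s e (\<lambda>j. 0) xs \<Psi> = 0" by (induction xs arbitrary: \<Psi>) simp_all
  show "wsum s e (\<lambda>j. - c j) xs \<Psi> = - wsum s e c xs \<Psi>"
    by (induction xs arbitrary: c \<Psi>) simp_all
qed

lemma wsum_none:
  assumes "vector_space s"
  shows "wsum s e (\<lambda>j. if j = 0 then 1 else 0) xs \<Psi> = \<Psi> xs"
proof -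
  interpret vector_space s by fact
  show ?thesis by (induction xs arbitrary: \<Psi>) (simp_all add: wsum_weight_zero[OF assms])
qed

lemma wsum_all:
  assumes "vector_space s"
  shows "wsum s e (\<lambda>j. if j = length xs then 1 else 0) xs \<Psi> = \<Psi> (map e xs)"
proof (induction xs arbitrary: \<Psi>)
  interpret vector_space s by fact
  case (Cons x xs)
  have "wsum s e (\<lambda>j. if j = Suc (length xs) then 1 else 0) xs (\<lambda>ys. \<Psi> (x # ys)) = wsum s e (\<lambda>j. 0) xs (\<lambda>ys. \<Psi> (x # ys))"
    by (rule wsum_cong_weight) simp
  then show ?case by (simp add: wsum_weight_zero[OF assms] Cons.IH)
qed (simp add: vector_space.vector_space_assms[OF assms])

context graded_space
begin

lemma wsum_cong:
  assumes "graded_linear V V 0 e" "hom_word V xs"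
    and "\<And>ys. hom_word V ys \<Longrightarrow> length ys = length xs \<Longrightarrow> \<Psi> ys = \<Psi>' ys"
  shows "wsum s e c xs \<Psi> = wsum s e c xs \<Psi>'"
  using assms(2,3)
proof (induction xs arbitrary: c \<Psi> \<Psi>')
  case (Cons x xs)
  have "wsum s e c xs (\<lambda>ys. \<Psi> (x # ys)) = wsum s e c xs (\<lambda>ys. \<Psi>' (x # ys))" for c
    by (rule Cons.IH) (use Cons.prems in auto)
  moreover have "wsum s e c xs (\<lambda>ys. \<Psi> (e x # ys)) = wsum s e c xs (\<lambda>ys. \<Psi>' (e x # ys))" for c
    by (rule Cons.IH) (use Cons.prems graded_linear_homogeneous[OF assms(1)] in auto)
  ultimately show ?case by simp
qed simp

lemma wsum_eq_0:
  assumes "vector_space s" "graded_linear V V 0 e" "hom_word V xs"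
    and "\<And>ys. hom_word V ys \<Longrightarrow> length ys = length xs \<Longrightarrow> \<Psi> ys = 0"
  shows "wsum s e c xs \<Psi> = 0"
  using wsum_cong[OF assms(2,3), of \<Psi> "\<lambda>_. 0"] assms(4) wsum_zero[OF assms(1)] by metis

text \<open>The weight depends only on the number of letters affected. Exchanging two neighbours
  thus permutes the four cases of which of them are affected, and \<open>e\<close> has degree 0, so
  the sign is the same in all of them.\<close>

lemma gsm_wsum:
  assumes e: "graded_linear V V 0 e" and \<Psi>: "gsm V s \<Psi>"
  shows "gsm V s (\<lambda>xs. wsum s e c xs \<Psi>)"
proof (rule gsmI[OF gsm_vs[OF \<Psi>]], goal_cases)
  note s = gsm_vs[OF \<Psi>]
  note el = graded_linear_linear[OF e] and eg = graded_linear_grd[OF e] and eh = graded_linear_homogeneous[OF e]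
  case (1 us vs)
  then show ?case using \<Psi>
  proof (induction us arbitrary: c \<Psi>)
    case Nil
    have "wsum s e c vs (\<lambda>ys. \<Psi> (0 # ys)) = 0" for c
      by (rule wsum_eq_0[OF s e Nil(2)]) (rule gsm_Cons_0[OF Nil(3)])
    then show ?case by (simp add: vs_linear_0[OF el])
  next
    case (Cons z us)
    then show ?case using gsm_Cons[OF Cons.prems(3), of z] gsm_Cons[OF Cons.prems(3), of "e z"] eh[of z] by simp
  qed
next
  note s = gsm_vs[OF \<Psi>]
  note el = graded_linear_linear[OF e] and eg = graded_linear_grd[OF e] and eh = graded_linear_homogeneous[OF e]
  interpret s: vector_space s by fact
  case (2 us vs x a)
  note x = 2(3)
  from 2(1,2) show ?case using \<Psi>
  proof (induction us arbitrary: c \<Psi>)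
    case Nil
    have "wsum s e c vs (\<lambda>ys. \<Psi> (scl V a y # ys)) = s a (wsum s e c vs (\<lambda>ys. \<Psi> (y # ys)))"
      if "y \<in> homogeneous V" for c y
      unfolding wsum_scale[OF s, symmetric]
      by (rule wsum_cong[OF e Nil(2)]) (use gsm_scale[OF Nil(3) _ _ that, of "[]"] in simp)
    then show ?case using x eh[OF x] by (simp add: vs_linear_scale[OF el] s.scale_right_distrib)
  next
    case (Cons z us)
    then show ?case using gsm_Cons[OF Cons.prems(3), of z] gsm_Cons[OF Cons.prems(3), of "e z"] eh[of z]
      by (simp add: s.scale_right_distrib)
  qed
next
  note s = gsm_vs[OF \<Psi>]
  note el = graded_linear_linear[OF e] and eg = graded_linear_grd[OF e] and eh = graded_linear_homogeneous[OF e]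
  case (3 us vs x y)
  define n where "n = deg V x"
  have xy: "x \<in> grd V n" "y \<in> grd V n" using in_grd_deg[OF 3(3)] in_grd_deg[OF 3(4)] 3(9) by (simp_all add: n_def)
  from 3(1,2) show ?case using \<Psi>
  proof (induction us arbitrary: c \<Psi>)
    case Nil
    have "wsum s e c vs (\<lambda>ys. \<Psi> ((x' + y') # ys)) = wsum s e c vs (\<lambda>ys. \<Psi> (x' # ys)) + wsum s e c vs (\<lambda>ys. \<Psi> (y' # ys))"
      if "x' \<in> grd V n" "y' \<in> grd V n" for c x' y'
      unfolding wsum_add[OF s, symmetric]
      by (rule wsum_cong[OF e Nil(2)]) (use gsm_add[OF Nil(3) _ _ that, of "[]"] in simp)
    then show ?case using xy eg[OF xy(1)] eg[OF xy(2)] by (simp add: vs_linear_add[OF el])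
  next
    case (Cons z us)
    then show ?case using gsm_Cons[OF Cons.prems(3), of z] gsm_Cons[OF Cons.prems(3), of "e z"] eh[of z]
      by simp
  qed
next
  note s = gsm_vs[OF \<Psi>]
  note el = graded_linear_linear[OF e] and eg = graded_linear_grd[OF e] and eh = graded_linear_homogeneous[OF e]
  case (4 us vs x y)
  define m n where "m = deg V x" and "n = deg V y"
  have xy: "x \<in> grd V m" "y \<in> grd V n" using in_grd_deg[OF 4(3)] in_grd_deg[OF 4(4)] by (simp_all add: m_def n_def)
  have exy: "e x \<in> grd V m" "e y \<in> grd V n" using eg[OF xy(1)] eg[OF xy(2)] by auto
  from 4(1,2) show ?case using \<Psi> unfolding m_def[symmetric] n_def[symmetric]
  proof (induction us arbitrary: c \<Psi>)
    case Nil
    have sw: "wsum s e c vs (\<lambda>ys. \<Psi> (x' # y' # ys)) = sg (m * n) (wsum s e c vs (\<lambda>ys. \<Psi> (y' # x' # ys)))"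
      if "x' \<in> grd V m" "y' \<in> grd V n" for c x' y'
      unfolding wsum_sg[OF s, symmetric]
      by (rule wsum_cong[OF e Nil(2)]) (rule gsm_Cons_swap[OF Nil(3) _ that])
    show ?case
      using sw[OF xy] sw[OF exy] sw[OF xy(1) exy(2)] sw[OF exy(1) xy(2)] by (simp add: sg_add algebra_simps)
  next
    case (Cons z us)
    then show ?case using gsm_Cons[OF Cons.prems(3), of z] gsm_Cons[OF Cons.prems(3), of "e z"] eh[of z]
      by (simp add: sg_add)
  qed
qed

text \<open>Since \<open>e\<close> has degree 0 and commutes with \<open>f\<close>, neither the
  selection of affected letters nor the Koszul signs interfere.\<close>

lemma cod_on_letter_wsum_commute:
  assumes e: "graded_linear V V 0 e" and f: "graded_linear V V k f"
    and fe: "\<And>x. x \<in> homogeneous V \<Longrightarrow> f (e x) = e (f x)"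
    and "gsm V s \<Psi>" "hom_word V xs"
  shows "cod V (on_letter f) xs (\<lambda>ys. wsum s e c ys \<Psi>) = wsum s e c xs (\<lambda>ys. cod V (on_letter f) ys \<Psi>)"
  using assms(4,5)
proof (induction xs arbitrary: c \<Psi>)
  case Nil
  interpret s: vector_space s using gsm_vs[OF Nil(1)] .
  show ?case by (simp add: cod_on_letter_Nil[OF gsm_wsum[OF e Nil(1)]] cod_on_letter_Nil[OF Nil(1)])
next
  case (Cons x xs)
  note \<Psi> = \<open>gsm V s \<Psi>\<close>
  note s = gsm_vs[OF \<Psi>]
  define m where "m = deg V x"
  have x: "x \<in> grd V m" and hx: "x \<in> homogeneous V" and xs: "hom_word V xs"
    using Cons.prems in_grd_deg[of x] by (auto simp: m_def)
  have ex: "e x \<in> grd V m" using graded_linear_grd[OF e x] by simp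
  note of = gsm_deg_on_letter_self[OF f]
  have w: "wsum s e c xs (\<lambda>ys. cod V (on_letter f) (y # ys) \<Psi>)
      = wsum s e c xs (\<lambda>ys. \<Psi> (f y # ys)) + sg (k * m) (cod V (on_letter f) xs (\<lambda>ys. wsum s e c ys (\<lambda>ys. \<Psi> (y # ys))))"
    if "y \<in> grd V m" for y c
  proof -
    have "wsum s e c xs (\<lambda>ys. cod V (on_letter f) (y # ys) \<Psi>)
      = wsum s e c xs (\<lambda>ys. \<Psi> (f y # ys) + sg (k * m) (cod V (on_letter f) ys (\<lambda>ys. \<Psi> (y # ys))))"
      by (rule wsum_cong[OF e xs]) (rule cod_on_letter_Cons[OF f \<Psi> that])
    then show ?thesis
      by (simp add: wsum_add[OF s] wsum_sg[OF s] Cons.IH[OF gsm_Cons[OF \<Psi> homogeneousI[OF that]] xs])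
  qed
  show ?case
    by (simp add: cod_on_letter_Cons[OF f gsm_wsum[OF e \<Psi>] x xs] cod_add w[OF x] w[OF ex] fe[OF hx] sg_add)
qed

text \<open>As \<open>e (r x) = 0\<close>, the letter hit by \<open>r = 1 - e\<close> must not be
  among the affected ones. Its part 1 gives a word with \<open>j\<close> affected letters from each
  of the n - j free places. Its part \<open>- e\<close> enlarges the set of affected letters, and a
  set of size \<open>j\<close> arises in this way from \<open>j\<close> sets of size j - 1.\<close>

lemma cod_on_letter_wsum:
  assumes e: "graded_linear V V 0 e" and r: "graded_linear V V 0 r"
    and re: "\<And>x. x \<in> homogeneous V \<Longrightarrow> r x = x - e x" and ee: "\<And>x. x \<in> homogeneous V \<Longrightarrow> e (e x) = e x"
    and "gsm V s \<Psi>" "hom_word V xs"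
  shows "cod V (on_letter r) xs (\<lambda>ys. wsum s e c ys \<Psi>)
    = wsum s e (\<lambda>j. (of_nat (length xs) - of_nat j) * c j - of_nat j * c (j - 1)) xs \<Psi>"
  using assms(5,6)
proof (induction xs arbitrary: c \<Psi>)
  case Nil
  interpret s: vector_space s using gsm_vs[OF Nil(1)] .
  show ?case by (simp add: cod_on_letter_Nil[OF gsm_wsum[OF e Nil(1)]] cod_on_letter_Nil[OF Nil(1)])
next
  case (Cons x xs)
  note \<Psi> = \<open>gsm V s \<Psi>\<close>
  note s = gsm_vs[OF \<Psi>]
  interpret s: vector_space s by fact
  define m where "m = deg V x"
  have x: "x \<in> grd V m" and hx: "x \<in> homogeneous V" and xs: "hom_word V xs"
    using Cons.prems in_grd_deg[of x] by (auto simp: m_def)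
  have ex: "e x \<in> grd V m" using graded_linear_grd[OF e x] by simp
  have hex: "e x \<in> homogeneous V" by (rule homogeneousI[OF ex])
  let ?n = "of_nat (length xs)"
  have "wsum s e c xs (\<lambda>ys. \<Psi> (r x # ys)) = wsum s e c xs (\<lambda>ys. \<Psi> (x # ys)) - wsum s e c xs (\<lambda>ys. \<Psi> (e x # ys))"
  proof -
    have "wsum s e c xs (\<lambda>ys. \<Psi> (r x # ys)) = wsum s e c xs (\<lambda>ys. \<Psi> (x # ys) + - \<Psi> (e x # ys))"
    proof (rule wsum_cong[OF e xs])
      fix ys assume ys: "hom_word V ys"
      show "\<Psi> (r x # ys) = \<Psi> (x # ys) + - \<Psi> (e x # ys)"
        using gsm_add[OF \<Psi> _ ys x grd_minus[OF ex], of "[]"] gsm_sg[OF \<Psi> _ ys hex, of "[]" 1] re[OF hx]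
        by (simp add: sg_def)
    qed
    also have "\<dots> = wsum s e c xs (\<lambda>ys. \<Psi> (x # ys)) - wsum s e c xs (\<lambda>ys. \<Psi> (e x # ys))"
      by (simp only: wsum_add[OF s] wsum_uminus[OF s]) simp
    finally show ?thesis .
  qed
  moreover have "wsum s e c' xs (\<lambda>ys. \<Psi> (e (r x) # ys)) = 0" for c'
  proof -
    have "e (r x) = 0"
      using ee[OF hx] re[OF hx] vs_linear_diff[OF graded_linear_linear[OF e]] by simp
    then show ?thesis by (simp add: wsum_eq_0[OF s e xs] gsm_Cons_0[OF \<Psi>])
  qed
  ultimately have "cod V (on_letter r) (x # xs) (\<lambda>ys. wsum s e c ys \<Psi>)
    = wsum s e c xs (\<lambda>ys. \<Psi> (x # ys)) + wsum s e (\<lambda>j. (?n - of_nat j) * c j - of_nat j * c (j - 1)) xs (\<lambda>ys. \<Psi> (x # ys))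
      + (wsum s e (\<lambda>j. (?n - of_nat j) * c (Suc j) - of_nat j * c (Suc (j - 1))) xs (\<lambda>ys. \<Psi> (e x # ys))
        + - wsum s e c xs (\<lambda>ys. \<Psi> (e x # ys)))"
    by (simp add: cod_on_letter_Cons[OF r gsm_wsum[OF e \<Psi>] x xs] cod_add
        Cons.IH[OF gsm_Cons[OF \<Psi> hx] xs] Cons.IH[OF gsm_Cons[OF \<Psi> hex] xs])
  also have "\<dots> = wsum s e (\<lambda>j. c j + ((?n - of_nat j) * c j - of_nat j * c (j - 1))) xs (\<lambda>ys. \<Psi> (x # ys))
      + wsum s e (\<lambda>j. ((?n - of_nat j) * c (Suc j) - of_nat j * c (Suc (j - 1))) + - c j) xs (\<lambda>ys. \<Psi> (e x # ys))"
    by (simp only: wsum_weight_add[OF s] wsum_weight_minus[OF s])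
  also have "\<dots> = wsum s e (\<lambda>j. (of_nat (length (x # xs)) - of_nat j) * c j - of_nat j * c (j - 1)) (x # xs) \<Psi>"
    unfolding wsum.simps
  proof (intro arg_cong2[where f = "(+)"] wsum_cong_weight)
    fix j
    \<comment> \<open>For \<open>j = 0\<close> truncated subtraction makes
      \<open>Suc (j - 1)\<close> differ from \<open>j\<close>, but the coefficient
      \<open>of_nat j\<close> is 0 there.\<close>
    show "(?n - of_nat j) * c (Suc j) - of_nat j * c (Suc (j - 1)) + - c j
        = (of_nat (length (x # xs)) - of_nat (Suc j)) * c (Suc j) - of_nat (Suc j) * c (Suc j - 1)"
      by (cases j) (simp_all add: algebra_simps)
  qed (simp add: algebra_simps)
  finally show ?case .
qed

end

subsection \<open>The homotopy\<close>

text \<open>The inner sum over permutations in K_n for fixed \<open>j\<close>, without the factor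
  1/(n - j) and the overall 1/n!.\<close>

definition psum :: "('k::field, 'a, 'z) gvs_scheme \<Rightarrow> ('k \<Rightarrow> 'v \<Rightarrow> 'v::ab_group_add) \<Rightarrow> ('a \<Rightarrow> 'a) \<Rightarrow> nat
    \<Rightarrow> 'a list \<Rightarrow> ('a list \<Rightarrow> 'v) \<Rightarrow> 'v" where
  "psum V s e j xs \<Psi> = (\<Sum>\<sigma> | \<sigma> permutes {..<length xs}. s (koszul V \<sigma> xs)
     (\<Psi> (map e (take j (permute_list \<sigma> xs)) @ drop j (permute_list \<sigma> xs))))"

lemma wsum_linear: "Vector_Spaces.linear s s' f \<Longrightarrow> wsum s' e c xs (\<lambda>ys. f (\<Psi> ys)) = f (wsum s e c xs \<Psi>)"
  by (induction xs arbitrary: c \<Psi>) (simp_all add: vs_linear_add vs_linear_scale)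

lemma wsum_weight_sum:
  assumes "vector_space s" "finite A"
  shows "wsum s e (\<lambda>i. \<Sum>j\<in>A. c j i) xs \<Psi> = (\<Sum>j\<in>A. wsum s e (c j) xs \<Psi>)"
  using assms(2) by (induction A rule: finite_induct) (simp_all add: wsum_weight_zero wsum_weight_add assms(1))

context graded_space
begin

text \<open>Sort the permutations by the position of the first letter. It is affected by
  \<open>e\<close> at the first \<open>j\<close> positions and unaffected at the others; moving it
  to the front cancels the new Koszul sign, so the value depends only on which of the two
  happens.\<close>

lemma psum_Cons:
  assumes e: "graded_linear V V 0 e" and \<Psi>: "gsm V s \<Psi>" and xs: "hom_word V (x # xs)"
    and j: "j \<le> Suc (length xs)"
  shows "psum V s e j (x # xs) \<Psi> = s (of_nat j) (psum V s e (j - 1) xs (\<lambda>ys. \<Psi> (e x # ys)))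
    + s (of_nat (Suc (length xs) - j)) (psum V s e j xs (\<lambda>ys. \<Psi> (x # ys)))"
proof -
  note s = gsm_vs[OF \<Psi>]
  interpret s: vector_space s by fact
  let ?n = "length xs"
  define m where "m = deg V x"
  have x: "x \<in> grd V m" using xs in_grd_deg[of x] by (simp add: m_def)
  have ex: "e x \<in> grd V m" using graded_linear_grd[OF e x] by simp
  have map_e: "graded_word (map e us) (map (deg V) us)" if "hom_word V us" for us
    using that graded_linear_grd[OF e in_grd_deg] by (induction us) auto
  have hom_e: "hom_word V (map e us)" if "hom_word V us" for us
    using that graded_linear_homogeneous[OF e] by auto
  have sum_deg: "sum_list (map (deg V) us) = wdeg V us" for us by (simp add: wdeg_def)
  have word: "s (koszul V (cins p \<sigma>) (x # xs)) (\<Psi> (map e (take j (permute_list (cins p \<sigma>) (x # xs)))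
        @ drop j (permute_list (cins p \<sigma>) (x # xs))))
     = s (koszul V \<sigma> xs) (if p < j
          then \<Psi> (e x # map e (take (j - 1) (permute_list \<sigma> xs)) @ drop (j - 1) (permute_list \<sigma> xs))
          else \<Psi> (x # map e (take j (permute_list \<sigma> xs)) @ drop j (permute_list \<sigma> xs)))"
    if \<sigma>: "\<sigma> permutes {..<?n}" and p: "p \<le> ?n" for \<sigma> p
  proof -
    define v where "v = permute_list \<sigma> xs"
    have v: "hom_word V v" "length v = ?n" using xs \<sigma> by (simp_all add: v_def)
    have hv: "hom_word V (take k v)" "hom_word V (drop k v)" for k
      using v(1) set_take_subset[of k v] set_drop_subset[of k v] by auto
    have "\<Psi> (map e (take j (take p v @ x # drop p v)) @ drop j (take p v @ x # drop p v))
      = sg (m * wdeg V (take p v)) (if p < j then \<Psi> (e x # map e (take (j - 1) v) @ drop (j - 1) v)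
          else \<Psi> (x # map e (take j v) @ drop j v))"
    proof (cases "p < j")
      case True
      then obtain k where k: "j = Suc (p + k)" using less_iff_Suc_add by auto
      have "take (p + k) v = take p v @ take k (drop p v)" by (rule take_add)
      then have split: "map e (take (j - 1) v) @ drop (j - 1) v = map e (take p v) @ map e (take k (drop p v)) @ drop k (drop p v)"
        using k by (simp add: add.commute)
      have "map e (take j (take p v @ x # drop p v)) @ drop j (take p v @ x # drop p v)
          = map e (take p v) @ e x # (map e (take k (drop p v)) @ drop k (drop p v))"
        using k v(2) p by (simp add: min_def)
      also have "\<Psi> \<dots> = sg (m * sum_list (map (deg V) (take p v)))
          (\<Psi> (e x # map e (take p v) @ map e (take k (drop p v)) @ drop k (drop p v)))"
        by (rule gsm_move[OF \<Psi> map_e[OF hv(1)] ex])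
          (use hom_e[of "take k (drop p v)"] hv(2)[of p] set_take_subset[of k "drop p v"] set_drop_subset[of k "drop p v"] in \<open>auto simp del: set_map\<close>)
      finally show ?thesis using True by (simp only: split sum_deg if_True)
    next
      case False
      then obtain k where k: "p = j + k" using le_Suc_ex[of j p] by auto
      have "take p v = take j v @ take k (drop j v)" "drop p v = drop k (drop j v)"
        using k by (simp_all add: take_add add.commute)
      then have split: "map e (take j (take p v @ x # drop p v)) @ drop j (take p v @ x # drop p v)
          = (map e (take j v) @ take k (drop j v)) @ x # drop p v"
        "map e (take j v) @ drop j v = (map e (take j v) @ take k (drop j v)) @ drop p v"
        using k v(2) p by (simp add: min_def, simp only: append_assoc append_take_drop_id)
      have g: "graded_word (map e (take j v) @ take k (drop j v)) (map (deg V) (take j v) @ map (deg V) (take k (drop j v)))"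
        by (rule list_all2_appendI[OF map_e[OF hv(1)] hom_word_graded_word])
          (use hv(2)[of j] set_take_subset[of k "drop j v"] in auto)
      have "sum_list (map (deg V) (take j v) @ map (deg V) (take k (drop j v))) = wdeg V (take p v)"
        using k by (simp add: wdeg_def take_add)
      with gsm_move[OF \<Psi> g x hv(2)[of p]] show ?thesis
        using False by (simp only: split if_False)
    qed
    moreover have "koszul V (cins p \<sigma>) (x # xs) = (-1) powi (m * wdeg V (take p v)) * koszul V \<sigma> xs"
      using koszul_cins[OF \<sigma> p, of V x] by (simp add: v_def m_def)
    moreover have "s ((-1) powi (m * wdeg V (take p v)) * koszul V \<sigma> xs) (sg (m * wdeg V (take p v)) y) = s (koszul V \<sigma> xs) y" for y
      by (simp add: sg_def)
    ultimately show ?thesis using permute_list_cins[OF \<sigma> p, of x] by (simp add: v_def)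
  qed
  have "psum V s e j (x # xs) \<Psi> = (\<Sum>p\<le>?n. \<Sum>\<sigma> | \<sigma> permutes {..<?n}. s (koszul V \<sigma> xs) (if p < j
          then \<Psi> (e x # map e (take (j - 1) (permute_list \<sigma> xs)) @ drop (j - 1) (permute_list \<sigma> xs))
          else \<Psi> (x # map e (take j (permute_list \<sigma> xs)) @ drop j (permute_list \<sigma> xs))))"
    unfolding psum_def list.size(4) add_Suc_right add_0_right sum_permutes_Suc
    by (intro sum.cong refl word) auto
  also have "\<dots> = (\<Sum>p\<le>?n. if p < j then psum V s e (j - 1) xs (\<lambda>ys. \<Psi> (e x # ys)) else psum V s e j xs (\<lambda>ys. \<Psi> (x # ys)))"
    by (intro sum.cong refl) (simp add: psum_def)
  also have "\<dots> = (\<Sum>p\<in>{..?n} \<inter> {p. p < j}. psum V s e (j - 1) xs (\<lambda>ys. \<Psi> (e x # ys)))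
      + (\<Sum>p\<in>{..?n} \<inter> - {p. p < j}. psum V s e j xs (\<lambda>ys. \<Psi> (x # ys)))"
    by (rule sum.If_cases) simp
  also have "{..?n} \<inter> {p. p < j} = {..<j}" using j by auto
  also have "{..?n} \<inter> - {p. p < j} = {j..<Suc ?n}" by auto
  finally show ?thesis by (simp only: s.sum_constant_scale card_lessThan card_atLeastLessThan)
qed

end

text \<open>A given choice of \<open>j\<close> affected letters arises from j! (n - j)!
  permutations, and graded symmetry makes their contributions equal.\<close>

lemma psum_eq_wsum:
  fixes V :: "('k::field_char_0, 'a::ab_group_add, 'z) gvs_scheme"
  assumes V: "graded_space V" and e: "graded_linear V V 0 e" and "gsm V s \<Psi>" "hom_word V xs" "j \<le> length xs"
  shows "psum V s e j xs \<Psi> = wsum s e (\<lambda>i. if i = j then fact j * fact (length xs - j) else 0) xs \<Psi>"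
  using assms(3-)
proof (induction xs arbitrary: j \<Psi>)
  case Nil
  interpret s: vector_space s using gsm_vs[OF Nil(1)] .
  have "koszul V id [] = 1" by (simp add: koszul_def)
  then show ?case using Nil by (simp add: psum_def)
next
  case (Cons x xs)
  interpret graded_space V by fact
  note \<Psi> = \<open>gsm V s \<Psi>\<close>
  note s = gsm_vs[OF \<Psi>]
  interpret s: vector_space s by fact
  let ?n = "length xs"
  have hx: "x \<in> homogeneous V" and hex: "e x \<in> homogeneous V" and xs: "hom_word V xs"
    using Cons.prems graded_linear_homogeneous[OF e, of x] by auto
  have "s (of_nat j) (psum V s e (j - 1) xs (\<lambda>ys. \<Psi> (e x # ys)))
      = wsum s e (\<lambda>i. if Suc i = j then fact j * fact (Suc ?n - j) else 0) xs (\<lambda>ys. \<Psi> (e x # ys))"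
  proof (cases j)
    case (Suc k)
    then have "psum V s e (j - 1) xs (\<lambda>ys. \<Psi> (e x # ys)) = wsum s e (\<lambda>i. if i = k then fact k * fact (?n - k) else 0) xs (\<lambda>ys. \<Psi> (e x # ys))"
      using Cons.IH[OF gsm_Cons[OF \<Psi> hex] xs, of k] Cons.prems(3) by simp
    then show ?thesis
      by (simp only: wsum_weight_scale[OF s, symmetric]) (rule wsum_cong_weight, simp add: Suc)
  qed (simp add: wsum_weight_zero[OF s])
  moreover have "s (of_nat (Suc ?n - j)) (psum V s e j xs (\<lambda>ys. \<Psi> (x # ys)))
      = wsum s e (\<lambda>i. if i = j then fact j * fact (Suc ?n - j) else 0) xs (\<lambda>ys. \<Psi> (x # ys))"
  proof (cases "j \<le> ?n")
    case True
    then show ?thesis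
      by (simp only: Cons.IH[OF gsm_Cons[OF \<Psi> hx] xs True] wsum_weight_scale[OF s, symmetric])
        (rule wsum_cong_weight, simp add: Suc_diff_le)
  next
    case False
    have "wsum s e (\<lambda>i. if i = j then fact j * fact (Suc ?n - j) else 0) xs (\<lambda>ys. \<Psi> (x # ys)) = wsum s e (\<lambda>i. 0) xs (\<lambda>ys. \<Psi> (x # ys))"
      by (rule wsum_cong_weight) (use False in auto)
    then show ?thesis using False by (simp add: wsum_weight_zero[OF s])
  qed
  ultimately show ?case
    using psum_Cons[OF e \<Psi> Cons.prems(2), of j] Cons.prems(3) by (simp add: add.commute cong: if_cong)
qed

text \<open>The multiplicity j! (n - j)! from \<open>psum_eq_wsum\<close> times the prefactors of
  K_n. It is 0 for \<open>j = n\<close> because the sum in K_n stops at n - 1.\<close>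

definition K_weight :: "nat \<Rightarrow> nat \<Rightarrow> 'k::field_char_0" where
  "K_weight n j = (if j < n then fact j * fact (n - j) / (fact n * of_nat (n - j)) else 0)"

text \<open>For 0 < j < n both products equal j! (n - j)! / n!. At \<open>j = 0\<close> the weight
  is 1/n, and at \<open>j = n\<close> only the preceding weight, again 1/n, contributes.\<close>

lemma K_weight_recursion:
  assumes "0 < n" "j \<le> n"
  shows "(of_nat n - of_nat j) * K_weight n j - of_nat j * K_weight n (j - 1)
    = (if j = 0 then 1 else 0) + - (if j = n then 1 else (0::'k::field_char_0))"
proof -
  consider "j = 0" | "0 < j" "j < n" | "j = n" using assms by linarith
  then show ?thesis
  proof cases
    case 1
    then show ?thesis using assms by (simp add: K_weight_def)
  next
    case 2
    then obtain l where l: "j = Suc l" by (cases j) auto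
    obtain k where k: "n = j + Suc k" using 2(2) less_iff_Suc_add by auto
    have nj: "of_nat n - of_nat j = (of_nat (Suc k) :: 'k)" using k by simp
    have "(of_nat n - of_nat j) * K_weight n j = fact j * fact (Suc k) / (fact n :: 'k)"
      using 2 unfolding nj by (simp add: K_weight_def k del: of_nat_Suc fact_Suc)
    moreover have "of_nat j * K_weight n (j - 1) = fact j * fact (Suc k) / (fact n :: 'k)"
    proof -
      have "n - l = Suc (Suc k)" "l < n" using k l by auto
      then have "K_weight n (j - 1) = fact l * (fact (Suc (Suc k)) / of_nat (Suc (Suc k))) / (fact n :: 'k)"
        by (simp add: K_weight_def l del: of_nat_Suc fact_Suc)
      also have "fact (Suc (Suc k)) / of_nat (Suc (Suc k)) = (fact (Suc k) :: 'k)"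
        unfolding fact_Suc[of "Suc k"] by (simp del: of_nat_Suc fact_Suc)
      finally show ?thesis unfolding l fact_Suc[of l] by (simp del: of_nat_Suc fact_Suc)
    qed
    ultimately show ?thesis using 2 by simp
  next
    case 3
    then obtain l where l: "n = Suc l" using assms by (cases n) auto
    have "of_nat (Suc l) * (fact l / fact (Suc l)) = (1::'k)"
      unfolding fact_Suc[of l] by (simp del: of_nat_Suc)
    then show ?thesis using 3 l by (simp add: K_weight_def del: of_nat_Suc fact_Suc)
  qed
qed

lemma lin_ext_K_map:
  fixes B :: "('k::field_char_0, 'b::ab_group_add) dgla"
  assumes V: "graded_space (B\<lbrakk>1\<rbrakk>)" and e: "graded_linear (B\<lbrakk>1\<rbrakk>) (B\<lbrakk>1\<rbrakk>) 0 e"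
    and \<Psi>: "gsm (B\<lbrakk>1\<rbrakk>) s \<Psi>" and xs: "hom_word (B\<lbrakk>1\<rbrakk>) xs"
  shows "lin_ext s \<Psi> (K_map B e (gen xs)) = wsum s e (K_weight (length xs)) xs \<Psi>"
proof -
  interpret graded_space "B\<lbrakk>1\<rbrakk>" by fact
  note s = gsm_vs[OF \<Psi>]
  interpret s: vector_space s by fact
  let ?n = "length xs" and ?V = "B\<lbrakk>1\<rbrakk>"
  let ?c = "\<lambda>j i. (1 / (fact ?n * of_nat (?n - j))) * (if i = j then fact j * fact (?n - j) else 0)"
  have "lin_ext s \<Psi> (K_map B e (gen xs))
      = s (1 / fact ?n) (\<Sum>j\<in>{0..<?n}. s (1 / of_nat (?n - j)) (psum ?V s e j xs \<Psi>))"
    by (simp add: K_map_def Let_def lin_ext_gen free.vector_space_axioms s lin_ext_scale lin_ext_sum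
        psum_def s.scale_sum_right)
  also have "\<dots> = (\<Sum>j\<in>{0..<?n}. wsum s e (?c j) xs \<Psi>)"
    unfolding s.scale_sum_right wsum_weight_scale[OF s]
    by (intro sum.cong refl) (simp add: psum_eq_wsum[OF V e \<Psi> xs])
  also have "\<dots> = wsum s e (K_weight ?n) xs \<Psi>"
    unfolding wsum_weight_sum[OF s finite_atLeastLessThan, symmetric]
  proof (rule wsum_cong_weight)
    fix i
    have "(\<Sum>j = 0..<?n. ?c j i :: 'k) = (\<Sum>j = 0..<?n. if j = i then fact i * fact (?n - i) / (fact ?n * of_nat (?n - i)) else 0)"
      by (rule sum.cong) (auto simp: divide_inverse)
    also have "\<dots> = K_weight ?n i" by (simp add: K_weight_def)
    finally show "(\<Sum>j = 0..<?n. ?c j i) = (K_weight ?n i :: 'k)" .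
  qed
  finally show ?thesis .
qed

text \<open>The transpose of H_n, with n the length of the word: first \<open>H_tilde\<close>, whose
  overall sign is put on the letter as \<open>- h x\<close>, then K.\<close>

definition hop :: "('k::field_char_0, 'b::ab_group_add) dgla \<Rightarrow> ('b \<Rightarrow> 'b) \<Rightarrow> ('b \<Rightarrow> 'b) \<Rightarrow> ('k \<Rightarrow> 'v \<Rightarrow> 'v::ab_group_add)
    \<Rightarrow> 'b list \<Rightarrow> ('b list \<Rightarrow> 'v) \<Rightarrow> 'v" where
  "hop B e h s xs \<Psi> = cod (B\<lbrakk>1\<rbrakk>) (on_letter (\<lambda>x. - h x)) xs (\<lambda>ys. wsum s e (K_weight (length ys)) ys \<Psi>)"

lemma hop_linear:
  assumes "Vector_Spaces.linear s s' f"
  shows "hop B e h s' xs (\<lambda>ys. f (\<Psi> ys)) = f (hop B e h s xs \<Psi>)"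
  unfolding hop_def wsum_linear[OF assms] by (rule cod_linear[OF assms])

section \<open>The contraction data and the homotopy on words\<close>

locale contraction = A: dgla A + B: dgla B
  for A :: "('k::field_char_0, 'a::ab_group_add) dgla" and B :: "('k, 'b::ab_group_add) dgla" +
  fixes i :: "'a \<Rightarrow> 'b" and p :: "'b \<Rightarrow> 'a" and h :: "'b \<Rightarrow> 'b"
  assumes quasi_i: "quasi_isomorphism A B i" and quasi_p: "quasi_isomorphism B A p"
    and h_linear: "Vector_Spaces.linear (scl B) (scl B) h" and h_grd: "\<forall>n. \<forall>x\<in>grd B n. h x \<in> grd B (n - 1)"
    and homotopy: "\<forall>x. h (dif B x) + dif B (h x) = x - i (p x)"
    and p_i: "\<forall>x. p (i x) = x"
    and h_i: "\<forall>x. h (i x) = 0"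
    and i_morphism: "dgla_morphism A B i"
begin

abbreviation "e \<equiv> i \<circ> p"
abbreviation "VA \<equiv> A\<lbrakk>1\<rbrakk>"
abbreviation "VB \<equiv> B\<lbrakk>1\<rbrakk>"
abbreviation "H \<equiv> hop B e h"

lemma i_linear: "Vector_Spaces.linear (scl A) (scl B) i" and i_grd: "x \<in> grd A n \<Longrightarrow> i x \<in> grd B n"
  and i_dif: "i (dif A x) = dif B (i x)" and i_brk: "i (brk A x y) = brk B (i x) (i y)"
  using i_morphism by (auto simp: dgla_morphism_def cochain_map_def)

lemma p_linear: "Vector_Spaces.linear (scl B) (scl A) p" and p_grd: "x \<in> grd B n \<Longrightarrow> p x \<in> grd A n"
  and p_dif: "p (dif B x) = dif A (p x)"
  using quasi_p by (auto simp: quasi_isomorphism_def cochain_map_def)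

lemma graded_linear_i: "graded_linear VA VB 0 i"
  using i_linear i_grd by (simp add: graded_linear_def)

lemma graded_linear_p: "graded_linear VB VA 0 p"
  using p_linear p_grd by (simp add: graded_linear_def)

lemma e_linear: "Vector_Spaces.linear (scl B) (scl B) e"
  by (rule vs_linearI)
    (simp_all add: B.Ls.vector_space_axioms vs_linear_add[OF i_linear] vs_linear_add[OF p_linear]
      vs_linear_scale[OF i_linear] vs_linear_scale[OF p_linear])

lemma graded_linear_e: "graded_linear VB VB 0 e"
  using e_linear i_grd p_grd by (simp add: graded_linear_def)

lemma graded_linear_h: "graded_linear VB VB (-1) (\<lambda>x. - h x)"
proof -
  have "Vector_Spaces.linear (scl B) (scl B) (\<lambda>x. - h x)"
    by (rule vs_linearI)
      (simp_all add: B.Ls.vector_space_axioms vs_linear_add[OF h_linear] vs_linear_scale[OF h_linear])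
  moreover have "- h x \<in> grd B n" if "x \<in> grd B (n + 1)" for x n
    using B.grd_minus[of "h x" "n - 1"] h_grd that by force
  ultimately show ?thesis by (simp add: graded_linear_def)
qed

lemma graded_linear_r: "graded_linear VB VB 0 (\<lambda>x. x - e x)"
proof -
  have "Vector_Spaces.linear (scl B) (scl B) (\<lambda>x. x - e x)"
    by (rule vs_linearI)
      (simp_all only: B.Ls.vector_space_axioms vs_linear_add[OF e_linear] vs_linear_scale[OF e_linear]
        B.Ls.scale_right_diff_distrib, simp)
  moreover have "x - e x \<in> grd VB (n + 0)" if "x \<in> grd VB n" for x n
    using B.grd_diff[OF that, of "e x"] graded_linear_grd[OF graded_linear_e that] by simp
  ultimately show ?thesis by (simp add: graded_linear_def)
qed

end

context dgla
begin

abbreviation "D1 \<equiv> on_letter (\<lambda>x. - dif L x)"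

lemma graded_linear_d: "graded_linear (L\<lbrakk>1\<rbrakk>) (L\<lbrakk>1\<rbrakk>) 1 (\<lambda>x. - dif L x)"
proof -
  have "Vector_Spaces.linear (scl L) (scl L) (\<lambda>x. - dif L x)"
    by (rule vs_linearI) (simp_all add: Ls.vector_space_axioms d_add d_scale)
  moreover have "- dif L x \<in> grd L (n + 1 + 1)" if "x \<in> grd L (n + 1)" for x n
    using grd_minus[of "dif L x" "n + 1"] dif_grd[OF dgla that] by simp
  ultimately show ?thesis by (simp add: graded_linear_def)
qed

end

text \<open>The graded commutator of an odd derivation with itself is twice its square, and by
  \<open>cod_on_letter_commutator\<close> it extends a multiple of d^2 = 0. Characteristic 0 allows
  division by 2.\<close>

lemma cod_D1_D1:
  fixes L :: "('k::field_char_0, 'a::ab_group_add) dgla"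
  assumes L: "is_dgla L" and \<Psi>: "gsm (L\<lbrakk>1\<rbrakk>) s \<Psi>" and xs: "hom_word (L\<lbrakk>1\<rbrakk>) xs"
  shows "cod (L\<lbrakk>1\<rbrakk>) (on_letter (\<lambda>x. - dif L x)) xs (\<lambda>ys. cod (L\<lbrakk>1\<rbrakk>) (on_letter (\<lambda>x. - dif L x)) ys \<Psi>) = 0"
    (is "?X = 0")
proof -
  interpret dgla L by standard fact
  interpret s: vector_space s using gsm_vs[OF \<Psi>] .
  have 0: "graded_linear (L\<lbrakk>1\<rbrakk>) (L\<lbrakk>1\<rbrakk>) (1 + 1) (\<lambda>x. 0)"
  proof -
    have "Vector_Spaces.linear (scl L) (scl L) (\<lambda>x. 0)"
      by (rule vs_linearI) (simp_all add: Ls.vector_space_axioms)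
    moreover have "0 \<in> grd L n" for n using grd_0[of "n - 1"] by simp
    ultimately show ?thesis by (simp add: graded_linear_def)
  qed
  have "?X - sg (1 * 1) ?X = cod (L\<lbrakk>1\<rbrakk>) (on_letter (\<lambda>x. 0)) xs \<Psi>"
    by (rule cod_on_letter_commutator[OF graded_linear_d graded_linear_d 0 _ \<Psi> xs])
      (simp add: d_minus dif_dif[OF dgla])
  also have "\<dots> = 0"
    unfolding cod_def
  proof (rule unsh_eq_0)
    fix u w :: "'a list" assume "set w \<subseteq> set xs"
    then have "hom_word (L\<lbrakk>1\<rbrakk>) w" using xs by auto
    then show "\<Psi> (on_letter (\<lambda>x. 0) u # w) = 0"
      using gsm_Cons_0[OF \<Psi>] by (cases u; cases "tl u") (auto simp: on_letter_length)
  qed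
  finally have "?X + ?X = 0" by (simp add: sg_def)
  then have "s 2 ?X = 0" using s.scale_left_distrib[of 1 1 ?X] by simp
  then show ?thesis by simp
qed

context contraction
begin

lemma gsm_wsum_K: "gsm VB s \<Psi> \<Longrightarrow> gsm VB s (\<lambda>ys. wsum s e (K_weight (length ys)) ys \<Psi>)"
  by (rule B.gsm_length_dep[where F = "\<lambda>n ys. wsum s e (K_weight n) ys \<Psi>"], rule B.gsm_wsum[OF graded_linear_e])

lemma gsm_H: "gsm VB s \<Psi> \<Longrightarrow> gsm VB s (\<lambda>xs. H s xs \<Psi>)"
  unfolding hop_def by (rule B.gsm_cod[OF B.gsm_deg_on_letter_self[OF graded_linear_h] gsm_wsum_K])

text \<open>The differential commutes with ip, hence with K. What remains is the commutator of the
  derivations extending d and h, which extends hd + dh = 1 - ip; its composite with K is evaluated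
  by \<open>cod_on_letter_wsum\<close> and telescopes.\<close>

lemma H_homotopy:
  assumes \<Psi>: "gsm VB s \<Psi>" and xs: "hom_word VB xs" "xs \<noteq> []"
  shows "cod VB B.D1 xs (\<lambda>ys. H s ys \<Psi>) + H s xs (\<lambda>ys. cod VB B.D1 ys \<Psi>) = \<Psi> xs - \<Psi> (map e xs)"
proof -
  note s = gsm_vs[OF \<Psi>]
  let ?n = "length xs" and ?h = "on_letter (\<lambda>x. - h x)"
  \<comment> \<open>All operators involved preserve the length, so the weights of K can be frozen at
    the length of \<open>xs\<close>.\<close>
  define \<Phi> where "\<Phi> zs = wsum s e (K_weight ?n) zs \<Psi>" for zs
  have \<Phi>: "gsm VB s \<Phi>" unfolding \<Phi>_def by (rule B.gsm_wsum[OF graded_linear_e \<Psi>])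
  note gh = B.gsm_deg_on_letter_self[OF graded_linear_h] and gd = B.gsm_deg_on_letter_self[OF B.graded_linear_d]
  have "cod VB B.D1 xs (\<lambda>ys. H s ys \<Psi>) = cod VB B.D1 xs (\<lambda>ys. cod VB ?h ys \<Phi>)"
  proof (rule B.cod_on_letter_cong[OF B.graded_linear_d gsm_H[OF \<Psi>] B.gsm_cod[OF gh \<Phi>] xs(1)])
    fix ys assume ys: "hom_word VB ys" "length ys = ?n"
    show "H s ys \<Psi> = cod VB ?h ys \<Phi>"
      unfolding hop_def
      by (rule B.cod_on_letter_cong[OF graded_linear_h gsm_wsum_K[OF \<Psi>] \<Phi> ys(1)]) (simp add: \<Phi>_def ys(2))
  qed
  moreover have "H s xs (\<lambda>ys. cod VB B.D1 ys \<Psi>) = cod VB ?h xs (\<lambda>zs. cod VB B.D1 zs \<Phi>)"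
    unfolding hop_def
  proof (rule B.cod_on_letter_cong[OF graded_linear_h gsm_wsum_K[OF B.gsm_cod[OF gd \<Psi>]] B.gsm_cod[OF gd \<Phi>] xs(1)])
    fix ys assume ys: "hom_word VB ys" "length ys = ?n"
    show "wsum s e (K_weight (length ys)) ys (\<lambda>ys. cod VB B.D1 ys \<Psi>) = cod VB B.D1 ys \<Phi>"
      unfolding \<Phi>_def ys(2)
      by (rule B.cod_on_letter_wsum_commute[OF graded_linear_e B.graded_linear_d _ \<Psi> ys(1), symmetric])
        (simp add: p_dif i_dif vs_linear_minus[OF e_linear, simplified])
  qed
  moreover have "cod VB B.D1 xs (\<lambda>ys. cod VB ?h ys \<Phi>) - sg (1 * - 1) (cod VB ?h xs (\<lambda>zs. cod VB B.D1 zs \<Phi>))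
      = cod VB (on_letter (\<lambda>x. x - e x)) xs \<Phi>"
  proof (rule B.cod_on_letter_commutator[OF B.graded_linear_d graded_linear_h _ _ \<Phi> xs(1)])
    show "graded_linear VB VB (1 + - 1) (\<lambda>x. x - e x)" using graded_linear_r by simp
    fix x
    show "x - e x = - h (- dif B x) - sg (1 * - 1) (- dif B (- h x))"
      using homotopy[rule_format, of x] by (simp add: sg_def vs_linear_minus[OF h_linear] B.d_minus)
  qed
  ultimately have "cod VB B.D1 xs (\<lambda>ys. H s ys \<Psi>) + H s xs (\<lambda>ys. cod VB B.D1 ys \<Psi>)
      = cod VB (on_letter (\<lambda>x. x - e x)) xs \<Phi>"
    by (simp add: sg_def)
  also have "\<dots> = wsum s e (\<lambda>j. (of_nat ?n - of_nat j) * K_weight ?n j - of_nat j * K_weight ?n (j - 1)) xs \<Psi>"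
    unfolding \<Phi>_def
    by (rule B.cod_on_letter_wsum[OF graded_linear_e graded_linear_r _ _ \<Psi> xs(1)]) (use p_i in auto)
  also have "\<dots> = wsum s e (\<lambda>j. (if j = 0 then 1 else 0) + - (if j = ?n then 1 else 0)) xs \<Psi>"
    by (rule wsum_cong_weight, rule K_weight_recursion) (use xs in auto)
  also have "\<dots> = \<Psi> xs - \<Psi> (map e xs)"
    by (simp only: wsum_weight_add[OF s] wsum_weight_minus[OF s] wsum_none[OF s] wsum_all[OF s]) simp
  finally show ?thesis .
qed

text \<open>The letter hit by \<open>h\<close> lies in the image of \<open>i\<close>, so every term
  is 0 before K is applied.\<close>

lemma H_map_i: "gsm VB s \<Psi> \<Longrightarrow> hom_word VB (map i ys) \<Longrightarrow> H s (map i ys) \<Psi> = 0"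
  unfolding hop_def cod_def
proof (rule unsh_eq_0)
  fix u w assume \<Psi>: "gsm VB s \<Psi>" and *: "hom_word VB (map i ys)" "set u \<subseteq> set (map i ys)" "set w \<subseteq> set (map i ys)"
  have "on_letter (\<lambda>x. - h x) u = 0"
    using *(2) h_i by (cases u; cases "tl u") (auto simp: on_letter_length)
  moreover have "hom_word VB w" using * by blast
  ultimately show "wsum s e (K_weight (length (on_letter (\<lambda>x. - h x) u # w))) (on_letter (\<lambda>x. - h x) u # w) \<Psi> = 0"
    using B.gsm_Cons_0[OF gsm_wsum_K[OF \<Psi>], of w] by simp
qed

lemma lin_ext_H_map:
  assumes \<Psi>: "gsm VB s \<Psi>" and xs: "hom_word VB xs" "xs \<noteq> []"
  shows "lin_ext s \<Psi> (H_map B i p h (length xs) (gen xs)) = H s xs \<Psi>"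
proof -
  note s = gsm_vs[OF \<Psi>] and fs = free.vector_space_axioms
  let ?\<Phi> = "\<lambda>ys. wsum s e (K_weight (length ys)) ys \<Psi>"
  have kl: "Vector_Spaces.linear fscale fscale (K_map B e)"
    unfolding K_map_def by (rule linear_lin_ext[OF fs])
  have h_hom: "h x \<in> homogeneous VB" if "x \<in> homogeneous VB" for x
  proof -
    have "- h x \<in> grd VB (deg VB x + - 1)" by (rule graded_linear_grd[OF graded_linear_h B.in_grd_deg[OF that]])
    from B.homogeneousI[OF B.grd_minus[OF this]] show ?thesis by simp
  qed
  have ht: "H_tilde B h (gen xs) = - unsh VB xs (\<lambda>u w. if length u = 1 then gen (map h u @ w) else 0)"
    unfolding H_tilde_def lin_ext_gen[OF fs]
    by (subst sum_Sh_eq_unsh[OF fs, where g = "\<lambda>u w. gen (map h u @ w)"]) (use xs in \<open>simp_all add: Suc_le_eq\<close>)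
  have "lin_ext s \<Psi> (H_map B i p h (length xs) (gen xs)) = lin_ext s (\<lambda>ys. lin_ext s \<Psi> (K_map B e (gen ys))) (H_tilde B h (gen xs))"
    by (simp add: H_map_def proj_def lin_ext_gen[OF fs] lin_ext_linear[OF kl s, of \<Psi> "H_tilde B h (gen xs)"])
  also have "\<dots> = - unsh VB xs (\<lambda>u w. if length u = 1 then lin_ext s \<Psi> (K_map B e (gen (map h u @ w))) else 0)"
    unfolding ht lin_ext_minus[OF s] lin_ext_unsh[OF s]
    by (simp add: if_distrib[of "lin_ext s _"] lin_ext_gen[OF s] lin_ext_0[OF s] cong: if_cong)
  also have "\<dots> = unsh VB xs (\<lambda>u w. ?\<Phi> (on_letter (\<lambda>x. - h x) u # w))"
    unfolding unsh_minus[symmetric]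
  proof (rule unsh_cong)
    fix u w assume "set u \<subseteq> set xs" "set w \<subseteq> set xs"
    then have u: "hom_word VB u" and w: "hom_word VB w" using xs by auto
    show "- (if length u = 1 then lin_ext s \<Psi> (K_map B e (gen (map h u @ w))) else 0) = ?\<Phi> (on_letter (\<lambda>x. - h x) u # w)"
    proof (cases "length u = 1")
      case True
      then obtain x where x: "u = [x]" by (auto simp: length_Suc_conv)
      have hx: "h x \<in> homogeneous VB" using u x by (intro h_hom) auto
      have "lin_ext s \<Psi> (K_map B e (gen (h x # w))) = ?\<Phi> (h x # w)"
        by (rule lin_ext_K_map[OF B.graded_space_axioms graded_linear_e \<Psi>]) (use hx w in simp)
      moreover have "?\<Phi> (- h x # w) = - ?\<Phi> (h x # w)"
        using B.gsm_sg[OF gsm_wsum_K[OF \<Psi>] _ w hx, of "[]" 1] by (simp add: sg_def)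
      ultimately show ?thesis using x by simp
    next
      case False
      then show ?thesis using B.gsm_Cons_0[OF gsm_wsum_K[OF \<Psi>] w] by (simp add: on_letter_length)
    qed
  qed
  finally show ?thesis by (simp add: hop_def cod_def)
qed

end

subsection \<open>Coalgebra morphisms commuting with codifferentials\<close>

lemma (in graded_space) gsm_lin_ext_param:
  assumes s: "vector_space s" and K: "\<And>b. b \<in> Poly_Mapping.keys t \<Longrightarrow> gsm V s (\<lambda>x. K x b)"
  shows "gsm V s (\<lambda>x. lin_ext s (K x) t)"
proof (rule gsm_rawI[OF s], goal_cases)
  case (1 us vs x y a b n)
  then show ?case
    unfolding lin_ext_fun_scale[OF s, symmetric] lin_ext_fun_add[OF s, symmetric]
    by (intro lin_ext_cong gsm_lincomb[OF K])
next
  case (2 us vs x y m n)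
  then show ?case
    unfolding lin_ext_fun_sg[OF s, symmetric] by (intro lin_ext_cong gsm_swap[OF K])
qed

context sym_morphism
begin

lemma P_gen_carrier: "hom_word V xs \<Longrightarrow> P (gen xs) \<in> sym_carrier W"
  by (rule P_carrier) simp

lemma P_keys: "hom_word V xs \<Longrightarrow> ys \<in> Poly_Mapping.keys (P (gen xs)) \<Longrightarrow> hom_word W ys"
  using P_gen_carrier by (auto simp: sym_carrier_iff)

lemma
  assumes "vector_space s"
  shows pull_add: "pull s P (\<lambda>ys. \<Psi> ys + \<Psi>' ys) xs = pull s P \<Psi> xs + pull s P \<Psi>' xs"
    and pull_diff: "pull s P (\<lambda>ys. \<Psi> ys - \<Psi>' ys) xs = pull s P \<Psi> xs - pull s P \<Psi>' xs"
    and pull_zero: "pull s P (\<lambda>ys. 0) xs = 0"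
    and pull_cod: "pull s P (\<lambda>b. cod X \<phi> us (\<lambda>a. G a b)) xs = cod X \<phi> us (\<lambda>a. pull s P (G a) xs)"
  by (simp_all add: pull_def lin_ext_fun_add lin_ext_fun_diff lin_ext_fun_0 cod_lin_ext assms)

lemma pull_linear: "Vector_Spaces.linear s s' f \<Longrightarrow> pull s' P (\<lambda>ys. f (\<Psi> ys)) xs = f (pull s P \<Psi> xs)"
  by (simp add: pull_def lin_ext_hom)

lemma gsm_pull_left: "bigsm W s G \<Longrightarrow> hom_word V w \<Longrightarrow> vector_space s \<Longrightarrow> gsm W s (\<lambda>a. pull s P (G a) w)"
  unfolding pull_def by (rule W.gsm_lin_ext_param) (auto dest: P_keys bigsm_left)

lemma bigsm_pull:
  assumes "bigsm W s G" "vector_space s"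
  shows "bigsm V s (\<lambda>u w. pull s P (\<lambda>a. pull s P (G a) w) u)"
proof (rule bigsmI)
  fix u assume u: "hom_word V u"
  show "gsm V s (\<lambda>w. pull s P (\<lambda>a. pull s P (G a) w) u)"
    unfolding pull_def[of s P "\<lambda>a. pull s P (G a) _" u]
    by (rule V.gsm_lin_ext_param[OF assms(2)], rule gsm_pull, rule bigsm_right[OF assms(1)], rule P_keys[OF u])
next
  fix w assume w: "hom_word V w"
  show "gsm V s (\<lambda>u. pull s P (\<lambda>a. pull s P (G a) w) u)"
    by (rule gsm_pull, rule gsm_pull_left[OF assms(1) w assms(2)])
qed

end

locale dgla_coalg = L: dgla L + M: dgla M + sym_morphism "L\<lbrakk>1\<rbrakk>" "M\<lbrakk>1\<rbrakk>" P
  for L :: "('k::field_char_0, 'a::ab_group_add) dgla" and M :: "('k, 'b::ab_group_add) dgla" and P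
begin

abbreviation "VL \<equiv> L\<lbrakk>1\<rbrakk>"
abbreviation "VM \<equiv> M\<lbrakk>1\<rbrakk>"

definition defect :: "'a list \<Rightarrow> ('b list \<Rightarrow>\<^sub>0 'k)" where
  "defect xs = codiff M (P (gen xs)) - P (codiff L (gen xs))"

lemma defect_carrier: "hom_word VL xs \<Longrightarrow> defect xs \<in> sym_carrier VM"
  unfolding defect_def
  by (intro free.subspace_diff[OF subspace_sym_carrier] M.codiff_carrier P_carrier L.codiff_carrier) simp_all

lemma lin_ext_defect:
  assumes \<Psi>: "gsm VM s \<Psi>" and xs: "hom_word VL xs"
  shows "lin_ext s \<Psi> (defect xs) = pull s P (\<lambda>ys. cod VM M.q ys \<Psi>) xs - cod VL L.q xs (pull s P \<Psi>)"
proof -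
  note s = gsm_vs[OF \<Psi>]
  have "lin_ext s \<Psi> (codiff M (P (gen xs))) = pull s P (\<lambda>ys. cod VM M.q ys \<Psi>) xs"
    unfolding M.lin_ext_codiff[OF \<Psi> P_gen_carrier[OF xs]] by (simp add: pull_def)
  moreover have "lin_ext s \<Psi> (P (codiff L (gen xs))) = cod VL L.q xs (pull s P \<Psi>)"
    using L.lin_ext_codiff_gen[OF gsm_pull[OF \<Psi>] xs] by (simp add: lin_ext_pull[OF s])
  ultimately show ?thesis by (simp add: defect_def lin_ext_diff[OF s])
qed

text \<open>Both codifferentials are coderivations and \<open>P\<close> respects coproducts. The
  terms with one codifferential therefore group into D tensor P plus P tensor D; the sign comes from
  the odd operator D passing \<open>u\<close>.\<close>

lemma defect_unsh:
  assumes G: "bigsm VM s G" and s: "vector_space s" and xs: "hom_word VL xs"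
  shows "lin_ext s (\<lambda>ys. unsh VM ys G) (defect xs) = unsh VL xs (\<lambda>u w.
    lin_ext s (\<lambda>a. pull s P (G a) w) (defect u)
      + sg (wdeg VL u) (pull s P (\<lambda>a. lin_ext s (G a) (defect w)) u))"
proof -
  define DG where "DG a b = cod VM M.q a (\<lambda>a. G a b) + sg (1 * wdeg VM a) (cod VM M.q b (G a))" for a b
  note bi = M.bigsm_cod[OF M.gsm_deg_q s G]
  have DG: "bigsm VM s DG" unfolding DG_def[abs_def] by (intro M.bigsm_plus M.bigsm_sg bi)
  define PG where "PG u w = pull s P (\<lambda>a. pull s P (G a) w) u" for u w
  have PG: "bigsm VL s PG" unfolding PG_def[abs_def] by (rule bigsm_pull[OF G s])
  have 1: "pull s P (\<lambda>ys. cod VM M.q ys (\<lambda>zs. unsh VM zs G)) xs = unsh VL xs (\<lambda>u w. pull s P (\<lambda>a. pull s P (DG a) w) u)"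
  proof -
    have "pull s P (\<lambda>ys. cod VM M.q ys (\<lambda>zs. unsh VM zs G)) xs = pull s P (\<lambda>ys. unsh VM ys DG) xs"
      unfolding DG_def[abs_def] by (rule pull_cong[OF xs]) (rule M.cod_unsh[OF M.gsm_deg_q G])
    also have "\<dots> = unsh VL xs (\<lambda>u w. pull s P (\<lambda>a. pull s P (DG a) w) u)"
      by (rule pull_unsh[OF s DG xs])
    finally show ?thesis .
  qed
  have 2: "cod VL L.q xs (pull s P (\<lambda>zs. unsh VM zs G))
      = unsh VL xs (\<lambda>u w. cod VL L.q u (\<lambda>u. PG u w) + sg (1 * wdeg VL u) (cod VL L.q w (PG u)))"
  proof -
    have "cod VL L.q xs (pull s P (\<lambda>zs. unsh VM zs G)) = cod VL L.q xs (\<lambda>ys. unsh VL ys PG)"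
      unfolding PG_def[abs_def] by (rule L.cod_cong_hom[OF L.gsm_deg_q xs]) (rule pull_unsh[OF s G])
    also have "\<dots> = unsh VL xs (\<lambda>u w. cod VL L.q u (\<lambda>u. PG u w) + sg (1 * wdeg VL u) (cod VL L.q w (PG u)))"
      by (rule L.cod_unsh[OF L.gsm_deg_q PG xs])
    finally show ?thesis .
  qed
  have "lin_ext s (\<lambda>ys. unsh VM ys G) (defect xs)
      = pull s P (\<lambda>ys. cod VM M.q ys (\<lambda>zs. unsh VM zs G)) xs - cod VL L.q xs (pull s P (\<lambda>zs. unsh VM zs G))"
    by (rule lin_ext_defect[OF M.gsm_unsh[OF s G] xs])
  also have "\<dots> = unsh VL xs (\<lambda>u w. lin_ext s (\<lambda>a. pull s P (G a) w) (defect u)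
      + sg (wdeg VL u) (pull s P (\<lambda>a. lin_ext s (G a) (defect w)) u))"
    unfolding 1 2 unsh_diff[symmetric]
  proof (rule unsh_cong)
    fix u w assume "set u \<subseteq> set xs" "set w \<subseteq> set xs"
    then have u: "hom_word VL u" and w: "hom_word VL w" using xs by auto
    have "pull s P (\<lambda>a. pull s P (DG a) w) u = pull s P (\<lambda>a. cod VM M.q a (\<lambda>a. pull s P (G a) w)
        + sg (1 * wdeg VM a) (pull s P (\<lambda>b. cod VM M.q b (G a)) w)) u"
    proof (rule pull_cong[OF u])
      fix a
      show "pull s P (DG a) w = cod VM M.q a (\<lambda>a. pull s P (G a) w) + sg (1 * wdeg VM a) (pull s P (\<lambda>b. cod VM M.q b (G a)) w)"
        unfolding DG_def[abs_def] pull_add[OF s] pull_cod[OF s]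
        by (simp add: pull_def lin_ext_fun_sg[OF s])
    qed
    also have "\<dots> = pull s P (\<lambda>a. cod VM M.q a (\<lambda>a. pull s P (G a) w)) u
        + sg (1 * wdeg VL u) (pull s P (\<lambda>a. pull s P (\<lambda>b. cod VM M.q b (G a)) w) u)"
      by (simp only: pull_add[OF s] pull_wdeg[OF gsm_pull_left[OF bi(2) w s] u])
    finally have 3: "pull s P (\<lambda>a. pull s P (DG a) w) u = \<dots>" .
    have 4: "cod VL L.q w (PG u) = pull s P (\<lambda>a. cod VL L.q w (pull s P (G a))) u"
      unfolding PG_def[abs_def] by (simp add: pull_cod[OF s])
    have 5: "lin_ext s (\<lambda>a. pull s P (G a) w) (defect u)
        = pull s P (\<lambda>a. cod VM M.q a (\<lambda>a. pull s P (G a) w)) u - cod VL L.q u (\<lambda>u. PG u w)"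
      unfolding PG_def by (rule lin_ext_defect[OF gsm_pull_left[OF G w s] u])
    have 6: "pull s P (\<lambda>a. lin_ext s (G a) (defect w)) u
        = pull s P (\<lambda>a. pull s P (\<lambda>b. cod VM M.q b (G a)) w - cod VL L.q w (pull s P (G a))) u"
      by (rule pull_cong[OF u]) (rule lin_ext_defect[OF bigsm_right[OF G] w])
    show "pull s P (\<lambda>a. pull s P (DG a) w) u - (cod VL L.q u (\<lambda>u. PG u w) + sg (1 * wdeg VL u) (cod VL L.q w (PG u)))
      = lin_ext s (\<lambda>a. pull s P (G a) w) (defect u) + sg (wdeg VL u) (pull s P (\<lambda>a. lin_ext s (G a) (defect w)) u)"
      unfolding 3 4 5 6 pull_diff[OF s] by (simp add: sg_diff)
  qed
  finally show ?thesis .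
qed

text \<open>By hypothesis D vanishes on proper subwords. The two remaining terms pair D of the whole
  word with \<open>P\<close> of the empty word, which is the empty word modulo relations.\<close>

lemma defect_primitive:
  assumes xs: "hom_word VL xs" and IH: "\<And>ys. hom_word VL ys \<Longrightarrow> length ys < length xs \<Longrightarrow> defect ys \<in> sym_rel VM"
    and G: "bigsm VM s G" and s: "vector_space s"
  shows "lin_ext s (\<lambda>ys. unsh VM ys G) (defect xs)
    = lin_ext s (\<lambda>ys. G ys []) (defect xs) + lin_ext s (\<lambda>ys. G [] ys) (defect xs)"
proof -
  have "unsh VL xs (\<lambda>u w. lin_ext s (\<lambda>a. pull s P (G a) w) (defect u)) = lin_ext s (\<lambda>a. pull s P (G a) []) (defect xs)"
  proof (rule unsh_right_Nil)
    fix u w :: "'a list" assume *: "length u < length xs" "set u \<subseteq> set xs" "set w \<subseteq> set xs"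
    then have "hom_word VL u" "hom_word VL w" using xs by auto
    then show "lin_ext s (\<lambda>a. pull s P (G a) w) (defect u) = 0"
      using M.lin_ext_sym_rel[OF gsm_pull_left[OF G _ s] IH[OF _ *(1)]] by simp
  qed
  also have "\<dots> = lin_ext s (\<lambda>a. G a []) (defect xs)"
    by (rule lin_ext_cong) (use defect_carrier[OF xs] pull_Nil[OF bigsm_right[OF G]] in \<open>auto simp: sym_carrier_iff\<close>)
  finally have 1: "unsh VL xs (\<lambda>u w. lin_ext s (\<lambda>a. pull s P (G a) w) (defect u)) = \<dots>" .
  have "unsh VL xs (\<lambda>u w. sg (wdeg VL u) (pull s P (\<lambda>a. lin_ext s (G a) (defect w)) u))
      = sg (wdeg VL []) (pull s P (\<lambda>a. lin_ext s (G a) (defect xs)) [])"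
  proof (rule unsh_left_Nil)
    fix u w :: "'a list" assume *: "length w < length xs" "set u \<subseteq> set xs" "set w \<subseteq> set xs"
    then have u: "hom_word VL u" and w: "hom_word VL w" using xs by auto
    have "pull s P (\<lambda>a. lin_ext s (G a) (defect w)) u = pull s P (\<lambda>a. 0) u"
      by (rule pull_cong[OF u]) (use M.lin_ext_sym_rel[OF bigsm_right[OF G] IH[OF w *(1)]] in simp)
    then show "sg (wdeg VL u) (pull s P (\<lambda>a. lin_ext s (G a) (defect w)) u) = 0"
      by (simp add: pull_zero[OF s])
  qed
  also have "\<dots> = lin_ext s (G []) (defect xs)"
    using pull_Nil[OF M.gsm_lin_ext_param[OF s, of "defect xs" G]] defect_carrier[OF xs] bigsm_left[OF G]
    by (simp add: sym_carrier_iff)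
  finally show ?thesis
    by (simp only: defect_unsh[OF G s xs] unsh_add 1)
qed

lemma defect_in_sym_rel:
  assumes "\<And>xs. hom_word VL xs \<Longrightarrow> (\<And>ys. hom_word VL ys \<Longrightarrow> length ys < length xs \<Longrightarrow> defect ys \<in> sym_rel VM)
    \<Longrightarrow> corestr VM (defect xs) = 0"
    and "hom_word VL xs"
  shows "defect xs \<in> sym_rel VM"
  using assms(2)
proof (induction "length xs" arbitrary: xs rule: less_induct)
  case less
  have IH: "defect ys \<in> sym_rel VM" if "hom_word VL ys" "length ys < length xs" for ys
    by (rule less.hyps[OF that(2,1)])
  show ?case
    by (rule primitive_in_sym_rel[OF M.graded_space_axioms defect_carrier[OF less.prems]])
      (use defect_primitive[OF less.prems IH _ free.vector_space_axioms] assms(1)[OF less.prems IH] in auto)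
qed

lemma Linf_morphismI:
  assumes "\<And>xs. hom_word VL xs \<Longrightarrow> defect xs \<in> sym_rel VM"
  shows "Linf_morphism L M P"
  unfolding Linf_morphism_def
proof (intro conjI ballI coalg)
  fix t :: "'a list \<Rightarrow>\<^sub>0 'k" assume t: "t \<in> sym_carrier VL"
  note lq = linear_quot[OF subspace_sym_rel[of VM]]
  note lPc = Vector_Spaces.linear_compose[OF L.codiff_linear linear]
    and lcP = Vector_Spaces.linear_compose[OF linear M.codiff_linear]
  have "quot (sym_rel VM) (P (codiff L t)) = lin_ext fscale (\<lambda>xs. quot (sym_rel VM) (P (codiff L (gen xs)))) t"
    using linear_eq_lin_ext[OF Vector_Spaces.linear_compose[OF lPc lq], of t] by simp
  also have "\<dots> = lin_ext fscale (\<lambda>xs. quot (sym_rel VM) (codiff M (P (gen xs)))) t"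
  proof (rule lin_ext_cong)
    fix xs assume "xs \<in> Poly_Mapping.keys t"
    then have "hom_word VL xs" using t unfolding sym_carrier_iff by blast
    from assms[OF this] show "quot (sym_rel VM) (P (codiff L (gen xs))) = quot (sym_rel VM) (codiff M (P (gen xs)))"
      by (simp add: defect_def quot_eq_0_iff[OF subspace_sym_rel, symmetric] vs_linear_diff[OF lq])
  qed
  also have "\<dots> = quot (sym_rel VM) (codiff M (P t))"
    using linear_eq_lin_ext[OF Vector_Spaces.linear_compose[OF lcP lq], of t] by simp
  finally show "sym_eq VM (P (codiff L t)) (codiff M (P t))"
    by (simp add: sym_eq_iff)
qed

end

subsection \<open>The recursion\<close>

lemma proj_gen: "proj n (gen xs) = (if length xs = n then gen xs else 0)"
  by (simp add: proj_def lin_ext_gen free.vector_space_axioms)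

lemma proj_carrier: "t \<in> sym_carrier V \<Longrightarrow> proj n t \<in> sym_carrier V"
  unfolding proj_def
  by (rule lin_ext_in_subspace[OF free.vector_space_axioms subspace_sym_carrier])
    (auto simp: sym_carrier_iff)

lemma (in graded_space) gsm_deg_length_if:
  assumes "graded_space W" "gsm_deg V W k \<Psi>"
  shows "gsm_deg V W k (\<lambda>xs. if R (length xs) then \<Psi> xs else 0)"
proof -
  interpret W: graded_space W by fact
  show ?thesis
    using gsm_length_if[OF gsm_deg_gsm[OF assms(2)], of R] gsm_deg_in_grd[OF assms(2)]
    by (simp add: gsm_deg_def)
qed

context dgla_coalg
begin

text \<open>The map \<open>L_infty\<close> as a function of words. The conditions on lengths stand
  for the projections: length 2 selects the quadratic part of the codifferential on the target,
  length \<open>k\<close> the component of the source codifferential that lowers the length by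
  one.\<close>

definition L_word :: "nat \<Rightarrow> 'a list \<Rightarrow> 'b" where
  "L_word k xs = (if length xs = k + 1 then
     pull (scl M) P (\<lambda>ys. if length ys = 2 then M.q ys else 0) xs
     - cod VL L.q xs (\<lambda>ys. if length ys = k then pull (scl M) P the_letter ys else 0) else 0)"

lemma gsm_deg_q2: "gsm_deg VM VM 1 (\<lambda>ys. if length ys = 2 then M.q ys else 0)"
  using M.gsm_deg_length_if[OF M.graded_space_axioms M.gsm_deg_q, of "\<lambda>n. n = 2"] .

lemma gsm_deg_P1: "gsm_deg VL VM 0 (pull (scl M) P the_letter)"
  using gsm_deg_pull[OF M.graded_space_axioms M.gsm_deg_the_letter] by simp

lemma gsm_deg_L_word: "gsm_deg VL VM 1 (L_word k)"
proof -
  have 1: "gsm_deg VL VM 1 (pull (scl M) P (\<lambda>ys. if length ys = 2 then M.q ys else 0))"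
    using gsm_deg_pull[OF M.graded_space_axioms gsm_deg_q2] by simp
  have 2: "gsm_deg VL VM 1 (\<lambda>xs. cod VL L.q xs (\<lambda>ys. if length ys = k then pull (scl M) P the_letter ys else 0))"
    using gsm_deg_cod[OF L.graded_space_axioms M.graded_space_axioms L.gsm_deg_q
      L.gsm_deg_length_if[OF M.graded_space_axioms gsm_deg_P1, of "\<lambda>n. n = k"]] by simp
  have "gsm_deg VL VM 1 (\<lambda>xs. pull (scl M) P (\<lambda>ys. if length ys = 2 then M.q ys else 0) xs
     - cod VL L.q xs (\<lambda>ys. if length ys = k then pull (scl M) P the_letter ys else 0))"
    using L.gsm_minus[OF gsm_deg_gsm[OF 1] gsm_deg_gsm[OF 2]] M.grd_diff[OF gsm_deg_in_grd[OF 1] gsm_deg_in_grd[OF 2]]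
    unfolding gsm_deg_def by blast
  from L.gsm_deg_length_if[OF M.graded_space_axioms this, of "\<lambda>n. n = k + 1"]
  show ?thesis by (simp add: L_word_def[abs_def])
qed

lemma structure_map_eq:
  "structure_map VM P n t = lin_ext (scl M) (\<lambda>xs. if length xs = n then pull (scl M) P the_letter xs else 0) t"
  unfolding structure_map_def corestr_eq
  by (simp add: lin_ext_pull[symmetric] lin_ext_proj M.Ls.vector_space_axioms)

lemma L_infty_eq:
  assumes t: "t \<in> sym_carrier VL"
  shows "L_infty M L P k t = lin_ext (scl M) (L_word k) t"
proof -
  note s = M.Ls.vector_space_axioms
  let ?q2 = "\<lambda>ys. if length ys = 2 then M.q ys else 0"
  have "structure_map VM (codiff M) 2 (component P (k + 1) 2 t)
      = lin_ext (scl M) the_letter (codiff M (proj 2 (proj 2 (P (proj (k + 1) t)))))"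
    by (simp add: structure_map_def component_def corestr_eq)
  also have "\<dots> = lin_ext (scl M) (\<lambda>ys. cod VM M.q ys the_letter) (proj 2 (proj 2 (P (proj (k + 1) t))))"
    using gsm_deg_gsm[OF M.gsm_deg_the_letter]
    by (intro M.lin_ext_codiff) (simp_all add: proj_carrier P_carrier t)
  also have "\<dots> = lin_ext (scl M) ?q2 (P (proj (k + 1) t))"
    by (simp add: M.cod_the_letter lin_ext_proj[OF s] cong: if_cong)
  also have "\<dots> = lin_ext (scl M) (\<lambda>xs. if length xs = k + 1 then pull (scl M) P ?q2 xs else 0) t"
    by (simp only: lin_ext_pull[OF s, symmetric] lin_ext_proj[OF s])
  finally have 1: "structure_map VM (codiff M) 2 (component P (k + 1) 2 t) = \<dots>" .
  let ?P1 = "\<lambda>ys. if length ys = k then pull (scl M) P the_letter ys else 0"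
  have g: "gsm VL (scl M) ?P1"
    using L.gsm_length_if[OF gsm_deg_gsm[OF gsm_deg_P1], of "\<lambda>n. n = k"] by simp
  have "structure_map VM P k (component (codiff L) (k + 1) k t) = lin_ext (scl M) ?P1 (codiff L (proj (k + 1) t))"
    by (simp add: structure_map_eq component_def lin_ext_proj[OF s] cong: if_cong)
  also have "\<dots> = lin_ext (scl M) (\<lambda>xs. if length xs = k + 1 then cod VL L.q xs ?P1 else 0) t"
    by (subst L.lin_ext_codiff[OF g proj_carrier[OF t]]) (simp add: lin_ext_proj[OF s])
  finally have 2: "structure_map VM P k (component (codiff L) (k + 1) k t) = \<dots>" .
  show ?thesis
    unfolding L_infty_def 1 2 lin_ext_fun_diff[OF s, symmetric]
    by (rule lin_ext_cong) (simp add: L_word_def)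
qed

end

section \<open>Words in the image of \<open>i\<close>\<close>

lemma unsh_map:
  "(\<And>x. x \<in> set xs \<Longrightarrow> deg W (f x) = deg V x) \<Longrightarrow> unsh W (map f xs) g = unsh V xs (\<lambda>u w. g (map f u) (map f w))"
proof (induction xs arbitrary: g)
  case (Cons x xs)
  have "wdeg W (map f u) = wdeg V u" if "set u \<subseteq> set xs" for u
    using that Cons.prems by (induction u) auto
  then have "unsh V xs (\<lambda>u w. sg (deg W (f x) * wdeg W (map f u)) (g (map f u) (f x # map f w)))
      = unsh V xs (\<lambda>u w. sg (deg V x * wdeg V u) (g (map f u) (f x # map f w)))"
    by (intro unsh_cong) (simp add: Cons.prems)
  then show ?case by (simp add: Cons.IH[OF Cons.prems])
qed simp

context contraction
begin

lemma hom_map_i: "hom_word VA ys \<Longrightarrow> hom_word VB (map i ys)"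
proof -
  have "i x \<in> homogeneous VB" if "x \<in> homogeneous VA" for x
    by (rule B.homogeneousI[OF graded_linear_grd[OF graded_linear_i A.in_grd_deg[OF that]]])
  then show "hom_word VA ys \<Longrightarrow> hom_word VB (map i ys)" by auto
qed

lemma hom_map_p: "hom_word VB ys \<Longrightarrow> hom_word VA (map p ys)"
proof -
  have "p x \<in> homogeneous VA" if "x \<in> homogeneous VB" for x
    by (rule A.homogeneousI[OF graded_linear_grd[OF graded_linear_p B.in_grd_deg[OF that]]])
  then show "hom_word VB ys \<Longrightarrow> hom_word VA (map p ys)" by auto
qed

lemma i_eq_0_iff: "i x = 0 \<longleftrightarrow> x = 0"
  using p_i vs_linear_0[OF i_linear] vs_linear_0[OF p_linear] by metis

lemma deg_i: "x \<in> homogeneous VA \<Longrightarrow> x \<noteq> 0 \<Longrightarrow> deg VB (i x) = deg VA x"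
  using B.deg_eq[OF graded_linear_grd[OF graded_linear_i A.in_grd_deg]] i_eq_0_iff by simp

text \<open>Degrees are preserved by the injective map \<open>i\<close> except at 0, where
  \<open>deg\<close> is an arbitrary choice on either side. Words with a zero letter are therefore
  excluded here and treated apart by multilinearity.\<close>

lemma unsh_map_i:
  assumes "hom_word VA ys" "0 \<notin> set ys"
  shows "unsh VB (map i ys) g = unsh VA ys (\<lambda>u w. g (map i u) (map i w))"
  by (rule unsh_map, rule deg_i) (use assms in auto)

text \<open>Compatibility of \<open>i\<close> with brackets enters here, in the case of two
  letters.\<close>

lemma q_map_i:
  assumes "hom_word VA ys"
  shows "B.q (map i ys) = i (A.q ys)"
proof -
  consider "ys = []" | x where "ys = [x]" | x y where "ys = [x, y]" | "3 \<le> length ys"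
    by (cases ys; cases "tl ys"; cases "tl (tl ys)") auto
  then show ?thesis
  proof cases
    case (3 x y)
    then have x: "x \<in> grd A (deg VA x + 1)" using assms A.in_grd_deg[of x] by simp
    show ?thesis
      using 3 A.q_two[OF x, of y] B.q_two[OF i_grd[OF x], of "i y"]
      by (simp add: i_brk vs_linear_minus[OF i_linear] vs_linear_sg[OF i_linear])
  next
    case 4
    then show ?thesis by (simp add: A.q_length B.q_length vs_linear_0[OF i_linear])
  qed (simp_all add: vs_linear_0[OF i_linear] vs_linear_minus[OF i_linear] i_dif)
qed

lemma cod_q_map_i:
  assumes "hom_word VA ys" "0 \<notin> set ys"
  shows "cod VB B.q (map i ys) \<Psi> = cod VA A.q ys (\<lambda>zs. \<Psi> (map i zs))"
  unfolding cod_def unsh_map_i[OF assms]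
  by (rule unsh_cong) (use assms in \<open>auto simp: q_map_i subset_trans\<close>)

lemma H_cong:
  assumes "gsm VB s \<Psi>" "gsm VB s \<Psi>'" "hom_word VB xs"
    and "\<And>ys. hom_word VB ys \<Longrightarrow> length ys = length xs \<Longrightarrow> \<Psi> ys = \<Psi>' ys"
  shows "H s xs \<Psi> = H s xs \<Psi>'"
  unfolding hop_def
proof (rule B.cod_on_letter_cong[OF graded_linear_h gsm_wsum_K[OF assms(1)] gsm_wsum_K[OF assms(2)] assms(3)])
  fix ys assume ys: "hom_word VB ys" "length ys = length xs"
  show "wsum s e (K_weight (length ys)) ys \<Psi> = wsum s e (K_weight (length ys)) ys \<Psi>'"
    by (rule B.wsum_cong[OF graded_linear_e ys(1)]) (rule assms(4), simp_all add: ys(2))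
qed

text \<open>A letter \<open>e y\<close> may be 0, so the intermediate words are controlled by the
  degrees of the letters of \<open>ys\<close> and not by their own \<open>deg\<close>.\<close>

lemma wsum_in_grd:
  assumes W: "graded_space W" and \<Psi>: "gsm_deg VB W k \<Psi>" and "hom_word VB ys"
  shows "wsum (scl W) e c ys \<Psi> \<in> grd W (wdeg VB ys + k)"
proof -
  interpret W: graded_space W by fact
  have *: "wsum (scl W) e c ys \<Phi> \<in> grd W n"
    if "hom_word VB ys" "\<And>zs. B.graded_word zs (map (deg VB) ys) \<Longrightarrow> \<Phi> zs \<in> grd W n" for c \<Phi> n
    using that
  proof (induction ys arbitrary: c \<Phi>)
    case (Cons y ys)
    have "y \<in> grd VB (deg VB y)" "e y \<in> grd VB (deg VB y)"
      using Cons.prems(1) B.in_grd_deg[of y] graded_linear_grd[OF graded_linear_e, of y "deg VB y"] by simp_all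
    then show ?case unfolding wsum.simps
      by (intro W.grd_add Cons.IH Cons.prems(2)) (use Cons.prems(1) in auto)
  qed (auto intro: W.grd_scale)
  show ?thesis
  proof (rule *[OF assms(3)])
    fix zs assume zs: "B.graded_word zs (map (deg VB) ys)"
    show "\<Psi> zs \<in> grd W (wdeg VB ys + k)"
    proof (cases "0 \<in> set zs")
      case True
      then show ?thesis using B.gsm_mem_0[OF gsm_deg_gsm[OF \<Psi>] B.graded_word_hom_word[OF zs]] by simp
    next
      case False
      then show ?thesis
        using B.wdeg_eq[OF zs] gsm_deg_in_grd[OF \<Psi> B.graded_word_hom_word[OF zs]] by (simp add: wdeg_def)
    qed
  qed
qed

lemma gsm_deg_H:
  assumes W: "graded_space W" and \<Psi>: "gsm_deg VB W k \<Psi>"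
  shows "gsm_deg VB W (k - 1) (\<lambda>xs. H (scl W) xs \<Psi>)"
proof -
  have "gsm_deg VB W k (\<lambda>ys. wsum (scl W) e (K_weight (length ys)) ys \<Psi>)"
    unfolding gsm_deg_def
    by (intro conjI allI impI gsm_wsum_K[OF gsm_deg_gsm[OF \<Psi>]] wsum_in_grd[OF W \<Psi>])
  from gsm_deg_cod[OF B.graded_space_axioms W B.gsm_deg_on_letter_self[OF graded_linear_h] this]
  show ?thesis by (simp add: hop_def)
qed

lemma H_map_carrier:
  assumes t: "t \<in> sym_carrier VB"
  shows "H_map B i p h n t \<in> sym_carrier VB"
proof -
  note fs = free.vector_space_axioms and sub = subspace_sym_carrier[of VB]
  have h_hom: "h x \<in> homogeneous VB" if "x \<in> homogeneous VB" for x
  proof -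
    have "- h x \<in> grd VB (deg VB x + - 1)" by (rule graded_linear_grd[OF graded_linear_h B.in_grd_deg[OF that]])
    from B.homogeneousI[OF B.grd_minus[OF this]] show ?thesis by simp
  qed
  have e_hom: "e x \<in> homogeneous VB" if "x \<in> homogeneous VB" for x
    by (rule B.graded_linear_homogeneous[OF graded_linear_e that])
  have word: "gen (map f (take j ys) @ drop j ys) \<in> sym_carrier VB"
    if "\<And>x. x \<in> homogeneous VB \<Longrightarrow> f x \<in> homogeneous VB" "hom_word VB ys" for f j ys
    using that(2) set_take_subset[of j ys] set_drop_subset[of j ys] that(1) by (auto simp del: homogeneous_shift)
  have perm: "hom_word VB (permute_list \<sigma> xs)" if "\<sigma> permutes {..<length xs}" "hom_word VB xs" for \<sigma> xs
    using that by simp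
  have Sh: "hom_word VB (permute_list \<sigma> xs)" if "\<sigma> \<in> Sh 1 (length xs - 1)" "hom_word VB xs" for \<sigma> xs
    using that by (cases xs) (auto simp: Sh_def simp del: homogeneous_shift)
  have "H_tilde B h (proj n t) \<in> sym_carrier VB"
    unfolding H_tilde_def
    by (rule lin_ext_in_subspace[OF fs sub], intro free.subspace_neg[OF sub] free.subspace_sum[OF sub]
        free.subspace_scale[OF sub] word h_hom Sh) (use proj_carrier[OF t, of n] in \<open>auto simp: sym_carrier_iff simp del: homogeneous_shift\<close>)
  then show ?thesis
    unfolding H_map_def K_map_def Let_def
    by (intro lin_ext_in_subspace[OF fs sub] free.subspace_sum[OF sub]
        free.subspace_scale[OF sub] word e_hom perm) (auto simp: sym_carrier_iff simp del: homogeneous_shift)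
qed

end

locale recursive_morphism = contraction A B i p h + dgla_coalg B A P
  for A :: "('k::field_char_0, 'a::ab_group_add) dgla" and B :: "('k, 'b::ab_group_add) dgla" and i p h P +
  assumes rec: "recursive_structure_maps A B i p h P"
begin

abbreviation "P1 \<equiv> pull (scl A) P the_letter"

lemma P1_letter:
  assumes "x \<in> homogeneous VB"
  shows "P1 [x] = p x"
proof -
  obtain n where x: "x \<in> grd VB n" using assms by (auto simp: homogeneous_def)
  have "p x = structure_map VA P 1 (incl VB x)"
    using rec by (auto simp: recursive_structure_maps_def first_map_def)
  also have "\<dots> = P1 [x]"
  proof (cases "x = 0")
    case True
    then have "incl VB x = 0" using B.hcomp_homogeneous[OF x] by (simp add: incl_def)
    moreover have "P1 [x] = 0"
      using B.gsm_Cons_0[OF gsm_deg_gsm[OF gsm_deg_P1], of "[]"] True by simp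
    ultimately show ?thesis using True by (simp add: structure_map_eq lin_ext_0[OF A.Ls.vector_space_axioms])
  next
    case False
    then have "incl VB x = gen [x]" using B.hcomp_homogeneous[OF x] by (simp add: incl_def)
    then show ?thesis by (simp add: structure_map_eq lin_ext_gen[OF A.Ls.vector_space_axioms])
  qed
  finally show ?thesis by simp
qed

lemma P1_rec:
  assumes xs: "hom_word VB xs" "length xs = k + 1" and k: "1 \<le> k"
  shows "P1 xs = H (scl A) xs (L_word k)"
proof -
  have "structure_map VA P (k + 1) (gen xs) = L_infty A B P k (H_map B i p h (k + 1) (gen xs))"
    using rec k xs(1) by (auto simp: recursive_structure_maps_def)
  also have "\<dots> = lin_ext (scl A) (L_word k) (H_map B i p h (length xs) (gen xs))"
    using L_infty_eq[OF H_map_carrier, of "gen xs" k] xs by simp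
  also have "\<dots> = H (scl A) xs (L_word k)"
    by (rule lin_ext_H_map) (use gsm_deg_gsm[OF gsm_deg_L_word] xs in auto)
  finally show ?thesis
    using xs by (simp add: structure_map_eq lin_ext_gen[OF A.Ls.vector_space_axioms])
qed

lemma gsm_P1: "gsm VB (scl A) P1"
  using gsm_deg_gsm[OF gsm_deg_P1] by simp

lemma gsm_L_word: "gsm VB (scl A) (L_word k)"
  using gsm_deg_gsm[OF gsm_deg_L_word] by simp

text \<open>\<open>P \<circ> i\<close> has the structure maps of the identity, hence equals the identity.\<close>

lemma P_map_i:
  assumes "hom_word VA ys"
  shows "P (gen (map i ys)) - gen ys \<in> sym_rel VA"
  using assms
proof (induction "length ys" arbitrary: ys rule: less_induct)
  case less
  note ys = less.prems
  show ?case
  proof (cases "0 \<in> set ys")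
    case True
    then have "0 \<in> set (map i ys)" using vs_linear_0[OF i_linear] by force
    with True show ?thesis
      using A.sym_rel_mem_0[OF ys True] P_rel[OF B.sym_rel_mem_0[OF hom_map_i[OF ys]]]
      by (intro free.subspace_diff[OF subspace_sym_rel])
  next
    case False
    note fs = free.vector_space_axioms
    let ?t = "\<lambda>ys. P (gen (map i ys)) - gen ys"
    have Z: "lin_ext s \<Psi> (?t zs) = pull s P \<Psi> (map i zs) - \<Psi> zs" if "vector_space s" for s \<Psi> zs
      by (simp add: lin_ext_diff lin_ext_gen that pull_def)
    have IH: "pull s P \<Psi> (map i zs) - \<Psi> zs = 0" if "gsm VA s \<Psi>" "hom_word VA zs" "length zs < length ys" for s \<Psi> zs
      using A.lin_ext_sym_rel[OF that(1) less.hyps[OF that(3,2)]] Z[OF gsm_vs[OF that(1)], of \<Psi> zs] by simp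
    have carrier: "?t ys \<in> sym_carrier VA"
      using P_gen_carrier[OF hom_map_i[OF ys]] ys by (intro free.subspace_diff[OF subspace_sym_carrier]) simp_all
    show ?thesis
    proof (rule primitive_in_sym_rel[OF A.graded_space_axioms carrier])
      fix G :: "'a list \<Rightarrow> 'a list \<Rightarrow> ('a list \<Rightarrow>\<^sub>0 'k)" assume G: "bigsm VA fscale G"
      let ?\<Phi> = "\<lambda>w a. pull fscale P (G a) (map i w)"
      have "lin_ext fscale (\<lambda>zs. unsh VA zs G) (?t ys)
          = unsh VA ys (\<lambda>u w. pull fscale P (?\<Phi> w) (map i u)) - unsh VA ys G"
        by (simp add: Z[OF fs] pull_unsh[OF fs G hom_map_i[OF ys]] unsh_map_i[OF ys False])
      \<comment> \<open>Write Pi tensor Pi - 1 tensor 1 as (Pi - 1) tensor Pi plus 1 tensor (Pi -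
        1). By the induction hypothesis only the terms with the full word in the factor of Pi - 1
        survive, so the difference is primitive.\<close>
      also have "\<dots> = unsh VA ys (\<lambda>u w. pull fscale P (?\<Phi> w) (map i u) - ?\<Phi> w u)
          + unsh VA ys (\<lambda>u w. ?\<Phi> w u - G u w)"
        by (simp add: unsh_diff)
      also have "unsh VA ys (\<lambda>u w. pull fscale P (?\<Phi> w) (map i u) - ?\<Phi> w u)
          = pull fscale P (?\<Phi> []) (map i ys) - ?\<Phi> [] ys"
      proof (rule unsh_right_Nil)
        fix u w :: "'a list" assume *: "length u < length ys" "set u \<subseteq> set ys" "set w \<subseteq> set ys"
        have "hom_word VA u" "hom_word VA w" using * ys by auto
        then show "pull fscale P (?\<Phi> w) (map i u) - ?\<Phi> w u = 0"
          by (intro IH gsm_pull_left[OF G] hom_map_i fs *(1))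
      qed
      also have "pull fscale P (?\<Phi> []) (map i ys) = pull fscale P (\<lambda>a. G a []) (map i ys)"
        by (rule pull_cong[OF hom_map_i[OF ys]]) (simp add: pull_Nil[OF bigsm_right[OF G]])
      also have "?\<Phi> [] ys = G ys []" using pull_Nil[OF bigsm_right[OF G ys]] by simp
      also have "unsh VA ys (\<lambda>u w. ?\<Phi> w u - G u w) = ?\<Phi> ys [] - G [] ys"
      proof (rule unsh_left_Nil)
        fix u w :: "'a list" assume *: "length w < length ys" "set u \<subseteq> set ys" "set w \<subseteq> set ys"
        have "hom_word VA u" "hom_word VA w" using * ys by auto
        then show "?\<Phi> w u - G u w = 0" by (intro IH bigsm_right[OF G] *(1))
      qed
      finally show "lin_ext fscale (\<lambda>zs. unsh VA zs G) (?t ys)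
          = lin_ext fscale (\<lambda>zs. G zs []) (?t ys) + lin_ext fscale (\<lambda>zs. G [] zs) (?t ys)"
        by (simp add: Z[OF fs])
    next
      have "corestr VA (?t ys) = P1 (map i ys) - the_letter ys"
        by (simp add: corestr_eq Z[OF A.Ls.vector_space_axioms])
      also have "\<dots> = 0"
      proof -
        consider "ys = []" | y where "ys = [y]" | "2 \<le> length ys" by (cases ys; cases "tl ys") auto
        then show ?thesis
        proof cases
          case 1
          then show ?thesis using pull_Nil[OF gsm_deg_gsm[OF A.gsm_deg_the_letter]] by simp
        next
          case (2 y)
          then show ?thesis using P1_letter[of "i y"] hom_map_i[OF ys] p_i by simp
        next
          case 3
          \<comment> \<open>From two letters on the structure map factors through the homotopy,
            which vanishes on the image of \<open>i\<close>.\<close>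
          then have "P1 (map i ys) = H (scl A) (map i ys) (L_word (length ys - 1))"
            by (intro P1_rec hom_map_i ys) auto
          also have "\<dots> = 0" by (rule H_map_i[OF gsm_L_word hom_map_i[OF ys]])
          finally show ?thesis using 3 by (simp add: the_letter_length)
        qed
      qed
      finally show "corestr VA (?t ys) = 0" .
    qed
  qed
qed

lemma pull_map_i:
  assumes "gsm VA s \<Psi>" "hom_word VA ys"
  shows "pull s P \<Psi> (map i ys) = \<Psi> ys"
  using A.lin_ext_sym_rel[OF assms(1) P_map_i[OF assms(2)]]
  by (simp add: pull_def lin_ext_diff lin_ext_gen gsm_vs[OF assms(1)])

text \<open>With P i = 1 the two terms of L become the corresponding expressions of the identity
  morphism of A. The first one is the bracket on words of length two, the second one the letter part
  of a word of length \<open>k\<close>; both are 0 unless \<open>k = 1\<close>, and then they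
  coincide.\<close>

lemma L_word_map_i:
  assumes ys: "hom_word VA ys" and k: "1 \<le> k"
  shows "L_word k (map i ys) = 0"
proof (cases "0 \<in> set ys \<or> length ys \<noteq> k + 1")
  case True
  then show ?thesis
  proof
    assume "0 \<in> set ys"
    then have "0 \<in> set (map i ys)" using vs_linear_0[OF i_linear] by force
    then show ?thesis by (rule B.gsm_mem_0[OF gsm_L_word hom_map_i[OF ys]])
  qed (simp add: L_word_def)
next
  case False
  have "pull (scl A) P (\<lambda>ys. if length ys = 2 then A.q ys else 0) (map i ys) = (if length ys = 2 then A.q ys else 0)"
    using pull_map_i[OF gsm_deg_gsm[OF gsm_deg_q2] ys] by simp
  moreover have "cod VB B.q (map i ys) (\<lambda>ys. if length ys = k then P1 ys else 0)
      = cod VA A.q ys (\<lambda>zs. if length zs = k then the_letter zs else 0)"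
  proof -
    have "cod VB B.q (map i ys) (\<lambda>ys. if length ys = k then P1 ys else 0)
      = cod VA A.q ys (\<lambda>zs. if length (map i zs) = k then P1 (map i zs) else 0)"
      by (rule cod_q_map_i) (use ys False in auto)
    also have "\<dots> = cod VA A.q ys (\<lambda>zs. if length zs = k then the_letter zs else 0)"
      by (rule A.cod_cong_hom[OF A.gsm_deg_q ys])
        (use pull_map_i[OF gsm_deg_gsm[OF A.gsm_deg_the_letter]] in simp)
    finally show ?thesis .
  qed
  moreover have "cod VA A.q ys (\<lambda>zs. if length zs = k then the_letter zs else 0) = (if k = 1 then A.q ys else 0)"
  proof (cases "k = 1")
    case True
    then have "(\<lambda>zs. if length zs = k then the_letter zs else 0) = (the_letter :: 'a list \<Rightarrow> 'a)"
      by (auto simp: the_letter_length)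
    then show ?thesis using True A.cod_the_letter by simp
  next
    case False
    then have "(\<lambda>zs. if length zs = k then the_letter zs else 0) = (\<lambda>zs :: 'a list. 0 :: 'a)"
      by (auto simp: the_letter_length)
    then show ?thesis using False by (simp add: cod_zero)
  qed
  ultimately show ?thesis using False k by (auto simp: L_word_def)
qed

lemma pull_q:
  "pull (scl A) P A.q xs = - dif A (P1 xs) + pull (scl A) P (\<lambda>ys. if length ys = 2 then A.q ys else 0) xs"
proof -
  note s = A.Ls.vector_space_axioms
  have lin: "Vector_Spaces.linear (scl A) (scl A) (\<lambda>x. - dif A x)"
    using graded_linear_linear[OF A.graded_linear_d] by simp
  have "A.q ys = - dif A (the_letter ys) + (if length ys = 2 then A.q ys else 0)" for ys
    by (cases ys; cases "tl ys") (auto simp: A.q_length the_letter_length)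
  then have "pull (scl A) P A.q xs = pull (scl A) P (\<lambda>ys. - dif A (the_letter ys) + (if length ys = 2 then A.q ys else 0)) xs"
    by metis
  then show ?thesis by (simp only: pull_add[OF s] pull_linear[OF lin])
qed

text \<open>The structure map \<open>q\<close> has at most two arguments, so the codifferential
  preserves the length or lowers it by one. The two summands are these parts.\<close>

lemma cod_q_length:
  assumes "gsm VB s \<Psi>" "hom_word VB xs" "length xs = k + 1"
  shows "cod VB B.q xs \<Psi> = cod VB B.D1 xs \<Psi> + cod VB B.q xs (\<lambda>ys. if length ys = k then \<Psi> ys else 0)"
  unfolding cod_def unsh_add[symmetric]
proof (rule unsh_cong)
  fix u w assume *: "set u \<subseteq> set xs" "set w \<subseteq> set xs" "length u + length w = length xs"
  then have w: "hom_word VB w" using assms(2) by auto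
  note 0 = B.gsm_Cons_0[OF assms(1) w]
  consider "u = []" | x where "u = [x]" | x y where "u = [x, y]" | "3 \<le> length u"
    by (cases u; cases "tl u"; cases "tl (tl u)") auto
  then show "\<Psi> (B.q u # w) = \<Psi> (B.D1 u # w) + (if length (B.q u # w) = k then \<Psi> (B.q u # w) else 0)"
  proof cases
    case 4
    then have "B.q u = 0" "B.D1 u = 0" by (auto intro: B.q_length on_letter_length)
    then show ?thesis using 0 by simp
  qed (use * assms(3) 0 in auto)
qed

text \<open>The image of a single letter is primitive, because \<open>P\<close> respects coproducts
  and fixes the empty word modulo relations. So the quadratic part of the codifferential does not
  see it.\<close>

lemma defect_letter:
  assumes "x \<in> homogeneous VB"
  shows "pull (scl A) P A.q [x] = - dif A (p x)"
proof -
  note fs = free.vector_space_axioms and s = A.Ls.vector_space_axioms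
  have x: "hom_word VB [x]" using assms by simp
  have "lin_ext (scl A) (\<lambda>ys. if length ys = 2 then A.q ys else 0) (P (gen [x]))
      = lin_ext (scl A) (\<lambda>ys. if length ys = 1 then (if length ys = 2 then A.q ys else 0) else 0) (P (gen [x]))"
  proof (rule primitive_lin_ext[OF A.graded_space_axioms P_gen_carrier[OF x]])
    fix G :: "'a list \<Rightarrow> 'a list \<Rightarrow> ('a list \<Rightarrow>\<^sub>0 'k)" assume G: "bigsm VA fscale G"
    have 1: "pull fscale P (\<lambda>a. pull fscale P (G a) []) [x] = pull fscale P (\<lambda>a. G a []) [x]"
      by (rule pull_cong[OF x]) (rule pull_Nil[OF bigsm_right[OF G]])
    have 2: "pull fscale P (\<lambda>a. pull fscale P (G a) [x]) [] = pull fscale P (G []) [x]"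
      by (rule pull_Nil[OF gsm_pull_left[OF G x fs]])
    show "lin_ext fscale (\<lambda>ys. unsh VA ys G) (P (gen [x]))
      = lin_ext fscale (\<lambda>ys. G ys []) (P (gen [x])) + lin_ext fscale (\<lambda>ys. G [] ys) (P (gen [x]))"
      using pull_unsh[OF fs G x] by (simp add: 1 2) (simp add: pull_def)
  next
    show "gsm VA (scl A) (\<lambda>ys. if length ys = 2 then A.q ys else 0)"
      using gsm_deg_gsm[OF gsm_deg_q2] by simp
  qed
  also have "\<dots> = lin_ext (scl A) (\<lambda>ys. 0) (P (gen [x]))"
    by (rule lin_ext_cong) simp
  finally have "pull (scl A) P (\<lambda>ys. if length ys = 2 then A.q ys else 0) [x] = 0"
    by (simp add: pull_def lin_ext_fun_0[OF s])
  then show ?thesis using pull_q[of "[x]"] P1_letter[OF assms] by simp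
qed

lemma corestr_defect_eq_0:
  assumes xs: "hom_word VB xs"
    and IH: "\<And>ys. hom_word VB ys \<Longrightarrow> length ys < length xs \<Longrightarrow> defect ys \<in> sym_rel VA"
  shows "corestr VA (defect xs) = 0"
proof -
  note s = A.Ls.vector_space_axioms
  have gl: "gsm VA (scl A) the_letter" and gq: "gsm VA (scl A) A.q"
    using gsm_deg_gsm[OF A.gsm_deg_the_letter] gsm_deg_gsm[OF A.gsm_deg_q] by simp_all
  define D where "D ys = lin_ext (scl A) the_letter (defect ys)" for ys
  have D: "D ys = pull (scl A) P A.q ys - cod VB B.q ys P1" if "hom_word VB ys" for ys
    using lin_ext_defect[OF gl that] by (simp add: D_def A.cod_the_letter)
  have gD: "gsm VB (scl A) D"
    by (rule B.gsm_cong[OF B.gsm_minus[OF gsm_pull[OF gq] B.gsm_cod[OF B.gsm_deg_q gsm_P1]]]) (simp add: D)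
  consider "xs = []" | x where "xs = [x]" | "2 \<le> length xs" by (cases xs; cases "tl xs") auto
  then have "D xs = 0"
  proof cases
    case 1
    then show ?thesis using D[OF xs] pull_Nil[OF gq] B.cod_Nil[OF B.gsm_deg_q _ gsm_P1] by simp
  next
    case (2 x)
    then have x: "x \<in> homogeneous VB" using xs by simp
    have "dif B x \<in> homogeneous VB"
      using B.homogeneousI[OF B.grd_minus[OF graded_linear_grd[OF B.graded_linear_d B.in_grd_deg[OF x]]]] by simp
    moreover have "P1 [0, x] = 0" using B.gsm_Cons_0[OF gsm_P1, of "[x]"] x by simp
    moreover have "- dif B x \<in> homogeneous VB"
      using B.homogeneousI[OF graded_linear_grd[OF B.graded_linear_d B.in_grd_deg[OF x]]] .
    ultimately have "cod VB B.q xs P1 = p (- dif B x)"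
      using P1_letter[of "- dif B x"] 2 by (simp add: cod_def)
    then show ?thesis
      using D[OF xs] defect_letter[OF x] 2 by (simp add: vs_linear_minus[OF p_linear] p_dif)
  next
    case 3
    then obtain k where k: "length xs = k + 1" "1 \<le> k" by (metis Suc_eq_plus1 Suc_le_D Suc_le_mono numeral_2_eq_2 One_nat_def)
    let ?L = "L_word k"
    \<comment> \<open>Splitting off the linear parts of both codifferentials leaves exactly the
      expression L.\<close>
    have Dk: "D ys = - dif A (P1 ys) + ?L ys - cod VB B.D1 ys P1" if ys: "hom_word VB ys" "length ys = k + 1" for ys
      using D[OF ys(1)] pull_q[of ys] cod_q_length[OF gsm_P1 ys] ys(2) by (simp add: L_word_def)
    have dlin: "Vector_Spaces.linear (scl A) (scl A) (dif A)" by (rule dif_linear[OF A.dgla])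
    have gdP1: "gsm VB (scl A) (\<lambda>ys. dif A (P1 ys))" by (rule B.gsm_linear[OF dlin gsm_P1])
    have gdL: "gsm VB (scl A) (\<lambda>ys. dif A (?L ys))" by (rule B.gsm_linear[OF dlin gsm_L_word])
    note gd1 = B.gsm_deg_on_letter_self[OF B.graded_linear_d]
    \<comment> \<open>The letter part of Q D = - D Q. On the left D is primitive, so
      \<open>A.q\<close> acts through \<open>- d\<close>; on the right D vanishes in length
      \<open>k\<close> by hypothesis, so only \<open>D1\<close> remains.\<close>
    have closedD: "dif A (D ys) = cod VB B.D1 ys D" if ys: "hom_word VB ys" "length ys = k + 1" for ys
    proof -
      have IH': "defect zs \<in> sym_rel VA" if "hom_word VB zs" "length zs < length ys" for zs
        using IH that ys k by simp
      have "lin_ext (scl A) A.q (defect ys) = lin_ext (scl A) (\<lambda>zs. if length zs = 1 then A.q zs else 0) (defect ys)"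
        by (rule primitive_lin_ext[OF A.graded_space_axioms defect_carrier[OF ys(1)]
            defect_primitive[OF ys(1) IH' _ free.vector_space_axioms] gq])
      also have "\<dots> = lin_ext (scl A) (\<lambda>zs. - dif A (the_letter zs)) (defect ys)"
      proof (rule lin_ext_cong)
        fix zs show "(if length zs = 1 then A.q zs else 0) = - dif A (the_letter zs)"
          by (cases zs; cases "tl zs") (auto simp: the_letter_length)
      qed
      also have "\<dots> = - dif A (D ys)"
        using lin_ext_hom[OF dlin, of the_letter "defect ys"] by (simp add: D_def lin_ext_fun_minus[OF s])
      finally have 1: "lin_ext (scl A) A.q (defect ys) = - dif A (D ys)" .
      have "lin_ext (scl A) A.q (defect ys) = pull (scl A) P (\<lambda>zs. cod VA A.q zs A.q) ys - cod VB B.q ys (pull (scl A) P A.q)"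
        by (rule lin_ext_defect[OF gq ys(1)])
      also have "pull (scl A) P (\<lambda>zs. cod VA A.q zs A.q) ys = pull (scl A) P (\<lambda>zs. 0) ys"
        by (rule pull_cong[OF ys(1)]) (rule A.cod_q_q)
      also have "\<dots> = 0" by (rule pull_zero[OF s])
      also have "cod VB B.q ys (pull (scl A) P A.q) = cod VB B.q ys (\<lambda>zs. D zs + cod VB B.q zs P1)"
        by (rule B.cod_cong_hom[OF B.gsm_deg_q ys(1)]) (simp add: D)
      also have "\<dots> = cod VB B.q ys D"
        by (simp add: cod_add cod_cod_codiff1[OF B.dgla gsm_P1 ys(1)])
      also have "\<dots> = cod VB B.D1 ys D + cod VB B.q ys (\<lambda>zs. if length zs = k then D zs else 0)"
        by (rule cod_q_length[OF gD ys])
      also have "cod VB B.q ys (\<lambda>zs. if length zs = k then D zs else 0) = cod VB B.q ys (\<lambda>zs. 0)"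
      proof (rule B.cod_cong_hom[OF B.gsm_deg_q ys(1)])
        fix zs assume "hom_word VB zs"
        then show "(if length zs = k then D zs else 0) = 0"
          using A.lin_ext_sym_rel[OF gl IH'[of zs]] ys(2) by (simp add: D_def)
      qed
      finally show ?thesis using 1 by (simp add: cod_zero)
    qed
    \<comment> \<open>Insert \<open>Dk\<close> into \<open>closedD\<close>; the terms with
      \<open>P1\<close> drop out, as the differentials square to 0 and the mixed term occurs on both
      sides.\<close>
    have closed: "dif A (?L ys) = cod VB B.D1 ys ?L" if ys: "hom_word VB ys" "length ys = k + 1" for ys
    proof -
      have "cod VB B.D1 ys D = cod VB B.D1 ys (\<lambda>zs. - dif A (P1 zs) + ?L zs - cod VB B.D1 zs P1)"
        by (rule B.cod_on_letter_cong[OF B.graded_linear_d gD _ ys(1)],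
            intro B.gsm_minus B.gsm_plus B.gsm_uminus gdP1 gsm_L_word B.gsm_cod[OF gd1 gsm_P1],
            rule Dk) (simp_all add: ys(2))
      also have "\<dots> = - dif A (cod VB B.D1 ys P1) + cod VB B.D1 ys ?L"
        by (simp add: cod_add cod_diff cod_linear[OF dlin] cod_D1_D1[OF B.dgla gsm_P1 ys(1)])
      finally have "dif A (D ys) = - dif A (cod VB B.D1 ys P1) + cod VB B.D1 ys ?L"
        using closedD[OF ys] by simp
      then show ?thesis
        unfolding Dk[OF ys]
        by (simp add: vs_linear_diff[OF dlin] vs_linear_add[OF dlin] vs_linear_minus[OF dlin] dif_dif[OF A.dgla])
    qed
    have P1H: "P1 ys = H (scl A) ys ?L" if "hom_word VB ys" "length ys = k + 1" for ys
      by (rule P1_rec[OF that k(2)])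
    \<comment> \<open>With \<open>P1 = H L\<close> the two \<open>P1\<close> terms in
      \<open>Dk\<close> are minus the left side of \<open>H_homotopy\<close> for L, where
      \<open>closed\<close> rewrites the second one. So \<open>Dk\<close> becomes L minus L plus L
      on \<open>map e xs\<close>.\<close>
    have "cod VB B.D1 xs P1 = cod VB B.D1 xs (\<lambda>ys. H (scl A) ys ?L)"
      by (rule B.cod_on_letter_cong[OF B.graded_linear_d gsm_P1 gsm_H[OF gsm_L_word] xs]) (simp add: P1H k(1))
    moreover have "H (scl A) xs (\<lambda>ys. cod VB B.D1 ys ?L) = dif A (P1 xs)"
    proof -
      have "H (scl A) xs (\<lambda>ys. cod VB B.D1 ys ?L) = H (scl A) xs (\<lambda>ys. dif A (?L ys))"
        by (rule H_cong[OF B.gsm_cod[OF gd1 gsm_L_word] gdL xs]) (simp add: closed k(1))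
      then show ?thesis by (simp add: hop_linear[OF dlin] P1H[OF xs k(1)])
    qed
    moreover have "?L (map e xs) = 0"
      using L_word_map_i[OF hom_map_p[OF xs] k(2)] by (simp add: map_map[symmetric] del: map_map)
    moreover have "xs \<noteq> []" using 3 by auto
    ultimately show ?thesis
      using Dk[OF xs k(1)] H_homotopy[OF gsm_L_word xs, of k] by (simp add: algebra_simps)
  qed
  then show ?thesis by (simp add: D_def corestr_eq)
qed

lemma Linf_morphism_P: "Linf_morphism B A P"
  by (rule Linf_morphismI[OF defect_in_sym_rel[OF corestr_defect_eq_0]])

end

subsection \<open>Construction of a coalgebra morphism from its structure maps\<close>

text \<open>The recursive calls of \<open>cofree\<close> sit under \<open>unsh\<close>; this
  supplies the bound on the length of \<open>w\<close> needed for termination.\<close>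

lemma unsh_fundef_cong [fundef_cong]:
  "V = V' \<Longrightarrow> xs = xs' \<Longrightarrow> (\<And>u w. length u + length w = length xs' \<Longrightarrow> g u w = g' u w) \<Longrightarrow> unsh V xs g = unsh V' xs' g'"
  by (auto intro: unsh_cong)

text \<open>\<open>cofree V \<phi> xs \<Psi>\<close> is the value of \<open>\<Psi>\<close> at the image of \<open>xs\<close> under the coalgebra morphism with
  structure maps \<open>\<phi>\<close>; the block of the set partition containing the first letter is split off.\<close>

function cofree :: "('k, 'a, 'z) gvs_scheme \<Rightarrow> ('a list \<Rightarrow> 'b) \<Rightarrow> 'a list \<Rightarrow> ('b list \<Rightarrow> 'v::ab_group_add) \<Rightarrow> 'v" where
  "cofree V \<phi> [] \<Psi> = \<Psi> []"
| "cofree V \<phi> (x # xs) \<Psi> = unsh V xs (\<lambda>u w. cofree V \<phi> w (\<lambda>a. \<Psi> (\<phi> (x # u) # a)))"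
  by pat_completeness auto
termination by (relation "measure (\<lambda>(V, \<phi>, xs, \<Psi>). length xs)") auto

lemma length_induct_word:
  assumes "\<And>xs. (\<And>ys. length ys < length xs \<Longrightarrow> R ys) \<Longrightarrow> R xs"
  shows "R xs"
  using assms by (rule length_induct) blast

lemma cofree_hom:
  assumes "\<And>v w. f (v + w) = f v + f w"
  shows "f (cofree V \<phi> xs \<Psi>) = cofree V \<phi> xs (\<lambda>ys. f (\<Psi> ys))"
proof (induction xs arbitrary: \<Psi> rule: length_induct_word)
  case (1 xs)
  show ?case
  proof (cases xs)
    case (Cons x xs')
    then show ?thesis by (auto simp: unsh_hom[of f, OF assms] intro!: unsh_cong 1)
  qed simp
qed

lemma cofree_add: "cofree V \<phi> xs (\<lambda>ys. \<Psi> ys + \<Psi>' ys) = cofree V \<phi> xs \<Psi> + cofree V \<phi> xs \<Psi>'"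
proof (induction xs arbitrary: \<Psi> \<Psi>' rule: length_induct_word)
  case (1 xs)
  show ?case
  proof (cases xs)
    case (Cons x xs')
    then show ?thesis by (auto simp: unsh_add[symmetric] intro!: unsh_cong 1)
  qed simp
qed

lemma cofree_minus: "cofree V \<phi> xs (\<lambda>ys. - \<Psi> ys) = - cofree V \<phi> xs \<Psi>"
  by (rule cofree_hom[symmetric]) simp

lemma cofree_diff: "cofree V \<phi> xs (\<lambda>ys. \<Psi> ys - \<Psi>' ys) = cofree V \<phi> xs \<Psi> - cofree V \<phi> xs \<Psi>'"
  using cofree_add[of V \<phi> xs \<Psi> "\<lambda>ys. - \<Psi>' ys"] by (simp add: cofree_minus)

lemma cofree_sg: "cofree V \<phi> xs (\<lambda>ys. sg n (\<Psi> ys)) = sg n (cofree V \<phi> xs \<Psi>)"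
  by (rule cofree_hom[symmetric]) (simp add: sg_add)

lemma cofree_unsh: "cofree V \<phi> xs (\<lambda>ys. unsh W zs (\<lambda>u w. G u w ys)) = unsh W zs (\<lambda>u w. cofree V \<phi> xs (G u w))"
  by (induction zs arbitrary: G) (simp_all add: cofree_add cofree_sg)

lemma lin_ext_cofree: "vector_space s \<Longrightarrow> lin_ext s \<Psi> (cofree V \<phi> xs gen) = cofree V \<phi> xs \<Psi>"
  by (simp add: cofree_hom[of "lin_ext s \<Psi>"] lin_ext_add lin_ext_gen)

lemma cofree_cong_structure:
  assumes "hom_word V xs" "\<And>us. hom_word V us \<Longrightarrow> length us \<le> length xs \<Longrightarrow> \<phi> us = \<phi>' us"
  shows "cofree V \<phi> xs \<Psi> = cofree V \<phi>' xs \<Psi>"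
  using assms
proof (induction xs arbitrary: \<Psi> rule: length_induct_word)
  case (1 xs)
  show ?case
  proof (cases xs)
    case (Cons x xs')
    show ?thesis unfolding Cons cofree.simps
    proof (rule unsh_cong)
      fix u w assume *: "set u \<subseteq> set xs'" "set w \<subseteq> set xs'" "length u + length w = length xs'"
      have "\<phi> (x # u) = \<phi>' (x # u)" by (rule 1(3)) (use * 1(2) Cons in auto)
      moreover have "cofree V \<phi> w (\<lambda>a. \<Psi> (\<phi>' (x # u) # a)) = cofree V \<phi>' w (\<lambda>a. \<Psi> (\<phi>' (x # u) # a))"
        by (rule 1(1)) (use * 1(2,3) Cons in auto)
      ultimately show "cofree V \<phi> w (\<lambda>a. \<Psi> (\<phi> (x # u) # a)) = cofree V \<phi>' w (\<lambda>a. \<Psi> (\<phi>' (x # u) # a))"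
        by simp
    qed
  qed simp
qed

text \<open>An image word with at least two letters comes from at least two nonempty blocks, all
  shorter than \<open>xs\<close>. This is why the Sym^2 component on k + 1 letters involves only
  structure maps of order at most k.\<close>

lemma cofree_cong_structure_2:
  assumes xs: "hom_word V xs" and \<phi>: "\<And>us. hom_word V us \<Longrightarrow> length us < length xs \<Longrightarrow> \<phi> us = \<phi>' us"
    and \<Psi>: "\<And>ys. length ys = 1 \<Longrightarrow> \<Psi> ys = 0"
  shows "cofree V \<phi> xs \<Psi> = cofree V \<phi>' xs \<Psi>"
proof (cases xs)
  case (Cons x xs')
  show ?thesis unfolding Cons cofree.simps
  proof (rule unsh_cong)
    fix u w assume *: "set u \<subseteq> set xs'" "set w \<subseteq> set xs'" "length u + length w = length xs'"
    then have hom: "hom_word V (x # u)" "hom_word V w" using xs Cons by auto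
    show "cofree V \<phi> w (\<lambda>a. \<Psi> (\<phi> (x # u) # a)) = cofree V \<phi>' w (\<lambda>a. \<Psi> (\<phi>' (x # u) # a))"
    proof (cases "w = []")
      case False
      then have "0 < length w" by simp
      then have "length (x # u) < length xs" unfolding Cons length_Cons using *(3) by linarith
      then have "\<phi> (x # u) = \<phi>' (x # u)" by (intro \<phi> hom)
      moreover have "cofree V \<phi> w \<Psi> = cofree V \<phi>' w \<Psi>" for \<Psi>
        by (rule cofree_cong_structure[OF hom(2)], rule \<phi>) (use * Cons in auto)
      ultimately show ?thesis by simp
    qed (simp add: \<Psi>)
  qed
qed simp

locale structure_maps = V: graded_space V + W: graded_space W
  for V :: "('k::field, 'a::ab_group_add, 'y) gvs_scheme" and W :: "('k, 'b::ab_group_add, 'z) gvs_scheme" +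
  fixes \<phi> :: "'a list \<Rightarrow> 'b"
  assumes \<phi>: "gsm_deg V W 0 \<phi>"
begin

abbreviation "cf \<equiv> cofree V \<phi>"

lemma \<phi>_grd: "hom_word V xs \<Longrightarrow> \<phi> xs \<in> grd W (wdeg V xs)"
  using gsm_deg_in_grd[OF \<phi>] by simp

lemma \<phi>_hom: "hom_word V xs \<Longrightarrow> \<phi> xs \<in> homogeneous W"
  by (rule W.homogeneousI[OF \<phi>_grd])

text \<open>Values of \<open>\<phi>\<close> may be 0, and then their \<open>deg\<close> says
  nothing. Hence each image word is accompanied by a list of degrees in which its letters are known
  to lie.\<close>

lemma cofree_closed:
  assumes U: "\<And>v w. v \<in> U \<Longrightarrow> w \<in> U \<Longrightarrow> v + w \<in> U" "\<And>v. v \<in> U \<Longrightarrow> - v \<in> U"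
    and "hom_word V xs"
    and "\<And>ys ns. W.graded_word ys ns \<Longrightarrow> sum_list ns = wdeg V xs \<Longrightarrow> ys = [] \<longleftrightarrow> xs = [] \<Longrightarrow> \<Psi> ys \<in> U"
  shows "cf xs \<Psi> \<in> U"
  using assms(3,4)
proof (induction xs arbitrary: \<Psi> rule: length_induct_word)
  case (1 xs)
  show ?case
  proof (cases xs)
    case Nil
    then show ?thesis using 1(3)[of "[]" "[]"] by simp
  next
    case (Cons x xs')
    show ?thesis unfolding Cons cofree.simps
    proof (rule unsh_closed[OF U])
      fix u w assume *: "mset u + mset w = mset xs'"
      then have m: "mset (u @ w) = mset xs'" by simp
      have hom: "hom_word V (x # u)" "hom_word V w"
        using mset_eq_setD[OF m] 1(2) Cons by auto
      have len: "length w < length xs" using mset_eq_length[OF m] Cons by simp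
      have wd: "wdeg V xs = wdeg V (x # u) + wdeg V w" using wdeg_mset[OF m, of V] Cons by simp
      show "cf w (\<lambda>a. \<Psi> (\<phi> (x # u) # a)) \<in> U"
      proof (rule 1(1)[OF len hom(2)])
        fix ys ns assume "W.graded_word ys ns" "sum_list ns = wdeg V w"
        then show "\<Psi> (\<phi> (x # u) # ys) \<in> U"
          using \<phi>_grd[OF hom(1)] wd by (intro 1(3)[of _ "wdeg V (x # u) # ns"]) (simp_all add: Cons)
      qed
    qed
  qed
qed

lemma cofree_eq_0:
  assumes "hom_word V xs"
    and "\<And>ys ns. W.graded_word ys ns \<Longrightarrow> sum_list ns = wdeg V xs \<Longrightarrow> ys = [] \<longleftrightarrow> xs = [] \<Longrightarrow> \<Psi> ys = 0"
  shows "cf xs \<Psi> = 0"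
  using cofree_closed[of "{0}" xs \<Psi>] assms by auto

lemma cofree_cong:
  assumes "hom_word V xs"
    and "\<And>ys. hom_word W ys \<Longrightarrow> \<Psi> ys = \<Psi>' ys"
  shows "cf xs \<Psi> = cf xs \<Psi>'"
proof -
  have "cf xs (\<lambda>ys. \<Psi> ys - \<Psi>' ys) = 0"
    by (rule cofree_eq_0[OF assms(1)]) (use assms(2) W.graded_word_hom_word in simp)
  then show ?thesis by (simp add: cofree_diff)
qed

lemma cofree_wdeg:
  assumes \<Psi>: "gsm W s \<Psi>" and xs: "hom_word V xs"
  shows "cf xs (\<lambda>ys. sg (c * wdeg W ys) (\<Psi> ys)) = sg (c * wdeg V xs) (cf xs \<Psi>)"
proof -
  have "cf xs (\<lambda>ys. sg (c * wdeg W ys) (\<Psi> ys) - sg (c * wdeg V xs) (\<Psi> ys)) = 0"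
  proof (rule cofree_eq_0[OF xs])
    fix ys ns assume ys: "W.graded_word ys ns" "sum_list ns = wdeg V xs"
    show "sg (c * wdeg W ys) (\<Psi> ys) - sg (c * wdeg V xs) (\<Psi> ys) = 0"
      using W.gsm_mem_0[OF \<Psi> W.graded_word_hom_word[OF ys(1)]] W.wdeg_eq[OF ys(1)] ys(2)
      by (cases "0 \<in> set ys") auto
  qed
  then show ?thesis by (simp add: cofree_diff cofree_sg)
qed

lemma cofree_carrier: "hom_word V xs \<Longrightarrow> cf xs gen \<in> sym_carrier W"
  by (rule cofree_closed)
    (auto intro: free.subspace_add[OF subspace_sym_carrier] free.subspace_neg[OF subspace_sym_carrier]
      dest: W.graded_word_hom_word)

lemma cofree_sym_grd: "hom_word V xs \<Longrightarrow> cf xs gen \<in> sym_grd W (wdeg V xs)"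
proof (rule cofree_closed)
  fix ys ns assume "W.graded_word ys ns" "sum_list ns = wdeg V xs"
  then show "gen ys \<in> sym_grd W (wdeg V xs)"
    unfolding sym_grd_def by (intro free.span_base) blast
qed (auto intro: free.subspace_add[OF W.subspace_sym_grd] free.subspace_neg[OF W.subspace_sym_grd])

lemma gsm_cofree_param:
  fixes s :: "'k \<Rightarrow> 'v::ab_group_add \<Rightarrow> 'v"
  assumes X: "graded_space X" and s: "vector_space s" and w: "hom_word V w"
    and K: "\<And>a. hom_word W a \<Longrightarrow> gsm X s (\<lambda>u. K u a)"
  shows "gsm X s (\<lambda>u. cf w (K u))"
proof -
  have "gsm X s (\<lambda>u. lin_ext s (K u) (cf w gen))"
    by (rule graded_space.gsm_lin_ext_param[OF X s], rule K)
      (use cofree_carrier[OF w, unfolded sym_carrier_iff] in blast)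
  then show ?thesis by (simp add: lin_ext_cofree[OF s])
qed

lemma gsm_cofree_head:
  assumes "gsm W s \<Psi>" "hom_word V w"
  shows "gsm V s (\<lambda>u. cf w (\<lambda>a. \<Psi> (\<phi> u # a)))"
  by (rule gsm_cofree_param[OF V.graded_space_axioms gsm_vs[OF assms(1)] assms(2)])
    (rule gsm_head[OF V.graded_space_axioms W.graded_space_axioms \<phi> assms(1)])

text \<open>The recursion singles out the first letter, so symmetry in the first two needs an
  argument. If both are in one block, \<open>\<phi>\<close> is symmetric; otherwise their two blocks
  are exchanged, as letters of the image and in the unshuffle.\<close>

lemma cofree_Cons_swap:
  assumes \<Psi>: "gsm W s \<Psi>" and hom: "x \<in> homogeneous V" "y \<in> homogeneous V" "hom_word V vs"
  shows "cf (x # y # vs) \<Psi> = sg (deg V x * deg V y) (cf (y # x # vs) \<Psi>)"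
proof -
  let ?N = "\<lambda>x u y u' w. cf w (\<lambda>a. \<Psi> (\<phi> (x # u) # \<phi> (y # u') # a))"
  have expand: "cf (x # y # vs) \<Psi> = unsh V vs (\<lambda>u w. cf w (\<lambda>a. \<Psi> (\<phi> (x # y # u) # a)))
      + unsh V vs (\<lambda>u w. unsh V w (\<lambda>u' w'. sg (deg V y * wdeg V u) (?N x u y u' w')))" for x y
    by (simp add: unsh_sg)
  have 1: "unsh V vs (\<lambda>u w. cf w (\<lambda>a. \<Psi> (\<phi> (x # y # u) # a)))
      = sg (deg V x * deg V y) (unsh V vs (\<lambda>u w. cf w (\<lambda>a. \<Psi> (\<phi> (y # x # u) # a))))"
    unfolding unsh_sg[symmetric]
  proof (rule unsh_cong)
    fix u w assume "set u \<subseteq> set vs" "set w \<subseteq> set vs"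
    then have u: "hom_word V u" and w: "hom_word V w" using hom(3) by auto
    show "cf w (\<lambda>a. \<Psi> (\<phi> (x # y # u) # a)) = sg (deg V x * deg V y) (cf w (\<lambda>a. \<Psi> (\<phi> (y # x # u) # a)))"
      by (rule V.gsm_Cons_swap[OF gsm_cofree_head[OF \<Psi> w] u V.in_grd_deg[OF hom(1)] V.in_grd_deg[OF hom(2)]])
  qed
  have "unsh V vs (\<lambda>u w. unsh V w (\<lambda>u' w'. sg (deg V y * wdeg V u) (?N x u y u' w')))
      = unsh V vs (\<lambda>u' w. unsh V w (\<lambda>u w'. sg (wdeg V u' * wdeg V u) (sg (deg V y * wdeg V u) (?N x u y u' w'))))"
    by (rule unsh_swap)
  also have "\<dots> = unsh V vs (\<lambda>u' w. unsh V w (\<lambda>u w'. sg (deg V x * deg V y) (sg (deg V x * wdeg V u') (?N y u' x u w'))))"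
  proof (intro unsh_cong)
    fix u' w u w' assume "set u' \<subseteq> set vs" "set w \<subseteq> set vs" "set u \<subseteq> set w" "set w' \<subseteq> set w"
    then have h: "hom_word V (x # u)" "hom_word V (y # u')" "hom_word V w'" using hom by auto
    have "?N x u y u' w' = cf w' (\<lambda>a. sg (wdeg V (x # u) * wdeg V (y # u')) (\<Psi> (\<phi> (y # u') # \<phi> (x # u) # a)))"
      by (rule cofree_cong[OF h(3)]) (rule W.gsm_Cons_swap[OF \<Psi> _ \<phi>_grd[OF h(1)] \<phi>_grd[OF h(2)]])
    then have "?N x u y u' w' = sg ((deg V x + wdeg V u) * (deg V y + wdeg V u')) (?N y u' x u w')"
      by (simp only: cofree_sg wdeg_simps)
    then show "sg (wdeg V u' * wdeg V u) (sg (deg V y * wdeg V u) (?N x u y u' w'))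
        = sg (deg V x * deg V y) (sg (deg V x * wdeg V u') (?N y u' x u w'))"
      by (simp only: sg_sg) (rule sg_cong, simp, blast)
  qed
  finally have 2: "unsh V vs (\<lambda>u w. unsh V w (\<lambda>u' w'. sg (deg V y * wdeg V u) (?N x u y u' w')))
      = sg (deg V x * deg V y) (unsh V vs (\<lambda>u w. unsh V w (\<lambda>u' w'. sg (deg V x * wdeg V u) (?N y u x u' w'))))"
    by (simp only: unsh_sg)
  show ?thesis unfolding expand 1 2 sg_add ..
qed

text \<open>Symmetry of \<open>cofree\<close> on a word rests on symmetry in its shorter tails.
  Truncation by length makes the induction hypothesis a statement about a function on all words, to
  which \<open>gsm_unsh\<close> applies.\<close>

lemma gsm_cofree_length:
  "gsm W s \<Psi> \<Longrightarrow> gsm V s (\<lambda>xs. if length xs \<le> n then cf xs \<Psi> else 0)"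
proof (induction n arbitrary: \<Psi>)
  case 0
  have "(\<lambda>xs. if length xs \<le> 0 then cf xs \<Psi> else 0) = (\<lambda>xs. if xs = [] then \<Psi> [] else 0)" by auto
  then show ?case by (simp only: V.gsm_Nil[OF gsm_vs[OF 0]])
next
  case (Suc n)
  note \<Psi> = Suc.prems
  note s = gsm_vs[OF \<Psi>]
  interpret s: vector_space s by fact
  let ?F = "\<lambda>xs. if length xs \<le> Suc n then cf xs \<Psi> else 0"
  define M where "M w u = cf w (\<lambda>a. \<Psi> (\<phi> u # a))" for w u
  have M: "gsm V s (M w)" if "hom_word V w" for w
    unfolding M_def by (rule gsm_cofree_head[OF \<Psi> that])
  have F: "?F (z # xs) = (if length xs \<le> n then unsh V xs (\<lambda>u w. M w (z # u)) else 0)" for z xs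
    by (simp add: M_def)
  \<comment> \<open>With the first letter fixed, multilinearity in the others is that of the
    coproduct. Only relations that touch the first letter are left for the case analysis
    below.\<close>
  have tail: "gsm V s (\<lambda>xs. ?F (z # xs))" if z: "z \<in> homogeneous V" for z
  proof -
    have "bigsm V s (\<lambda>u w. if length w \<le> n then M w (z # u) else 0)"
    proof (rule bigsmI)
      fix u assume "hom_word V u"
      then have "\<phi> (z # u) \<in> homogeneous W" using z by (intro \<phi>_hom) simp
      from Suc.IH[OF W.gsm_Cons[OF \<Psi> this]]
      show "gsm V s (\<lambda>w. if length w \<le> n then M w (z # u) else 0)" unfolding M_def .
    next
      fix w assume "hom_word V w"
      then show "gsm V s (\<lambda>u. if length w \<le> n then M w (z # u) else 0)"
        using V.gsm_Cons[OF M z] V.gsm_zero_fun[OF s] by (cases "length w \<le> n") simp_all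
    qed
    from V.gsm_length_if[OF V.gsm_unsh[OF s this], of "\<lambda>m. m \<le> n"]
    have "gsm V s (\<lambda>xs. if length xs \<le> n then unsh V xs (\<lambda>u w. if length w \<le> n then M w (z # u) else 0) else 0)" .
    moreover have "?F (z # xs) = (if length xs \<le> n then unsh V xs (\<lambda>u w. if length w \<le> n then M w (z # u) else 0) else 0)" for xs
      unfolding F by (auto intro!: unsh_cong)
    ultimately show ?thesis by simp
  qed
  show ?case
  proof (rule V.gsmI[OF s])
    fix us vs assume us: "hom_word V us" "hom_word V vs"
    show "?F (us @ 0 # vs) = 0"
    proof (cases us)
      case Nil
      have "unsh V vs (\<lambda>u w. M w (0 # u)) = 0"
        by (rule unsh_eq_0, rule V.gsm_Cons_0[OF M]) (use us in auto)
      then show ?thesis unfolding Nil append_Nil F by simp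
    next
      case (Cons z us')
      then show ?thesis using V.gsm_0[OF tail[of z], of us' vs] us by (auto simp del: cofree.simps)
    qed
  next
    fix us vs x and a :: 'k assume us: "hom_word V us" "hom_word V vs" and x: "x \<in> homogeneous V"
    show "?F (us @ scl V a x # vs) = s a (?F (us @ x # vs))"
    proof (cases us)
      case Nil
      have "unsh V vs (\<lambda>u w. M w (scl V a x # u)) = s a (unsh V vs (\<lambda>u w. M w (x # u)))"
        unfolding vs_linear_unsh[OF s.linear_scale_self]
        by (rule unsh_cong, use V.gsm_scale[OF M, of _ "[]"] us x in auto)
      then show ?thesis unfolding Nil append_Nil F by simp
    next
      case (Cons z us')
      then show ?thesis using V.gsm_scale[OF tail[of z], of us' vs x a] us x by (auto simp del: cofree.simps)
    qed
  next
    fix us vs x y assume us: "hom_word V us" "hom_word V vs" and x: "x \<in> homogeneous V" "y \<in> homogeneous V"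
      and dy: "deg V y = deg V x"
    have xy: "x \<in> grd V (deg V x)" "y \<in> grd V (deg V x)"
      using V.in_grd_deg[OF x(1)] V.in_grd_deg[OF x(2)] dy by auto
    show "?F (us @ (x + y) # vs) = ?F (us @ x # vs) + ?F (us @ y # vs)"
    proof (cases us)
      case Nil
      have "unsh V vs (\<lambda>u w. M w ((x + y) # u)) = unsh V vs (\<lambda>u w. M w (x # u)) + unsh V vs (\<lambda>u w. M w (y # u))"
        unfolding unsh_add[symmetric]
        by (rule unsh_cong, use V.gsm_add[OF M _ _ xy, of _ "[]"] us in auto)
      then show ?thesis unfolding Nil append_Nil F by simp
    next
      case (Cons z us')
      then show ?thesis using V.gsm_add[OF tail[of z] _ _ xy, of us' vs] us by (auto simp del: cofree.simps)
    qed
  next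
    fix us vs x y assume us: "hom_word V us" "hom_word V vs" and x: "x \<in> homogeneous V" "y \<in> homogeneous V"
    show "?F (us @ x # y # vs) = sg (deg V x * deg V y) (?F (us @ y # x # vs))"
    proof (cases us)
      case Nil
      then show ?thesis using cofree_Cons_swap[OF \<Psi> x us(2)] by (simp del: cofree.simps)
    next
      case (Cons z us')
      then show ?thesis
        using gsm_swap[OF tail[of z], of us' vs x "deg V x" y "deg V y"] us x V.in_grd_deg
        by (auto simp del: cofree.simps split: if_splits)
    qed
  qed
qed

lemma gsm_cofree: "gsm W s \<Psi> \<Longrightarrow> gsm V s (\<lambda>xs. cf xs \<Psi>)"
proof -
  assume \<Psi>: "gsm W s \<Psi>"
  from V.gsm_length_dep[of s "\<lambda>n xs. if length xs \<le> n then cf xs \<Psi> else 0", OF gsm_cofree_length[OF \<Psi>]]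
  show ?thesis by simp
qed

text \<open>The image of the block of the first letter lands in the left or in the right factor,
  which gives the two summands of \<open>unsh\<close> on \<open>x # xs'\<close>. In the second case
  it passes the left factor; \<open>unsh_swap\<close> reorders the blocks accordingly.\<close>

lemma cofree_comult:
  assumes s: "vector_space s" and "bigsm W s G" "hom_word V xs"
  shows "cf xs (\<lambda>ys. unsh W ys G) = unsh V xs (\<lambda>u w. cf u (\<lambda>a. cf w (G a)))"
  using assms(2,3)
proof (induction xs arbitrary: G rule: length_induct_word)
  case (1 xs)
  note G = \<open>bigsm W s G\<close>
  show ?case
  proof (cases xs)
    case (Cons x xs')
    define dx where "dx = deg V x"
    have xs': "hom_word V xs'" and x: "x \<in> homogeneous V" using 1(3) Cons by auto
    let ?R = "\<lambda>u w1 w2. cf w1 (\<lambda>a. cf w2 (\<lambda>b. G a (\<phi> (x # u) # b)))"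
    have "cf xs (\<lambda>ys. unsh W ys G) = unsh V xs' (\<lambda>u w. unsh V w (\<lambda>w1 w2. cf w1 (\<lambda>a. cf w2 (G (\<phi> (x # u) # a)))))
        + unsh V xs' (\<lambda>u w. unsh V w (\<lambda>w1 w2. sg ((dx + wdeg V u) * wdeg V w1) (?R u w1 w2)))"
      unfolding Cons cofree.simps
    proof (subst unsh_add[symmetric], rule unsh_cong)
      fix u w assume *: "set u \<subseteq> set xs'" "set w \<subseteq> set xs'" "length u + length w = length xs'"
      then have u: "hom_word V (x # u)" and w: "hom_word V w" using xs' x by auto
      have len: "length w < length xs" using * Cons by simp
      let ?y = "\<phi> (x # u)" and ?n = "dx + wdeg V u"
      have y: "?y \<in> grd W ?n" using \<phi>_grd[OF u] by (simp add: dx_def)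
      have hy: "?y \<in> homogeneous W" by (rule \<phi>_hom[OF u])
      have "cf w (\<lambda>a. unsh W (?y # a) G) = cf w (\<lambda>ys. unsh W ys (\<lambda>a b. G (?y # a) b)
          + unsh W ys (\<lambda>a b. sg (?n * wdeg W a) (G a (?y # b))))"
      proof (rule cofree_cong[OF w])
        fix ys assume ys: "hom_word W ys"
        have "unsh W ys (\<lambda>a b. sg (deg W ?y * wdeg W a) (G a (?y # b))) = unsh W ys (\<lambda>a b. sg (?n * wdeg W a) (G a (?y # b)))"
        proof (rule unsh_cong)
          fix a b assume "set a \<subseteq> set ys" "set b \<subseteq> set ys"
          then have "hom_word W a" "hom_word W b" using ys by auto
          then show "sg (deg W ?y * wdeg W a) (G a (?y # b)) = sg (?n * wdeg W a) (G a (?y # b))"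
            using W.gsm_Cons_0[OF bigsm_right[OF G], of a b] W.deg_eq[OF y] by (cases "?y = 0") auto
        qed
        then show "unsh W (?y # ys) G = unsh W ys (\<lambda>a b. G (?y # a) b) + unsh W ys (\<lambda>a b. sg (?n * wdeg W a) (G a (?y # b)))"
          by simp
      qed
      also have "\<dots> = unsh V w (\<lambda>w1 w2. cf w1 (\<lambda>a. cf w2 (G (?y # a))))
          + unsh V w (\<lambda>w1 w2. cf w1 (\<lambda>a. cf w2 (\<lambda>b. sg (?n * wdeg W a) (G a (?y # b)))))"
        unfolding cofree_add
        by (simp only: 1(1)[OF len W.bigsm_Cons_left[OF G hy] w] 1(1)[OF len W.bigsm_Cons_right[OF G hy] w])
      also have "unsh V w (\<lambda>w1 w2. cf w1 (\<lambda>a. cf w2 (\<lambda>b. sg (?n * wdeg W a) (G a (?y # b)))))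
          = unsh V w (\<lambda>w1 w2. sg (?n * wdeg V w1) (?R u w1 w2))"
      proof (rule unsh_cong)
        fix w1 w2 assume "set w1 \<subseteq> set w" "set w2 \<subseteq> set w"
        then have w1: "hom_word V w1" and w2: "hom_word V w2" using w by auto
        have "gsm W s (\<lambda>a. cf w2 (\<lambda>b. G a (?y # b)))"
          by (rule gsm_cofree_param[OF W.graded_space_axioms s w2], rule bigsm_left[OF G]) (use hy in simp)
        from cofree_wdeg[OF this w1]
        show "cf w1 (\<lambda>a. cf w2 (\<lambda>b. sg (?n * wdeg W a) (G a (?y # b)))) = sg (?n * wdeg V w1) (?R u w1 w2)"
          by (simp only: cofree_sg)
      qed
      finally show "cf w (\<lambda>a. unsh W (?y # a) G) = unsh V w (\<lambda>w1 w2. cf w1 (\<lambda>a. cf w2 (G (?y # a))))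
          + unsh V w (\<lambda>w1 w2. sg (?n * wdeg V w1) (?R u w1 w2))" .
    qed
    also have "unsh V xs' (\<lambda>u w. unsh V w (\<lambda>w1 w2. cf w1 (\<lambda>a. cf w2 (G (\<phi> (x # u) # a)))))
        = unsh V xs' (\<lambda>v w2. cf (x # v) (\<lambda>a. cf w2 (G a)))"
      by (simp add: unsh_assoc[symmetric])
    also have "unsh V xs' (\<lambda>u w. unsh V w (\<lambda>w1 w2. sg ((dx + wdeg V u) * wdeg V w1) (?R u w1 w2)))
        = unsh V xs' (\<lambda>w1 v. unsh V v (\<lambda>u w2. sg (wdeg V w1 * wdeg V u) (sg ((dx + wdeg V u) * wdeg V w1) (?R u w1 w2))))"
      by (rule unsh_swap)
    also have "\<dots> = unsh V xs' (\<lambda>w1 v. sg (dx * wdeg V w1) (cf w1 (\<lambda>a. cf (x # v) (G a))))"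
      unfolding cofree.simps cofree_unsh unsh_sg[symmetric]
      by (intro unsh_cong) (auto simp: sg_def)
    finally show ?thesis by (simp add: Cons dx_def del: cofree.simps)
  qed simp
qed

definition morphism :: "('a list \<Rightarrow>\<^sub>0 'k) \<Rightarrow> ('b list \<Rightarrow>\<^sub>0 'k)" where
  "morphism = lin_ext fscale (\<lambda>xs. cf xs gen)"

lemma coalg_morphism: "coalg_morphism V W morphism"
  unfolding morphism_def
proof (rule coalg_morphismI[OF V.graded_space_axioms W.graded_space_axioms])
  note fs = free.vector_space_axioms
  show "gsm V fscale (\<lambda>xs. quot (sym_rel W) (cf xs gen))"
    using gsm_cofree[OF W.gsm_sym_class] lin_ext_cofree[OF fs, of "sym_class W" V \<phi>]
    by (simp add: lin_ext_sym_class)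
  fix xs assume xs: "hom_word V xs"
  show "cf xs gen \<in> sym_carrier W" by (rule cofree_carrier[OF xs])
  show "cf xs gen \<in> sym_grd W (wdeg V xs)" by (rule cofree_sym_grd[OF xs])
  show "lin_ext fscale (\<lambda>ys. unsh W ys G) (cf xs gen)
      = unsh V xs (\<lambda>u w. lin_ext fscale (\<lambda>a. lin_ext fscale (G a) (cf w gen)) (cf u gen))"
    if "bigsm W fscale G" for G :: "'b list \<Rightarrow> 'b list \<Rightarrow> ('b list \<times> 'b list \<Rightarrow>\<^sub>0 'k)"
    using cofree_comult[OF fs that xs] by (simp add: lin_ext_cofree[OF fs])
  show "Poly_Mapping.lookup (cf xs gen) [] = (if xs = [] then 1 else 0)"
  proof (cases "xs = []")
    case False
    have "Poly_Mapping.lookup (cf xs gen) [] = cf xs (\<lambda>ys. Poly_Mapping.lookup (gen ys) [])"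
      by (rule cofree_hom) (simp add: lookup_add)
    also have "\<dots> = 0" by (rule cofree_eq_0[OF xs]) (use False in \<open>simp add: lookup_single when_def\<close>)
    finally show ?thesis using False by simp
  qed simp
qed (simp add: sym_eq_def free.subspace_0[OF subspace_sym_rel])

lemma pull_morphism: "vector_space s \<Longrightarrow> pull s morphism \<Psi> xs = cf xs \<Psi>"
  by (simp add: pull_def morphism_def lin_ext_gen free.vector_space_axioms lin_ext_cofree)

text \<open>Only the partition with a single block yields a word of length one.\<close>

lemma cofree_the_letter:
  assumes "hom_word V xs" "xs \<noteq> []"
  shows "cf xs the_letter = \<phi> xs"
proof -
  obtain x xs' where xs: "xs = x # xs'" using assms(2) by (cases xs) auto
  have "unsh V xs' (\<lambda>u w. cf w (\<lambda>a. the_letter (\<phi> (x # u) # a))) = cf [] (\<lambda>a. the_letter (\<phi> (x # xs') # a))"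
  proof (rule unsh_right_Nil)
    fix u w :: "'a list" assume *: "length u < length xs'" "set w \<subseteq> set xs'" "length u + length w = length xs'"
    then have w: "hom_word V w" "w \<noteq> []" using assms xs by auto
    show "cf w (\<lambda>a. the_letter (\<phi> (x # u) # a)) = 0"
      by (rule cofree_eq_0[OF w(1)], rule the_letter_length) (use w(2) in auto)
  qed
  then show ?thesis by (simp add: xs)
qed

end

lemma (in dgla_coalg) first_map_eq:
  assumes f: "Vector_Spaces.linear (scl L) (scl M) f"
    and P1: "\<And>y. y \<in> homogeneous VL \<Longrightarrow> pull (scl M) P the_letter [y] = f y"
  shows "first_map L M P = f"
proof
  fix x
  note s = M.Ls.vector_space_axioms
  have "hcomp VL x n \<in> homogeneous VL" for n
    by (rule L.homogeneousI[OF L.hcomp_in_grd])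
  then have "first_map L M P x = (\<Sum>n | hcomp VL x n \<noteq> 0. f (hcomp VL x n))"
    by (simp add: first_map_def structure_map_eq incl_def lin_ext_sum[OF s] lin_ext_gen[OF s] P1)
  also have "\<dots> = f x"
    using L.sum_hcomp[OF L.finite_hcomp order_refl, of x] by (simp add: vs_linear_sum[OF f, symmetric])
  finally show "first_map L M P x = f x" .
qed

context contraction
begin

text \<open>Defined for every \<open>\<phi>\<close>, without symmetry assumptions, so that the
  recursion for the structure maps can be written down before its values are known to be
  admissible.\<close>

definition morph :: "('b list \<Rightarrow> 'a) \<Rightarrow> ('b list \<Rightarrow>\<^sub>0 'k) \<Rightarrow> ('a list \<Rightarrow>\<^sub>0 'k)" where
  "morph \<phi> = lin_ext fscale (\<lambda>xs. cofree VB \<phi> xs gen)"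

lemma structure_maps: "gsm_deg VB VA 0 \<phi> \<Longrightarrow> structure_maps VB VA \<phi>"
  by (simp add: structure_maps_def structure_maps_axioms_def A.graded_space_axioms B.graded_space_axioms)

lemma
  assumes "gsm_deg VB VA 0 \<phi>"
  shows coalg_morph: "coalg_morphism VB VA (morph \<phi>)"
    and pull_morph: "vector_space s \<Longrightarrow> pull s (morph \<phi>) \<Psi> xs = cofree VB \<phi> xs \<Psi>"
    and pull_the_letter: "hom_word VB xs \<Longrightarrow> xs \<noteq> [] \<Longrightarrow> pull (scl A) (morph \<phi>) the_letter xs = \<phi> xs"
proof -
  interpret S: structure_maps VB VA \<phi> by (rule structure_maps[OF assms])
  have eq: "morph \<phi> = S.morphism" by (simp add: morph_def S.morphism_def)
  show "coalg_morphism VB VA (morph \<phi>)" unfolding eq by (rule S.coalg_morphism)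
  show pull: "pull s (morph \<phi>) \<Psi> xs = cofree VB \<phi> xs \<Psi>" if "vector_space s" for s and \<Psi> :: "'a list \<Rightarrow> 'v::ab_group_add" and xs
    unfolding eq by (rule S.pull_morphism[OF that])
  show "hom_word VB xs \<Longrightarrow> xs \<noteq> [] \<Longrightarrow> pull (scl A) (morph \<phi>) the_letter xs = \<phi> xs"
    unfolding pull[OF A.Ls.vector_space_axioms] by (rule S.cofree_the_letter)
qed

lemma dgla_coalg_morph: "gsm_deg VB VA 0 \<phi> \<Longrightarrow> dgla_coalg B A (morph \<phi>)"
  by (intro dgla_coalg.intro sym_morphism.intro sym_morphism_axioms.intro coalg_morph
      A.dgla_axioms B.dgla_axioms A.graded_space_axioms B.graded_space_axioms)

lemma H_map_linear: "Vector_Spaces.linear fscale fscale (H_map B i p h n)"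
proof -
  note fs = free.vector_space_axioms
  have "H_map B i p h n = K_map B e \<circ> (H_tilde B h \<circ> proj n)"
    by (auto simp: H_map_def fun_eq_iff)
  moreover have K: "Vector_Spaces.linear fscale fscale (K_map B e)"
    and H: "Vector_Spaces.linear fscale fscale (H_tilde B h)"
    unfolding K_map_def H_tilde_def by (rule linear_lin_ext[OF fs])+
  ultimately show ?thesis
    using Vector_Spaces.linear_compose[OF Vector_Spaces.linear_compose[OF linear_proj H] K] by (simp only:)
qed

lemma H_map_other_length: "length xs \<noteq> n \<Longrightarrow> H_map B i p h n (gen xs) = 0"
  by (simp add: H_map_def proj_gen H_tilde_def K_map_def lin_ext_0[OF free.vector_space_axioms])

text \<open>Both terms of L only use structure maps of order at most \<open>k\<close>: the first one
  by \<open>cofree_cong_structure_2\<close>, the second one because it evaluates the structure map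
  of order \<open>k\<close>.\<close>

lemma L_word_cong:
  assumes \<phi>: "gsm_deg VB VA 0 \<phi>" and \<psi>: "gsm_deg VB VA 0 \<psi>"
    and eq: "\<And>us. hom_word VB us \<Longrightarrow> length us \<le> k \<Longrightarrow> \<phi> us = \<psi> us" and xs: "hom_word VB xs" and k: "1 \<le> k"
  shows "dgla_coalg.L_word B A (morph \<phi>) k xs = dgla_coalg.L_word B A (morph \<psi>) k xs"
proof (cases "length xs = k + 1")
  case True
  note s = A.Ls.vector_space_axioms
  have "cofree VB \<phi> xs (\<lambda>ys. if length ys = 2 then A.q ys else 0) = cofree VB \<psi> xs (\<lambda>ys. if length ys = 2 then A.q ys else 0)"
    by (rule cofree_cong_structure_2[OF xs eq]) (use True in auto)
  moreover have "cod VB B.q xs (\<lambda>ys. if length ys = k then pull (scl A) (morph \<phi>) the_letter ys else 0)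
      = cod VB B.q xs (\<lambda>ys. if length ys = k then pull (scl A) (morph \<psi>) the_letter ys else 0)"
  proof (rule B.cod_cong_hom[OF B.gsm_deg_q xs])
    fix ys assume ys: "hom_word VB ys"
    show "(if length ys = k then pull (scl A) (morph \<phi>) the_letter ys else 0)
        = (if length ys = k then pull (scl A) (morph \<psi>) the_letter ys else 0)"
    proof (cases "length ys = k")
      case True
      then have "ys \<noteq> []" using k by auto
      then show ?thesis
        using pull_the_letter[OF \<phi> ys] pull_the_letter[OF \<psi> ys] eq[OF ys] True by simp
    qed simp
  qed
  ultimately show ?thesis
    unfolding dgla_coalg.L_word_def[OF dgla_coalg_morph[OF \<phi>]] dgla_coalg.L_word_def[OF dgla_coalg_morph[OF \<psi>]]
      pull_morph[OF \<phi> s] pull_morph[OF \<psi> s] by simp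
next
  case False
  then show ?thesis
    by (simp add: dgla_coalg.L_word_def[OF dgla_coalg_morph[OF \<phi>]] dgla_coalg.L_word_def[OF dgla_coalg_morph[OF \<psi>]])
qed

text \<open>\<open>stage n\<close> collects the structure maps of order at most \<open>n + 1\<close>.\<close>

primrec stage :: "nat \<Rightarrow> 'b list \<Rightarrow> 'a" where
  "stage 0 = on_letter p"
| "stage (Suc n) = (\<lambda>xs. if length xs = n + 2
     then L_infty A B (morph (stage n)) (n + 1) (H_map B i p h (n + 2) (gen xs)) else stage n xs)"

lemma L_infty_H_map:
  assumes \<phi>: "gsm_deg VB VA 0 \<phi>" and xs: "hom_word VB xs" "length xs = k + 1"
  shows "L_infty A B (morph \<phi>) k (H_map B i p h (k + 1) (gen xs)) = H (scl A) xs (dgla_coalg.L_word B A (morph \<phi>) k)"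
proof -
  interpret C: dgla_coalg B A "morph \<phi>" by (rule dgla_coalg_morph[OF \<phi>])
  have "L_infty A B (morph \<phi>) k (H_map B i p h (k + 1) (gen xs)) = lin_ext (scl A) (C.L_word k) (H_map B i p h (length xs) (gen xs))"
    unfolding xs(2) by (rule C.L_infty_eq[OF H_map_carrier]) (use xs in simp)
  also have "\<dots> = H (scl A) xs (C.L_word k)"
    by (rule lin_ext_H_map) (use gsm_deg_gsm[OF C.gsm_deg_L_word] xs in auto)
  finally show ?thesis .
qed

text \<open>Vanishing on longer words is proved along with symmetry, since it turns the case
  distinction in \<open>stage\<close> into a sum of two symmetric multilinear functions.\<close>

lemma gsm_deg_stage: "gsm_deg VB VA 0 (stage n) \<and> (\<forall>xs. n + 1 < length xs \<longrightarrow> stage n xs = 0)"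
proof (induction n)
  case 0
  show ?case
    using gsm_deg_on_letter[OF B.graded_space_axioms A.graded_space_axioms graded_linear_p]
    by (auto simp: on_letter_length)
next
  case (Suc n)
  then have IH: "gsm_deg VB VA 0 (stage n)" and long: "\<And>xs. n + 1 < length xs \<Longrightarrow> stage n xs = 0" by auto
  interpret C: dgla_coalg B A "morph (stage n)" by (rule dgla_coalg_morph[OF IH])
  let ?T = "\<lambda>xs. if length xs = n + 2 then H (scl A) xs (C.L_word (n + 1)) else 0"
  have "gsm_deg VB VA 0 (\<lambda>xs. H (scl A) xs (C.L_word (n + 1)))"
    using gsm_deg_H[OF A.graded_space_axioms C.gsm_deg_L_word, of "n + 1"] by simp
  from B.gsm_deg_length_if[OF A.graded_space_axioms this, of "\<lambda>m. m = n + 2"]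
  have T: "gsm_deg VB VA 0 ?T" .
  have eq: "stage (Suc n) xs = ?T xs + stage n xs" if "hom_word VB xs" for xs
    using L_infty_H_map[OF IH that, of "n + 1"] long[of xs] by simp
  have "gsm VB (scl VA) (stage (Suc n))"
    by (rule B.gsm_cong[OF B.gsm_plus[OF gsm_deg_gsm[OF T] gsm_deg_gsm[OF IH]] eq])
  moreover have "stage (Suc n) xs \<in> grd VA (wdeg VB xs + 0)" if "hom_word VB xs" for xs
    unfolding eq[OF that] by (rule A.grd_add[OF gsm_deg_in_grd[OF T that] gsm_deg_in_grd[OF IH that]])
  ultimately show ?case using long by (simp add: gsm_deg_def)
qed

text \<open>The diagonal of the stages: on words of a given length they become constant, see
  \<open>stage_eq\<close>.\<close>

definition P_structure :: "'b list \<Rightarrow> 'a" where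
  "P_structure xs = stage (length xs) xs"

lemma stage_eq: "length xs \<le> n + 1 \<Longrightarrow> stage n xs = P_structure xs"
proof -
  assume *: "length xs \<le> n + 1"
  have "stage (m + k) xs = stage m xs" if "length xs \<le> m + 1" for m k
    using that by (induction k) auto
  from this[OF *, of "length xs"] this[of "length xs" n] show ?thesis
    by (simp only: P_structure_def add.commute[of n] le_add1)
qed

lemma gsm_deg_P_structure: "gsm_deg VB VA 0 P_structure"
proof -
  have stage: "gsm_deg VB VA 0 (stage n)" for n using gsm_deg_stage by blast
  show ?thesis
    unfolding gsm_deg_def P_structure_def
    using B.gsm_length_dep[of "scl VA" stage, OF gsm_deg_gsm[OF stage]] gsm_deg_in_grd[OF stage] by simp
qed

lemma exists_recursive_morphism:
  "coalg_morphism VB VA (morph P_structure) \<and> recursive_structure_maps A B i p h (morph P_structure)"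
proof
  note \<phi> = gsm_deg_P_structure
  note s = A.Ls.vector_space_axioms
  let ?P = "morph P_structure"
  show "coalg_morphism VB VA ?P" by (rule coalg_morph[OF \<phi>])
  interpret C: dgla_coalg B A ?P by (rule dgla_coalg_morph[OF \<phi>])
  have "first_map B A ?P = p"
  proof (rule C.first_map_eq[OF p_linear])
    fix y assume "y \<in> homogeneous VB"
    then show "pull (scl A) ?P the_letter [y] = p y"
      using pull_the_letter[OF \<phi>, of "[y]"] stage_eq[of "[y]" 0] by simp
  qed
  moreover have "structure_map VA ?P (k + 1) t = L_infty A B ?P k (H_map B i p h (k + 1) t)"
    if k: "1 \<le> k" and t: "t \<in> sym_carrier VB" for k t
  proof -
    have "L_infty A B ?P k (H_map B i p h (k + 1) t) = lin_ext (scl A) (C.L_word k) (H_map B i p h (k + 1) t)"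
      by (rule C.L_infty_eq[OF H_map_carrier[OF t]])
    also have "\<dots> = lin_ext (scl A) (\<lambda>xs. lin_ext (scl A) (C.L_word k) (H_map B i p h (k + 1) (gen xs))) t"
      by (rule lin_ext_linear[OF H_map_linear s])
    also have "\<dots> = lin_ext (scl A) (\<lambda>xs. if length xs = k + 1 then pull (scl A) ?P the_letter xs else 0) t"
    proof (rule lin_ext_cong)
      fix xs assume "xs \<in> Poly_Mapping.keys t"
      then have xs: "hom_word VB xs" using t unfolding sym_carrier_iff by blast
      show "lin_ext (scl A) (C.L_word k) (H_map B i p h (k + 1) (gen xs)) = (if length xs = k + 1 then pull (scl A) ?P the_letter xs else 0)"
      proof (cases "length xs = k + 1")
        case True
        obtain n where n: "k = Suc n" using k by (cases k) auto
        note st = conjunct1[OF gsm_deg_stage[of n]]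
        have ne: "xs \<noteq> []" using True by auto
        have "pull (scl A) ?P the_letter xs = stage k xs"
          using pull_the_letter[OF \<phi> xs ne] stage_eq[of xs k] True by simp
        also have "\<dots> = L_infty A B (morph (stage n)) k (H_map B i p h (k + 1) (gen xs))"
          using True n by simp
        also have "\<dots> = H (scl A) xs (dgla_coalg.L_word B A (morph (stage n)) k)"
          by (rule L_infty_H_map[OF st xs True])
        \<comment> \<open>Stage n agrees with the final structure maps up to order n + 1 = k, which
          is all that L depends on.\<close>
        also have "\<dots> = H (scl A) xs (C.L_word k)"
        proof (rule H_cong[OF _ _ xs])
          show "gsm VB (scl A) (dgla_coalg.L_word B A (morph (stage n)) k)" "gsm VB (scl A) (C.L_word k)"
            using gsm_deg_gsm[OF dgla_coalg.gsm_deg_L_word[OF dgla_coalg_morph[OF st]]] gsm_deg_gsm[OF C.gsm_deg_L_word]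
            by simp_all
          fix ys assume "hom_word VB ys"
          then show "dgla_coalg.L_word B A (morph (stage n)) k ys = C.L_word k ys"
            by (intro L_word_cong[OF st \<phi> _ _ k]) (simp_all add: stage_eq n)
        qed
        also have "\<dots> = lin_ext (scl A) (C.L_word k) (H_map B i p h (k + 1) (gen xs))"
          using lin_ext_H_map[of "scl A" "C.L_word k" xs] gsm_deg_gsm[OF C.gsm_deg_L_word] xs ne True by simp
        finally show ?thesis using True by simp
      qed (simp add: H_map_other_length lin_ext_0[OF s])
    qed
    also have "\<dots> = structure_map VA ?P (k + 1) t"
      by (rule C.structure_map_eq[symmetric])
    finally show ?thesis ..
  qed
  ultimately show "recursive_structure_maps A B i p h ?P"
    by (simp add: recursive_structure_maps_def)
qed

subsection \<open>The inclusion and the quasi-inverse\<close>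

lemma gsm_map_i:
  assumes \<Psi>: "gsm VB s \<Psi>"
  shows "gsm VA s (\<lambda>xs. \<Psi> (map i xs))"
proof (rule gsm_rawI[OF gsm_vs[OF \<Psi>]], goal_cases)
  case (1 us vs x y a b n)
  have "i x \<in> grd VB n" "i y \<in> grd VB n" using graded_linear_grd[OF graded_linear_i] 1(3,4) by force+
  from gsm_lincomb[OF \<Psi> hom_map_i[OF 1(1)] hom_map_i[OF 1(2)] this, of a b]
  show ?case by (simp add: vs_linear_add[OF i_linear] vs_linear_scale[OF i_linear])
next
  case (2 us vs x y m n)
  have "i x \<in> grd VB m" "i y \<in> grd VB n" using graded_linear_grd[OF graded_linear_i] 2(3,4) by force+
  from gsm_swap[OF \<Psi> hom_map_i[OF 2(1)] hom_map_i[OF 2(2)] this] show ?case by simp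
qed

lemma mem_0_map_i: "0 \<in> set xs \<Longrightarrow> 0 \<in> set (map i xs)"
  using vs_linear_0[OF i_linear] by force

lemma coalg_morphism_i: "coalg_morphism VA VB (Linf_of i :: _ \<Rightarrow> 'b list \<Rightarrow>\<^sub>0 'k)"
  unfolding Linf_of_def
proof (rule coalg_morphismI[OF A.graded_space_axioms B.graded_space_axioms])
  note fs = free.vector_space_axioms
  show "gsm VA fscale (\<lambda>xs. sym_class VB (map i xs))" by (rule gsm_map_i[OF B.gsm_sym_class])
  fix xs assume xs: "hom_word VA xs"
  show "gen (map i xs) \<in> sym_carrier VB" using hom_map_i[OF xs] by simp
  show "Poly_Mapping.lookup (gen (map i xs)) [] = (if xs = [] then 1 else 0)"
    by (simp add: lookup_single when_def)
  have "B.graded_word (map i xs) (map (deg VA) xs)"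
    using xs graded_linear_grd[OF graded_linear_i A.in_grd_deg] by (induction xs) auto
  then show "gen (map i xs) \<in> sym_grd VB (wdeg VA xs)"
    unfolding sym_grd_def wdeg_def by (intro free.span_base) blast
  fix G :: "'b list \<Rightarrow> 'b list \<Rightarrow> ('b list \<times> 'b list \<Rightarrow>\<^sub>0 'k)" assume G: "bigsm VB fscale G"
  \<comment> \<open>A zero letter makes both sides vanish; otherwise \<open>i\<close> preserves the
    degrees and thus the signs.\<close>
  have "unsh VB (map i xs) G = unsh VA xs (\<lambda>u w. G (map i u) (map i w))"
  proof (cases "0 \<in> set xs")
    case True
    have "bigsm VA fscale (\<lambda>u w. G (map i u) (map i w))"
      by (rule bigsmI) (auto intro!: gsm_map_i[OF bigsm_right[OF G]] gsm_map_i[OF bigsm_left[OF G]] simp del: homogeneous_shift dest: hom_map_i)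
    from A.gsm_mem_0[OF A.gsm_unsh[OF fs this] xs True] B.gsm_mem_0[OF B.gsm_unsh[OF fs G] hom_map_i[OF xs] mem_0_map_i[OF True]]
    show ?thesis by simp
  next
    case False
    then show ?thesis by (rule unsh_map_i[OF xs])
  qed
  then show "lin_ext fscale (\<lambda>ys. unsh VB ys G) (gen (map i xs))
      = unsh VA xs (\<lambda>u w. lin_ext fscale (\<lambda>a. lin_ext fscale (G a) (gen (map i w))) (gen (map i u)))"
    by (simp add: lin_ext_gen[OF fs])
qed (simp add: sym_eq_def free.subspace_0[OF subspace_sym_rel])

lemma
  shows Linf_morphism_i: "Linf_morphism A B (Linf_of i)"
    and first_map_i: "first_map A B (Linf_of i :: _ \<Rightarrow> 'b list \<Rightarrow>\<^sub>0 'k) = i"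
proof -
  note fs = free.vector_space_axioms
  interpret I: dgla_coalg A B "Linf_of i"
    by (intro dgla_coalg.intro sym_morphism.intro sym_morphism_axioms.intro coalg_morphism_i
      A.dgla_axioms B.dgla_axioms A.graded_space_axioms B.graded_space_axioms)
  have pull: "pull s (Linf_of i) \<Psi> xs = \<Psi> (map i xs)" if "vector_space s"
    for s :: "'k \<Rightarrow> 'v \<Rightarrow> 'v::ab_group_add" and \<Psi> :: "'b list \<Rightarrow> 'v" and xs
    by (simp add: pull_def Linf_of_def lin_ext_gen[OF fs] lin_ext_gen[OF that])
  show "first_map A B (Linf_of i :: _ \<Rightarrow> 'b list \<Rightarrow>\<^sub>0 'k) = i"
    by (rule I.first_map_eq[OF i_linear]) (simp add: pull B.Ls.vector_space_axioms)
  show "Linf_morphism A B (Linf_of i)"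
  proof (rule I.Linf_morphismI, rule B.sym_relI)
    fix xs assume xs: "hom_word VA xs"
    note c = B.gsm_sym_class
    have "lin_ext fscale (sym_class VB) (I.defect xs)
        = cod VB B.q (map i xs) (sym_class VB) - cod VA A.q xs (\<lambda>ys. sym_class VB (map i ys))"
      unfolding I.lin_ext_defect[OF c xs] by (simp add: pull[OF fs] pull[OF fs, abs_def])
    also have "\<dots> = 0"
    proof (cases "0 \<in> set xs")
      case True
      then show ?thesis
        using B.gsm_mem_0[OF B.gsm_cod[OF B.gsm_deg_q c] hom_map_i[OF xs] mem_0_map_i[OF True]]
          A.gsm_mem_0[OF A.gsm_cod[OF A.gsm_deg_q gsm_map_i[OF c]] xs True] by simp
    next
      case False
      then show ?thesis by (simp add: cod_q_map_i[OF xs])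
    qed
    finally show "lin_ext fscale (sym_class VB) (I.defect xs) = 0" .
  qed
qed

end

text \<open>A homotopy inverse on cocycles is an inverse on classes. Since
  \<open>cohomology_map\<close> is a relational image, the inclusions need \<open>g\<close> to
  respect the relation and the relation to be transitive and symmetric.\<close>

lemma cohomology_map_inverse:
  fixes L :: "('k::field, 'a::ab_group_add) dgla" and M :: "('k, 'b::ab_group_add) dgla"
  assumes L: "is_dgla L" and f: "cochain_map L M f" and g: "cochain_map M L g"
    and hom: "\<And>n x. x \<in> cocycles L n \<Longrightarrow> g (f x) - x \<in> dif L ` grd L (n - 1)"
    and X: "X \<in> cohomology L n"
  shows "cohomology_map L g n (cohomology_map M f n X) = X"
proof -
  interpret L: dgla L by standard fact
  have fl: "Vector_Spaces.linear (scl L) (scl M) f" and gl: "Vector_Spaces.linear (scl M) (scl L) g"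
    using f g by (simp_all add: cochain_map_def)
  have f_grd: "f x \<in> grd M k" if "x \<in> grd L k" for x k using f that by (simp add: cochain_map_def)
  have g_grd: "g y \<in> grd L k" if "y \<in> grd M k" for y k using g that by (simp add: cochain_map_def)
  have f_dif: "dif M (f x) = f (dif L x)" for x using f by (simp add: cochain_map_def)
  have g_dif: "dif L (g y) = g (dif M y)" for y using g by (simp add: cochain_map_def)
  have f_c: "f x \<in> cocycles M n" if "x \<in> cocycles L n" for x
    using that by (simp add: cocycles_def f_grd f_dif vs_linear_0[OF fl])
  have g_c: "g y \<in> cocycles L n" if "y \<in> cocycles M n" for y
    using that by (simp add: cocycles_def g_grd g_dif vs_linear_0[OF gl])
  have B_add: "u + v \<in> dif L ` grd L (n - 1)" if uv: "u \<in> dif L ` grd L (n - 1)" "v \<in> dif L ` grd L (n - 1)" for u v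
  proof -
    obtain a b where "u = dif L a" "v = dif L b" "a \<in> grd L (n - 1)" "b \<in> grd L (n - 1)" using uv by blast
    then show ?thesis using L.grd_add[of a "n - 2" b] by (intro image_eqI[of _ _ "a + b"]) (simp_all add: L.d_add)
  qed
  have B_minus: "- u \<in> dif L ` grd L (n - 1)" if u: "u \<in> dif L ` grd L (n - 1)" for u
  proof -
    obtain a where "u = dif L a" "a \<in> grd L (n - 1)" using u by blast
    then show ?thesis using L.grd_minus[of a "n - 2"] by (intro image_eqI[of _ _ "- a"]) (simp_all add: L.d_minus)
  qed
  have trans: "(x, z) \<in> cohomologous L n" if "(x, y) \<in> cohomologous L n" "(y, z) \<in> cohomologous L n" for x y z
    using that B_add[of "x - y" "y - z"] by (auto simp: cohomologous_def)
  have sym: "(y, x) \<in> cohomologous L n" if "(x, y) \<in> cohomologous L n" for x y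
    using that B_minus[of "x - y"] by (auto simp: cohomologous_def)
  have g_rel: "(g y, g y') \<in> cohomologous L n" if yy: "(y, y') \<in> cohomologous M n" for y y'
  proof -
    obtain b where "b \<in> grd M (n - 1)" "y - y' = dif M b" using yy by (auto simp: cohomologous_def)
    then have "g y - g y' = dif L (g b)" "g b \<in> grd L (n - 1)"
      by (simp_all add: g_grd g_dif vs_linear_diff[OF gl, symmetric])
    then show ?thesis using yy g_c by (auto simp: cohomologous_def)
  qed
  have f_refl: "(f x, f x) \<in> cohomologous M n" if "x \<in> cocycles L n" for x
  proof -
    have "0 \<in> grd L (n - 1)" using L.grd_0[of "n - 2"] by simp
    then have "0 \<in> grd M (n - 1)" "dif M 0 = 0"
      using f_grd[of 0 "n - 1"] f_dif[of 0] vs_linear_0[OF fl] by simp_all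
    then have "0 \<in> dif M ` grd M (n - 1)" by (metis image_eqI)
    then show ?thesis using f_c[OF that] by (auto simp: cohomologous_def)
  qed
  have gf: "(g (f x), x) \<in> cohomologous L n" if "x \<in> cocycles L n" for x
    using hom[OF that] g_c[OF f_c[OF that]] that by (auto simp: cohomologous_def)
  obtain x where x: "x \<in> cocycles L n" "X = cohomologous L n `` {x}"
    using X by (auto simp: cohomology_def elim: quotientE)
  show ?thesis
  proof (intro equalityI subsetI)
    fix z assume "z \<in> cohomology_map L g n (cohomology_map M f n X)"
    then obtain x' y where *: "(x, x') \<in> cohomologous L n" "(f x', y) \<in> cohomologous M n" "(g y, z) \<in> cohomologous L n"
      by (auto simp: cohomology_map_def x)
    have x': "x' \<in> cocycles L n" using *(1) by (auto simp: cohomologous_def)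
    have "(x, z) \<in> cohomologous L n"
      by (rule trans[OF *(1) trans[OF sym[OF gf[OF x']] trans[OF g_rel[OF *(2)] *(3)]]])
    then show "z \<in> X" by (simp add: x)
  next
    fix z assume "z \<in> X"
    then have z: "(x, z) \<in> cohomologous L n" by (simp add: x)
    have "(g (f z), z) \<in> cohomologous L n" using z gf[of z] by (auto simp: cohomologous_def)
    moreover have "(f z, f z) \<in> cohomologous M n" using z f_refl[of z] by (auto simp: cohomologous_def)
    ultimately show "z \<in> cohomology_map L g n (cohomology_map M f n X)"
      using z by (auto simp: cohomology_map_def x)
  qed
qed

context recursive_morphism
begin

lemma first_map_P: "first_map B A P = p"
  using rec by (simp add: recursive_structure_maps_def)

lemma Linf_quasi_isomorphism_P: "Linf_quasi_isomorphism B A P"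
  using Linf_morphism_P quasi_p by (simp add: Linf_quasi_isomorphism_def first_map_P)

lemma quasi_inverse_P: "quasi_inverse B A P (Linf_of i)"
proof -
  have ci: "cochain_map A B i" and cp: "cochain_map B A p"
    using quasi_i quasi_p by (auto simp: quasi_isomorphism_def)
  have "i (p x) - x \<in> dif B ` grd B (n - 1)" if "x \<in> cocycles B n" for x n
  proof -
    have "h 0 = 0" using vs_linear_0[OF h_linear] .
    \<comment> \<open>On a cocycle the homotopy formula loses its term h d, so the difference is the
      boundary of \<open>- h x\<close>.\<close>
    then have "i (p x) - x = dif B (- h x)"
      using homotopy[rule_format, of x] that by (simp add: cocycles_def B.d_minus)
    moreover have "- h x \<in> grd B (n - 1)"
      using that graded_linear_grd[OF graded_linear_h, of x "n - 1"] by (simp add: cocycles_def)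
    ultimately show ?thesis by blast
  qed
  from cohomology_map_inverse[OF B.dgla cp ci this]
  have 1: "cohomology_map B i n (cohomology_map A p n X) = X" if "X \<in> cohomology B n" for n X
    using that by blast
  have "p (i x) - x \<in> dif A ` grd A (n - 1)" if "x \<in> cocycles A n" for x n
    using A.grd_0[of "n - 2"] by (intro image_eqI[of _ _ 0]) (simp_all add: p_i)
  from cohomology_map_inverse[OF A.dgla ci cp this]
  have 2: "cohomology_map A p n (cohomology_map B i n Y) = Y" if "Y \<in> cohomology A n" for n Y
    using that by blast
  show ?thesis
    unfolding quasi_inverse_def first_map_P first_map_i
    using Linf_quasi_isomorphism_P Linf_morphism_i quasi_i 1 2
    by (auto simp: Linf_quasi_isomorphism_def first_map_i)
qed

end

theorem proposition3p2:
  fixes A :: "('k::field_char_0, 'a::ab_group_add) dgla"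
    and B :: "('k, 'b::ab_group_add) dgla"
    and i :: "'a \<Rightarrow> 'b" and p :: "'b \<Rightarrow> 'a" and h :: "'b \<Rightarrow> 'b"
  assumes "is_dgla A" and "is_dgla B"
    and "quasi_isomorphism A B i" and "quasi_isomorphism B A p"
    and "Vector_Spaces.linear (scl B) (scl B) h" and "\<forall>n. \<forall>x\<in>grd B n. h x \<in> grd B (n - 1)"
    and "\<forall>x. h (dif B x) + dif B (h x) = x - i (p x)"
    and "\<forall>x. p (i x) = x"
    and "\<forall>x. h (h x) = 0" and "\<forall>x. h (i x) = 0" and "\<forall>x. p (h x) = 0"
    and "dgla_morphism A B i"
  shows "(\<exists>P. coalg_morphism (B\<lbrakk>1\<rbrakk>) (A\<lbrakk>1\<rbrakk>) P \<and> recursive_structure_maps A B i p h P) \<and>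
    (\<forall>P. coalg_morphism (B\<lbrakk>1\<rbrakk>) (A\<lbrakk>1\<rbrakk>) P \<and> recursive_structure_maps A B i p h P \<longrightarrow>
       Linf_quasi_isomorphism B A P \<and> quasi_inverse B A P (Linf_of i))"
proof -
  interpret contraction A B i p h
    by (intro contraction.intro dgla.intro contraction_axioms.intro assms)
  have "Linf_quasi_isomorphism B A P \<and> quasi_inverse B A P (Linf_of i)"
    if "coalg_morphism VB VA P" "recursive_structure_maps A B i p h P" for P
  proof -
    interpret recursive_morphism A B i p h P
      by (intro recursive_morphism.intro contraction_axioms dgla_coalg.intro sym_morphism.intro
          sym_morphism_axioms.intro recursive_morphism_axioms.intro that
          A.dgla_axioms B.dgla_axioms A.graded_space_axioms B.graded_space_axioms)
    show ?thesis using Linf_quasi_isomorphism_P quasi_inverse_P by simp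
  qed
  then show ?thesis using exists_recursive_morphism by blast
qed

end
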